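(* Let $0<\gamma<1$, $|\beta|\le1$, $\rho>0$ and $\alpha>0$. Let $u_{\rho;\gamma,\beta}$ be the zero-potential density of the Lévy process $Z_{\gamma,\beta}$ killed at an independent exponential time with parameter $\rho$ (mean $1/\rho$), and let $Y_{\alpha;\rho,\gamma,\beta}=\{Y_{\alpha;\rho,\gamma,\beta}(x),x\in\mathbb R^+\}$ be an $\alpha$-permanental process, with continuous sample paths, with kernel $u_{\rho;\gamma,\beta}$. Set $$C_{\gamma,\beta}=\frac{-\sin\left((\gamma+1)\frac{\pi}{2}\right)\Gamma(-\gamma)}{\pi\left(1+\beta^2\tan^2((\gamma+1)\pi/2)\right)}>0,\qquad D_{\rho,\gamma,\beta}=\frac1\pi\int_0^\infty\frac{\mathrm{Re}\,(\rho+\psi_{\gamma,\beta}(\lambda))}{|\rho+\psi_{\gamma,\beta}(\lambda)|^2}\,d\lambda.$$ Then for all $T>0$ $$\limsup_{h\to0}\sup_{\substack{|s-t|\le h\\ s,t\in[0,T]}}\frac{|Y_{\alpha;\rho,\gamma,\beta}(s)-Y_{\alpha;\rho,\gamma,\beta}(t)|}{(h^\gamma\log1/h)^{1/2}}\le2\sqrt2\,\big((1+|\beta|)C_{\gamma,\beta}\big)^{1/2}\Big(\sup_{t\in[0,T]}Y_{\alpha;\rho,\gamma,\beta}(t)\Big)^{1/2}\qquad a.s.,$$ $$\limsup_{h\to0}\sup_{0\le t\le h}\frac{|Y_{\alpha;\rho,\gamma,\beta}(t)-Y_{\alpha;\rho,\gamma,\beta}(0)|}{(h^\gamma\log\log1/h)^{1/2}}\le2\sqrt2\,\big((1+|\beta|)C_{\gamma,\beta}\big)^{1/2}\,Y^{1/2}_{\alpha;\rho,\gamma,\beta}(0)\qquad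 a.s.,$$ and $$\limsup_{t\to\infty}\frac{Y_{\alpha;\rho,\gamma,\beta}(t)}{\log t}=D_{\rho,\gamma,\beta}\qquad a.s.$$
   Context: For $\alpha>0$, a random vector $(X_1,\dots,X_n)$ with nonnegative components is $\alpha$-permanental with kernel $U$ (a real $n\times n$ matrix) if $E\big(e^{-\sum_{i=1}^n s_iX_i}\big)=|I+US|^{-\alpha}$ for every diagonal matrix $S$ with positive diagonal entries $s_1,\dots,s_n$, where $|\cdot|$ denotes the determinant. A stochastic process $\{X_\alpha(t),t\in\mathcal T\}$ is an $\alpha$-permanental process with kernel $\{u(s,t),s,t\in\mathcal T\}$ if for all $t_1,\dots,t_n\in\mathcal T$ the vector $(X_\alpha(t_1),\dots,X_\alpha(t_n))$ is $\alpha$-permanental with kernel $\{u(t_i,t_j)\}_{i,j=1}^n$. $Z_{\gamma,\beta}=\{Z_t,t\in\mathbb R^+\}$ is the real-valued Lévy process with characteristic function $E e^{i\lambda Z_t}=e^{-t\psi_{\gamma,\beta}(\lambda)}$, where $\psi_{\gamma,\beta}(\lambda)=|\lambda|^{\gamma+1}\big(1-i\beta\,\mathrm{sign}(\lambda)\tan((\gamma+1)\pi/2)\big)$. The zero-potential density (with respect to Lebesgue measure) of the killed process is $$u_{\rho;\gamma,\beta}(x,y)=\frac1\pi\int_0^\infty\frac{\cos(\lambda(x-y))\,\mathrm{Re}(\rho+\psi_{\gamma,\beta}(\lambda))}{|\rho+\psi_{\gamma,\beta}(\lambda)|^2}\,d\lambda+\frac1\pi\int_0^\infty\frac{\sin(\lambda(x-y))\,\mathrm{Im}\,\psi_{\gamma,\beta}(\lambda)}{|\rho+\psi_{\gamma,\beta}(\lambda)|^2}\,d\lambda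 .$$ It is known that $u_{\rho;\gamma,\beta}$ is the kernel of an $\alpha$-permanental process for every $\alpha>0$. $\mathbb R^+=[0,\infty)$. *)

theory Defs
  imports "HOL-Probability.Probability" "Jordan_Normal_Form.Determinant"
begin

(* X (0), ..., X (n - 1) are the components.  The determinant has to be positive for its real power
   to make sense; this is stated explicitly because powr is total. *)
definition permanental_vector ::
    "'a measure \<Rightarrow> real \<Rightarrow> nat \<Rightarrow> (nat \<Rightarrow> 'a \<Rightarrow> real) \<Rightarrow> real mat \<Rightarrow> bool"
  where
  "permanental_vector M \<alpha> n X U \<longleftrightarrow>
     U \<in> carrier_mat n n \<and>
     (\<forall>i<n. X i \<in> borel_measurable M \<and> (\<forall>\<omega>\<in>space M. 0 \<le> X i \<omega>)) \<and>
     (\<forall>s. (\<forall>i<n. 0 < s i) \<longrightarrow>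
        0 < Determinant.det (1\<^sub>m n + U * mat_diag n s) \<and>
        integral\<^sup>L M (\<lambda>\<omega>. exp (- (\<Sum>i<n. s i * X i \<omega>)))
          = Determinant.det (1\<^sub>m n + U * mat_diag n s) powr (- \<alpha>))"

definition permanental_process ::
    "'a measure \<Rightarrow> real \<Rightarrow> real set \<Rightarrow> (real \<Rightarrow> 'a \<Rightarrow> real) \<Rightarrow> (real \<Rightarrow> real \<Rightarrow> real) \<Rightarrow> bool"
  where
  "permanental_process M \<alpha> T X u \<longleftrightarrow>
     (\<forall>n (t :: nat \<Rightarrow> real). (\<forall>i<n. t i \<in> T) \<longrightarrow>
        permanental_vector M \<alpha> n (\<lambda>i. X (t i)) (Matrix.mat n n (\<lambda>(i, j). u (t i) (t j))))"

definition psi :: "real \<Rightarrow> real \<Rightarrow> real \<Rightarrow> complex" where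
  "psi \<gamma> \<beta> l = of_real (\<bar>l\<bar> powr (\<gamma> + 1)) *
     (1 - \<i> * of_real (\<beta> * sgn l * tan ((\<gamma> + 1) * pi / 2)))"

(* The zero-potential density of the Levy process with exponent psi, killed at rate rho; see
   u_dens_zero_potential_density below for the identification with the process.  Both integrands
   are Lebesgue integrable when 0 < gamma and 0 < rho. *)
definition u_dens :: "real \<Rightarrow> real \<Rightarrow> real \<Rightarrow> real \<Rightarrow> real \<Rightarrow> real" where
  "u_dens \<rho> \<gamma> \<beta> x y =
     1 / pi * (LBINT l:{0..}. cos (l * (x - y)) * Re (of_real \<rho> + psi \<gamma> \<beta> l)
                                / (cmod (of_real \<rho> + psi \<gamma> \<beta> l))\<^sup>2) +
     1 / pi * (LBINT l:{0..}. sin (l * (x - y)) * Im (psi \<gamma> \<beta> l)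
                                / (cmod (of_real \<rho> + psi \<gamma> \<beta> l))\<^sup>2)"

definition C_const :: "real \<Rightarrow> real \<Rightarrow> real" where
  "C_const \<gamma> \<beta> = - sin ((\<gamma> + 1) * pi / 2) * Gamma (- \<gamma>) /
     (pi * (1 + \<beta>\<^sup>2 * (tan ((\<gamma> + 1) * pi / 2))\<^sup>2))"

definition D_const :: "real \<Rightarrow> real \<Rightarrow> real \<Rightarrow> real" where
  "D_const \<rho> \<gamma> \<beta> =
     1 / pi * (LBINT l:{0..}. Re (of_real \<rho> + psi \<gamma> \<beta> l)
                                / (cmod (of_real \<rho> + psi \<gamma> \<beta> l))\<^sup>2)"

definition levy_process :: "'b measure \<Rightarrow> (real \<Rightarrow> 'b \<Rightarrow> real) \<Rightarrow> bool" where
  "levy_process N Z \<longleftrightarrow>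
     prob_space N \<and>
     (\<forall>t\<ge>0. Z t \<in> borel_measurable N) \<and>
     (AE \<omega> in N. Z 0 \<omega> = 0) \<and>
     (\<forall>n (t :: nat \<Rightarrow> real). 0 \<le> t 0 \<and> mono t \<longrightarrow>
        prob_space.indep_vars N (\<lambda>_. borel) (\<lambda>i \<omega>. Z (t (Suc i)) \<omega> - Z (t i) \<omega>) {..<n}) \<and>
     (\<forall>s\<ge>0. \<forall>t\<ge>0. distr N borel (\<lambda>\<omega>. Z (s + t) \<omega> - Z s \<omega>) = distr N borel (Z t)) \<and>
     (\<forall>\<omega>\<in>space N. \<forall>t\<ge>0. continuous (at_right t) (\<lambda>s. Z s \<omega>) \<and>
        (0 < t \<longrightarrow> (\<exists>l. ((\<lambda>s. Z s \<omega>) \<longlongrightarrow> l) (at_left t))))"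

(* Expected time spent in A before the killing time by the process started at x. *)
definition killed_potential ::
    "'b measure \<Rightarrow> (real \<Rightarrow> 'b \<Rightarrow> real) \<Rightarrow> ('b \<Rightarrow> real) \<Rightarrow> real \<Rightarrow> real set \<Rightarrow> ennreal" where
  "killed_potential N Z \<xi> x A =
     (\<integral>\<^sup>+\<omega>. (\<integral>\<^sup>+t\<in>{0..<\<xi> \<omega>}. indicator A (x + Z t \<omega>) \<partial>lborel) \<partial>N)"

lemma density_of_integrable_char:
  assumes "real_distribution M" and int: "integrable lborel (char M)"
  defines "f \<equiv> \<lambda>y. 1 / (2 * pi) * Re (CLBINT t. iexp (- (t * y)) * char M t)"
  shows "(\<forall>y. 0 \<le> f y) \<and> f \<in> borel_measurable borel \<and> M = density lborel (\<lambda>y. ennreal (f y))"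
proof -
  interpret real_distribution M by fact
  define G where "G y = (CLBINT t. iexp (- (t * y)) * char M t)" for y :: real
  have fG: "f y = 1 / (2 * pi) * Re (G y)" for y
    by (simp add: f_def G_def)
  have [measurable]: "char M \<in> borel_measurable lborel"
    using int by (rule borel_measurable_integrable)
  have intG: "integrable lborel (\<lambda>t. iexp (- (t * y)) * char M t)" for y :: real
    by (rule Bochner_Integration.integrable_bound[OF int]) (auto simp: norm_mult)
  have contG: "continuous_on UNIV G"
    unfolding continuous_on_sequentially
  proof safe
    fix x and a :: real
    assume x: "x \<longlonglongrightarrow> a"
    show "(G \<circ> x) \<longlonglongrightarrow> G a"
      unfolding G_def comp_def
    proof (rule integral_dominated_convergence[where w="\<lambda>t. cmod (char M t)"])
      show "AE t in lborel. (\<lambda>i. iexp (- (t * x i)) * char M t) \<longlonglongrightarrow> iexp (- (t * a)) * char M t"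
        by (intro AE_I2 tendsto_intros x)
    qed (use int in \<open>auto simp: norm_mult\<close>)
  qed
  have contf: "continuous_on UNIV f"
    unfolding fG by (intro continuous_intros contG)
  hence meas[measurable]: "f \<in> borel_measurable borel"
    by (rule borel_measurable_continuous_onI)
  have intf: "set_integrable lborel {a..b} f" for a b
    by (rule borel_integrable_atLeastAtMost')(rule continuous_on_subset[OF contf], simp)
  have cnt: "countable {x. measure M {x} \<noteq> 0}"
    by (rule countable_support)
  have basic: "measure M {a<..b} = (LBINT y:{a..b}. f y)"
    if ab: "a \<le> b" "measure M {a} = 0" "measure M {b} = 0" for a b
  proof -
    let ?F = "\<lambda>t::real. (iexp (-(t * a)) - iexp (-(t * b))) / (\<i> * t)"
    have bd: "cmod (?F t) \<le> b - a" if "t \<noteq> 0" for t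
      using Levy_Inversion_aux2[of "-b" "-a" t] that \<open>a \<le> b\<close> by simp
    have AEbd: "AE t in lborel. cmod (?F t) \<le> b - a"
      by (rule AE_I[of _ _ "{0}"]) (use bd in auto)
    have intb: "integrable lborel (\<lambda>t. (b - a) * cmod (char M t))"
      using int by auto
    have lim1: "(\<lambda>n::nat. CLBINT t. indicator {- real n<..<real n} t *\<^sub>R (?F t * char M t))
        \<longlonglongrightarrow> (CLBINT t. ?F t * char M t)"
    proof (rule integral_dominated_convergence[OF _ _ intb])
      show "AE t in lborel. (\<lambda>n. indicator {- real n<..<real n} t *\<^sub>R (?F t * char M t))
              \<longlonglongrightarrow> ?F t * char M t"
      proof (rule AE_I2)
        fix t :: real
        have "eventually (\<lambda>n. \<bar>t\<bar> < real n) sequentially"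
          using filterlim_real_sequentially by (simp add: filterlim_at_top_dense)
        hence "eventually (\<lambda>n. indicator {- real n<..<real n} t *\<^sub>R (?F t * char M t) = ?F t * char M t) sequentially"
          by eventually_elim (auto simp: abs_less_iff)
        thus "(\<lambda>n. indicator {- real n<..<real n} t *\<^sub>R (?F t * char M t)) \<longlonglongrightarrow> ?F t * char M t"
          by (rule tendsto_eventually)
      qed
      show "AE t in lborel. norm (indicator {- real n<..<real n} t *\<^sub>R (?F t * char M t))
              \<le> (b - a) * cmod (char M t)" for n
        using AEbd
      proof eventually_elim
        case (elim t)
        thus ?case using \<open>a \<le> b\<close>
          unfolding norm_scaleR norm_mult
          by (cases "t \<in> {- real n<..<real n}")
             (simp_all add: mult_right_mono del: norm_divide of_real_mult)
      qed
    qed measurable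
    have lim2: "(\<lambda>n::nat. 1 / (2 * pi) * (CLBINT t. indicator {- real n<..<real n} t *\<^sub>R (?F t * char M t)))
        \<longlonglongrightarrow> measure M {a<..b}"
      using Levy_Inversion[OF ab]
      by (simp add: interval_lebesgue_integral_def set_lebesgue_integral_def)
    have lim: "complex_of_real (measure M {a<..b}) = 1 / (2 * pi) * (CLBINT t. ?F t * char M t)"
      by (rule LIMSEQ_unique[OF lim2 tendsto_mult_left[OF lim1]])
    have Fint: "?F t = (CLBINT y. indicator {a..b} y *\<^sub>R iexp (- (t * y)))" if "t \<noteq> 0" for t
    proof -
      have fd: "((\<lambda>z. - exp (- (\<i> * of_real t * z)) / (\<i> * of_real t)) has_field_derivative
              exp (- (\<i> * of_real t * z))) (at z)" for z
        by (auto intro!: derivative_eq_intros simp: that)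
      have vd: "((\<lambda>y. - iexp (-(t * y)) / (\<i> * t)) has_vector_derivative iexp (- (t * y))) (at y within S)" for y S
        using has_vector_derivative_real_field[OF fd[of "of_real y"], of S] by (simp add: mult.assoc)
      have "(CLBINT y. indicator {a..b} y *\<^sub>R iexp (- (t * y))) = - iexp (-(t * b)) / (\<i> * t) - (- iexp (-(t * a)) / (\<i> * t))"
        by (rule integral_FTC_Icc[OF ab(1) vd]) (intro continuous_intros)
      also have "\<dots> = ?F t" by (simp add: diff_divide_distrib)
      finally show ?thesis ..
    qed
    have ii: "integrable (lborel \<Otimes>\<^sub>M lborel) (\<lambda>(t, y). indicator {a..b} y *\<^sub>R iexp (- (t * y)) * char M t)"
    proof (rule lborel_pair.Fubini_integrable)
      have "(LBINT y. norm (case (t, y) of (t, y) \<Rightarrow> indicator {a..b} y *\<^sub>R iexp (- (t * y)) * char M t))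
          = (b - a) * cmod (char M t)" for t :: real
      proof -
        have "(LBINT y. norm (case (t, y) of (t, y) \<Rightarrow> indicator {a..b} y *\<^sub>R iexp (- (t * y)) * char M t))
          = (LBINT y. indicator {a..b} y * cmod (char M t))"
          by (rule Bochner_Integration.integral_cong) (auto simp: norm_mult)
        thus ?thesis using ab(1) by simp
      qed
      thus "integrable lborel (\<lambda>t. LBINT y. norm (case (t, y) of (t, y) \<Rightarrow>
              indicator {a..b} y *\<^sub>R iexp (- (t * y)) * char M t))"
        using intb by simp
      have "integrable lborel (\<lambda>y. indicator {a..b} y *\<^sub>R iexp (- (t * y)) * char M t)" for t :: real
        using borel_integrable_atLeastAtMost'[of a b "\<lambda>y. iexp (- (t * y)) * char M t"]
        by (simp add: set_integrable_def continuous_intros)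
      thus "AE t in lborel. integrable lborel (\<lambda>y. case (t, y) of (t, y) \<Rightarrow>
              indicator {a..b} y *\<^sub>R iexp (- (t * y)) * char M t)"
        by simp
    qed measurable
    have Fint': "?F t * char M t = (CLBINT y. indicator {a..b} y *\<^sub>R iexp (- (t * y)) * char M t)" if "t \<noteq> 0" for t
      by (simp only: Fint[OF that] integral_mult_left_zero)
    have "(CLBINT t. ?F t * char M t) = (CLBINT t. CLBINT y. indicator {a..b} y *\<^sub>R iexp (- (t * y)) * char M t)"
    proof (rule integral_cong_AE)
      show "AE t in lborel. ?F t * char M t = (CLBINT y. indicator {a..b} y *\<^sub>R iexp (- (t * y)) * char M t)"
        using AE_lborel_singleton[of 0] by eventually_elim (rule Fint')
    qed measurable
    also have "\<dots> = (CLBINT y. CLBINT t. indicator {a..b} y *\<^sub>R iexp (- (t * y)) * char M t)"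
      using lborel_pair.Fubini_integral[OF ii] by simp
    also have "\<dots> = (CLBINT y:{a..b}. G y)"
      by (simp add: G_def set_lebesgue_integral_def)
    finally have "complex_of_real (measure M {a<..b}) = 1 / (2 * pi) * (CLBINT y:{a..b}. G y)"
      using lim by simp
    hence "measure M {a<..b} = Re (1 / (2 * pi) * (CLBINT y:{a..b}. G y))"
      by (metis Re_complex_of_real)
    also have "\<dots> = 1 / (2 * pi) * (LBINT y:{a..b}. Re (G y))"
    proof -
      have "complex_integrable lborel (\<lambda>y. indicator {a..b} y *\<^sub>R G y)"
        using borel_integrable_atLeastAtMost'[OF continuous_on_subset[OF contG], of a b]
        by (simp add: set_integrable_def)
      hence "Re (CLBINT y:{a..b}. G y) = (LBINT y:{a..b}. Re (G y))"
        unfolding set_lebesgue_integral_def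
        by (subst integral_Re[symmetric]) auto
      thus ?thesis
        by (simp add: Re_divide_of_real flip: of_real_mult)
    qed
    also have "\<dots> = (LBINT y:{a..b}. f y)"
      by (simp add: fG)
    finally show ?thesis .
  qed
  have nonatom: "\<exists>x. a < x \<and> x < b \<and> measure M {x} = 0" if "a < b" for a b
    using open_minus_countable[OF cnt, of "{a<..<b}"] that by auto
  have nonneg: "0 \<le> f y" for y
  proof (rule ccontr)
    assume "\<not> 0 \<le> f y"
    hence y: "y \<in> {z. f z < 0}" by simp
    have "open {z. f z < 0}"
      by (rule open_Collect_less[OF contf]) simp
    then obtain d where d: "d > 0" "ball y d \<subseteq> {z. f z < 0}"
      using y by (meson openE)
    obtain a where a: "y - d < a" "a < y" "measure M {a} = 0"
      using nonatom[of "y - d" y] d by auto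
    obtain b where b: "y < b" "b < y + d" "measure M {b} = 0"
      using nonatom[of y "y + d"] d by auto
    obtain c where c: "c \<in> {a..b}" "\<forall>z\<in>{a..b}. f z \<le> f c"
      using continuous_attains_sup[of "{a..b}" f] continuous_on_subset[OF contf] a b by auto
    have "c \<in> ball y d" using c a b by (auto simp: dist_real_def abs_less_iff)
    hence neg: "f c < 0" using d by auto
    have "measure M {a<..b} = (LBINT z:{a..b}. f z)"
      using basic a b by auto
    also have "\<dots> \<le> (LBINT z:{a..b}. f c)"
      by (rule set_integral_mono[OF intf]) (use c borel_integrable_atLeastAtMost'[OF continuous_on_const] in auto)
    also have "\<dots> = f c * (b - a)"
      using a b by (simp add: set_lebesgue_integral_def)
    also have "\<dots> < 0" using neg a b by (simp add: mult_neg_pos)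
    finally show False using measure_nonneg[of M "{a<..b}"] by linarith
  qed
  define K where "K = (LBINT t. cmod (char M t))"
  have Gb: "cmod (G y) \<le> K" for y
  proof -
    have "cmod (G y) \<le> (LBINT t. cmod (iexp (- (t * y)) * char M t))"
      unfolding G_def by (rule integral_norm_bound)
    thus ?thesis by (simp add: norm_mult K_def)
  qed
  have K: "f y \<le> K" "0 \<le> K" for y
  proof -
    show "0 \<le> K" by (simp add: K_def)
    have "f y \<le> 1 / (2 * pi) * K"
      unfolding fG using Gb[of y] complex_Re_le_cmod[of "G y"]
      by (intro mult_left_mono) auto
    also have "\<dots> \<le> 1 * K"
      using pi_gt3 by (intro mult_right_mono) (auto simp: K_def)
    finally show "f y \<le> K" by simp
  qed
  have atom: "measure M {x} = 0" for x
  proof (rule ccontr)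
    assume "measure M {x} \<noteq> 0"
    hence p: "measure M {x} > 0" by (simp add: zero_less_measure_iff)
    define e where "e = measure M {x} / (4 * (K + 1))"
    have e: "e > 0" using p K(2) by (simp add: e_def)
    obtain a where a: "x - e < a" "a < x" "measure M {a} = 0"
      using nonatom[of "x - e" x] e by auto
    obtain b where b: "x < b" "b < x + e" "measure M {b} = 0"
      using nonatom[of x "x + e"] e by auto
    have "measure M {x} \<le> measure M {a<..b}"
      by (rule finite_measure_mono) (use a b in auto)
    also have "\<dots> = (LBINT z:{a..b}. f z)"
      using basic a b by auto
    also have "\<dots> \<le> (LBINT z:{a..b}. K)"
      by (rule set_integral_mono[OF intf]) (use K borel_integrable_atLeastAtMost'[OF continuous_on_const] in auto)
    also have "\<dots> = K * (b - a)"
      using a b by (simp add: set_lebesgue_integral_def)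
    also have "\<dots> \<le> (K + 1) * (2 * e)"
      using a b K(2) by (intro mult_mono) auto
    also have "\<dots> = measure M {x} / 2"
      using K(2) by (simp add: e_def field_simps)
    finally show False using p by simp
  qed
  have Ioc: "emeasure M {a<..b} = emeasure (density lborel (\<lambda>y. ennreal (f y))) {a<..b}"
    if "a \<le> b" for a b
  proof -
    have "emeasure M {a<..b} = ennreal (LBINT y:{a..b}. f y)"
      using basic[OF that atom atom] by (simp add: emeasure_eq_measure)
    also have "\<dots> = (\<integral>\<^sup>+y\<in>{a..b}. ennreal (f y) \<partial>lborel)"
    proof -
      have "(\<integral>\<^sup>+y. ennreal (indicator {a..b} y *\<^sub>R f y) \<partial>lborel) = ennreal (LBINT y:{a..b}. f y)"
        unfolding set_lebesgue_integral_def
        by (rule nn_integral_eq_integral) (use intf[of a b] nonneg in \<open>auto simp: set_integrable_def\<close>)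
      moreover have "(\<integral>\<^sup>+y. ennreal (indicator {a..b} y *\<^sub>R f y) \<partial>lborel) = (\<integral>\<^sup>+y\<in>{a..b}. ennreal (f y) \<partial>lborel)"
        by (rule nn_integral_cong) (auto simp: indicator_def)
      ultimately show ?thesis by simp
    qed
    also have "\<dots> = (\<integral>\<^sup>+y\<in>{a<..b}. ennreal (f y) \<partial>lborel)"
      by (rule nn_integral_cong_AE) (auto intro!: AE_I[of _ _ "{a}"] simp: indicator_def split: if_splits)
    also have "\<dots> = emeasure (density lborel (\<lambda>y. ennreal (f y))) {a<..b}"
      by (subst emeasure_density) auto
    finally show ?thesis .
  qed
  have "M = density lborel (\<lambda>y. ennreal (f y))"
  proof (rule measure_eqI_generator_eq[where \<Omega>=UNIV and A="\<lambda>i. {- real (i::nat)<..real i}"])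
    fix X assume "X \<in> range (\<lambda>(a, b). {a<..b::real})"
    then obtain a b where Xeq: "X = {a<..b}" by auto
    thus "emeasure M X = emeasure (density lborel (\<lambda>y. ennreal (f y))) X"
      by (cases "a \<le> b") (simp_all add: Ioc)
  next
    show "(\<Union>i. {- real (i::nat)<..real i}) = UNIV"
      by (rule UN_Ioc_eq_UNIV)
  qed (auto simp: borel_sigma_sets_Ioc Int_stable_def)
  thus ?thesis using nonneg meas by blast
qed

lemma psi_Re: "Re (psi \<gamma> \<beta> l) = \<bar>l\<bar> powr (\<gamma> + 1)"
  by (simp add: psi_def)

lemma psi_uminus: "psi \<gamma> \<beta> (- l) = cnj (psi \<gamma> \<beta> l)"
  by (simp add: psi_def)

lemma psi_measurable [measurable]: "psi \<gamma> \<beta> \<in> borel_measurable borel"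
  unfolding psi_def by measurable

lemma norm_rho_psi_ge:
  assumes "0 < \<rho>"
  shows "\<rho> + \<bar>l\<bar> powr (\<gamma> + 1) \<le> cmod (of_real \<rho> + psi \<gamma> \<beta> l)"
proof -
  have "\<rho> + \<bar>l\<bar> powr (\<gamma> + 1) = Re (of_real \<rho> + psi \<gamma> \<beta> l)"
    by (simp add: psi_Re)
  thus ?thesis using complex_Re_le_cmod by metis
qed

lemma integrable_inverse_rho_powr:
  assumes "0 < \<gamma>" "0 < \<rho>"
  shows "integrable lborel (\<lambda>l::real. 1 / (\<rho> + \<bar>l\<bar> powr (\<gamma> + 1)))"
proof -
  let ?g = "\<lambda>l::real. indicator {1..} l * l powr (- (\<gamma> + 1))"
  have g: "integrable lborel ?g"
  proof -
    have "integrable lborel (\<lambda>l. indicator {1..} l *\<^sub>R l powr (- (\<gamma> + 1)))"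
    proof (rule integrable_completion[THEN iffD1, rotated])
      have "(\<lambda>l::real. l powr (- (\<gamma> + 1))) absolutely_integrable_on {1..}"
        by (rule nonnegative_absolutely_integrable_1)
           (use has_integral_powr_to_inf[of "- (\<gamma> + 1)" 1] assms in auto)
      thus "integrable (completion lborel) (\<lambda>l. indicator {1..} l *\<^sub>R l powr (- (\<gamma> + 1)))"
        by (simp add: set_integrable_def)
    qed measurable
    thus ?thesis by simp
  qed
  have g': "integrable lborel (\<lambda>l. ?g (- l))"
    using lborel_integrable_real_affine[OF g, of "-1" 0] by simp
  have h: "integrable lborel (\<lambda>l. 1 / \<rho> * indicator {-1..1::real} l)"
    by (intro integrable_mult_right) (auto simp: integrable_indicator_iff)
  show ?thesis
  proof (rule Bochner_Integration.integrable_bound[OF Bochner_Integration.integrable_add[OF h Bochner_Integration.integrable_add[OF g g']]])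
    show "AE l in lborel. norm (1 / (\<rho> + \<bar>l\<bar> powr (\<gamma> + 1)))
      \<le> norm (1 / \<rho> * indicator {-1..1} l + (?g l + ?g (- l)))"
    proof (rule AE_I2)
      fix l :: real
      have a: "1 / (\<rho> + \<bar>l\<bar> powr (\<gamma> + 1)) \<le> 1 / \<rho>"
        using assms by (intro frac_le) auto
      have b: "1 / (\<rho> + \<bar>l\<bar> powr (\<gamma> + 1)) \<le> \<bar>l\<bar> powr (- (\<gamma> + 1))" if "\<bar>l\<bar> > 1"
      proof -
        have "1 / (\<rho> + \<bar>l\<bar> powr (\<gamma> + 1)) \<le> 1 / (\<bar>l\<bar> powr (\<gamma> + 1))"
          using assms that by (intro frac_le) auto
        thus ?thesis by (simp only: powr_minus_divide)
      qed
      have nn: "0 \<le> 1 / (\<rho> + \<bar>l\<bar> powr (\<gamma> + 1))"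
        using assms by simp
      consider "\<bar>l\<bar> \<le> 1" | "l > 1" | "l < -1" by linarith
      hence "1 / (\<rho> + \<bar>l\<bar> powr (\<gamma> + 1)) \<le> 1 / \<rho> * indicator {-1..1} l + (?g l + ?g (- l))"
      proof cases
        case 1
        hence "1 / \<rho> * indicator {-1..1} l = 1 / \<rho>" by (auto simp: indicator_def)
        moreover have "0 \<le> ?g l" "0 \<le> ?g (-l)" by auto
        ultimately show ?thesis using a by linarith
      qed (use b in \<open>auto simp: indicator_def\<close>)
      thus "norm (1 / (\<rho> + \<bar>l\<bar> powr (\<gamma> + 1)))
        \<le> norm (1 / \<rho> * indicator {-1..1} l + (?g l + ?g (- l)))"
        using nn by simp
    qed
  qed measurable
qed

lemma integrable_inverse_rho_psi:
  assumes "0 < \<gamma>" "0 < \<rho>" and [measurable]: "c \<in> borel_measurable borel"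
    and "\<And>l. cmod (c l) \<le> B"
  shows "integrable lborel (\<lambda>l::real. c l / (of_real \<rho> + psi \<gamma> \<beta> l))"
proof (rule Bochner_Integration.integrable_bound)
  show "integrable lborel (\<lambda>l::real. B * (1 / (\<rho> + \<bar>l\<bar> powr (\<gamma> + 1))))"
    by (intro integrable_mult_right integrable_inverse_rho_powr assms)
  show "AE l in lborel. cmod (c l / (of_real \<rho> + psi \<gamma> \<beta> l)) \<le> norm (B * (1 / (\<rho> + \<bar>l\<bar> powr (\<gamma> + 1))))"
  proof (rule AE_I2)
    fix l :: real
    have "0 \<le> B" using assms(4)[of 0] norm_ge_zero order_trans by blast
    have pos: "0 < \<rho> + \<bar>l\<bar> powr (\<gamma> + 1)" using assms(2) by (simp add: add_pos_nonneg)
    have "cmod (c l / (of_real \<rho> + psi \<gamma> \<beta> l)) \<le> B / (\<rho> + \<bar>l\<bar> powr (\<gamma> + 1))"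
      unfolding norm_divide
      by (rule frac_le) (use \<open>0 \<le> B\<close> assms(4) pos norm_rho_psi_ge[OF assms(2)] in auto)
    thus "cmod (c l / (of_real \<rho> + psi \<gamma> \<beta> l)) \<le> norm (B * (1 / (\<rho> + \<bar>l\<bar> powr (\<gamma> + 1))))"
      using pos \<open>0 \<le> B\<close> by simp
  qed
qed measurable

lemma u_dens_eq:
  assumes "0 < \<gamma>" "0 < \<rho>"
  shows "u_dens \<rho> \<gamma> \<beta> x y =
    1 / (2 * pi) * Re (CLBINT l. iexp (l * (x - y)) / (of_real \<rho> + psi \<gamma> \<beta> l))"
proof -
  define w where "w l = of_real \<rho> + psi \<gamma> \<beta> l" for l
  have wR: "Re (w l) = \<rho> + \<bar>l\<bar> powr (\<gamma> + 1)" for l by (simp add: w_def psi_Re)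
  have w0: "w l \<noteq> 0" for l
    using wR[of l] assms by (metis add_pos_nonneg less_irrefl powr_ge_zero zero_complex.sel(1))
  have [measurable]: "w \<in> borel_measurable borel"
    unfolding w_def by measurable
  have wm: "w (- l) = cnj (w l)" for l by (simp add: w_def psi_uminus)
  define q where "q l = Re (iexp (l * (x - y)) / w l)" for l
  have q: "integrable lborel q"
    unfolding q_def w_def
    by (intro integrable_Re integrable_inverse_rho_psi[where B=1] assms) auto
  have qm: "q (- l) = q l" for l
  proof -
    have "iexp (- l * (x - y)) / w (- l) = cnj (iexp (l * (x - y)) / w l)"
      by (simp add: wm exp_cnj)
    thus ?thesis unfolding q_def by (metis complex_cnj(1) complex.sel(1) cnj.simps(1))
  qed
  have bnd1: "integrable lborel (\<lambda>l. cos (l * (x - y)) * Re (w l) / (cmod (w l))\<^sup>2)"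
  proof -
    have "integrable lborel (\<lambda>l. Re (of_real (cos (l * (x - y))) / w l))"
      unfolding w_def
      by (intro integrable_Re integrable_inverse_rho_psi[where B=1] assms) auto
    thus ?thesis by (simp add: Re_divide cmod_power2)
  qed
  have bnd2: "integrable lborel (\<lambda>l. sin (l * (x - y)) * Im (w l) / (cmod (w l))\<^sup>2)"
  proof -
    have "integrable lborel (\<lambda>l. - Im (of_real (sin (l * (x - y))) / w l))"
      unfolding w_def
      by (intro integrable_minus integrable_Im integrable_inverse_rho_psi[where B=1] assms) auto
    thus ?thesis by (simp add: Im_divide cmod_power2)
  qed
  have q2: "q l = cos (l * (x - y)) * Re (w l) / (cmod (w l))\<^sup>2 + sin (l * (x - y)) * Im (w l) / (cmod (w l))\<^sup>2" for l
    by (simp add: q_def Re_divide cmod_power2 Re_exp Im_exp add_divide_distrib)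
  have half: "(LBINT l. q l) = 2 * (LBINT l:{0..}. q l)"
  proof -
    have sp: "set_integrable lborel A q" if "A \<in> sets lborel" for A
      unfolding set_integrable_def using integrable_mult_indicator[OF that q] .
    have "(LBINT l. q l) = (LBINT l:{0..} \<union> {..<0}. q l)"
      by (simp add: set_lebesgue_integral_def indicator_def Un_def flip: not_less)
    also have "\<dots> = (LBINT l:{0..}. q l) + (LBINT l:{..<0}. q l)"
      by (rule set_integral_Un) (auto intro!: sp)
    also have "(LBINT l:{..<0}. q l) = (LBINT l. indicator {..<0} (0 + (-1) * l) *\<^sub>R q (0 + (-1) * l))"
      unfolding set_lebesgue_integral_def
      by (subst lborel_integral_real_affine[where c="-1" and t=0]) auto
    also have "\<dots> = (LBINT l. indicator {0<..} l *\<^sub>R q l)"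
      by (rule Bochner_Integration.integral_cong) (auto simp: qm indicator_def)
    also have "\<dots> = (LBINT l:{0..}. q l)"
      unfolding set_lebesgue_integral_def
    proof (rule integral_cong_AE)
      show "AE l in lborel. indicator {0<..} l *\<^sub>R q l = indicator {0..} l *\<^sub>R q l"
        using AE_lborel_singleton[of 0] by eventually_elim (auto simp: indicator_def)
    qed (use q in \<open>auto simp: q_def\<close>)
    finally show ?thesis by simp
  qed
  have add: "(LBINT l:{0..}. q l) =
      (LBINT l:{0..}. cos (l * (x - y)) * Re (w l) / (cmod (w l))\<^sup>2) +
      (LBINT l:{0..}. sin (l * (x - y)) * Im (w l) / (cmod (w l))\<^sup>2)"
    unfolding q2
    by (rule set_integral_add(2))
       (unfold set_integrable_def, rule integrable_mult_indicator[OF _ bnd1], simp,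
        rule integrable_mult_indicator[OF _ bnd2], simp)
  have "Re (CLBINT l. iexp (l * (x - y)) / w l) = (LBINT l. q l)"
    unfolding q_def
    by (rule integral_Re[symmetric]) (unfold w_def, intro integrable_inverse_rho_psi[where B=1] assms, auto)
  also have "\<dots> = 2 * ((LBINT l:{0..}. cos (l * (x - y)) * Re (w l) / (cmod (w l))\<^sup>2) +
                     (LBINT l:{0..}. sin (l * (x - y)) * Im (w l) / (cmod (w l))\<^sup>2))"
    unfolding half add by simp
  finally show ?thesis
    by (simp add: u_dens_def w_def field_simps)
qed

lemma integral_exp_halfline:
  assumes "0 < Re w"
  shows "integrable lborel (\<lambda>t. indicator {0..} t *\<^sub>R exp (- (w * of_real t)))"
    and "(CLBINT t. indicator {0..} t *\<^sub>R exp (- (w * of_real t))) = 1 / w"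
proof -
  have w0: "w \<noteq> 0" using assms by auto
  have "set_integrable lborel {0<..} (\<lambda>x. exp (-(x * Re w)))"
    by (rule integrable_I0i_exp_mscale[OF assms])
  hence int: "set_integrable lborel {0<..} (\<lambda>t. exp (- (w * of_real t)))"
    unfolding set_integrable_def
    by (rule Bochner_Integration.integrable_bound) (auto simp: indicator_def norm_exp mult.commute)
  have eq: "AE t in lborel. indicator {0<..} t *\<^sub>R exp (- (w * of_real t)) = indicator {0..} t *\<^sub>R exp (- (w * of_real t))"
    using AE_lborel_singleton[of "0::real"] by eventually_elim (auto simp: indicator_def)
  show "integrable lborel (\<lambda>t. indicator {0..} t *\<^sub>R exp (- (w * of_real t)))"
    by (rule integrable_cong_AE_imp[OF int[unfolded set_integrable_def]]) (use eq in auto)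
  have fd: "((\<lambda>z. - exp (- (w * z)) / w) has_field_derivative exp (- (w * z))) (at z)" for z
    by (auto intro!: derivative_eq_intros simp: w0)
  have "(CLBINT t=0..\<infinity>. exp (- (w * of_real t))) = 0 - (- 1 / w)"
  proof (rule interval_integral_FTC_integrable[where F="\<lambda>t. - exp (- (w * of_real t)) / w"])
    show "((\<lambda>t. - exp (- (w * of_real t)) / w) has_vector_derivative exp (- (w * of_real t))) (at t)" for t
      using has_vector_derivative_real_field[OF fd] by simp
    show "set_integrable lborel (einterval 0 \<infinity>) (\<lambda>t. exp (- (w * of_real t)))"
      using int by (simp add: zero_ereal_def)
    show "(((\<lambda>t. - exp (- (w * of_real t)) / w) \<circ> real_of_ereal) \<longlongrightarrow> - 1 / w) (at_right 0)"
    proof -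
      have "isCont (\<lambda>t. - exp (- (w * of_real t)) / w) 0"
        by (intro continuous_intros w0)
      hence "((\<lambda>t. - exp (- (w * of_real t)) / w) \<longlongrightarrow> - 1 / w) (at 0)"
        by (simp add: isCont_def)
      thus ?thesis
        unfolding zero_ereal_def ereal_tendsto_simps
        by (rule tendsto_mono[rotated]) (simp add: at_le)
    qed
    have "((\<lambda>t. exp (- (Re w * t))) \<longlongrightarrow> 0) at_top"
      using assms by real_asymp
    hence "((\<lambda>t. - exp (- (w * of_real t)) / w) \<longlongrightarrow> 0) at_top"
      by (intro tendsto_norm_zero_cancel[where f="\<lambda>t. - exp (- (w * of_real t)) / w"])
         (auto simp: norm_divide norm_exp intro!: tendsto_divide_zero)
    thus "(((\<lambda>t. - exp (- (w * of_real t)) / w) \<circ> real_of_ereal) \<longlongrightarrow> 0) (at_left \<infinity>)"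
      unfolding ereal_tendsto_simps .
  qed (auto intro!: continuous_intros)
  hence "(CLBINT t. indicator {0<..} t *\<^sub>R exp (- (w * of_real t))) = 1 / w"
    by (simp add: interval_lebesgue_integral_def set_lebesgue_integral_def zero_ereal_def)
  moreover have "(CLBINT t. indicator {0<..} t *\<^sub>R exp (- (w * of_real t))) = (CLBINT t. indicator {0..} t *\<^sub>R exp (- (w * of_real t)))"
    by (rule integral_cong_AE) (use eq in auto)
  ultimately show "(CLBINT t. indicator {0..} t *\<^sub>R exp (- (w * of_real t))) = 1 / w"
    by simp
qed

lemma levy_process_measurable_pair:
  assumes "levy_process N Z"
  shows "(\<lambda>(\<omega>, t). Z (max 0 t) \<omega>) \<in> borel_measurable (N \<Otimes>\<^sub>M borel)"
proof -
  have m: "\<And>t. 0 \<le> t \<Longrightarrow> Z t \<in> borel_measurable N"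
    and rc: "\<And>\<omega> t. \<omega> \<in> space N \<Longrightarrow> 0 \<le> t \<Longrightarrow> continuous (at_right t) (\<lambda>s. Z s \<omega>)"
    using assms by (auto simp: levy_process_def)
  define g where "g n t = (real_of_int (\<lfloor>real (Suc n) * t\<rfloor> + 1)) / real (Suc n)" for n :: nat and t :: real
  have g1: "t \<le> g n t" for n t
    unfolding g_def by (simp add: pos_le_divide_eq mult.commute)
  have g2: "g n t \<le> t + inverse (real (Suc n))" for n t
  proof -
    have "real_of_int (\<lfloor>real (Suc n) * t\<rfloor> + 1) \<le> real (Suc n) * t + 1" by simp
    hence "g n t \<le> (real (Suc n) * t + 1) / real (Suc n)"
      unfolding g_def by (rule divide_right_mono) simp
    thus ?thesis by (simp add: add_divide_distrib inverse_eq_divide del: of_nat_Suc)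
  qed
  have g: "(\<lambda>n. g n t) \<longlonglongrightarrow> t" for t
  proof (rule tendsto_sandwich)
    show "(\<lambda>n. t) \<longlonglongrightarrow> t" by simp
    show "(\<lambda>n. t + inverse (real (Suc n))) \<longlonglongrightarrow> t"
      using tendsto_add[OF tendsto_const LIMSEQ_inverse_real_of_nat] by simp
  qed (use g1 g2 in auto)
  show ?thesis
  proof (rule borel_measurable_LIMSEQ_real)
    fix n
    have a: "(\<lambda>p. Z (max 0 (real_of_int (k + 1) / real (Suc n))) (fst p)) \<in> borel_measurable (N \<Otimes>\<^sub>M borel)" for k :: int
      by (rule measurable_compose[OF measurable_fst m]) simp
    have b: "(\<lambda>p. \<lfloor>real (Suc n) * snd p\<rfloor>) \<in> N \<Otimes>\<^sub>M borel \<rightarrow>\<^sub>M count_space UNIV"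
      by measurable
    show "(\<lambda>(\<omega>, t). Z (max 0 (g n t)) \<omega>) \<in> borel_measurable (N \<Otimes>\<^sub>M borel)"
      using measurable_compose_countable[OF a b] by (simp add: g_def split_beta' del: of_nat_Suc)
  next
    fix p assume p: "p \<in> space (N \<Otimes>\<^sub>M (borel :: real measure))"
    obtain \<omega> t where pt: "p = (\<omega>, t)" by (cases p)
    have \<omega>: "\<omega> \<in> space N" using p pt by (simp add: space_pair_measure)
    have c: "continuous (at (max 0 t) within {max 0 t..}) (\<lambda>s. Z s \<omega>)"
      using rc[OF \<omega>, of "max 0 t"] by (simp add: at_within_Ici_at_right)
    have "(\<lambda>n. Z (max 0 (g n t)) \<omega>) \<longlonglongrightarrow> Z (max 0 t) \<omega>"
    proof (rule continuous_within_sequentially[THEN iffD1, OF c, rule_format, unfolded comp_def])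
      have "max 0 t \<le> max 0 (g n t)" for n using g1[of t n] by linarith
      thus "(\<forall>n. max 0 (g n t) \<in> {max 0 t..}) \<and> (\<lambda>n. max 0 (g n t)) \<longlonglongrightarrow> max 0 t"
        using tendsto_max[OF tendsto_const g[of t], of 0] by simp
    qed
    thus "(\<lambda>n. case p of (\<omega>, t) \<Rightarrow> Z (max 0 (g n t)) \<omega>) \<longlonglongrightarrow> (case p of (\<omega>, t) \<Rightarrow> Z (max 0 t) \<omega>)"
      by (simp add: pt)
  qed
qed

(* For a Levy process Z with exponent psi and an exponential time xi of mean 1 / rho that is
   independent of the whole process, u_dens is a density of the zero-potential of the killed
   process with respect to Lebesgue measure. *)
lemma u_dens_zero_potential_density:
  assumes levy: "levy_process N Z"
    and ch: "\<And>t l. 0 \<le> t \<Longrightarrow> char (distr N borel (Z t)) l = exp (- (of_real t * psi \<gamma> \<beta> l))"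
    and xi: "distributed N lborel \<xi> (exponential_density \<rho>)"
    and ind: "prob_space.indep_set N (sets (vimage_algebra (space N) \<xi> borel))
        (sets (vimage_algebra (space N) (\<lambda>\<omega>. \<lambda>t\<in>{0..}. Z t \<omega>) (\<Pi>\<^sub>M t\<in>{0..}. borel)))"
    and pos: "0 < \<gamma>" "0 < \<rho>"
  shows "0 \<le> u_dens \<rho> \<gamma> \<beta> x y"
    and "A \<in> sets borel \<Longrightarrow>
      killed_potential N Z \<xi> x A = (\<integral>\<^sup>+y\<in>A. ennreal (u_dens \<rho> \<gamma> \<beta> x y) \<partial>lborel)"
proof -
  interpret N: prob_space N using levy by (simp add: levy_process_def)
  define E where "E = density lborel (\<lambda>t. ennreal (exponential_density \<rho> t))"
  interpret E: prob_space E
    unfolding E_def by (rule prob_space_exponential_density) fact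
  have sE[simp, measurable_cong]: "sets E = sets borel" by (simp add: E_def)
  interpret NE: pair_prob_space N E ..
  interpret NL: pair_sigma_finite N lborel ..
  have mZ: "\<And>t. 0 \<le> t \<Longrightarrow> Z t \<in> borel_measurable N"
    using levy by (simp add: levy_process_def)
  have mxi[measurable]: "\<xi> \<in> borel_measurable N"
    using distributed_measurable[OF xi] by simp
  note pair = levy_process_measurable_pair[OF levy]
  have W[measurable]: "(\<lambda>(\<omega>, t). x + Z (max 0 t) \<omega>) \<in> borel_measurable (N \<Otimes>\<^sub>M borel)"
    using pair by (simp add: split_beta')
  have WE[measurable]: "(\<lambda>(\<omega>, t). x + Z (max 0 t) \<omega>) \<in> borel_measurable (N \<Otimes>\<^sub>M E)"
    using W by (simp add: measurable_cong_sets[OF sets_pair_measure_cong[OF refl sE] refl])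
  define K where "K = distr (N \<Otimes>\<^sub>M E) borel (\<lambda>(\<omega>, t). x + Z (max 0 t) \<omega>)"
  have Kd: "real_distribution K"
    unfolding K_def by (rule NE.P.real_distribution_distr) measurable
  have charK: "char K l = of_real \<rho> * iexp (l * x) / (of_real \<rho> + psi \<gamma> \<beta> l)" for l
  proof -
    have w: "0 < Re (of_real \<rho> + psi \<gamma> \<beta> l)" using pos by (simp add: psi_Re add_pos_nonneg)
    have "char K l = (CLINT p|N \<Otimes>\<^sub>M E. iexp (l * (case p of (\<omega>, t) \<Rightarrow> x + Z (max 0 t) \<omega>)))"
      unfolding char_def K_def by (subst integral_distr) auto
    also have "\<dots> = (CLINT t|E. CLINT \<omega>|N. iexp (l * (x + Z (max 0 t) \<omega>)))"
    proof -
      have m: "(\<lambda>p. x + Z (max 0 (snd p)) (fst p)) \<in> borel_measurable (N \<Otimes>\<^sub>M E)"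
        using WE by (simp add: split_beta')
      have "integrable (N \<Otimes>\<^sub>M E) (\<lambda>(\<omega>, t). iexp (l * (x + Z (max 0 t) \<omega>)))"
        by (rule NE.P.integrable_const_bound[where B=1])
           (use m in \<open>auto simp: split_beta' simp del: of_real_mult of_real_add\<close>)
      from NE.integral_snd[OF this] show ?thesis by (simp add: split_beta')
    qed
    also have "\<dots> = (CLINT t|E. iexp (l * x) * exp (- (of_real (max 0 t) * psi \<gamma> \<beta> l)))"
    proof (rule Bochner_Integration.integral_cong[OF refl])
      fix t :: real
      have "(CLINT \<omega>|N. iexp (l * (x + Z (max 0 t) \<omega>))) = (CLINT \<omega>|N. iexp (l * x) * iexp (l * Z (max 0 t) \<omega>))"
        by (simp add: distrib_left exp_add)
      also have "\<dots> = iexp (l * x) * (CLINT \<omega>|N. iexp (l * Z (max 0 t) \<omega>))"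
        by (rule integral_mult_right_zero)
      also have "(CLINT \<omega>|N. iexp (l * Z (max 0 t) \<omega>)) = char (distr N borel (Z (max 0 t))) l"
        unfolding char_def by (subst integral_distr) (auto intro!: mZ)
      finally show "(CLINT \<omega>|N. iexp (l * (x + Z (max 0 t) \<omega>))) = iexp (l * x) * exp (- (of_real (max 0 t) * psi \<gamma> \<beta> l))"
        using ch[of "max 0 t" l] by simp
    qed
    also have "\<dots> = (CLBINT t. exponential_density \<rho> t *\<^sub>R (iexp (l * x) * exp (- (of_real (max 0 t) * psi \<gamma> \<beta> l))))"
      unfolding E_def
      by (subst integral_density) (auto intro!: AE_I2 exponential_density_nonneg pos)
    also have "\<dots> = (CLBINT t. (of_real \<rho> * iexp (l * x)) * (indicator {0..} t *\<^sub>R exp (- ((of_real \<rho> + psi \<gamma> \<beta> l) * of_real t))))"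
    proof (rule Bochner_Integration.integral_cong[OF refl])
      fix t :: real
      show "exponential_density \<rho> t *\<^sub>R (iexp (l * x) * exp (- (of_real (max 0 t) * psi \<gamma> \<beta> l))) =
        (of_real \<rho> * iexp (l * x)) * (indicator {0..} t *\<^sub>R exp (- ((of_real \<rho> + psi \<gamma> \<beta> l) * of_real t)))"
      proof (cases "0 \<le> t")
        case True
        have "exp (- ((of_real \<rho> + psi \<gamma> \<beta> l) * of_real t)) = exp (- (of_real (t * \<rho>))) * exp (- (of_real t * psi \<gamma> \<beta> l))"
          by (simp add: exp_add[symmetric] algebra_simps)
        thus ?thesis using True
          by (simp add: exponential_density_def scaleR_conv_of_real exp_of_real[symmetric] max_def del: exp_of_real)
      qed (simp add: exponential_density_def)
    qed
    also have "\<dots> = of_real \<rho> * iexp (l * x) / (of_real \<rho> + psi \<gamma> \<beta> l)"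
      by (simp only: integral_mult_right_zero integral_exp_halfline(2)[OF w] times_divide_eq_right mult_1_right)
    finally show ?thesis .
  qed
  have intK: "integrable lborel (char K)"
    unfolding charK
    by (rule integrable_inverse_rho_psi[where B=\<rho>]) (use pos in \<open>auto simp: norm_mult\<close>)
  have f: "1 / (2 * pi) * Re (CLBINT t. iexp (- (t * y)) * char K t) = \<rho> * u_dens \<rho> \<gamma> \<beta> x y" for y
  proof -
    have "(CLBINT t. iexp (- (t * y)) * char K t) =
        (CLBINT t. of_real \<rho> * (iexp (t * (x - y)) / (of_real \<rho> + psi \<gamma> \<beta> t)))"
      by (rule Bochner_Integration.integral_cong)
         (auto simp: charK right_diff_distrib exp_diff exp_minus field_simps)
    also have "\<dots> = of_real \<rho> * (CLBINT t. iexp (t * (x - y)) / (of_real \<rho> + psi \<gamma> \<beta> t))"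
      by (rule integral_mult_right_zero)
    finally have eq: "(CLBINT t. iexp (- (t * y)) * char K t) =
      of_real \<rho> * (CLBINT t. iexp (t * (x - y)) / (of_real \<rho> + psi \<gamma> \<beta> t))" .
    have "Re (of_real \<rho> * C) = \<rho> * Re C" for C by simp
    thus ?thesis
      unfolding u_dens_eq[OF pos] eq by (simp only: mult.left_commute)
  qed
  note dK = density_of_integrable_char[OF Kd intK, unfolded f]
  show nn: "0 \<le> u_dens \<rho> \<gamma> \<beta> x y" for y
    using dK pos by (simp add: zero_le_mult_iff)
  assume A[measurable]: "A \<in> sets borel"
  have Zt: "emeasure N {\<omega> \<in> space N. t < \<xi> \<omega> \<and> x + Z t \<omega> \<in> A}
      = ennreal (exp (- t * \<rho>)) * emeasure N {\<omega> \<in> space N. x + Z t \<omega> \<in> A}" if t: "0 \<le> t" for t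
  proof -
    have [measurable]: "Z t \<in> borel_measurable N" using mZ t by simp
    have comp: "(\<lambda>f. f t) \<in> measurable (\<Pi>\<^sub>M t\<in>{0..}. borel :: real measure) borel"
      by (rule measurable_component_singleton) (use t in auto)
    have B: "(\<lambda>z. x + z) -` A \<in> sets borel"
    proof -
      have "(\<lambda>z. x + z) -` A \<inter> space borel \<in> sets borel" by measurable
      thus ?thesis by simp
    qed
    have "N.prob ((\<xi> -` {t<..} \<inter> space N) \<inter> (Z t -` ((\<lambda>z. x + z) -` A) \<inter> space N)) =
        N.prob (\<xi> -` {t<..} \<inter> space N) * N.prob (Z t -` ((\<lambda>z. x + z) -` A) \<inter> space N)"
    proof (rule N.indep_setD[OF ind])
      show "\<xi> -` {t<..} \<inter> space N \<in> sets (vimage_algebra (space N) \<xi> borel)"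
        by (rule in_vimage_algebra) simp
      have "(\<lambda>\<omega>. \<lambda>t\<in>{0..}. Z t \<omega>) -` ((\<lambda>f. f t) -` ((\<lambda>z. x + z) -` A) \<inter> space (\<Pi>\<^sub>M t\<in>{0..}. borel :: real measure)) \<inter> space N
        \<in> sets (vimage_algebra (space N) (\<lambda>\<omega>. \<lambda>t\<in>{0..}. Z t \<omega>) (\<Pi>\<^sub>M t\<in>{0..}. borel))"
        by (rule in_vimage_algebra) (rule measurable_sets[OF comp B])
      also have "(\<lambda>\<omega>. \<lambda>t\<in>{0..}. Z t \<omega>) -` ((\<lambda>f. f t) -` ((\<lambda>z. x + z) -` A) \<inter> space (\<Pi>\<^sub>M t\<in>{0..}. borel :: real measure)) \<inter> space N
        = Z t -` ((\<lambda>z. x + z) -` A) \<inter> space N"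
        using t by (auto simp: space_PiM)
      finally show "Z t -` ((\<lambda>z. x + z) -` A) \<inter> space N
        \<in> sets (vimage_algebra (space N) (\<lambda>\<omega>. \<lambda>t\<in>{0..}. Z t \<omega>) (\<Pi>\<^sub>M t\<in>{0..}. borel))" .
    qed
    moreover have "(\<xi> -` {t<..} \<inter> space N) \<inter> (Z t -` ((\<lambda>z. x + z) -` A) \<inter> space N) = {\<omega> \<in> space N. t < \<xi> \<omega> \<and> x + Z t \<omega> \<in> A}"
      "Z t -` ((\<lambda>z. x + z) -` A) \<inter> space N = {\<omega> \<in> space N. x + Z t \<omega> \<in> A}"
      "\<xi> -` {t<..} \<inter> space N = {\<omega> \<in> space N. t < \<xi> \<omega>}"
      by auto
    moreover have "N.prob {\<omega> \<in> space N. t < \<xi> \<omega>} = exp (- t * \<rho>)"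
      using N.exponential_distributedD_gt[OF xi t pos(2)] .
    ultimately have "N.prob {\<omega> \<in> space N. t < \<xi> \<omega> \<and> x + Z t \<omega> \<in> A} = exp (- t * \<rho>) * N.prob {\<omega> \<in> space N. x + Z t \<omega> \<in> A}"
      by simp
    thus ?thesis by (simp add: N.emeasure_eq_measure ennreal_mult)
  qed
  have m1[measurable]: "(\<lambda>(\<omega>, t). indicator {0..<\<xi> \<omega>} t * indicator A (x + Z (max 0 t) \<omega>) :: ennreal)
      \<in> borel_measurable (N \<Otimes>\<^sub>M lborel)"
  proof -
    have "(\<lambda>p. x + Z (max 0 (snd p)) (fst p)) \<in> borel_measurable (N \<Otimes>\<^sub>M lborel)"
      using W by (simp add: split_beta' measurable_cong_sets[OF sets_pair_measure_cong[OF refl sets_lborel] refl])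
    note [measurable] = this
    have "(\<lambda>p. (if 0 \<le> snd p \<and> snd p < \<xi> (fst p) then 1 else 0) * indicator A (x + Z (max 0 (snd p)) (fst p)) :: ennreal)
      \<in> borel_measurable (N \<Otimes>\<^sub>M lborel)"
      by measurable
    thus ?thesis by (simp add: split_beta' indicator_def)
  qed
  have "killed_potential N Z \<xi> x A = (\<integral>\<^sup>+\<omega>. (\<integral>\<^sup>+t. indicator {0..<\<xi> \<omega>} t * indicator A (x + Z (max 0 t) \<omega>) \<partial>lborel) \<partial>N)"
    unfolding killed_potential_def
    by (intro nn_integral_cong) (auto simp: indicator_def max_def)
  also have "\<dots> = (\<integral>\<^sup>+t. (\<integral>\<^sup>+\<omega>. indicator {0..<\<xi> \<omega>} t * indicator A (x + Z (max 0 t) \<omega>) \<partial>N) \<partial>lborel)"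
    by (rule NL.Fubini'[symmetric]) (use m1 in simp)
  also have "\<dots> = (\<integral>\<^sup>+t. indicator {0..} t * (ennreal (exp (- t * \<rho>)) * emeasure N {\<omega> \<in> space N. x + Z (max 0 t) \<omega> \<in> A}) \<partial>lborel)"
  proof (rule nn_integral_cong)
    fix t :: real
    show "(\<integral>\<^sup>+\<omega>. indicator {0..<\<xi> \<omega>} t * indicator A (x + Z (max 0 t) \<omega>) \<partial>N) =
      indicator {0..} t * (ennreal (exp (- t * \<rho>)) * emeasure N {\<omega> \<in> space N. x + Z (max 0 t) \<omega> \<in> A})"
    proof (cases "0 \<le> t")
      case True
      have [measurable]: "Z t \<in> borel_measurable N" using mZ True by simp
      have "(\<integral>\<^sup>+\<omega>. indicator {0..<\<xi> \<omega>} t * indicator A (x + Z (max 0 t) \<omega>) \<partial>N) =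
        (\<integral>\<^sup>+\<omega>. indicator {\<omega> \<in> space N. t < \<xi> \<omega> \<and> x + Z t \<omega> \<in> A} \<omega> \<partial>N)"
        by (rule nn_integral_cong) (use True in \<open>auto simp: indicator_def max_def\<close>)
      also have "\<dots> = emeasure N {\<omega> \<in> space N. t < \<xi> \<omega> \<and> x + Z t \<omega> \<in> A}"
        by (rule nn_integral_indicator) measurable
      finally show ?thesis using Zt[OF True] True by simp
    qed simp
  qed
  finally have kp: "killed_potential N Z \<xi> x A =
     (\<integral>\<^sup>+t. indicator {0..} t * (ennreal (exp (- t * \<rho>)) * emeasure N {\<omega> \<in> space N. x + Z (max 0 t) \<omega> \<in> A}) \<partial>lborel)" .
  have mt[measurable]: "(\<lambda>t. emeasure N {\<omega> \<in> space N. x + Z (max 0 t) \<omega> \<in> A}) \<in> borel_measurable borel"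
  proof -
    have "(\<lambda>t. \<integral>\<^sup>+\<omega>. indicator A (x + Z (max 0 t) \<omega>) \<partial>N) \<in> borel_measurable borel"
    proof (rule N.borel_measurable_nn_integral)
      have "(\<lambda>p. indicator A (case (snd p, fst p) of (\<omega>, t) \<Rightarrow> x + Z (max 0 t) \<omega>) :: ennreal) \<in> borel_measurable (borel \<Otimes>\<^sub>M N)"
        by (intro measurable_compose[OF measurable_compose[OF _ W]]) measurable
      thus "(\<lambda>(t, \<omega>). indicator A (x + Z (max 0 t) \<omega>) :: ennreal) \<in> borel_measurable (borel \<Otimes>\<^sub>M N)"
        by (simp add: split_beta')
    qed
    moreover have "(\<integral>\<^sup>+\<omega>. indicator A (x + Z (max 0 t) \<omega>) \<partial>N) = emeasure N {\<omega> \<in> space N. x + Z (max 0 t) \<omega> \<in> A}" for t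
    proof -
      have [measurable]: "Z (max 0 t) \<in> borel_measurable N" using mZ by simp
      have "(\<integral>\<^sup>+\<omega>. indicator A (x + Z (max 0 t) \<omega>) \<partial>N) = (\<integral>\<^sup>+\<omega>. indicator {\<omega> \<in> space N. x + Z (max 0 t) \<omega> \<in> A} \<omega> \<partial>N)"
        by (rule nn_integral_cong) (auto simp: indicator_def)
      also have "\<dots> = emeasure N {\<omega> \<in> space N. x + Z (max 0 t) \<omega> \<in> A}"
        by (rule nn_integral_indicator) measurable
      finally show ?thesis .
    qed
    ultimately show ?thesis by simp
  qed
  have "emeasure K A = emeasure (N \<Otimes>\<^sub>M E) ((\<lambda>(\<omega>, t). x + Z (max 0 t) \<omega>) -` A \<inter> space (N \<Otimes>\<^sub>M E))"
    unfolding K_def by (rule emeasure_distr) (use WE in auto)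
  also have "\<dots> = (\<integral>\<^sup>+t. emeasure N ((\<lambda>\<omega>. (\<omega>, t)) -` ((\<lambda>(\<omega>, t). x + Z (max 0 t) \<omega>) -` A \<inter> space (N \<Otimes>\<^sub>M E))) \<partial>E)"
    by (rule NE.emeasure_pair_measure_alt2) (use measurable_sets[OF WE A] in simp)
  also have "\<dots> = (\<integral>\<^sup>+t. emeasure N {\<omega> \<in> space N. x + Z (max 0 t) \<omega> \<in> A} \<partial>E)"
    by (rule nn_integral_cong, rule arg_cong[where f="emeasure N"]) (auto simp: space_pair_measure)
  also have "\<dots> = (\<integral>\<^sup>+t. ennreal (exponential_density \<rho> t) * emeasure N {\<omega> \<in> space N. x + Z (max 0 t) \<omega> \<in> A} \<partial>lborel)"
    unfolding E_def by (rule nn_integral_density) auto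
  also have "\<dots> = (\<integral>\<^sup>+t. ennreal \<rho> * (indicator {0..} t * (ennreal (exp (- t * \<rho>)) * emeasure N {\<omega> \<in> space N. x + Z (max 0 t) \<omega> \<in> A})) \<partial>lborel)"
    by (rule nn_integral_cong)
       (use pos in \<open>auto simp: exponential_density_def indicator_def ennreal_mult mult.assoc\<close>)
  also have "\<dots> = ennreal \<rho> * killed_potential N Z \<xi> x A"
    unfolding kp by (rule nn_integral_cmult) auto
  finally have k1: "emeasure K A = ennreal \<rho> * killed_potential N Z \<xi> x A" .
  have mu: "u_dens \<rho> \<gamma> \<beta> x \<in> borel_measurable borel"
  proof -
    have "(\<lambda>y. (1 / \<rho>) * (\<rho> * u_dens \<rho> \<gamma> \<beta> x y)) \<in> borel_measurable borel"
      by (rule borel_measurable_times) (use dK in auto)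
    thus ?thesis using pos by simp
  qed
  note [measurable] = mu
  have "emeasure K A = (\<integral>\<^sup>+y\<in>A. ennreal (\<rho> * u_dens \<rho> \<gamma> \<beta> x y) \<partial>lborel)"
  proof -
    have "emeasure K A = emeasure (density lborel (\<lambda>y. ennreal (\<rho> * u_dens \<rho> \<gamma> \<beta> x y))) A"
      using dK by metis
    also have "\<dots> = (\<integral>\<^sup>+y\<in>A. ennreal (\<rho> * u_dens \<rho> \<gamma> \<beta> x y) \<partial>lborel)"
      by (rule emeasure_density) auto
    finally show ?thesis .
  qed
  also have "\<dots> = (\<integral>\<^sup>+y. ennreal \<rho> * (ennreal (u_dens \<rho> \<gamma> \<beta> x y) * indicator A y) \<partial>lborel)"
    using pos nn by (intro nn_integral_cong) (simp add: ennreal_mult mult.assoc)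
  also have "\<dots> = ennreal \<rho> * (\<integral>\<^sup>+y\<in>A. ennreal (u_dens \<rho> \<gamma> \<beta> x y) \<partial>lborel)"
    by (rule nn_integral_cmult) auto
  finally have "ennreal \<rho> * killed_potential N Z \<xi> x A = ennreal \<rho> * (\<integral>\<^sup>+y\<in>A. ennreal (u_dens \<rho> \<gamma> \<beta> x y) \<partial>lborel)"
    using k1 by simp
  thus "killed_potential N Z \<xi> x A = (\<integral>\<^sup>+y\<in>A. ennreal (u_dens \<rho> \<gamma> \<beta> x y) \<partial>lborel)"
    using pos by (simp add: ennreal_mult_cancel_left)
qed

end

theory Submission
  imports Defs
begin

text \<open>
  Everything about the sample paths is extracted from the laws of \<open>Y s\<close> and of the pairs
  \<open>(Y s, Y t)\<close>. Write \<open>u\<close> for the constant diagonal value of the kernel, which is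
  \<open>D_const\<close>, and \<open>\<kappa> = u\<^sup>2 - u(s,t) u(t,s)\<close> for the determinant of the two-by-two kernel.
  Then \<open>Y s\<close> has a gamma law with scale \<open>u\<close>, and the pair has the Laplace transform
  \<open>(1 + u s1 + u s2 + \<kappa> s1 s2) powr (-\<alpha>)\<close>. The kernel need not be symmetric, but only the product
  \<open>u(s,t) u(t,s)\<close> enters here.

  Increments. The square \<open>(sqrt x1 - sqrt x2)\<^sup>2\<close> for \<open>x2 < x1\<close> is the supremum over \<open>0 < e < 1\<close> of the
  linear forms \<open>e x1 - e / (1 - e) x2\<close>. Each of these forms has explicit exponential moments: with
  the weight \<open>exp (- s2 X2)\<close> the variable \<open>X1\<close> is, up to normalization, again gamma distributed
  (\<open>weighted_gamma_law\<close>), so one of the two arguments of the Laplace transform may be negative.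
  Replacing the supremum by a maximum over a geometric sequence of values \<open>e\<close> costs an arbitrarily
  small factor in the exponent, and the resulting probabilities form a geometric sum. Hence
  \<open>(sqrt (Y s) - sqrt (Y t))\<^sup>2\<close> has an exponential tail of rate almost \<open>u / \<kappa>\<close> (\<open>pair_tail\<close>):
  \<open>sqrt Y\<close> behaves like a Gaussian process with increment variance \<open>\<kappa> / (2 u)\<close>.

  The kernel near the diagonal. Split the kernel into its even part \<open>A\<close> and its odd part \<open>B\<close> in
  \<open>x = s - t\<close>, so that \<open>\<kappa> = A(0)\<^sup>2 - A(x)\<^sup>2 + B(x)\<^sup>2\<close>. The integral of
  \<open>(1 - cos t) / t powr (\<gamma> + 1)\<close>, evaluated through Gamma functions, gives
  \<open>A(0) - A(x) \<le> C \<bar>x\<bar> powr \<gamma> + O(\<bar>x\<bar>)\<close> with \<open>C = C_const\<close>, while \<open>B(x)\<^sup>2\<close> is of smaller order.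
  Hence \<open>\<kappa>\<close> is at most \<open>2 u C \<bar>s - t\<bar> powr \<gamma>\<close> up to a factor close to one
  (\<open>kernel_gap_upper\<close>).

  Moduli of continuity. A dyadic chaining argument and the Borel-Cantelli lemma turn the tail
  bound into moduli for \<open>V = sqrt Y\<close> with the constant \<open>sqrt (2 C)\<close> (\<open>uniform_modulus\<close>,
  \<open>local_modulus\<close>). Finally \<open>\<bar>Y s - Y t\<bar> = \<bar>V s - V t\<bar> (V s + V t)\<close>, and the second factor is at most
  \<open>2 sqrt (sup Y)\<close>, respectively converges to \<open>2 sqrt (Y 0)\<close> as \<open>t\<close> tends to \<open>0\<close>. This yields
  the constant \<open>2 sqrt 2 sqrt C\<close>, which is at most \<open>2 sqrt 2 sqrt ((1 + \<bar>\<beta>\<bar>) C)\<close>.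

  Growth at infinity. The gamma tail on a finite grid in each block of fixed length, together
  with chaining inside the block, gives the upper bound \<open>u\<close> (\<open>eventual_growth\<close>). For the lower bound
  consider an arithmetic progression of times. Expanding the joint Laplace transform into a
  negative binomial series shows that the covariance of a function of \<open>Y s\<close> and a function of
  \<open>Y t\<close> is at most \<open>\<bar>u(s,t) u(t,s)\<bar> / u\<^sup>2\<close> times the mean of their variances (\<open>cov_bound\<close>). An
  integration by parts shows \<open>u(s,t) = O(1 / \<bar>s - t\<bar>)\<close> (\<open>u_dens_decay\<close>), so these factors are
  summable along the progression, and the second-moment form of the Borel-Cantelli lemma
  (\<open>weakly_correlated_sum_diverges\<close>) applies: the events \<open>(1 - \<epsilon>) u ln t < Y t\<close> occur for
  arbitrarily large \<open>t\<close>.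
\<close>

section \<open>Laplace transforms and gamma laws\<close>

text \<open>
  Under \<open>y = exp (- x)\<close> sums of integer exponentials become polynomials on
  \<open>{0..1}\<close>, so this is the Weierstrass theorem. A factor \<open>y\<close> is split
  off before approximating, because the exponents start at \<open>1\<close>; this is possible
  since \<open>\<phi>\<close> vanishes near infinity, that is, near \<open>y = 0\<close>.
\<close>
lemma exp_sum_approx:
  fixes \<phi> :: "real \<Rightarrow> real"
  assumes cont: "continuous_on {0..} \<phi>" and R: "\<And>x. R \<le> x \<Longrightarrow> \<phi> x = 0" and "0 < \<delta>"
  obtains n :: nat and a :: "nat \<Rightarrow> real"
    where "\<And>x. 0 \<le> x \<Longrightarrow> \<bar>\<phi> x - (\<Sum>m\<le>n. a m * exp (- (real (Suc m) * x)))\<bar> < \<delta>"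
proof -
  define R' where "R' = max R 0"
  \<comment> \<open>The truncation keeps \<open>q\<close> continuous at \<open>0\<close>; it only
    acts where \<open>\<phi>\<close> vanishes.\<close>
  define z where "z y = max y (exp (- R'))" for y
  define q where "q y = \<phi> (- ln (z y)) / z y" for y
  have z0: "0 < z y" for y by (simp add: z_def less_max_iff_disj)
  have z1: "z y \<le> 1" if "y \<le> 1" for y using that by (simp add: z_def R'_def)
  have "continuous_on {0..1} q"
    unfolding q_def
  proof (intro continuous_on_divide)
    have z: "continuous_on {0..1} z" unfolding z_def by (intro continuous_intros)
    show "continuous_on {0..1} z" by fact
    show "continuous_on {0..1} (\<lambda>y. \<phi> (- ln (z y)))"
    proof (rule continuous_on_compose2[OF cont])
      show "continuous_on {0..1} (\<lambda>y. - ln (z y))"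
        using z0 by (intro continuous_intros z) (metis less_irrefl)
      show "(\<lambda>y. - ln (z y)) ` {0..1} \<subseteq> {0..}" using z0 z1 by auto
    qed
    show "\<forall>x\<in>{0..1}. z x \<noteq> 0" using z0 by (metis less_irrefl)
  qed
  then obtain g where g: "real_polynomial_function g" "\<And>y. y \<in> {0..1} \<Longrightarrow> \<bar>q y - g y\<bar> < \<delta>"
    using Stone_Weierstrass_real_polynomial_function[of "{0..1}" q \<delta>] \<open>0 < \<delta>\<close> by auto
  obtain a n where gs: "g = (\<lambda>x. \<Sum>i\<le>n. a i * x ^ i)"
    using g(1) real_polynomial_function_iff_sum by metis
  show thesis
  proof
    fix x :: real assume x: "0 \<le> x"
    let ?y = "exp (- x)"
    have "\<phi> x = ?y * q ?y"
    proof (cases "x \<le> R'")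
      case True
      hence "z ?y = ?y" by (simp add: z_def)
      thus ?thesis by (simp add: q_def)
    next
      case False
      hence "z ?y = exp (- R')" by (simp add: z_def)
      thus ?thesis using False R[of x] R[of R'] by (simp add: q_def R'_def)
    qed
    moreover have "(\<Sum>m\<le>n. a m * exp (- (real (Suc m) * x))) = ?y * g ?y"
      unfolding gs by (simp add: sum_distrib_left exp_of_nat_mult[symmetric] algebra_simps exp_add[symmetric])
    ultimately have "\<bar>\<phi> x - (\<Sum>m\<le>n. a m * exp (- (real (Suc m) * x)))\<bar> = ?y * \<bar>q ?y - g ?y\<bar>"
      by (simp add: abs_mult flip: right_diff_distrib)
    also have "\<dots> \<le> 1 * \<bar>q ?y - g ?y\<bar>" using x by (intro mult_right_mono) auto
    also have "\<dots> < \<delta>" using g(2)[of ?y] x by simp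
    finally show "\<bar>\<phi> x - (\<Sum>m\<le>n. a m * exp (- (real (Suc m) * x)))\<bar> < \<delta>" .
  qed
qed

text \<open>
  Finite measures on the half-line are determined by the Laplace transform at the positive
  integers: by \<open>exp_sum_approx\<close> it determines the integrals of bounded continuous
  functions vanishing near infinity, and indicators of \<open>{..c}\<close> are limits of such
  functions.
\<close>
lemma laplace_unique:
  fixes \<mu> \<nu> :: "real measure"
  assumes fin: "finite_measure \<mu>" "finite_measure \<nu>"
    and sets: "sets \<mu> = sets borel" "sets \<nu> = sets borel"
    and nonneg: "AE x in \<mu>. 0 \<le> x" "AE x in \<nu>. 0 \<le> x"
    and eq: "\<And>n. (LINT x|\<mu>. exp (- (real (Suc n) * x))) = (LINT x|\<nu>. exp (- (real (Suc n) * x)))"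
  shows "\<mu> = \<nu>"
proof -
  interpret m: finite_measure \<mu> by fact
  interpret n: finite_measure \<nu> by fact
  note [measurable_cong] = sets
  have [simp]: "space \<mu> = UNIV" "space \<nu> = UNIV"
    using sets_eq_imp_space_eq[OF sets(1)] sets_eq_imp_space_eq[OF sets(2)] by auto
  have eqphi: "(LINT x|\<mu>. \<phi> x) = (LINT x|\<nu>. \<phi> x)"
    if c: "continuous_on UNIV \<phi>" and R: "\<And>x. R \<le> x \<Longrightarrow> \<phi> x = 0" and B: "\<And>x. \<bar>\<phi> x\<bar> \<le> B" for \<phi> :: "real \<Rightarrow> real" and R B
  proof -
    have [measurable]: "\<phi> \<in> borel_measurable borel" using c by (rule borel_measurable_continuous_onI)
    have "\<bar>(LINT x|\<mu>. \<phi> x) - (LINT x|\<nu>. \<phi> x)\<bar> \<le> 0 + \<epsilon>" if "\<epsilon> > 0" for \<epsilon>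
    proof -
      define d where "d = \<epsilon> / (measure \<mu> UNIV + measure \<nu> UNIV + 1)"
      have d: "0 < d" "d * measure \<mu> UNIV + d * measure \<nu> UNIV \<le> \<epsilon>"
      proof -
        have K: "0 < measure \<mu> UNIV + measure \<nu> UNIV + 1"
          using measure_nonneg[of \<mu> UNIV] measure_nonneg[of \<nu> UNIV] by linarith
        show "0 < d" using K \<open>\<epsilon> > 0\<close> by (simp add: d_def)
        hence "d * (measure \<mu> UNIV + measure \<nu> UNIV) \<le> d * (measure \<mu> UNIV + measure \<nu> UNIV + 1)"
          by (intro mult_left_mono) auto
        also have "\<dots> = \<epsilon>" using K by (simp add: d_def)
        finally show "d * measure \<mu> UNIV + d * measure \<nu> UNIV \<le> \<epsilon>" by (simp add: distrib_left)
      qed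
      obtain n a where na: "\<And>x. 0 \<le> x \<Longrightarrow> \<bar>\<phi> x - (\<Sum>m\<le>n. a m * exp (- (real (Suc m) * x)))\<bar> < d"
      proof (rule exp_sum_approx[of \<phi> R d])
        show "continuous_on {0..} \<phi>" using c by (rule continuous_on_subset) simp
      qed (use R d in auto)
      define g where "g x = (\<Sum>m\<le>n. a m * exp (- (real (Suc m) * x)))" for x
      have key: "\<bar>(LINT x|\<eta>. \<phi> x) - (LINT x|\<eta>. g x)\<bar> \<le> d * measure \<eta> UNIV \<and> (LINT x|\<eta>. g x) = (\<Sum>m\<le>n. a m * (LINT x|\<eta>. exp (- (real (Suc m) * x))))"
        if "finite_measure \<eta>" and s: "sets \<eta> = sets borel" and ae: "AE x in \<eta>. 0 \<le> x" for \<eta>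
      proof -
        interpret e: finite_measure \<eta> by fact
        note [measurable_cong] = s
        have sp: "space \<eta> = UNIV" using sets_eq_imp_space_eq[OF s] by auto
        have ie: "integrable \<eta> (\<lambda>x. exp (- (real (Suc m) * x)))" for m
          by (rule e.integrable_const_bound[where B=1]) (use ae in \<open>eventually_elim, simp\<close>, measurable)
        have ig: "integrable \<eta> g" unfolding g_def by (intro Bochner_Integration.integrable_sum integrable_mult_right ie)
        have ip: "integrable \<eta> \<phi>"
          by (rule e.integrable_const_bound[where B=B]) (use B in \<open>auto\<close>)
        have "\<bar>(LINT x|\<eta>. \<phi> x) - (LINT x|\<eta>. g x)\<bar> = \<bar>LINT x|\<eta>. \<phi> x - g x\<bar>"
          using ip ig by simp
        also have "\<dots> \<le> (LINT x|\<eta>. norm (\<phi> x - g x))"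
          using integral_norm_bound[of \<eta> "\<lambda>x. \<phi> x - g x"] by simp
        also have "\<dots> \<le> (LINT x|\<eta>. d)"
        proof (rule integral_mono_AE)
          show "AE x in \<eta>. norm (\<phi> x - g x) \<le> d"
            using ae by eventually_elim (use na in \<open>auto simp: g_def intro: less_imp_le\<close>)
        qed (use ip ig in auto)
        finally show ?thesis using ie sp by (simp add: g_def mult.commute)
      qed
      have k1: "\<bar>(LINT x|\<mu>. \<phi> x) - (LINT x|\<mu>. g x)\<bar> \<le> d * measure \<mu> UNIV"
        and k2: "\<bar>(LINT x|\<nu>. \<phi> x) - (LINT x|\<nu>. g x)\<bar> \<le> d * measure \<nu> UNIV"
        and k3: "(LINT x|\<mu>. g x) = (LINT x|\<nu>. g x)"
        using key[OF fin(1) sets(1) nonneg(1)] key[OF fin(2) sets(2) nonneg(2)] eq by auto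
      thus ?thesis using d by linarith
    qed
    hence "\<bar>(LINT x|\<mu>. \<phi> x) - (LINT x|\<nu>. \<phi> x)\<bar> \<le> 0" by (rule field_le_epsilon)
    thus ?thesis by simp
  qed
  have Iic: "measure \<mu> {..c} = measure \<nu> {..c}" for c
  proof -
    define \<phi> where "\<phi> k x = max 0 (min 1 (1 - real (Suc k) * (x - c)))" for k :: nat and x
    have lim: "(\<lambda>k. \<phi> k x) \<longlonglongrightarrow> indicator {..c} x" for x
    proof (cases "x \<le> c")
      case True
      hence "\<phi> k x = 1" for k by (simp add: \<phi>_def max_def min_def mult_nonneg_nonpos)
      thus ?thesis using True by simp
    next
      case False
      obtain N :: nat where N: "1 < real N * (x - c)"
        using reals_Archimedean3[of "x - c"] False by auto
      have "\<phi> k x = 0" if "k \<ge> N" for k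
      proof -
        have "real N * (x - c) \<le> real (Suc k) * (x - c)"
          using that False by (intro mult_right_mono) auto
        thus ?thesis using N by (simp add: \<phi>_def)
      qed
      hence "eventually (\<lambda>k. \<phi> k x = 0) sequentially"
        by (auto simp: eventually_sequentially)
      thus ?thesis using False by (simp add: tendsto_eventually)
    qed
    have L: "(\<lambda>k. LINT x|\<eta>. \<phi> k x) \<longlonglongrightarrow> measure \<eta> {..c}" if "finite_measure \<eta>" and s: "sets \<eta> = sets borel" for \<eta>
    proof -
      interpret e: finite_measure \<eta> by fact
      note [measurable_cong] = s
      have sp: "space \<eta> = UNIV" using sets_eq_imp_space_eq[OF s] by auto
      have "(\<lambda>k. LINT x|\<eta>. \<phi> k x) \<longlonglongrightarrow> (LINT x|\<eta>. indicator {..c} x)"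
        by (rule integral_dominated_convergence[where w="\<lambda>_. 1"]) (use lim in \<open>auto simp: \<phi>_def\<close>)
      thus ?thesis by (simp add: sp)
    qed
    have "(LINT x|\<mu>. \<phi> k x) = (LINT x|\<nu>. \<phi> k x)" for k
    proof (rule eqphi[where R="c + 1" and B=1])
      show "continuous_on UNIV (\<phi> k)" unfolding \<phi>_def by (intro continuous_intros)
      show "\<phi> k x = 0" if "c + 1 \<le> x" for x
      proof -
        have "1 * 1 \<le> real (Suc k) * (x - c)" using that by (intro mult_mono) auto
        thus ?thesis by (simp add: \<phi>_def)
      qed
    qed (auto simp: \<phi>_def)
    thus ?thesis using L[OF fin(1) sets(1)] L[OF fin(2) sets(2)] LIMSEQ_unique by auto
  qed
  show ?thesis
  proof (rule measure_eqI_generator_eq[where E="range atMost" and \<Omega>=UNIV and A="\<lambda>i. {..real i}"])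
    show "Int_stable (range (atMost :: real \<Rightarrow> _))" by (auto simp: Int_stable_def)
    show "sets \<mu> = sigma_sets UNIV (range atMost)" "sets \<nu> = sigma_sets UNIV (range atMost)"
      unfolding sets borel_eq_atMost by auto
    show "(\<Union>i. {..real i}) = UNIV" by (auto intro: real_arch_simple)
    show "emeasure \<mu> X = emeasure \<nu> X" if "X \<in> range atMost" for X
      using that Iic by (auto simp: m.emeasure_eq_measure n.emeasure_eq_measure)
  qed (auto simp: m.emeasure_eq_measure)
qed

lemma nn_integral_powr_exp:
  assumes "0 < \<alpha>" "0 < b"
  shows "(\<integral>\<^sup>+x. ennreal (indicator {0<..} x * (x powr (\<alpha> - 1) * exp (- (b * x)))) \<partial>lborel)
    = ennreal (Gamma \<alpha> * b powr (- \<alpha>))"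
proof -
  have "ennreal (Gamma \<alpha>) = (\<integral>\<^sup>+t. ennreal (indicator {0..} t * t powr (\<alpha> - 1) / exp t) \<partial>lborel)"
    by (rule Gamma_conv_nn_integral_real[OF assms(1)])
  also have "\<dots> = ennreal \<bar>b\<bar> * (\<integral>\<^sup>+t. ennreal (indicator {0..} (0 + b * t) * (0 + b * t) powr (\<alpha> - 1) / exp (0 + b * t)) \<partial>lborel)"
    by (rule nn_integral_real_affine) (use assms in auto)
  also have "\<dots> = (\<integral>\<^sup>+t. ennreal b * ennreal (indicator {0..} (0 + b * t) * (0 + b * t) powr (\<alpha> - 1) / exp (0 + b * t)) \<partial>lborel)"
    using assms by (subst nn_integral_cmult) auto
  also have "\<dots> = (\<integral>\<^sup>+t. ennreal (b powr \<alpha>) * ennreal (indicator {0<..} t * (t powr (\<alpha> - 1) * exp (- (b * t)))) \<partial>lborel)"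
  proof (rule nn_integral_cong)
    fix t :: real
    have "b * (b * t) powr (\<alpha> - 1) = b powr \<alpha> * t powr (\<alpha> - 1)" if "0 < t"
      using assms that by (simp add: powr_mult powr_diff)
    hence "b * (indicator {0..} (0 + b * t) * (0 + b * t) powr (\<alpha> - 1) / exp (0 + b * t)) =
      b powr \<alpha> * (indicator {0<..} t * (t powr (\<alpha> - 1) * exp (- (b * t))))"
      using assms by (cases "0 < t"; cases "t = 0") (auto simp: indicator_def exp_minus field_simps zero_le_mult_iff)
    thus "ennreal b * ennreal (indicator {0..} (0 + b * t) * (0 + b * t) powr (\<alpha> - 1) / exp (0 + b * t)) =
      ennreal (b powr \<alpha>) * ennreal (indicator {0<..} t * (t powr (\<alpha> - 1) * exp (- (b * t))))"
      using assms by (simp flip: ennreal_mult')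
  qed
  also have "\<dots> = ennreal (b powr \<alpha>) * (\<integral>\<^sup>+t. ennreal (indicator {0<..} t * (t powr (\<alpha> - 1) * exp (- (b * t)))) \<partial>lborel)"
    by (rule nn_integral_cmult) auto
  finally have "ennreal (b powr (- \<alpha>)) * ennreal (Gamma \<alpha>) = ennreal (b powr (- \<alpha>)) * (ennreal (b powr \<alpha>) * (\<integral>\<^sup>+t. ennreal (indicator {0<..} t * (t powr (\<alpha> - 1) * exp (- (b * t)))) \<partial>lborel))"
    by simp
  also have "\<dots> = ennreal (b powr (- \<alpha>) * b powr \<alpha>) * (\<integral>\<^sup>+t. ennreal (indicator {0<..} t * (t powr (\<alpha> - 1) * exp (- (b * t)))) \<partial>lborel)"
    by (simp add: ennreal_mult' mult.assoc)
  also have "b powr (- \<alpha>) * b powr \<alpha> = 1" using assms by (simp flip: powr_add)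
  finally show ?thesis
    using Gamma_real_pos[OF assms(1)] by (simp only: ennreal_1 mult_1 ennreal_mult' mult.commute[of _ "b powr _"] powr_ge_zero)
qed

definition gamma_density :: "real \<Rightarrow> real \<Rightarrow> real \<Rightarrow> real" where
  "gamma_density \<alpha> \<theta> x = indicator {0<..} x * (x powr (\<alpha> - 1) * exp (- (x / \<theta>))) / (Gamma \<alpha> * \<theta> powr \<alpha>)"

lemma gamma_density_nonneg: "0 < \<alpha> \<Longrightarrow> 0 \<le> gamma_density \<alpha> \<theta> x"
  using Gamma_real_pos[of \<alpha>] by (simp add: gamma_density_def)

lemma gamma_density_measurable [measurable]: "gamma_density \<alpha> \<theta> \<in> borel_measurable borel"
  unfolding gamma_density_def by measurable

lemma gamma_exp_moment:
  assumes "0 < \<alpha>" "0 < \<theta>" "\<theta> * p < 1"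
  shows "(\<integral>\<^sup>+x. ennreal (gamma_density \<alpha> \<theta> x) * ennreal (exp (p * x)) \<partial>lborel) = ennreal ((1 - \<theta> * p) powr (- \<alpha>))"
proof -
  define b where "b = 1 / \<theta> - p"
  have b: "0 < b" using assms by (simp add: b_def field_simps)
  define c where "c = 1 / (Gamma \<alpha> * \<theta> powr \<alpha>)"
  have c: "0 < c" using assms by (simp add: c_def Gamma_real_pos)
  have "(\<integral>\<^sup>+x. ennreal (gamma_density \<alpha> \<theta> x) * ennreal (exp (p * x)) \<partial>lborel) =
    (\<integral>\<^sup>+x. ennreal c * ennreal (indicator {0<..} x * (x powr (\<alpha> - 1) * exp (- (b * x)))) \<partial>lborel)"
  proof (rule nn_integral_cong)
    fix x :: real
    have "exp (- (x / \<theta>)) * exp (p * x) = exp (- (b * x))"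
      by (simp add: b_def algebra_simps flip: exp_add)
    hence "gamma_density \<alpha> \<theta> x * exp (p * x) = c * (indicator {0<..} x * (x powr (\<alpha> - 1) * exp (- (b * x))))"
      by (simp add: gamma_density_def c_def mult.assoc)
    thus "ennreal (gamma_density \<alpha> \<theta> x) * ennreal (exp (p * x)) = ennreal c * ennreal (indicator {0<..} x * (x powr (\<alpha> - 1) * exp (- (b * x))))"
      using c gamma_density_nonneg[OF assms(1)] by (simp flip: ennreal_mult')
  qed
  also have "\<dots> = ennreal c * ennreal (Gamma \<alpha> * b powr (- \<alpha>))"
    by (subst nn_integral_cmult) (auto simp: nn_integral_powr_exp[OF assms(1) b])
  also have "\<dots> = ennreal (c * (Gamma \<alpha> * b powr (- \<alpha>)))" using c by (simp add: ennreal_mult')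
  also have "c * (Gamma \<alpha> * b powr (- \<alpha>)) = (1 - \<theta> * p) powr (- \<alpha>)"
  proof -
    have "1 - \<theta> * p = \<theta> * b" using assms by (simp add: b_def field_simps)
    hence "(1 - \<theta> * p) powr (- \<alpha>) = \<theta> powr (- \<alpha>) * b powr (- \<alpha>)"
      using assms b by (simp add: powr_mult)
    moreover have "Gamma \<alpha> \<noteq> 0" using Gamma_real_pos[OF assms(1)] by simp
    ultimately show ?thesis using assms by (simp add: c_def powr_minus field_simps)
  qed
  finally show ?thesis .
qed

text \<open>
  The weight \<open>W\<close> is an exponential tilting in the application, \<open>W = exp (- s2
  X2)\<close>. Identifying the tilted law, and not only its Laplace transform on the positive
  half-line, is what gives access to positive exponents.
\<close>
lemma weighted_gamma_law:
  fixes W X :: "'a \<Rightarrow> real"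
  assumes "prob_space M" and [measurable]: "W \<in> borel_measurable M" "X \<in> borel_measurable M"
    and W: "\<And>\<omega>. \<omega> \<in> space M \<Longrightarrow> 0 \<le> W \<omega> \<and> W \<omega> \<le> 1"
    and X: "\<And>\<omega>. \<omega> \<in> space M \<Longrightarrow> 0 \<le> X \<omega>"
    and pos: "0 < \<alpha>" "0 < \<theta>" "0 < A"
    and L: "\<And>s. 0 < s \<Longrightarrow> (LINT \<omega>|M. W \<omega> * exp (- (s * X \<omega>))) = A * (1 + \<theta> * s) powr (- \<alpha>)"
  shows "distr (density M (\<lambda>\<omega>. ennreal (W \<omega>))) borel X = density lborel (\<lambda>x. ennreal (A * gamma_density \<alpha> \<theta> x))"
    (is "?\<mu> = ?\<nu>")
proof -
  interpret prob_space M by fact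
  have mom: "(\<integral>\<^sup>+x. ennreal (exp (p * x)) \<partial>?\<nu>) = ennreal (A * (1 - \<theta> * p) powr (- \<alpha>))" if "\<theta> * p < 1" for p
  proof -
    have "(\<integral>\<^sup>+x. ennreal (exp (p * x)) \<partial>?\<nu>) = (\<integral>\<^sup>+x. ennreal A * (ennreal (gamma_density \<alpha> \<theta> x) * ennreal (exp (p * x))) \<partial>lborel)"
      using pos gamma_density_nonneg[OF pos(1)]
      by (subst nn_integral_density) (auto simp: ennreal_mult mult.assoc)
    also have "\<dots> = ennreal A * ennreal ((1 - \<theta> * p) powr (- \<alpha>))"
      by (subst nn_integral_cmult) (auto simp: gamma_exp_moment[OF pos(1,2) that])
    finally show ?thesis using pos by (simp add: ennreal_mult')
  qed
  have nu: "emeasure ?\<nu> UNIV = ennreal A"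
    using mom[of 0] pos by simp
  have mu: "(\<integral>\<^sup>+x. ennreal (f x) \<partial>?\<mu>) = (\<integral>\<^sup>+\<omega>. ennreal (W \<omega> * f (X \<omega>)) \<partial>M)"
    if [measurable]: "f \<in> borel_measurable borel" and "\<And>x. 0 \<le> f x" for f
    using W that(2) by (simp add: nn_integral_distr nn_integral_density ennreal_mult cong: nn_integral_cong)
  show ?thesis
  proof (rule laplace_unique)
    have "emeasure ?\<mu> UNIV = (\<integral>\<^sup>+\<omega>. ennreal (W \<omega> * 1) \<partial>M)"
      using mu[of "\<lambda>_. 1"] by simp
    also have "\<dots> \<le> (\<integral>\<^sup>+\<omega>. 1 \<partial>M)" using W by (intro nn_integral_mono) auto
    finally have "emeasure ?\<mu> UNIV \<le> 1" by (simp add: emeasure_space_1)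
    thus "finite_measure ?\<mu>" by (intro finite_measureI) (auto simp: top_unique)
    show "finite_measure ?\<nu>" by (intro finite_measureI) (use nu in auto)
    show "sets ?\<mu> = sets borel" "sets ?\<nu> = sets borel" by auto
    have "{x. (0::real) \<le> x} \<in> sets borel" by measurable
    show "AE x in ?\<mu>. 0 \<le> x" using X by (simp add: AE_distr_iff AE_density AE_I2)
    show "AE x in ?\<nu>. 0 \<le> x" by (auto simp: AE_density gamma_density_def indicator_def)
    fix n
    let ?s = "real (Suc n)"
    have s: "0 < ?s" by simp
    have "(LINT x|?\<mu>. exp (- (?s * x))) = (LINT \<omega>|M. W \<omega> * exp (- (?s * X \<omega>)))"
      by (subst integral_distr, simp, simp, subst integral_density) (use W in auto)
    moreover have "(LINT x|?\<nu>. exp (- (?s * x))) = A * (1 + \<theta> * ?s) powr (- \<alpha>)"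
    proof (rule integral_eq_nn_integral[THEN trans])
      have "\<theta> * (- ?s) < 1" using pos s by (smt (verit) mult_pos_pos mult_minus_right)
      from mom[OF this] show "enn2real (\<integral>\<^sup>+x. ennreal (exp (- (?s * x))) \<partial>?\<nu>) = A * (1 + \<theta> * ?s) powr (- \<alpha>)"
        using pos by (simp add: mult_nonneg_nonneg del: of_nat_Suc)
    qed auto
    ultimately show "(LINT x|?\<mu>. exp (- (?s * x))) = (LINT x|?\<nu>. exp (- (?s * x)))"
      using L[OF s] by simp
  qed
qed

lemma weighted_gamma_exp_moment:
  fixes W X :: "'a \<Rightarrow> real"
  assumes "prob_space M" and [measurable]: "W \<in> borel_measurable M" "X \<in> borel_measurable M"
    and W: "\<And>\<omega>. \<omega> \<in> space M \<Longrightarrow> 0 \<le> W \<omega> \<and> W \<omega> \<le> 1"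
    and X: "\<And>\<omega>. \<omega> \<in> space M \<Longrightarrow> 0 \<le> X \<omega>"
    and pos: "0 < \<alpha>" "0 < \<theta>" "0 < A"
    and L: "\<And>s. 0 < s \<Longrightarrow> (LINT \<omega>|M. W \<omega> * exp (- (s * X \<omega>))) = A * (1 + \<theta> * s) powr (- \<alpha>)"
    and p: "\<theta> * p < 1"
  shows "(\<integral>\<^sup>+\<omega>. ennreal (W \<omega> * exp (p * X \<omega>)) \<partial>M) = ennreal (A * (1 - \<theta> * p) powr (- \<alpha>))"
proof -
  have "(\<integral>\<^sup>+\<omega>. ennreal (W \<omega> * exp (p * X \<omega>)) \<partial>M) =
     (\<integral>\<^sup>+x. ennreal (exp (p * x)) \<partial>distr (density M (\<lambda>\<omega>. ennreal (W \<omega>))) borel X)"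
    using W by (simp add: nn_integral_distr nn_integral_density ennreal_mult cong: nn_integral_cong)
  also have "\<dots> = (\<integral>\<^sup>+x. ennreal (exp (p * x)) \<partial>density lborel (\<lambda>x. ennreal (A * gamma_density \<alpha> \<theta> x)))"
    by (subst weighted_gamma_law[OF assms(1-3) W X pos L]) auto
  also have "\<dots> = (\<integral>\<^sup>+x. ennreal A * (ennreal (gamma_density \<alpha> \<theta> x) * ennreal (exp (p * x))) \<partial>lborel)"
    using pos gamma_density_nonneg[OF pos(1)]
    by (subst nn_integral_density) (auto simp: ennreal_mult mult.assoc)
  also have "\<dots> = ennreal A * ennreal ((1 - \<theta> * p) powr (- \<alpha>))"
    by (subst nn_integral_cmult) (auto simp: gamma_exp_moment[OF pos(1,2) p])
  finally show ?thesis using pos by (simp add: ennreal_mult')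
qed

section \<open>Increments of a pair with gamma marginals\<close>

text \<open>
  Stated for the nonnegative integral, so that finiteness of the exponential moment follows from
  the bound and needs no separate argument.
\<close>
lemma (in prob_space) exp_markov:
  assumes [measurable]: "Z \<in> borel_measurable M" and "(\<integral>\<^sup>+\<omega>. ennreal (exp (Z \<omega>)) \<partial>M) \<le> ennreal c" "0 \<le> c"
  shows "prob {\<omega> \<in> space M. t < Z \<omega>} \<le> c * exp (- t)"
proof -
  have "emeasure M {\<omega> \<in> space M. t < Z \<omega>} = (\<integral>\<^sup>+\<omega>. indicator {\<omega> \<in> space M. t < Z \<omega>} \<omega> \<partial>M)"
    by (rule nn_integral_indicator[symmetric]) measurable
  also have "\<dots> \<le> (\<integral>\<^sup>+\<omega>. ennreal (exp (- t)) * ennreal (exp (Z \<omega>)) \<partial>M)"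
  proof (rule nn_integral_mono)
    fix \<omega> assume "\<omega> \<in> space M"
    have "indicator {\<omega> \<in> space M. t < Z \<omega>} \<omega> \<le> ennreal (exp (Z \<omega> - t))"
      by (auto simp: indicator_def)
    thus "indicator {\<omega> \<in> space M. t < Z \<omega>} \<omega> \<le> ennreal (exp (- t)) * ennreal (exp (Z \<omega>))"
      by (simp add: ennreal_mult[symmetric] exp_add[symmetric])
  qed
  also have "\<dots> = ennreal (exp (- t)) * (\<integral>\<^sup>+\<omega>. ennreal (exp (Z \<omega>)) \<partial>M)"
    by (rule nn_integral_cmult) measurable
  also have "\<dots> \<le> ennreal (exp (- t)) * ennreal c" using assms(2) by (rule mult_left_mono) simp
  finally have "ennreal (prob {\<omega> \<in> space M. t < Z \<omega>}) \<le> ennreal (c * exp (- t))"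
    using assms(3) by (simp add: emeasure_eq_measure ennreal_mult mult.commute)
  thus ?thesis using assms(3) by (subst (asm) ennreal_le_iff) auto
qed

text \<open>The one-dimensional permanental law with kernel \<open>u\<close>.\<close>
locale gamma_variable = prob_space M for M :: "'a measure" +
  fixes X :: "'a \<Rightarrow> real" and \<alpha> u :: real
  assumes X_meas [measurable]: "X \<in> borel_measurable M"
    and X_nonneg: "\<And>\<omega>. \<omega> \<in> space M \<Longrightarrow> 0 \<le> X \<omega>"
    and alpha_pos: "0 < \<alpha>" and u_pos: "0 < u"
    and laplace: "\<And>s. 0 < s \<Longrightarrow> expectation (\<lambda>\<omega>. exp (- (s * X \<omega>))) = (1 + u * s) powr (- \<alpha>)"
begin

lemma law: "distr M borel X = density lborel (\<lambda>x. ennreal (gamma_density \<alpha> u x))"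
proof -
  have "density M (\<lambda>\<omega>. ennreal 1) = M" by (simp add: density_1)
  thus ?thesis
    using weighted_gamma_law[OF prob_space_axioms borel_measurable_const X_meas _ X_nonneg alpha_pos u_pos, of 1 1] laplace by simp
qed

lemma tail_upper:
  assumes \<delta>: "0 < \<delta>" "\<delta> < 1"
  shows "prob {\<omega> \<in> space M. x < X \<omega>} \<le> \<delta> powr (- \<alpha>) * exp (- ((1 - \<delta>) * x / u))"
proof -
  define p where "p = (1 - \<delta>) / u"
  have p: "u * p = 1 - \<delta>" "0 < p" using u_pos \<delta> by (auto simp: p_def)
  have "(\<integral>\<^sup>+\<omega>. ennreal (exp (p * X \<omega>)) \<partial>M) = ennreal ((1 - u * p) powr (- \<alpha>))"
    using weighted_gamma_exp_moment[OF prob_space_axioms borel_measurable_const X_meas _ X_nonneg alpha_pos u_pos, of 1 1 p] laplace p \<delta> by simp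
  hence "prob {\<omega> \<in> space M. p * x < p * X \<omega>} \<le> \<delta> powr (- \<alpha>) * exp (- (p * x))"
    by (intro exp_markov) (use p in auto)
  moreover have "{\<omega> \<in> space M. p * x < p * X \<omega>} = {\<omega> \<in> space M. x < X \<omega>}" using p by auto
  ultimately show ?thesis by (simp add: p_def)
qed

text \<open>
  The density is at least a constant times \<open>exp (- (1 + \<epsilon>) t / u)\<close> for
  \<open>1 \<le> t\<close>, because the factor \<open>exp (\<epsilon> t / u)\<close> absorbs the
  possibly negative power of \<open>t\<close>. Integrating it over an interval of length one
  suffices, as only the exponential rate matters later.
\<close>
lemma tail_lower:
  assumes \<epsilon>: "0 < \<epsilon>" and x: "1 \<le> x"
  shows "\<epsilon> / u / (Gamma \<alpha> * u powr \<alpha>) * exp (- ((1 + \<epsilon>) * (x + 1) / u)) \<le> prob {\<omega> \<in> space M. x < X \<omega>}"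
proof -
  define c where "c = \<epsilon> / u / (Gamma \<alpha> * u powr \<alpha>)"
  have G: "0 < Gamma \<alpha> * u powr \<alpha>" using alpha_pos u_pos by (simp add: Gamma_real_pos)
  have c: "0 < c" unfolding c_def using G u_pos \<epsilon> by simp
  have gd: "c * exp (- ((1 + \<epsilon>) * (x + 1) / u)) \<le> gamma_density \<alpha> u t" if t: "x < t" "t \<le> x + 1" for t
  proof -
    have t1: "1 \<le> t" using t x by simp
    have "\<epsilon> / u \<le> t powr (\<alpha> - 1) * exp (\<epsilon> * t / u)"
    proof -
      have "t powr (- 1) \<le> t powr (\<alpha> - 1)" using t1 alpha_pos by (intro powr_mono) auto
      moreover have "\<epsilon> * t / u \<le> exp (\<epsilon> * t / u)" using exp_ge_add_one_self[of "\<epsilon> * t / u"] by linarith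
      ultimately have "t powr (- 1) * (\<epsilon> * t / u) \<le> t powr (\<alpha> - 1) * exp (\<epsilon> * t / u)"
        using t1 \<epsilon> u_pos by (intro mult_mono) auto
      thus ?thesis using t1 by (simp add: powr_minus_divide)
    qed
    hence "\<epsilon> / u * exp (- ((1 + \<epsilon>) * t / u)) \<le> t powr (\<alpha> - 1) * exp (\<epsilon> * t / u) * exp (- ((1 + \<epsilon>) * t / u))"
      by (intro mult_right_mono) auto
    also have "\<dots> = t powr (\<alpha> - 1) * exp (- (t / u))"
      by (simp add: mult.assoc add_divide_distrib distrib_right flip: exp_add)
    finally have "\<epsilon> / u * exp (- ((1 + \<epsilon>) * t / u)) / (Gamma \<alpha> * u powr \<alpha>) \<le> t powr (\<alpha> - 1) * exp (- (t / u)) / (Gamma \<alpha> * u powr \<alpha>)"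
      using G by (intro divide_right_mono) auto
    hence "c * exp (- ((1 + \<epsilon>) * t / u)) \<le> gamma_density \<alpha> u t" using t1 by (simp add: c_def gamma_density_def)
    moreover have "exp (- ((1 + \<epsilon>) * (x + 1) / u)) \<le> exp (- ((1 + \<epsilon>) * t / u))"
      using t \<epsilon> u_pos by (simp add: divide_right_mono mult_left_mono)
    ultimately show ?thesis using c by (meson mult_left_mono less_imp_le order_trans)
  qed
  have "ennreal (c * exp (- ((1 + \<epsilon>) * (x + 1) / u))) = (\<integral>\<^sup>+t. ennreal (c * exp (- ((1 + \<epsilon>) * (x + 1) / u))) * indicator {x<..x + 1} t \<partial>lborel)"
    by (subst nn_integral_cmult_indicator) auto
  also have "\<dots> \<le> (\<integral>\<^sup>+t. ennreal (gamma_density \<alpha> u t) * indicator {x<..} t \<partial>lborel)"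
    by (rule nn_integral_mono) (use gd in \<open>auto simp: indicator_def intro!: ennreal_leI\<close>)
  also have "\<dots> = emeasure (distr M borel X) {x<..}" unfolding law by (subst emeasure_density) auto
  also have "\<dots> = emeasure M (X -` {x<..} \<inter> space M)" by (rule emeasure_distr) auto
  also have "X -` {x<..} \<inter> space M = {\<omega> \<in> space M. x < X \<omega>}" by auto
  finally show ?thesis unfolding c_def[symmetric] by (simp add: emeasure_eq_measure)
qed
end

text \<open>
  Let \<open>d = (a - b) / a\<close>. For \<open>0 < b\<close> the form \<open>e a\<^sup>2 - e /
  (1 - e) b\<^sup>2\<close> is largest at \<open>e = d\<close>, where it equals \<open>(a -
  b)\<^sup>2\<close>. A value \<open>e\<close> slightly below \<open>d\<close> loses only the
  factor \<open>1 - \<eta>\<close>, which is why a geometric net of values \<open>e\<close> is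
  enough.
\<close>
lemma sqrt_diff_quadratic_form:
  fixes a b :: real
  assumes ab: "0 \<le> b" "b < a" and e: "0 < e" "e < 1" "(1 - \<eta>) * ((a - b) / a) \<le> e" "e \<le> (a - b) / a"
  shows "(1 - \<eta>) * (a - b)\<^sup>2 \<le> e * a\<^sup>2 - e / (1 - e) * b\<^sup>2"
proof -
  define d where "d = (a - b) / a"
  have a: "0 < a" using ab by simp
  have d: "d \<le> 1" "0 < d" using ab a by (auto simp: d_def field_simps)
  have b: "b = (1 - d) * a" using a by (simp add: d_def field_simps)
  have e': "(1 - \<eta>) * d \<le> e" "e \<le> d" using e unfolding d_def by auto
  have "(1 - \<eta>) * d\<^sup>2 * (1 - e) = ((1 - \<eta>) * d) * (d * (1 - e))" by (simp add: power2_eq_square)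
  also have "\<dots> \<le> e * (d * (1 - e))" using e' d e by (intro mult_right_mono) auto
  also have "\<dots> \<le> e * (d * (1 - e) + (d - e) * (1 - d))" using e' d e by (intro mult_left_mono) auto
  also have "\<dots> = e * (1 - e) - e * (1 - d)\<^sup>2" by (simp add: algebra_simps power2_eq_square)
  finally have "(1 - \<eta>) * d\<^sup>2 \<le> (e * (1 - e) - e * (1 - d)\<^sup>2) / (1 - e)" using e by (simp add: pos_le_divide_eq)
  also have "\<dots> = e - e / (1 - e) * (1 - d)\<^sup>2" using e by (simp add: diff_divide_distrib)
  finally have "(1 - \<eta>) * d\<^sup>2 * a\<^sup>2 \<le> (e - e / (1 - e) * (1 - d)\<^sup>2) * a\<^sup>2" by (rule mult_right_mono) simp
  moreover have "(a - b)\<^sup>2 = d\<^sup>2 * a\<^sup>2" using a by (simp add: d_def power_divide)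
  moreover have "b\<^sup>2 = (1 - d)\<^sup>2 * a\<^sup>2" using b by (simp add: power_mult_distrib)
  ultimately show ?thesis by (simp add: algebra_simps)
qed

lemma geometric_net_point:
  fixes d \<eta> :: real
  assumes \<eta>: "0 < \<eta>" "\<eta> < 1" and d: "d \<le> 1" "(1 - \<eta>) ^ N \<le> d" and N: "1 \<le> N"
  obtains i where "i \<in> {1..N}" "(1 - \<eta>) ^ i \<le> d" "(1 - \<eta>) * d \<le> (1 - \<eta>) ^ i"
proof -
  define i where "i = (LEAST i. 1 \<le> i \<and> (1 - \<eta>) ^ i \<le> d)"
  have i: "1 \<le> i \<and> (1 - \<eta>) ^ i \<le> d" unfolding i_def by (rule LeastI[of _ N]) (use N d in auto)
  have iN: "i \<le> N" unfolding i_def by (rule Least_le) (use N d in auto)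
  have "d \<le> (1 - \<eta>) ^ (i - 1)"
  proof (cases "i = 1")
    case False
    hence "\<not> (1 \<le> i - 1 \<and> (1 - \<eta>) ^ (i - 1) \<le> d)"
      unfolding i_def by (intro not_less_Least) (use i[unfolded i_def] in linarith)
    thus ?thesis using False i by auto
  qed (use d in simp)
  hence "(1 - \<eta>) * d \<le> (1 - \<eta>) * (1 - \<eta>) ^ (i - 1)" using \<eta> by (intro mult_left_mono) auto
  also have "\<dots> = (1 - \<eta>) ^ i" using i by (simp flip: power_Suc)
  finally show thesis using that[of i] i iN by auto
qed

lemma sum_powers_le:
  fixes G :: real assumes "1 < G"
  shows "(\<Sum>i=1..N. G ^ i) \<le> G ^ N * (G / (G - 1))"
proof (induction N)
  case (Suc N)
  have "(\<Sum>i=1..Suc N. G ^ i) \<le> G ^ N * (G / (G - 1)) + G ^ Suc N" using Suc by simp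
  also have "\<dots> = G ^ Suc N * (G / (G - 1))" using assms by (simp add: field_simps)
  finally show ?case .
qed (use assms in simp)

text \<open>
  The constant that the union bound over the geometric net produces. Its first summand is the
  contribution of large values of the larger variable, its second one that of the net.
\<close>
definition tail_const :: "real \<Rightarrow> real \<Rightarrow> real" where
  "tail_const \<alpha> \<eta> = 2 powr \<alpha> + (\<eta> * (1 - \<eta>)\<^sup>2 / 2) powr (- \<alpha>) / (1 - (1 - \<eta>) powr (2 * \<alpha>))"

lemma tail_const_ge_1:
  assumes "0 < \<alpha>" "0 < \<eta>" "\<eta> < 1" shows "1 \<le> tail_const \<alpha> \<eta>"
proof -
  have "1 \<le> 2 powr \<alpha>" using assms by (intro ge_one_powr_ge_zero) auto
  moreover have "(1 - \<eta>) powr (2 * \<alpha>) < 1" using assms powr_less_mono2[of "2 * \<alpha>" "1 - \<eta>" 1] by simp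
  ultimately show ?thesis unfolding tail_const_def by (smt (verit) divide_nonneg_nonneg powr_ge_zero)
qed

text \<open>
  The two-dimensional permanental law for a kernel with both diagonal entries \<open>u\<close> and
  with determinant \<open>\<kappa>\<close>. The off-diagonal entries enter only through
  \<open>\<kappa>\<close>.
\<close>
locale gamma_pair = prob_space M for M :: "'a measure" +
  fixes X1 X2 :: "'a \<Rightarrow> real" and \<alpha> u \<kappa> :: real
  assumes gamma1: "gamma_variable M X1 \<alpha> u" and gamma2: "gamma_variable M X2 \<alpha> u"
    and kappa_nonneg: "0 \<le> \<kappa>"
    and joint_laplace: "\<And>s1 s2. 0 < s1 \<Longrightarrow> 0 < s2 \<Longrightarrow> expectation (\<lambda>\<omega>. exp (- (s1 * X1 \<omega> + s2 * X2 \<omega>)))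
        = (1 + u * s1 + u * s2 + \<kappa> * s1 * s2) powr (- \<alpha>)"
begin

lemma X12_meas [measurable]: "X1 \<in> borel_measurable M" "X2 \<in> borel_measurable M"
  and X: "\<And>\<omega>. \<omega> \<in> space M \<Longrightarrow> 0 \<le> X1 \<omega>" "\<And>\<omega>. \<omega> \<in> space M \<Longrightarrow> 0 \<le> X2 \<omega>"
  and pos: "0 < \<alpha>" "0 < u"
  using gamma1 gamma2 by (auto simp: gamma_variable_def gamma_variable_axioms_def)

lemma swap: "gamma_pair M X2 X1 \<alpha> u \<kappa>"
proof (rule gamma_pair.intro[OF prob_space_axioms], rule gamma_pair_axioms.intro[OF gamma2 gamma1 kappa_nonneg])
  fix s1 s2 :: real assume "0 < s1" "0 < s2"
  thus "expectation (\<lambda>\<omega>. exp (- (s1 * X2 \<omega> + s2 * X1 \<omega>))) = (1 + u * s1 + u * s2 + \<kappa> * s1 * s2) powr (- \<alpha>)"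
    using joint_laplace[of s2 s1] by (simp add: algebra_simps)
qed

text \<open>
  Under the weight \<open>exp (- s2 X2)\<close> the variable \<open>X1\<close> has, up to
  normalization, a gamma law with scale \<open>(u + \<kappa> s2) / (1 + u s2)\<close>, so the
  exponent \<open>l e X1\<close> is admissible as long as \<open>l e\<close> times this scale is
  below one. For \<open>s2 = l e / (1 - e)\<close> this holds exactly when the base of the power
  in the conclusion is positive, and \<open>\<kappa> l \<le> u\<close> makes that base at least
  one. The same \<open>l\<close> thus works for all \<open>e\<close>.
\<close>
lemma pair_exp_moment:
  assumes e: "0 < e" "e < 1" and l: "0 < l" "\<kappa> * l \<le> u"
  shows "(\<integral>\<^sup>+\<omega>. ennreal (exp (l * (e * X1 \<omega> - e / (1 - e) * X2 \<omega>))) \<partial>M)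
    = ennreal ((1 + e\<^sup>2 / (1 - e) * (l * (u - \<kappa> * l))) powr (- \<alpha>))"
proof -
  define s2 where "s2 = l * e / (1 - e)"
  have s2: "0 < s2" using e l by (simp add: s2_def)
  have u2: "0 < 1 + u * s2" using pos s2 by (simp add: add_pos_pos)
  define \<theta> where "\<theta> = (u + \<kappa> * s2) / (1 + u * s2)"
  have th: "0 < \<theta>" using pos kappa_nonneg s2 u2 by (simp add: \<theta>_def add_pos_nonneg)
  have th': "(1 + u * s2) * \<theta> = u + \<kappa> * s2" using u2 by (simp add: \<theta>_def)
  have eq: "(1 + u * s2) * (1 - \<theta> * (l * e)) = 1 + e\<^sup>2 / (1 - e) * (l * (u - \<kappa> * l))"
  proof -
    have "(1 + u * s2) * (1 - \<theta> * (l * e)) = 1 + u * s2 - (u + \<kappa> * s2) * (l * e)"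
      by (simp only: th'[symmetric]) (simp add: algebra_simps)
    also have "\<dots> = 1 + e\<^sup>2 / (1 - e) * (l * (u - \<kappa> * l))"
    proof -
      define r where "r = e / (1 - e)"
      have r: "r - e = r * e" using e by (simp add: r_def field_simps)
      have "1 + u * (l * r) - (u + \<kappa> * (l * r)) * (l * e) = 1 + u * l * (r - e) - \<kappa> * l * l * (r * e)"
        by (simp add: algebra_simps)
      also have "\<dots> = 1 + (r * e) * (l * (u - \<kappa> * l))" unfolding r by (simp add: algebra_simps)
      finally show ?thesis by (simp add: s2_def r_def power2_eq_square)
    qed
    finally show ?thesis .
  qed
  have ge1: "1 \<le> 1 + e\<^sup>2 / (1 - e) * (l * (u - \<kappa> * l))" using e l by simp
  have thp: "\<theta> * (l * e) < 1"
  proof -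
    have "0 < (1 + u * s2) * (1 - \<theta> * (l * e))" using eq ge1 by simp
    thus ?thesis using u2 by (simp add: zero_less_mult_iff)
  qed
  have "(\<integral>\<^sup>+\<omega>. ennreal (exp (- (s2 * X2 \<omega>)) * exp ((l * e) * X1 \<omega>)) \<partial>M)
    = ennreal ((1 + u * s2) powr (- \<alpha>) * (1 - \<theta> * (l * e)) powr (- \<alpha>))"
  proof (rule weighted_gamma_exp_moment[OF prob_space_axioms _ _ _ X(1) pos(1) th])
    show "0 < (1 + u * s2) powr (- \<alpha>)" using u2 by simp
    fix s :: real assume s: "0 < s"
    have "expectation (\<lambda>\<omega>. exp (- (s2 * X2 \<omega>)) * exp (- (s * X1 \<omega>))) = expectation (\<lambda>\<omega>. exp (- (s * X1 \<omega> + s2 * X2 \<omega>)))"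
      by (simp add: exp_add[symmetric] algebra_simps)
    also have "\<dots> = (1 + u * s + u * s2 + \<kappa> * s * s2) powr (- \<alpha>)" by (rule joint_laplace[OF s s2])
    also have "1 + u * s + u * s2 + \<kappa> * s * s2 = 1 + u * s2 + s * (u + \<kappa> * s2)" by (simp add: algebra_simps)
    also have "\<dots> = (1 + u * s2) * (1 + \<theta> * s)"
      by (simp only: th'[symmetric]) (simp add: algebra_simps)
    also have "\<dots> powr (- \<alpha>) = (1 + u * s2) powr (- \<alpha>) * (1 + \<theta> * s) powr (- \<alpha>)"
      by (rule powr_mult)
    finally show "expectation (\<lambda>\<omega>. exp (- (s2 * X2 \<omega>)) * exp (- (s * X1 \<omega>))) = (1 + u * s2) powr (- \<alpha>) * (1 + \<theta> * s) powr (- \<alpha>)" .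
  qed (use X(2) s2 thp in auto)
  also have "(1 + u * s2) powr (- \<alpha>) * (1 - \<theta> * (l * e)) powr (- \<alpha>) = ((1 + u * s2) * (1 - \<theta> * (l * e))) powr (- \<alpha>)"
    by (rule powr_mult[symmetric])
  also have "\<dots> = (1 + e\<^sup>2 / (1 - e) * (l * (u - \<kappa> * l))) powr (- \<alpha>)" unfolding eq ..
  also have "(\<integral>\<^sup>+\<omega>. ennreal (exp (- (s2 * X2 \<omega>)) * exp ((l * e) * X1 \<omega>)) \<partial>M)
    = (\<integral>\<^sup>+\<omega>. ennreal (exp (l * (e * X1 \<omega> - e / (1 - e) * X2 \<omega>))) \<partial>M)"
    by (simp add: exp_add[symmetric] s2_def algebra_simps)
  finally show ?thesis .
qed

text \<open>
  A union bound over the forms with \<open>e = (1 - \<eta>) ^ i\<close>. The exponential moment of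
  the form with parameter \<open>e\<close> is at most of order \<open>e powr (- 2
  \<alpha>)\<close>, so the bounds grow geometrically in \<open>i\<close> and the net has to be
  stopped at some \<open>N\<close>. On the event \<open>X1 \<le> B\<close> only relative
  differences above \<open>sqrt (x / B)\<close> matter, so that \<open>N\<close> is such that
  \<open>e N\<close> is about \<open>sqrt (x / B)\<close>. With \<open>B = 2 u l x\<close> the
  factors \<open>x\<close> cancel, which leaves a constant independent of \<open>x\<close>,
  \<open>l\<close> and \<open>\<kappa>\<close>; the event \<open>X1 > B\<close> is handled by the
  gamma tail.
\<close>
lemma pair_tail_one_sided:
  assumes \<eta>: "0 < \<eta>" "\<eta> < 1" and l: "0 < l" "\<kappa> * l \<le> (1 - \<eta>) * u" and x: "0 \<le> x"
  shows "prob {\<omega> \<in> space M. X2 \<omega> \<le> X1 \<omega> \<and> x < (sqrt (X1 \<omega>) - sqrt (X2 \<omega>))\<^sup>2}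
    \<le> tail_const \<alpha> \<eta> * exp (- ((1 - \<eta>) * l * x))"
proof (cases "x = 0")
  case True
  show ?thesis using True tail_const_ge_1[OF pos(1) \<eta>] order_trans[OF prob_le_1] by simp
next
  case False
  let ?E = "{\<omega> \<in> space M. X2 \<omega> \<le> X1 \<omega> \<and> x < (sqrt (X1 \<omega>) - sqrt (X2 \<omega>))\<^sup>2}"
  have x0: "0 < x" using x False by simp
  define B where "B = 2 * u * l * x"
  have B0: "0 < B" using pos l x0 by (simp add: B_def)
  define E1 where "E1 = {\<omega> \<in> space M. B < X1 \<omega>}"
  define e where "e i = (1 - \<eta>) ^ i" for i :: nat
  have e: "0 < e i" "1 \<le> i \<Longrightarrow> e i < 1" for i
    using \<eta> by (auto simp: e_def power_less_one_iff)
  define E2 where "E2 i = {\<omega> \<in> space M. (1 - \<eta>) * l * x < l * (e i * X1 \<omega> - e i / (1 - e i) * X2 \<omega>)}" for i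
  have [measurable]: "E1 \<in> sets M" "E2 i \<in> sets M" for i unfolding E1_def E2_def by measurable
  have p1: "prob E1 \<le> 2 powr \<alpha> * exp (- ((1 - \<eta>) * l * x))"
  proof -
    have "prob E1 \<le> (1/2) powr (- \<alpha>) * exp (- ((1 - 1/2) * B / u))"
      unfolding E1_def by (rule gamma_variable.tail_upper[OF gamma1]) auto
    also have "(1/2) powr (- \<alpha>) = 2 powr \<alpha>" by (simp add: powr_minus powr_divide)
    also have "(1 - 1/2) * B / u = l * x" using pos by (simp add: B_def)
    also have "exp (- (l * x)) \<le> exp (- ((1 - \<eta>) * l * x))"
      using \<eta> l x0 by simp
    finally show ?thesis by simp
  qed
  define G where "G = (1 - \<eta>) powr (- 2 * \<alpha>)"
  have g: "(1 - \<eta>) powr (2 * \<alpha>) < 1" "0 < (1 - \<eta>) powr (2 * \<alpha>)"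
    using \<eta> pos powr_less_mono2[of "2 * \<alpha>" "1 - \<eta>" 1] by auto
  have G1: "1 < G" and Gd: "G / (G - 1) = 1 / (1 - (1 - \<eta>) powr (2 * \<alpha>))"
    using g by (auto simp: G_def powr_minus field_simps)
  have eG: "((e i)\<^sup>2) powr (- \<alpha>) = G ^ i" for i
  proof -
    have "((e i)\<^sup>2) powr (- \<alpha>) = ((1 - \<eta>) powr real (i * 2)) powr (- \<alpha>)"
      using \<eta> by (subst powr_realpow) (auto simp: e_def power_mult)
    also have "\<dots> = ((1 - \<eta>) powr (- 2 * \<alpha>)) powr real i"
      by (simp only: powr_powr) (simp add: mult_ac)
    also have "\<dots> = G ^ i" unfolding G_def using \<eta> by (subst powr_realpow) auto
    finally show ?thesis .
  qed
  have p2: "prob (E2 i) \<le> (\<eta> * u * l) powr (- \<alpha>) * G ^ i * exp (- ((1 - \<eta>) * l * x))" if i: "1 \<le> i" for i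
  proof -
    let ?m = "(e i)\<^sup>2 / (1 - e i) * (l * (u - \<kappa> * l))"
    have "(1 - \<eta>) * u \<le> u" using \<eta> pos by (simp add: mult_le_cancel_right1)
    hence kl: "\<kappa> * l \<le> u" using l by simp
    have m: "(e i)\<^sup>2 * (\<eta> * u * l) \<le> ?m"
    proof -
      have "(e i)\<^sup>2 \<le> (e i)\<^sup>2 / (1 - e i)" using e[of i] i by (simp add: pos_le_divide_eq mult_left_le)
      moreover have "\<eta> * u * l \<le> l * (u - \<kappa> * l)"
      proof -
        have "l * (\<eta> * u) \<le> l * (u - \<kappa> * l)" using l by (intro mult_left_mono) (auto simp: algebra_simps)
        thus ?thesis by (simp add: mult.commute)
      qed
      moreover have "0 \<le> (e i)\<^sup>2 / (1 - e i)" using e[of i] i by simp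
      moreover have "0 \<le> \<eta> * u * l" using \<eta> pos l by simp
      ultimately show ?thesis by (rule mult_mono)
    qed
    have "prob (E2 i) \<le> (1 + ?m) powr (- \<alpha>) * exp (- ((1 - \<eta>) * l * x))"
      unfolding E2_def
      by (rule exp_markov, measurable)
         (use pair_exp_moment[OF e(1) e(2)[OF i] l(1) kl] in auto)
    also have "\<dots> \<le> ((e i)\<^sup>2 * (\<eta> * u * l)) powr (- \<alpha>) * exp (- ((1 - \<eta>) * l * x))"
    proof (intro mult_right_mono powr_mono2')
      show "0 < (e i)\<^sup>2 * (\<eta> * u * l)" using e[of i] \<eta> pos l by simp
    qed (use m pos in auto)
    also have "((e i)\<^sup>2 * (\<eta> * u * l)) powr (- \<alpha>) = (\<eta> * u * l) powr (- \<alpha>) * G ^ i"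
      using \<eta> pos l by (simp add: powr_mult eG del: powr_power)
    finally show ?thesis .
  qed
  have rest: "prob (?E - E1) \<le> (\<eta> * (1 - \<eta>)\<^sup>2 / 2) powr (- \<alpha>) / (1 - (1 - \<eta>) powr (2 * \<alpha>)) * exp (- ((1 - \<eta>) * l * x))"
  proof (cases "x < B")
    case False
    have "?E - E1 = {}"
    proof -
      have "\<not> x < (sqrt (X1 \<omega>) - sqrt (X2 \<omega>))\<^sup>2" if "\<omega> \<in> space M" "X2 \<omega> \<le> X1 \<omega>" "X1 \<omega> \<le> B" for \<omega>
      proof -
        have "(sqrt (X1 \<omega>) - sqrt (X2 \<omega>))\<^sup>2 \<le> (sqrt (X1 \<omega>))\<^sup>2"
          using X that by (intro power_mono) auto
        thus ?thesis using X that False by simp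
      qed
      thus ?thesis unfolding E1_def by (blast intro: leI)
    qed
    thus ?thesis using g by (simp only: measure_empty) (simp add: divide_nonneg_nonneg)
  next
    case True
    \<comment> \<open>The first net point below the least relevant relative difference \<open>sqrt
      (x / B)\<close>. By minimality it is not much smaller, which bounds the largest term of the
      geometric sum.\<close>
    define N where "N = (LEAST i. 1 \<le> i \<and> (e i)\<^sup>2 \<le> x / B)"
    have "\<exists>i. 1 \<le> i \<and> (e i)\<^sup>2 \<le> x / B"
    proof -
      have "(1 - \<eta>)\<^sup>2 < 1" using \<eta> by (simp add: power_less_one_iff)
      then obtain i where i: "((1 - \<eta>)\<^sup>2) ^ i < x / B"
        using real_arch_pow_inv[of "x / B" "(1 - \<eta>)\<^sup>2"] x0 B0 by auto
      have "((1 - \<eta>)\<^sup>2) ^ Suc i \<le> ((1 - \<eta>)\<^sup>2) ^ i"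
        using \<eta> \<open>(1 - \<eta>)\<^sup>2 < 1\<close> by (intro power_decreasing) auto
      moreover have "(e (Suc i))\<^sup>2 = ((1 - \<eta>)\<^sup>2) ^ Suc i"
        unfolding e_def power_mult[symmetric] by (simp only: mult.commute)
      ultimately have "(e (Suc i))\<^sup>2 \<le> x / B" using i by simp
      thus ?thesis by (intro exI[of _ "Suc i"]) simp
    qed
    hence N: "1 \<le> N \<and> (e N)\<^sup>2 \<le> x / B" unfolding N_def by (rule LeastI_ex)
    have N': "(1 - \<eta>)\<^sup>2 * (x / B) \<le> (e N)\<^sup>2"
    proof -
      have "x / B \<le> (e (N - 1))\<^sup>2"
      proof (cases "N = 1")
        case True
        thus ?thesis using \<open>x < B\<close> B0 by (simp add: e_def)
      next
        case False
        hence "\<not> (1 \<le> N - 1 \<and> (e (N - 1))\<^sup>2 \<le> x / B)"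
          unfolding N_def by (intro not_less_Least) (use N[unfolded N_def] in linarith)
        thus ?thesis using False N by auto
      qed
      hence "(1 - \<eta>)\<^sup>2 * (x / B) \<le> (1 - \<eta>)\<^sup>2 * (e (N - 1))\<^sup>2" by (intro mult_left_mono) auto
      also have "\<dots> = (e N)\<^sup>2" using N unfolding e_def power_mult_distrib[symmetric] by (simp flip: power_Suc)
      finally show ?thesis .
    qed
    have sub: "?E - E1 \<subseteq> (\<Union>i\<in>{1..N}. E2 i)"
    proof
      fix \<omega> assume \<omega>: "\<omega> \<in> ?E - E1"
      define a where "a = sqrt (X1 \<omega>)"
      define b where "b = sqrt (X2 \<omega>)"
      have sp: "\<omega> \<in> space M" and le: "X2 \<omega> \<le> X1 \<omega>" and gt: "x < (a - b)\<^sup>2" and XB: "X1 \<omega> \<le> B"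
        using \<omega> by (auto simp: E1_def a_def b_def)
      have b0: "0 \<le> b" and "b \<le> a" using X sp le by (auto simp: a_def b_def)
      moreover have "a \<noteq> b" using gt x0 by auto
      ultimately have ba: "b < a" by simp
      have a0: "0 < a" using b0 ba by simp
      have a2: "a\<^sup>2 = X1 \<omega>" and b2: "b\<^sup>2 = X2 \<omega>" using X sp by (auto simp: a_def b_def)
      define d where "d = (a - b) / a"
      have d: "0 < d" "d \<le> 1" using a0 b0 ba by (auto simp: d_def)
      have "x / B \<le> (a - b)\<^sup>2 / a\<^sup>2"
      proof (rule frac_le)
        show "a\<^sup>2 \<le> B" using XB a2 by simp
      qed (use a0 gt in simp_all)
      moreover have "(e N)\<^sup>2 \<le> x / B" using N by blast
      moreover have "(a - b)\<^sup>2 / a\<^sup>2 = d\<^sup>2" by (simp add: d_def power_divide)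
      ultimately have "(e N)\<^sup>2 \<le> d\<^sup>2" by linarith
      hence "e N \<le> d" by (rule power2_le_imp_le) (use d in simp)
      hence eN: "(1 - \<eta>) ^ N \<le> d" by (simp add: e_def)
      obtain i where "i \<in> {1..N}" "(1 - \<eta>) ^ i \<le> d" "(1 - \<eta>) * d \<le> (1 - \<eta>) ^ i"
        by (rule geometric_net_point[OF \<eta> d(2) eN conjunct1[OF N]])
      hence i: "i \<in> {1..N}" "e i \<le> d" "(1 - \<eta>) * d \<le> e i" by (simp_all add: e_def)
      have "(1 - \<eta>) * (a - b)\<^sup>2 \<le> e i * a\<^sup>2 - e i / (1 - e i) * b\<^sup>2"
        by (rule sqrt_diff_quadratic_form) (use i e b0 ba in \<open>auto simp: d_def\<close>)
      moreover have "(1 - \<eta>) * x < (1 - \<eta>) * (a - b)\<^sup>2" using gt \<eta> by simp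
      ultimately have "l * ((1 - \<eta>) * x) < l * (e i * X1 \<omega> - e i / (1 - e i) * X2 \<omega>)"
        using l unfolding a2 b2 by (intro mult_strict_left_mono) auto
      hence "\<omega> \<in> E2 i" using sp by (simp add: E2_def mult_ac)
      thus "\<omega> \<in> (\<Union>i\<in>{1..N}. E2 i)" using i by blast
    qed
    have "prob (?E - E1) \<le> prob (\<Union>i\<in>{1..N}. E2 i)"
      by (rule finite_measure_mono[OF sub]) measurable
    also have "\<dots> \<le> (\<Sum>i=1..N. prob (E2 i))"
      by (rule finite_measure_subadditive_finite) auto
    also have "\<dots> \<le> (\<Sum>i=1..N. (\<eta> * u * l) powr (- \<alpha>) * G ^ i * exp (- ((1 - \<eta>) * l * x)))"
      by (rule sum_mono) (use p2 in auto)
    also have "\<dots> = (\<eta> * u * l) powr (- \<alpha>) * (\<Sum>i=1..N. G ^ i) * exp (- ((1 - \<eta>) * l * x))"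
      by (simp add: sum_distrib_left sum_distrib_right mult_ac)
    also have "\<dots> \<le> (\<eta> * u * l) powr (- \<alpha>) * (G ^ N * (G / (G - 1))) * exp (- ((1 - \<eta>) * l * x))"
      by (intro mult_right_mono mult_left_mono sum_powers_le G1) auto
    also have "(\<eta> * u * l) powr (- \<alpha>) * (G ^ N * (G / (G - 1))) = ((\<eta> * u * l) powr (- \<alpha>) * G ^ N) * (G / (G - 1))"
      by simp
    also have "(\<eta> * u * l) powr (- \<alpha>) * G ^ N = (\<eta> * u * l * (e N)\<^sup>2) powr (- \<alpha>)"
      using \<eta> pos l by (simp add: powr_mult eG del: powr_power)
    also have "\<dots> * (G / (G - 1)) * exp (- ((1 - \<eta>) * l * x))
      \<le> (\<eta> * (1 - \<eta>)\<^sup>2 / 2) powr (- \<alpha>) * (G / (G - 1)) * exp (- ((1 - \<eta>) * l * x))"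
    proof (intro mult_right_mono powr_mono2')
      have "\<eta> * (1 - \<eta>)\<^sup>2 / 2 = \<eta> * u * l * ((1 - \<eta>)\<^sup>2 * (x / B))"
        using pos l x0 by (simp add: B_def)
      also have "\<dots> \<le> \<eta> * u * l * (e N)\<^sup>2" using N' \<eta> pos l by (intro mult_left_mono) auto
      finally show "\<eta> * (1 - \<eta>)\<^sup>2 / 2 \<le> \<eta> * u * l * (e N)\<^sup>2" .
    qed (use \<eta> pos G1 in auto)
    finally show ?thesis by (simp add: Gd)
  qed
  have "prob ?E \<le> prob (E1 \<union> (?E - E1))" by (rule finite_measure_mono) auto
  also have "\<dots> \<le> prob E1 + prob (?E - E1)" by (rule measure_Un_le) auto
  also have "\<dots> \<le> 2 powr \<alpha> * exp (- ((1 - \<eta>) * l * x)) +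
    (\<eta> * (1 - \<eta>)\<^sup>2 / 2) powr (- \<alpha>) / (1 - (1 - \<eta>) powr (2 * \<alpha>)) * exp (- ((1 - \<eta>) * l * x))"
    using p1 rest by (rule add_mono)
  also have "\<dots> = tail_const \<alpha> \<eta> * exp (- ((1 - \<eta>) * l * x))"
    by (simp add: tail_const_def distrib_right)
  finally show ?thesis .
qed

lemma pair_tail:
  assumes \<eta>: "0 < \<eta>" "\<eta> < 1" and l: "0 < l" "\<kappa> * l \<le> (1 - \<eta>) * u" and x: "0 \<le> x"
  shows "prob {\<omega> \<in> space M. x < (sqrt (X1 \<omega>) - sqrt (X2 \<omega>))\<^sup>2}
    \<le> 2 * tail_const \<alpha> \<eta> * exp (- ((1 - \<eta>) * l * x))"
proof -
  let ?A = "{\<omega> \<in> space M. X2 \<omega> \<le> X1 \<omega> \<and> x < (sqrt (X1 \<omega>) - sqrt (X2 \<omega>))\<^sup>2}"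
  let ?B = "{\<omega> \<in> space M. X1 \<omega> \<le> X2 \<omega> \<and> x < (sqrt (X2 \<omega>) - sqrt (X1 \<omega>))\<^sup>2}"
  have "prob {\<omega> \<in> space M. x < (sqrt (X1 \<omega>) - sqrt (X2 \<omega>))\<^sup>2} \<le> prob (?A \<union> ?B)"
    by (rule finite_measure_mono) (auto simp: power2_commute)
  also have "\<dots> \<le> prob ?A + prob ?B" by (rule measure_Un_le) auto
  also have "prob ?A \<le> tail_const \<alpha> \<eta> * exp (- ((1 - \<eta>) * l * x))"
    by (rule pair_tail_one_sided[OF \<eta> l x])
  also have "prob ?B \<le> tail_const \<alpha> \<eta> * exp (- ((1 - \<eta>) * l * x))"
    by (rule gamma_pair.pair_tail_one_sided[OF swap \<eta> l x])
  finally show ?thesis by simp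
qed

end

section \<open>Decorrelation of a pair with gamma marginals\<close>

text \<open>
  Writing the coefficients as \<open>pochhammer \<alpha> k / fact k\<close> makes them visibly
  nonnegative for \<open>0 \<le> \<alpha>\<close>; they serve as weights below.
\<close>
lemma negative_binomial_series:
  fixes \<alpha> t :: real
  assumes "\<bar>t\<bar> < 1"
  shows "(\<lambda>k. pochhammer \<alpha> k / fact k * t ^ k) sums ((1 - t) powr (- \<alpha>))"
proof -
  have "(\<lambda>k. (- \<alpha> gchoose k) * (- t) ^ k) sums (1 + - t) powr (- \<alpha>)"
    using assms by (intro gen_binomial_real) auto
  moreover have "(- \<alpha> gchoose k) * (- t) ^ k = pochhammer \<alpha> k / fact k * t ^ k" for k
  proof -
    have "(- \<alpha> gchoose k) * (- t) ^ k = ((- 1) ^ k * (- 1) ^ k) * (pochhammer \<alpha> k / fact k * t ^ k)"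
      by (subst power_minus) (simp add: gbinomial_pochhammer)
    also have "(- 1) ^ k * (- 1) ^ k = (1 :: real)" by (simp flip: power_mult_distrib)
    finally show ?thesis by simp
  qed
  ultimately show ?thesis by simp
qed

text \<open>
  For \<open>\<kappa> = u\<^sup>2 (1 - r)\<close> the base of the joint Laplace transform factors
  as \<open>(1 + u s1) (1 + u s2) (1 - r z1 z2)\<close> with \<open>zi = u si / (1 + u
  si)\<close>. Expanding the last factor separates the variables, so that every power of
  \<open>r\<close> is multiplied by a product of two single sums.
\<close>
lemma gamma_pair_exp_sum_expansion:
  fixes a b :: "nat \<Rightarrow> real"
  assumes pos: "0 < \<alpha>" "0 < u" and r: "\<bar>r\<bar> \<le> 1"
  defines "c \<equiv> \<lambda>m. (1 + u * real (Suc m)) powr (- \<alpha>)"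
    and "z \<equiv> \<lambda>m. u * real (Suc m) / (1 + u * real (Suc m))"
  shows "(\<lambda>k. pochhammer \<alpha> k / fact k * r ^ k * ((\<Sum>m\<le>n. a m * c m * z m ^ k) * (\<Sum>l\<le>n'. b l * c l * z l ^ k)))
     sums (\<Sum>m\<le>n. \<Sum>l\<le>n'. a m * b l *
        (1 + u * real (Suc m) + u * real (Suc l) + u\<^sup>2 * (1 - r) * real (Suc m) * real (Suc l)) powr (- \<alpha>))"
proof -
  have z: "0 \<le> z m" "z m < 1" for m using pos by (auto simp: z_def divide_simps add_pos_nonneg)
  have one: "(\<lambda>k. a m * b l * (c m * c l) * (pochhammer \<alpha> k / fact k * (r * z m * z l) ^ k))
      sums (a m * b l * (1 + u * real (Suc m) + u * real (Suc l) + u\<^sup>2 * (1 - r) * real (Suc m) * real (Suc l)) powr (- \<alpha>))" for m l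
  proof -
    have zz: "z m * z l < 1" using mult_strict_mono'[OF z(2)[of m] z(2)[of l] z(1) z(1)] by simp
    have "\<bar>r * z m * z l\<bar> = \<bar>r\<bar> * (z m * z l)" using z by (simp add: abs_mult)
    also have "\<dots> \<le> 1 * (z m * z l)" using r z by (intro mult_right_mono) auto
    finally have t: "\<bar>r * z m * z l\<bar> < 1" using zz by simp
    have p: "0 < 1 + u * real (Suc k)" for k using pos by (simp add: add_pos_pos)
    have "c m * c l * (1 - r * z m * z l) powr (- \<alpha>)
      = ((1 + u * real (Suc m)) * (1 + u * real (Suc l)) * (1 - r * z m * z l)) powr (- \<alpha>)"
      by (simp only: c_def powr_mult)
    also have "(1 + u * real (Suc m)) * (1 + u * real (Suc l)) * (1 - r * z m * z l)
      = (1 + u * real (Suc m)) * (1 + u * real (Suc l)) - r * ((1 + u * real (Suc m)) * z m) * ((1 + u * real (Suc l)) * z l)"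
      by (simp add: algebra_simps)
    also have "\<dots> = (1 + u * real (Suc m)) * (1 + u * real (Suc l)) - r * (u * real (Suc m)) * (u * real (Suc l))"
      using p[of m] p[of l] by (simp add: z_def del: of_nat_Suc)
    also have "\<dots> = 1 + u * real (Suc m) + u * real (Suc l) + u\<^sup>2 * (1 - r) * real (Suc m) * real (Suc l)"
      by (simp add: algebra_simps power2_eq_square)
    finally have eq: "a m * b l * (1 + u * real (Suc m) + u * real (Suc l) + u\<^sup>2 * (1 - r) * real (Suc m) * real (Suc l)) powr (- \<alpha>)
      = a m * b l * (c m * c l) * (1 - r * z m * z l) powr (- \<alpha>)" by simp
    show ?thesis unfolding eq by (intro sums_mult negative_binomial_series t)
  qed
  have "(\<lambda>k. \<Sum>m\<le>n. \<Sum>l\<le>n'. a m * b l * (c m * c l) * (pochhammer \<alpha> k / fact k * (r * z m * z l) ^ k))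
     sums (\<Sum>m\<le>n. \<Sum>l\<le>n'. a m * b l *
        (1 + u * real (Suc m) + u * real (Suc l) + u\<^sup>2 * (1 - r) * real (Suc m) * real (Suc l)) powr (- \<alpha>))"
    by (intro sums_sum one)
  moreover have "(\<Sum>m\<le>n. \<Sum>l\<le>n'. a m * b l * (c m * c l) * (pochhammer \<alpha> k / fact k * (r * z m * z l) ^ k))
    = pochhammer \<alpha> k / fact k * r ^ k * ((\<Sum>m\<le>n. a m * c m * z m ^ k) * (\<Sum>l\<le>n'. b l * c l * z l ^ k))" for k
    by (subst sum_product, simp only: sum_distrib_left power_mult_distrib, intro sum.cong refl, simp add: mult_ac)
  ultimately show ?thesis by simp
qed

context gamma_pair
begin

text \<open>
  For a permanental pair this is \<open>u(s,t) u(t,s) / u\<^sup>2\<close>; it is also the ordinary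
  correlation coefficient of the pair.
\<close>
definition corr :: real where "corr = 1 - \<kappa> / u\<^sup>2"

text \<open>
  By \<open>gamma_pair_exp_sum_expansion\<close> there are coefficient sequences \<open>F\<close>,
  \<open>G\<close> and weights \<open>w \<ge> 0\<close> with \<open>E (f(X1) g(X2)) = (\<Sum>k. w
  k * corr ^ k * F k * G k)\<close>. The second moment of \<open>f(X1)\<close> is the same series
  for \<open>corr = 1\<close> and \<open>G = F\<close>, since \<open>\<kappa> = 0\<close>
  describes two equal variables. The terms with \<open>k = 0\<close> are the products of the
  means, and each of the other ones carries at least one factor \<open>corr\<close>.
\<close>
lemma exp_sum_cov_bound:
  fixes a b :: "nat \<Rightarrow> real" and n n' :: nat
  assumes r: "\<bar>corr\<bar> \<le> 1"
  defines "f \<equiv> \<lambda>x. \<Sum>m\<le>n. a m * exp (- (real (Suc m) * x))"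
    and "g \<equiv> \<lambda>x. \<Sum>m\<le>n'. b m * exp (- (real (Suc m) * x))"
  shows "\<bar>expectation (\<lambda>\<omega>. f (X1 \<omega>) * g (X2 \<omega>)) - expectation (\<lambda>\<omega>. f (X1 \<omega>)) * expectation (\<lambda>\<omega>. g (X2 \<omega>))\<bar>
    \<le> \<bar>corr\<bar> * ((expectation (\<lambda>\<omega>. (f (X1 \<omega>))\<^sup>2) - (expectation (\<lambda>\<omega>. f (X1 \<omega>)))\<^sup>2) + (expectation (\<lambda>\<omega>. (g (X2 \<omega>))\<^sup>2) - (expectation (\<lambda>\<omega>. g (X2 \<omega>)))\<^sup>2)) / 2"
proof -
  have L1: "\<And>s. 0 < s \<Longrightarrow> expectation (\<lambda>\<omega>. exp (- (s * X1 \<omega>))) = (1 + u * s) powr (- \<alpha>)"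
    and L2: "\<And>s. 0 < s \<Longrightarrow> expectation (\<lambda>\<omega>. exp (- (s * X2 \<omega>))) = (1 + u * s) powr (- \<alpha>)"
    using gamma1 gamma2 by (auto simp: gamma_variable_def gamma_variable_axioms_def)
  have kappa: "u\<^sup>2 * (1 - corr) = \<kappa>" using pos by (simp add: corr_def)
  have L: "expectation (\<lambda>\<omega>. exp (- (s1 * X1 \<omega> + s2 * X2 \<omega>))) = (1 + u * s1 + u * s2 + u\<^sup>2 * (1 - corr) * s1 * s2) powr (- \<alpha>)"
    if "0 < s1" "0 < s2" for s1 s2
    unfolding kappa by (rule joint_laplace[OF that])
  define c where "c m = (1 + u * real (Suc m)) powr (- \<alpha>)" for m :: nat
  define z where "z m = u * real (Suc m) / (1 + u * real (Suc m))" for m :: nat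
  define F where "F k = (\<Sum>m\<le>n. a m * c m * z m ^ k)" for k
  define G where "G k = (\<Sum>m\<le>n'. b m * c m * z m ^ k)" for k
  define w where "w k = pochhammer \<alpha> k / fact k" for k
  have w: "0 \<le> w k" for k using pos by (simp add: w_def pochhammer_nonneg)
  have i1: "integrable M (\<lambda>\<omega>. exp (- (real (Suc m) * X \<omega>)))"
    if [measurable]: "X \<in> borel_measurable M" and "\<And>\<omega>. \<omega> \<in> space M \<Longrightarrow> 0 \<le> X \<omega>" for X :: "'a \<Rightarrow> real" and m
    by (rule integrable_const_bound[where B=1]) (use that(2) in auto)
  have i2: "integrable M (\<lambda>\<omega>. exp (- (real (Suc m) * X \<omega>)) * exp (- (real (Suc l) * Y \<omega>)))"
    if [measurable]: "X \<in> borel_measurable M" "Y \<in> borel_measurable M" and "\<And>\<omega>. \<omega> \<in> space M \<Longrightarrow> 0 \<le> X \<omega>" "\<And>\<omega>. \<omega> \<in> space M \<Longrightarrow> 0 \<le> Y \<omega>"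
    for X Y :: "'a \<Rightarrow> real" and m l
    by (rule integrable_const_bound[where B=1]) (use that(3,4) in \<open>auto intro!: AE_I2 simp: mult_le_one\<close>)
  have Ef: "expectation (\<lambda>\<omega>. f (X1 \<omega>)) = F 0"
    unfolding f_def F_def using L1
    by (subst Bochner_Integration.integral_sum) (auto intro!: i1 X simp: c_def simp del: of_nat_Suc)
  have Eg: "expectation (\<lambda>\<omega>. g (X2 \<omega>)) = G 0"
    unfolding g_def G_def using L2
    by (subst Bochner_Integration.integral_sum) (auto intro!: i1 X simp: c_def simp del: of_nat_Suc)
  have prodE: "expectation (\<lambda>\<omega>. (\<Sum>m\<le>n. a m * exp (- (real (Suc m) * X \<omega>))) * (\<Sum>m\<le>n'. b m * exp (- (real (Suc m) * Y \<omega>))))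
      = (\<Sum>m\<le>n. \<Sum>l\<le>n'. a m * b l * expectation (\<lambda>\<omega>. exp (- (real (Suc m) * X \<omega> + real (Suc l) * Y \<omega>))))"
    if XY: "X \<in> borel_measurable M" "Y \<in> borel_measurable M" "\<And>\<omega>. \<omega> \<in> space M \<Longrightarrow> 0 \<le> X \<omega>" "\<And>\<omega>. \<omega> \<in> space M \<Longrightarrow> 0 \<le> Y \<omega>"
    for X Y :: "'a \<Rightarrow> real" and a b :: "nat \<Rightarrow> real" and n n'
  proof -
    have "expectation (\<lambda>\<omega>. (\<Sum>m\<le>n. a m * exp (- (real (Suc m) * X \<omega>))) * (\<Sum>m\<le>n'. b m * exp (- (real (Suc m) * Y \<omega>))))
      = expectation (\<lambda>\<omega>. (\<Sum>m\<le>n. \<Sum>l\<le>n'. a m * b l * (exp (- (real (Suc m) * X \<omega>)) * exp (- (real (Suc l) * Y \<omega>)))))"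
      by (simp add: sum_product mult_ac del: of_nat_Suc)
    also have "\<dots> = (\<Sum>m\<le>n. \<Sum>l\<le>n'. a m * b l * expectation (\<lambda>\<omega>. exp (- (real (Suc m) * X \<omega>)) * exp (- (real (Suc l) * Y \<omega>))))"
      by (simp add: Bochner_Integration.integral_sum i2[OF XY] del: of_nat_Suc)
    also have "\<dots> = (\<Sum>m\<le>n. \<Sum>l\<le>n'. a m * b l * expectation (\<lambda>\<omega>. exp (- (real (Suc m) * X \<omega> + real (Suc l) * Y \<omega>))))"
      by (simp only: minus_add_distrib exp_add)
    finally show ?thesis .
  qed
  have sfg: "(\<lambda>k. w k * corr ^ k * (F k * G k)) sums expectation (\<lambda>\<omega>. f (X1 \<omega>) * g (X2 \<omega>))"
  proof -
    have "expectation (\<lambda>\<omega>. f (X1 \<omega>) * g (X2 \<omega>)) = (\<Sum>m\<le>n. \<Sum>l\<le>n'. a m * b l *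
        (1 + u * real (Suc m) + u * real (Suc l) + u\<^sup>2 * (1 - corr) * real (Suc m) * real (Suc l)) powr (- \<alpha>))"
      unfolding f_def g_def using L by (subst prodE) (auto simp: X simp del: of_nat_Suc)
    thus ?thesis
      using gamma_pair_exp_sum_expansion[OF pos r, of a n b n'] unfolding F_def G_def w_def c_def z_def by simp
  qed
  have sq: "(\<lambda>k. w k * (H k)\<^sup>2) sums expectation (\<lambda>\<omega>. (\<Sum>m\<le>n. a m * exp (- (real (Suc m) * X \<omega>)))\<^sup>2)"
    if XX: "X \<in> borel_measurable M" "\<And>\<omega>. \<omega> \<in> space M \<Longrightarrow> 0 \<le> X \<omega>"
     and LX: "\<And>s. 0 < s \<Longrightarrow> expectation (\<lambda>\<omega>. exp (- (s * X \<omega>))) = (1 + u * s) powr (- \<alpha>)"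
     and H: "\<And>k. H k = (\<Sum>m\<le>n. a m * c m * z m ^ k)"
    for X :: "'a \<Rightarrow> real" and a :: "nat \<Rightarrow> real" and n H
  proof -
    \<comment> \<open>The pair \<open>(X, X)\<close> has the joint transform for \<open>r =
      1\<close>.\<close>
    have two: "expectation (\<lambda>\<omega>. exp (- (real (Suc m) * X \<omega> + real (Suc l) * X \<omega>)))
        = (1 + u * real (Suc m) + u * real (Suc l) + u\<^sup>2 * (1 - 1) * real (Suc m) * real (Suc l)) powr (- \<alpha>)" for m l
    proof -
      have "0 < real (Suc m) + real (Suc l)" by simp
      from LX[OF this] show ?thesis
        by (simp only: distrib_right distrib_left add.assoc[symmetric]) simp
    qed
    have "expectation (\<lambda>\<omega>. (\<Sum>m\<le>n. a m * exp (- (real (Suc m) * X \<omega>)))\<^sup>2) = (\<Sum>m\<le>n. \<Sum>l\<le>n. a m * a l *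
        (1 + u * real (Suc m) + u * real (Suc l) + u\<^sup>2 * (1 - 1) * real (Suc m) * real (Suc l)) powr (- \<alpha>))"
      unfolding power2_eq_square using XX
      by (simp only: prodE two power2_eq_square)
    thus ?thesis
      using gamma_pair_exp_sum_expansion[OF pos, of 1 a n a n] unfolding H w_def c_def z_def
      by (simp add: power2_eq_square)
  qed
  have sf: "(\<lambda>k. w k * (F k)\<^sup>2) sums expectation (\<lambda>\<omega>. (f (X1 \<omega>))\<^sup>2)"
    unfolding f_def by (rule sq) (auto simp: X L1 F_def)
  have sg: "(\<lambda>k. w k * (G k)\<^sup>2) sums expectation (\<lambda>\<omega>. (g (X2 \<omega>))\<^sup>2)"
    unfolding g_def by (rule sq) (auto simp: X L2 G_def)
  have w0: "w 0 = 1" by (simp add: w_def)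
  let ?cov = "expectation (\<lambda>\<omega>. f (X1 \<omega>) * g (X2 \<omega>)) - F 0 * G 0"
  let ?vf = "expectation (\<lambda>\<omega>. (f (X1 \<omega>))\<^sup>2) - (F 0)\<^sup>2"
  let ?vg = "expectation (\<lambda>\<omega>. (g (X2 \<omega>))\<^sup>2) - (G 0)\<^sup>2"
  have tfg: "(\<lambda>k. w (Suc k) * corr ^ Suc k * (F (Suc k) * G (Suc k))) sums ?cov"
    by (subst sums_Suc_iff) (use sfg w0 in simp)
  have tf: "(\<lambda>k. w (Suc k) * (F (Suc k))\<^sup>2) sums ?vf"
    by (subst sums_Suc_iff) (use sf w0 in simp)
  have tg: "(\<lambda>k. w (Suc k) * (G (Suc k))\<^sup>2) sums ?vg"
    by (subst sums_Suc_iff) (use sg w0 in simp)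
  have ts: "(\<lambda>k. \<bar>corr\<bar> / 2 * (w (Suc k) * (F (Suc k))\<^sup>2 + w (Suc k) * (G (Suc k))\<^sup>2)) sums (\<bar>corr\<bar> / 2 * (?vf + ?vg))"
    by (intro sums_mult sums_add tf tg)
  have le: "\<bar>w (Suc k) * corr ^ Suc k * (F (Suc k) * G (Suc k))\<bar> \<le> \<bar>corr\<bar> / 2 * (w (Suc k) * (F (Suc k))\<^sup>2 + w (Suc k) * (G (Suc k))\<^sup>2)" for k
  proof -
    have "\<bar>corr ^ Suc k\<bar> \<le> \<bar>corr\<bar>" using r by (simp add: abs_mult power_abs mult_left_le power_le_one)
    moreover have "\<bar>F (Suc k) * G (Suc k)\<bar> \<le> ((F (Suc k))\<^sup>2 + (G (Suc k))\<^sup>2) / 2"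
      using sum_squares_bound[of "\<bar>F (Suc k)\<bar>" "\<bar>G (Suc k)\<bar>"] by (simp add: abs_mult)
    ultimately have "w (Suc k) * (\<bar>corr ^ Suc k\<bar> * \<bar>F (Suc k) * G (Suc k)\<bar>) \<le> w (Suc k) * (\<bar>corr\<bar> * (((F (Suc k))\<^sup>2 + (G (Suc k))\<^sup>2) / 2))"
      using w by (intro mult_left_mono mult_mono) auto
    thus ?thesis using w[of "Suc k"] by (simp add: abs_mult algebra_simps)
  qed
  have "?cov \<le> \<bar>corr\<bar> / 2 * (?vf + ?vg)"
    by (rule sums_le[OF _ tfg ts]) (use le abs_le_D1 in blast)
  moreover have "- ?cov \<le> \<bar>corr\<bar> / 2 * (?vf + ?vg)"
    by (rule sums_le[OF _ sums_minus[OF tfg] ts]) (use le abs_le_D2 in blast)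
  ultimately have "\<bar>?cov\<bar> \<le> \<bar>corr\<bar> / 2 * (?vf + ?vg)" by (rule abs_leI)
  thus ?thesis unfolding Ef Eg by simp
qed

lemma cov_bound:
  assumes r: "\<bar>corr\<bar> \<le> 1"
    and \<phi>: "continuous_on UNIV \<phi>" "\<And>x. R \<le> x \<Longrightarrow> \<phi> x = 0" "\<And>x. \<bar>\<phi> x\<bar> \<le> B"
    and \<psi>: "continuous_on UNIV \<psi>" "\<And>x. R' \<le> x \<Longrightarrow> \<psi> x = 0" "\<And>x. \<bar>\<psi> x\<bar> \<le> B"
  shows "\<bar>expectation (\<lambda>\<omega>. \<phi> (X1 \<omega>) * \<psi> (X2 \<omega>)) - expectation (\<lambda>\<omega>. \<phi> (X1 \<omega>)) * expectation (\<lambda>\<omega>. \<psi> (X2 \<omega>))\<bar>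
    \<le> \<bar>corr\<bar> * ((expectation (\<lambda>\<omega>. (\<phi> (X1 \<omega>))\<^sup>2) - (expectation (\<lambda>\<omega>. \<phi> (X1 \<omega>)))\<^sup>2) + (expectation (\<lambda>\<omega>. (\<psi> (X2 \<omega>))\<^sup>2) - (expectation (\<lambda>\<omega>. \<psi> (X2 \<omega>)))\<^sup>2)) / 2"
proof -
  have ex: "\<exists>n a. \<forall>x\<ge>0. \<bar>f x - (\<Sum>m\<le>n. a m * exp (- (real (Suc m) * x)))\<bar> < inverse (real (Suc i))"
    if "continuous_on UNIV f" "\<And>x. R \<le> x \<Longrightarrow> f x = 0" for f R i
    by (rule exp_sum_approx[of f R "inverse (real (Suc i))"]) (use that continuous_on_subset in \<open>auto, blast+\<close>)
  define app where "app f i n a \<longleftrightarrow> (\<forall>x\<ge>0. \<bar>f x - (\<Sum>m\<le>n. a m * exp (- (real (Suc m) * x)))\<bar> < inverse (real (Suc i)))"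
    for f i and n :: nat and a
  obtain n a where f: "app \<phi> i (n i) (a i)" for i using ex[OF \<phi>(1,2)] unfolding app_def by metis
  obtain n' b where g: "app \<psi> i (n' i) (b i)" for i using ex[OF \<psi>(1,2)] unfolding app_def by metis
  define F where "F i x = (\<Sum>m\<le>n i. a i m * exp (- (real (Suc m) * x)))" for i x
  define G where "G i x = (\<Sum>m\<le>n' i. b i m * exp (- (real (Suc m) * x)))" for i x
  have [measurable]: "\<phi> \<in> borel_measurable borel" "\<psi> \<in> borel_measurable borel" "F i \<in> borel_measurable borel" "G i \<in> borel_measurable borel" for i
    unfolding F_def G_def using \<phi>(1) \<psi>(1) by (auto intro: borel_measurable_continuous_onI)
  have inv: "(\<lambda>i. inverse (real (Suc i))) \<longlonglongrightarrow> 0" by (rule LIMSEQ_inverse_real_of_nat)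
  have Fd: "\<bar>\<phi> x - F i x\<bar> < inverse (real (Suc i))" "\<bar>\<psi> x - G i x\<bar> < inverse (real (Suc i))" if "0 \<le> x" for x i
    using f[of i] g[of i] that unfolding app_def F_def G_def by blast+
  have inv1: "inverse (real (Suc i)) \<le> 1" for i by (simp add: inverse_le_1_iff)
  have FB: "\<bar>F i x\<bar> \<le> B + 1" "\<bar>G i x\<bar> \<le> B + 1" if "0 \<le> x" for x i
    using Fd[OF that, of i] inv1[of i] \<phi>(3)[of x] \<psi>(3)[of x] by linarith+
  have lF: "(\<lambda>i. F i x) \<longlonglongrightarrow> \<phi> x" "(\<lambda>i. G i x) \<longlonglongrightarrow> \<psi> x" if "0 \<le> x" for x
  proof -
    have "(\<lambda>i. F i x - \<phi> x) \<longlonglongrightarrow> 0" "(\<lambda>i. G i x - \<psi> x) \<longlonglongrightarrow> 0"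
      by (rule Lim_null_comparison[OF _ inv], use Fd[OF that] in \<open>auto intro!: always_eventually less_imp_le simp: abs_minus_commute simp del: of_nat_Suc\<close>)+
    thus "(\<lambda>i. F i x) \<longlonglongrightarrow> \<phi> x" "(\<lambda>i. G i x) \<longlonglongrightarrow> \<psi> x" by (auto intro: LIM_zero_cancel)
  qed
  have B0: "0 \<le> B" using \<phi>(3)[of 0] by linarith
  have bd2: "\<bar>p * q\<bar> \<le> (B + 1)\<^sup>2" if "\<bar>p\<bar> \<le> B + 1" "\<bar>q\<bar> \<le> B + 1" for p q :: real
    unfolding abs_mult power2_eq_square using that B0 by (intro mult_mono) auto
  have bd2': "p\<^sup>2 \<le> (B + 1)\<^sup>2" if "\<bar>p\<bar> \<le> B + 1" for p :: real
    using that B0 by (intro abs_le_square_iff[THEN iffD1]) auto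
  have Fae: "AE \<omega> in M. (\<lambda>i. F i (X1 \<omega>)) \<longlonglongrightarrow> \<phi> (X1 \<omega>)" "AE \<omega> in M. (\<lambda>i. G i (X2 \<omega>)) \<longlonglongrightarrow> \<psi> (X2 \<omega>)"
    by (rule AE_I2, rule lF, erule X)+
  have bae: "AE \<omega> in M. \<bar>F i (X1 \<omega>)\<bar> \<le> B + 1" "AE \<omega> in M. \<bar>G i (X2 \<omega>)\<bar> \<le> B + 1" for i
    by (rule AE_I2, rule FB, erule X)+
  have c1: "(\<lambda>i. LINT \<omega>|M. F i (X1 \<omega>)) \<longlonglongrightarrow> expectation (\<lambda>\<omega>. \<phi> (X1 \<omega>))"
    by (rule integral_dominated_convergence[where w="\<lambda>_. B + 1"]) (use Fae bae in auto)
  have c2: "(\<lambda>i. LINT \<omega>|M. G i (X2 \<omega>)) \<longlonglongrightarrow> expectation (\<lambda>\<omega>. \<psi> (X2 \<omega>))"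
    by (rule integral_dominated_convergence[where w="\<lambda>_. B + 1"]) (use Fae bae in auto)
  have c3: "(\<lambda>i. LINT \<omega>|M. F i (X1 \<omega>) * G i (X2 \<omega>)) \<longlonglongrightarrow> expectation (\<lambda>\<omega>. \<phi> (X1 \<omega>) * \<psi> (X2 \<omega>))"
  proof (rule integral_dominated_convergence[where w="\<lambda>_. (B + 1)\<^sup>2"])
    show "AE \<omega> in M. (\<lambda>i. F i (X1 \<omega>) * G i (X2 \<omega>)) \<longlonglongrightarrow> \<phi> (X1 \<omega>) * \<psi> (X2 \<omega>)"
      using Fae by eventually_elim (rule tendsto_mult)
    show "AE \<omega> in M. norm (F i (X1 \<omega>) * G i (X2 \<omega>)) \<le> (B + 1)\<^sup>2" for i
      using bae[of i] by eventually_elim (unfold real_norm_def, rule bd2)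
  qed auto
  have c4: "(\<lambda>i. LINT \<omega>|M. (F i (X1 \<omega>))\<^sup>2) \<longlonglongrightarrow> expectation (\<lambda>\<omega>. (\<phi> (X1 \<omega>))\<^sup>2)"
  proof (rule integral_dominated_convergence[where w="\<lambda>_. (B + 1)\<^sup>2"])
    show "AE \<omega> in M. (\<lambda>i. (F i (X1 \<omega>))\<^sup>2) \<longlonglongrightarrow> (\<phi> (X1 \<omega>))\<^sup>2"
      using Fae(1) by eventually_elim (rule tendsto_power)
    show "AE \<omega> in M. norm ((F i (X1 \<omega>))\<^sup>2) \<le> (B + 1)\<^sup>2" for i
      using bae(1)[of i] by eventually_elim (simp add: bd2')
  qed auto
  have c5: "(\<lambda>i. LINT \<omega>|M. (G i (X2 \<omega>))\<^sup>2) \<longlonglongrightarrow> expectation (\<lambda>\<omega>. (\<psi> (X2 \<omega>))\<^sup>2)"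
  proof (rule integral_dominated_convergence[where w="\<lambda>_. (B + 1)\<^sup>2"])
    show "AE \<omega> in M. (\<lambda>i. (G i (X2 \<omega>))\<^sup>2) \<longlonglongrightarrow> (\<psi> (X2 \<omega>))\<^sup>2"
      using Fae(2) by eventually_elim (rule tendsto_power)
    show "AE \<omega> in M. norm ((G i (X2 \<omega>))\<^sup>2) \<le> (B + 1)\<^sup>2" for i
      using bae(2)[of i] by eventually_elim (simp add: bd2')
  qed auto
  show ?thesis
  proof (rule LIMSEQ_le)
    show "(\<lambda>i. \<bar>expectation (\<lambda>\<omega>. F i (X1 \<omega>) * G i (X2 \<omega>)) - expectation (\<lambda>\<omega>. F i (X1 \<omega>)) * expectation (\<lambda>\<omega>. G i (X2 \<omega>))\<bar>)
       \<longlonglongrightarrow> \<bar>expectation (\<lambda>\<omega>. \<phi> (X1 \<omega>) * \<psi> (X2 \<omega>)) - expectation (\<lambda>\<omega>. \<phi> (X1 \<omega>)) * expectation (\<lambda>\<omega>. \<psi> (X2 \<omega>))\<bar>"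
      by (intro tendsto_intros c1 c2 c3)
    show "(\<lambda>i. \<bar>corr\<bar> * ((expectation (\<lambda>\<omega>. (F i (X1 \<omega>))\<^sup>2) - (expectation (\<lambda>\<omega>. F i (X1 \<omega>)))\<^sup>2) + (expectation (\<lambda>\<omega>. (G i (X2 \<omega>))\<^sup>2) - (expectation (\<lambda>\<omega>. G i (X2 \<omega>)))\<^sup>2)) / 2)
      \<longlonglongrightarrow> \<bar>corr\<bar> * ((expectation (\<lambda>\<omega>. (\<phi> (X1 \<omega>))\<^sup>2) - (expectation (\<lambda>\<omega>. \<phi> (X1 \<omega>)))\<^sup>2) + (expectation (\<lambda>\<omega>. (\<psi> (X2 \<omega>))\<^sup>2) - (expectation (\<lambda>\<omega>. \<psi> (X2 \<omega>)))\<^sup>2)) / 2"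
      by (intro tendsto_intros c1 c2 c4 c5) auto
    show "\<exists>N. \<forall>i\<ge>N. \<bar>expectation (\<lambda>\<omega>. F i (X1 \<omega>) * G i (X2 \<omega>)) - expectation (\<lambda>\<omega>. F i (X1 \<omega>)) * expectation (\<lambda>\<omega>. G i (X2 \<omega>))\<bar>
      \<le> \<bar>corr\<bar> * ((expectation (\<lambda>\<omega>. (F i (X1 \<omega>))\<^sup>2) - (expectation (\<lambda>\<omega>. F i (X1 \<omega>)))\<^sup>2) + (expectation (\<lambda>\<omega>. (G i (X2 \<omega>))\<^sup>2) - (expectation (\<lambda>\<omega>. G i (X2 \<omega>)))\<^sup>2)) / 2"
      unfolding F_def G_def by (intro exI allI impI exp_sum_cov_bound[OF r])
  qed
qed

end

section \<open>The constant of the cosine integral\<close>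

lemma Gamma_reflection_real:
  fixes x :: real
  shows "Gamma x * Gamma (1 - x) = pi / sin (pi * x)"
proof -
  have "complex_of_real (Gamma x * Gamma (1 - x)) = complex_of_real (pi / sin (pi * x))"
    using Gamma_reflection_complex[of "of_real x"]
    by (simp add: Gamma_complex_of_real[symmetric] sin_of_real[symmetric])
  thus ?thesis by (simp only: of_real_eq_iff)
qed

text \<open>The Gamma integral after the substitution \<open>x = v y\<^sup>2\<close>.\<close>
lemma nn_integral_powr_exp_square:
  assumes "0 < a" "0 < v"
  shows "(\<integral>\<^sup>+y. ennreal (indicator {0<..} y * (y powr (2 * a - 1) * exp (- (v * y\<^sup>2)))) \<partial>lborel)
    = ennreal (Gamma a * v powr (- a) / 2)"
proof -
  define f where "f x = x powr (a - 1) / exp x" for x :: real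
  have "(f has_integral Gamma a) {0..}" unfolding f_def by (rule Gamma_integral_real[OF assms(1)])
  hence "((\<lambda>t. if t \<in> {0<..} then f t else 0) has_integral Gamma a) {0..}"
    by (rule has_integral_spike[of "{0}", rotated 2]) auto
  hence f: "(f has_integral Gamma a) {0<..}"
    by (subst (asm) has_integral_restrict) auto
  have fi: "f absolutely_integrable_on {0<..}"
    by (rule nonnegative_absolutely_integrable_1) (use f in \<open>auto simp: f_def\<close>)
  define g where "g y = v * y\<^sup>2" for y :: real
  have img: "g ` {0<..} = {0<..}"
  proof -
    have "x \<in> g ` {0<..}" if "0 < x" for x
      by (rule image_eqI[of _ _ "sqrt (x / v)"]) (use that assms in \<open>auto simp: g_def\<close>)
    thus ?thesis using assms by (auto simp: g_def)
  qed
  have "(\<lambda>y. \<bar>2 * v * y\<bar> * f (g y)) absolutely_integrable_on {0<..} \<and> integral {0<..} (\<lambda>y. \<bar>2 * v * y\<bar> * f (g y)) = Gamma a"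
  proof (rule has_absolute_integral_change_of_variables_1'[where g'="\<lambda>y. 2 * v * y" and g=g and f=f and S="{0<..}", THEN iffD2])
    show "inj_on g {0<..}" using assms by (auto simp: inj_on_def g_def power2_eq_iff_nonneg)
    show "{0<..} \<in> sets (lebesgue :: real measure)" by simp
    show "(g has_real_derivative 2 * v * x) (at x within {0<..})" for x
      unfolding g_def by (auto intro!: derivative_eq_intros)
    show "f absolutely_integrable_on g ` {0<..} \<and> integral (g ` {0<..}) f = Gamma a"
      unfolding img using f fi by (simp add: integral_unique)
  qed
  hence "((\<lambda>y. \<bar>2 * v * y\<bar> * f (g y)) has_integral Gamma a) {0<..}"
    by (metis has_integral_integral set_lebesgue_integral_eq_integral(1))
  hence "(\<integral>\<^sup>+y. ennreal (indicator {0<..} y * (\<bar>2 * v * y\<bar> * f (g y))) \<partial>lborel) = ennreal (Gamma a)"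
    by (intro nn_integral_has_integral_lebesgue) (auto simp: f_def)
  also have "(\<integral>\<^sup>+y. ennreal (indicator {0<..} y * (\<bar>2 * v * y\<bar> * f (g y))) \<partial>lborel)
    = (\<integral>\<^sup>+y. ennreal (2 * v powr a) * ennreal (indicator {0<..} y * (y powr (2 * a - 1) * exp (- (v * y\<^sup>2)))) \<partial>lborel)"
  proof (rule nn_integral_cong)
    fix y :: real
    have "\<bar>2 * v * y\<bar> * f (g y) = 2 * v powr a * (y powr (2 * a - 1) * exp (- (v * y\<^sup>2)))" if y: "0 < y"
    proof -
      have "(v * y\<^sup>2) powr (a - 1) = v powr (a - 1) * (y powr 2) powr (a - 1)"
        using y by (simp add: powr_mult)
      also have "\<dots> = v powr (a - 1) * y powr (2 * (a - 1))" by (simp only: powr_powr)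
      finally have e: "(v * y\<^sup>2) powr (a - 1) = v powr (a - 1) * y powr (2 * (a - 1))" .
      have "v * v powr (a - 1) = v powr a" using assms by (simp add: powr_diff)
      moreover have "y * y powr (2 * (a - 1)) = y powr (2 * a - 1)"
        using y powr_add[of y 1 "2 * (a - 1)"] by simp
      ultimately have "2 * v * y * ((v * y\<^sup>2) powr (a - 1)) = 2 * v powr a * y powr (2 * a - 1)"
        unfolding e by (metis (no_types, lifting) mult.assoc mult.commute)
      thus ?thesis using y assms by (simp add: f_def g_def exp_minus field_simps)
    qed
    thus "ennreal (indicator {0<..} y * (\<bar>2 * v * y\<bar> * f (g y))) = ennreal (2 * v powr a) * ennreal (indicator {0<..} y * (y powr (2 * a - 1) * exp (- (v * y\<^sup>2))))"
      by (cases "0 < y") (simp_all flip: ennreal_mult')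
  qed
  also have "\<dots> = ennreal (2 * v powr a) * (\<integral>\<^sup>+y. ennreal (indicator {0<..} y * (y powr (2 * a - 1) * exp (- (v * y\<^sup>2)))) \<partial>lborel)"
    by (rule nn_integral_cmult) auto
  finally have e: "ennreal (2 * v powr a) * (\<integral>\<^sup>+y. ennreal (indicator {0<..} y * (y powr (2 * a - 1) * exp (- (v * y\<^sup>2)))) \<partial>lborel) = ennreal (Gamma a)" .
  have "ennreal (2 * v powr a) * ennreal (Gamma a * v powr (- a) / 2) = ennreal (Gamma a)"
  proof -
    have "v powr a * v powr (- a) = 1" using assms by (simp flip: powr_add)
    hence e1: "2 * v powr a * (Gamma a * v powr (- a) / 2) = Gamma a" by (simp add: mult.left_commute)
    have e2: "ennreal (2 * v powr a) * ennreal (Gamma a * v powr (- a) / 2) = ennreal (2 * v powr a * (Gamma a * v powr (- a) / 2))"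
      by (rule ennreal_mult'[symmetric]) simp
    show ?thesis unfolding e2 e1 ..
  qed
  with e have "ennreal (2 * v powr a) * (\<integral>\<^sup>+y. ennreal (indicator {0<..} y * (y powr (2 * a - 1) * exp (- (v * y\<^sup>2)))) \<partial>lborel) = ennreal (2 * v powr a) * ennreal (Gamma a * v powr (- a) / 2)"
    by simp
  thus ?thesis using assms by (subst (asm) ennreal_mult_cancel_left) auto
qed

text \<open>
  Writing \<open>1 / (1 + y\<^sup>2)\<close> as the integral of \<open>exp (- v (1 +
  y\<^sup>2))\<close> over \<open>v > 0\<close> and exchanging the integrals leaves \<open>Gamma
  (\<gamma> / 2) Gamma (1 - \<gamma> / 2) / 2\<close>, to which the reflection formula applies.
\<close>
lemma nn_integral_powr_over_one_plus_square:
  assumes g: "0 < \<gamma>" "\<gamma> < 2"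
  shows "(\<integral>\<^sup>+y. ennreal (indicator {0<..} y * (y powr (\<gamma> - 1) / (1 + y\<^sup>2))) \<partial>lborel)
    = ennreal (pi / (2 * sin (pi * \<gamma> / 2)))"
proof -
  let ?h = "\<lambda>y v. ennreal (indicator {0<..} y * y powr (\<gamma> - 1)) * ennreal (indicator {0<..} v * exp (- (v * (1 + y\<^sup>2))))"
  have inner: "(\<integral>\<^sup>+v. ennreal (indicator {0<..} v * exp (- (v * b))) \<partial>lborel) = ennreal (1 / b)" if "0 < b" for b :: real
  proof -
    have "(\<integral>\<^sup>+v. ennreal (indicator {0<..} v * exp (- (v * b))) \<partial>lborel)
      = (\<integral>\<^sup>+v. ennreal (indicator {0<..} v * (v powr (1 - 1) * exp (- (b * v)))) \<partial>lborel)"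
      by (rule nn_integral_cong) (auto simp: indicator_def mult.commute)
    also have "\<dots> = ennreal (Gamma 1 * b powr (- 1))"
      by (rule nn_integral_powr_exp) (use that in auto)
    finally show ?thesis using that by (simp add: powr_minus divide_inverse)
  qed
  have "(\<integral>\<^sup>+y. ennreal (indicator {0<..} y * (y powr (\<gamma> - 1) / (1 + y\<^sup>2))) \<partial>lborel) = (\<integral>\<^sup>+y. \<integral>\<^sup>+v. ?h y v \<partial>lborel \<partial>lborel)"
  proof (rule nn_integral_cong)
    fix y :: real
    have p: "0 < 1 + y\<^sup>2" by (simp add: add_pos_nonneg)
    show "ennreal (indicator {0<..} y * (y powr (\<gamma> - 1) / (1 + y\<^sup>2))) = (\<integral>\<^sup>+v. ?h y v \<partial>lborel)"
      by (subst nn_integral_cmult, simp, subst inner[OF p]) (use p in \<open>simp flip: ennreal_mult'\<close>)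
  qed
  also have "\<dots> = (\<integral>\<^sup>+v. \<integral>\<^sup>+y. ?h y v \<partial>lborel \<partial>lborel)"
    by (rule lborel_pair.Fubini') measurable
  also have "\<dots> = (\<integral>\<^sup>+v. ennreal (Gamma (\<gamma> / 2) / 2) * ennreal (indicator {0<..} v * (v powr ((1 - \<gamma> / 2) - 1) * exp (- (1 * v)))) \<partial>lborel)"
  proof (rule nn_integral_cong)
    fix v :: real
    show "(\<integral>\<^sup>+y. ?h y v \<partial>lborel) = ennreal (Gamma (\<gamma> / 2) / 2) * ennreal (indicator {0<..} v * (v powr ((1 - \<gamma> / 2) - 1) * exp (- (1 * v))))"
    proof (cases "0 < v")
      case True
      have "(\<integral>\<^sup>+y. ?h y v \<partial>lborel) = (\<integral>\<^sup>+y. ennreal (exp (- v)) * ennreal (indicator {0<..} y * (y powr (2 * (\<gamma> / 2) - 1) * exp (- (v * y\<^sup>2)))) \<partial>lborel)"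
        using True by (intro nn_integral_cong) (auto simp: indicator_def distrib_left exp_diff exp_minus field_simps simp flip: ennreal_mult' intro!: arg_cong[where f=ennreal])
      also have "\<dots> = ennreal (exp (- v)) * ennreal (Gamma (\<gamma> / 2) * v powr (- (\<gamma> / 2)) / 2)"
        using g True by (subst nn_integral_cmult) (simp_all add: nn_integral_powr_exp_square[of "\<gamma> / 2" v, simplified])
      also have "\<dots> = ennreal (Gamma (\<gamma> / 2) / 2) * ennreal (indicator {0<..} v * (v powr ((1 - \<gamma> / 2) - 1) * exp (- (1 * v))))"
        using True g Gamma_real_pos[of "\<gamma> / 2"] by (simp add: mult_ac flip: ennreal_mult')
      finally show ?thesis .
    qed simp
  qed
  also have "\<dots> = ennreal (Gamma (\<gamma> / 2) / 2) * ennreal (Gamma (1 - \<gamma> / 2) * 1 powr (- (1 - \<gamma> / 2)))"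
    using g by (subst nn_integral_cmult, simp, subst nn_integral_powr_exp) auto
  also have "\<dots> = ennreal ((Gamma (\<gamma> / 2) * Gamma (1 - \<gamma> / 2)) / 2)"
    using g Gamma_real_pos[of "\<gamma> / 2"] by (simp flip: ennreal_mult')
  also have "(Gamma (\<gamma> / 2) * Gamma (1 - \<gamma> / 2)) / 2 = pi / (2 * sin (pi * \<gamma> / 2))"
    by (simp add: Gamma_reflection_real)
  finally show ?thesis .
qed

text \<open>
  The real part of the difference of two exponential integrals, with exponents \<open>y\<close>
  and \<open>y - \<i>\<close>.
\<close>
lemma nn_integral_one_minus_cos_exp:
  assumes y: "0 < y"
  shows "(\<integral>\<^sup>+t. ennreal (indicator {0<..} t * ((1 - cos t) * exp (- (y * t)))) \<partial>lborel) = ennreal (1 / (y * (1 + y\<^sup>2)))"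
proof -
  let ?f = "\<lambda>w t. indicator {0..} t *\<^sub>R exp (- (w * complex_of_real t))"
  have i1: "integrable lborel (?f (of_real y))" and v1: "(CLBINT t. ?f (of_real y) t) = 1 / of_real y"
    using y by (auto intro!: integral_exp_halfline)
  have i2: "integrable lborel (?f (of_real y - \<i>))" and v2: "(CLBINT t. ?f (of_real y - \<i>) t) = 1 / (of_real y - \<i>)"
    using y by (auto intro!: integral_exp_halfline)
  have i: "integrable lborel (\<lambda>t. Re (?f (of_real y) t - ?f (of_real y - \<i>) t))"
    by (intro integrable_Re Bochner_Integration.integrable_diff i1 i2)
  have eq: "Re (?f (of_real y) t - ?f (of_real y - \<i>) t) = indicator {0..} t * ((1 - cos t) * exp (- (y * t)))" for t
    by (simp add: Re_exp algebra_simps)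
  have "(LBINT t. Re (?f (of_real y) t - ?f (of_real y - \<i>) t)) = Re (1 / of_real y - 1 / (of_real y - \<i>))"
    by (subst integral_Re) (auto simp: i1 i2 v1 v2 intro!: Bochner_Integration.integrable_diff simp del: minus_complex.sel)
  also have "\<dots> = 1 / (y * (1 + y\<^sup>2))"
  proof -
    have "Re (1 / (of_real y - \<i>)) = y / (y\<^sup>2 + 1)" by (simp add: Re_divide power2_eq_square)
    moreover have "1 / y - y / (y\<^sup>2 + 1) = 1 / (y * (1 + y\<^sup>2))"
    proof -
      have "y\<^sup>2 + 1 \<noteq> 0" "1 + y\<^sup>2 \<noteq> 0" by (simp_all add: add_pos_nonneg add_nonneg_pos less_imp_neq[symmetric])
      thus ?thesis using y by (simp add: field_simps power2_eq_square)
    qed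
    ultimately show ?thesis by simp
  qed
  finally have v: "(LBINT t. indicator {0..} t * ((1 - cos t) * exp (- (y * t)))) = 1 / (y * (1 + y\<^sup>2))" by (simp only: eq)
  have "(\<integral>\<^sup>+t. ennreal (indicator {0<..} t * ((1 - cos t) * exp (- (y * t)))) \<partial>lborel) =
    (\<integral>\<^sup>+t. ennreal (indicator {0..} t * ((1 - cos t) * exp (- (y * t)))) \<partial>lborel)"
    by (rule nn_integral_cong) (auto simp: indicator_def)
  also have "\<dots> = ennreal (LBINT t. indicator {0..} t * ((1 - cos t) * exp (- (y * t))))"
    by (rule nn_integral_eq_integral) (use i[unfolded eq] in auto)
  finally show ?thesis by (simp only: v)
qed

text \<open>
  The integral behind \<open>C_const\<close>. Replacing \<open>t powr (- (\<gamma> + 1))\<close>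
  by a Gamma integral in a new variable \<open>y\<close> and integrating over \<open>t\<close>
  first reduces it to the integral of \<open>y powr (\<gamma> - 1) / (1 + y\<^sup>2)\<close>; the
  reflection formula brings the result into the stated form.
\<close>
lemma nn_integral_one_minus_cos_powr:
  assumes g: "0 < \<gamma>" "\<gamma> < 1"
  shows "(\<integral>\<^sup>+t. ennreal (indicator {0<..} t * ((1 - cos t) * t powr (- (\<gamma> + 1)))) \<partial>lborel)
    = ennreal (- sin ((\<gamma> + 1) * pi / 2) * Gamma (- \<gamma>))" (is "?I = _")
    and "0 < - sin ((\<gamma> + 1) * pi / 2) * Gamma (- \<gamma>)"
proof -
  have G: "0 < Gamma (\<gamma> + 1)" using g by (intro Gamma_real_pos) auto
  have s1: "0 < sin (pi * \<gamma> / 2)" using g by (intro sin_gt_zero) (auto simp: field_simps)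
  have c1: "0 < cos (pi * \<gamma> / 2)" using g by (intro cos_gt_zero) (auto simp: field_simps)
  have val: "- sin ((\<gamma> + 1) * pi / 2) * Gamma (- \<gamma>) = pi / (2 * sin (pi * \<gamma> / 2)) / Gamma (\<gamma> + 1)"
  proof -
    have "sin ((\<gamma> + 1) * pi / 2) = cos (pi * \<gamma> / 2)"
      using sin_add[of "\<gamma> * pi / 2" "pi / 2"] by (simp add: field_simps)
    moreover have "Gamma (- \<gamma>) * Gamma (1 + \<gamma>) = - pi / sin (pi * \<gamma>)"
      using Gamma_reflection_real[of "- \<gamma>"] by simp
    moreover have "sin (pi * \<gamma>) = 2 * sin (pi * \<gamma> / 2) * cos (pi * \<gamma> / 2)"
      using sin_double[of "pi * \<gamma> / 2"] by simp
    ultimately have "(- sin ((\<gamma> + 1) * pi / 2) * Gamma (- \<gamma>)) * Gamma (\<gamma> + 1) = pi / (2 * sin (pi * \<gamma> / 2))"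
      using c1 s1 by (simp add: field_simps)
    thus ?thesis by (rule eq_divide_imp[OF less_imp_neq[OF G, symmetric]])
  qed
  show "0 < - sin ((\<gamma> + 1) * pi / 2) * Gamma (- \<gamma>)"
    unfolding val using G s1 by simp
  let ?h = "\<lambda>t y. ennreal (indicator {0<..} t * (1 - cos t)) * ennreal (indicator {0<..} y * (y powr ((\<gamma> + 1) - 1) * exp (- (t * y))))"
  have "ennreal (Gamma (\<gamma> + 1)) * ?I = (\<integral>\<^sup>+t. ennreal (Gamma (\<gamma> + 1)) * ennreal (indicator {0<..} t * ((1 - cos t) * t powr (- (\<gamma> + 1)))) \<partial>lborel)"
    by (rule nn_integral_cmult[symmetric]) simp
  also have "\<dots> = (\<integral>\<^sup>+t. \<integral>\<^sup>+y. ?h t y \<partial>lborel \<partial>lborel)"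
  proof (rule nn_integral_cong)
    fix t :: real
    show "ennreal (Gamma (\<gamma> + 1)) * ennreal (indicator {0<..} t * ((1 - cos t) * t powr (- (\<gamma> + 1)))) = (\<integral>\<^sup>+y. ?h t y \<partial>lborel)"
    proof (cases "0 < t")
      case True
      have "(\<integral>\<^sup>+y. ?h t y \<partial>lborel) = ennreal (1 - cos t) * ennreal (Gamma (\<gamma> + 1) * t powr (- (\<gamma> + 1)))"
        using True g by (subst nn_integral_cmult, simp, subst nn_integral_powr_exp) auto
      thus ?thesis using True G by (simp add: mult_ac flip: ennreal_mult')
    qed simp
  qed
  also have "\<dots> = (\<integral>\<^sup>+y. \<integral>\<^sup>+t. ?h t y \<partial>lborel \<partial>lborel)"
    by (rule lborel_pair.Fubini') measurable
  also have "\<dots> = (\<integral>\<^sup>+y. ennreal (indicator {0<..} y * (y powr (\<gamma> - 1) / (1 + y\<^sup>2))) \<partial>lborel)"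
  proof (rule nn_integral_cong)
    fix y :: real
    show "(\<integral>\<^sup>+t. ?h t y \<partial>lborel) = ennreal (indicator {0<..} y * (y powr (\<gamma> - 1) / (1 + y\<^sup>2)))"
    proof (cases "0 < y")
      case True
      have "(\<integral>\<^sup>+t. ?h t y \<partial>lborel) = (\<integral>\<^sup>+t. ennreal (y powr \<gamma>) * ennreal (indicator {0<..} t * ((1 - cos t) * exp (- (y * t)))) \<partial>lborel)"
        using True by (intro nn_integral_cong) (auto simp: indicator_def mult_ac simp flip: ennreal_mult')
      also have "\<dots> = ennreal (y powr \<gamma>) * ennreal (1 / (y * (1 + y\<^sup>2)))"
        by (subst nn_integral_cmult) (auto simp: nn_integral_one_minus_cos_exp[OF True])
      also have "\<dots> = ennreal (y powr (\<gamma> - 1) / (1 + y\<^sup>2))"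
        using True by (simp add: powr_diff flip: ennreal_mult')
      finally show ?thesis using True by simp
    qed simp
  qed
  also have "\<dots> = ennreal (pi / (2 * sin (pi * \<gamma> / 2)))"
    by (rule nn_integral_powr_over_one_plus_square) (use g in auto)
  also have "\<dots> = ennreal (Gamma (\<gamma> + 1)) * ennreal (- sin ((\<gamma> + 1) * pi / 2) * Gamma (- \<gamma>))"
    unfolding val using G by (simp flip: ennreal_mult')
  finally show "?I = ennreal (- sin ((\<gamma> + 1) * pi / 2) * Gamma (- \<gamma>))"
    using G by (subst (asm) ennreal_mult_cancel_left) auto
qed

section \<open>The kernel near the diagonal and at infinity\<close>

lemma integral_one_minus_cos_powr_scaled:
  assumes g: "0 < \<gamma>" "\<gamma> < 1" and x: "0 < x"
  shows "has_bochner_integral lborel (\<lambda>l. indicator {0<..} l * ((1 - cos (l * x)) * l powr (- (\<gamma> + 1))))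
    (- sin ((\<gamma> + 1) * pi / 2) * Gamma (- \<gamma>) * x powr \<gamma>)"
proof -
  define I where "I = - sin ((\<gamma> + 1) * pi / 2) * Gamma (- \<gamma>)"
  have I: "0 < I" unfolding I_def by (rule nn_integral_one_minus_cos_powr(2)[OF g])
  let ?J = "\<integral>\<^sup>+l. ennreal (indicator {0<..} l * ((1 - cos (l * x)) * l powr (- (\<gamma> + 1)))) \<partial>lborel"
  have "ennreal I = (\<integral>\<^sup>+t. ennreal (indicator {0<..} t * ((1 - cos t) * t powr (- (\<gamma> + 1)))) \<partial>lborel)"
    unfolding I_def by (rule nn_integral_one_minus_cos_powr(1)[OF g, symmetric])
  also have "\<dots> = ennreal \<bar>x\<bar> * (\<integral>\<^sup>+l. ennreal (indicator {0<..} (0 + x * l) * ((1 - cos (0 + x * l)) * (0 + x * l) powr (- (\<gamma> + 1)))) \<partial>lborel)"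
    by (rule nn_integral_real_affine) (use x in auto)
  also have "\<dots> = (\<integral>\<^sup>+l. ennreal x * ennreal (indicator {0<..} (0 + x * l) * ((1 - cos (0 + x * l)) * (0 + x * l) powr (- (\<gamma> + 1)))) \<partial>lborel)"
    using x by (subst nn_integral_cmult) auto
  also have "\<dots> = (\<integral>\<^sup>+l. ennreal (x powr (- \<gamma>)) * ennreal (indicator {0<..} l * ((1 - cos (l * x)) * l powr (- (\<gamma> + 1)))) \<partial>lborel)"
  proof (rule nn_integral_cong)
    fix l :: real
    have "x * x powr (- (\<gamma> + 1)) = x powr (- \<gamma>)" using x powr_add[of x 1 "- (\<gamma> + 1)"] by simp
    hence "x * ((1 - cos (x * l)) * (x * l) powr (- (\<gamma> + 1))) = x powr (- \<gamma>) * ((1 - cos (l * x)) * l powr (- (\<gamma> + 1)))" if "0 < l"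
      by (simp only: powr_mult mult.commute[of l x]) (simp add: mult_ac)
    thus "ennreal x * ennreal (indicator {0<..} (0 + x * l) * ((1 - cos (0 + x * l)) * (0 + x * l) powr (- (\<gamma> + 1))))
      = ennreal (x powr (- \<gamma>)) * ennreal (indicator {0<..} l * ((1 - cos (l * x)) * l powr (- (\<gamma> + 1))))"
      using x by (cases "0 < l") (simp_all add: zero_less_mult_iff flip: ennreal_mult')
  qed
  also have "\<dots> = ennreal (x powr (- \<gamma>)) * ?J" by (rule nn_integral_cmult) auto
  finally have "ennreal (x powr \<gamma>) * ennreal I = ennreal (x powr \<gamma>) * (ennreal (x powr (- \<gamma>)) * ?J)" by simp
  also have "\<dots> = ennreal (x powr \<gamma> * x powr (- \<gamma>)) * ?J" by (simp add: ennreal_mult' mult.assoc)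
  also have "x powr \<gamma> * x powr (- \<gamma>) = 1" using x by (simp flip: powr_add)
  finally have "ennreal (x powr \<gamma>) * ennreal I = ?J" by (simp only: ennreal_1 mult_1)
  hence J: "?J = ennreal (I * x powr \<gamma>)"
    by (subst mult.commute) (simp only: ennreal_mult'[OF powr_ge_zero])
  have "has_bochner_integral lborel (\<lambda>l. indicator {0<..} l * ((1 - cos (l * x)) * l powr (- (\<gamma> + 1)))) (I * x powr \<gamma>)"
    by (rule has_bochner_integral_nn_integral) (use J I in auto)
  thus ?thesis by (simp add: I_def)
qed

lemma C_const_pos:
  assumes "0 < \<gamma>" "\<gamma> < 1" shows "0 < C_const \<gamma> \<beta>"
proof -
  have "0 < pi * (1 + \<beta>\<^sup>2 * (tan ((\<gamma> + 1) * pi / 2))\<^sup>2)" by (simp add: add_pos_nonneg)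
  thus ?thesis unfolding C_const_def using nn_integral_one_minus_cos_powr(2)[OF assms] by (intro divide_pos_pos)
qed

lemma D_const_eq: "D_const \<rho> \<gamma> \<beta> = u_dens \<rho> \<gamma> \<beta> x x"
  by (simp add: D_const_def u_dens_def)

context
  fixes \<rho> \<gamma> \<beta> :: real
  assumes g: "0 < \<gamma>" "\<gamma> < 1" and \<rho>: "0 < \<rho>"
begin

\<comment> \<open>With \<open>p l = \<bar>l\<bar> powr (\<gamma> + 1)\<close> the exponent is
  \<open>psi l = p l * (1 - \<i> * tau)\<close> for \<open>l > 0\<close>; \<open>N\<close> is the
  squared modulus of \<open>\<rho> + psi\<close>, and \<open>ev\<close> and \<open>od\<close> are
  the real and the imaginary part divided by it.\<close>
private definition tau where "tau = \<beta> * tan ((\<gamma> + 1) * pi / 2)"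
private definition p where "p l = \<bar>l\<bar> powr (\<gamma> + 1)" for l :: real
private definition N where "N l = (\<rho> + p l)\<^sup>2 + (p l * tau)\<^sup>2" for l
private definition ev where "ev l = (\<rho> + p l) / N l" for l
private definition od where "od l = - (p l * tau) / N l" for l

private lemma p_nonneg: "0 \<le> p l" by (simp add: p_def)

private lemma p_meas [measurable]: "p \<in> borel_measurable borel"
  unfolding p_def by measurable

private lemma N_pos: "0 < N l"
  unfolding N_def using \<rho> p_nonneg[of l] by (intro add_pos_nonneg) auto

private lemma N_ge: "(\<rho> + p l)\<^sup>2 \<le> N l" unfolding N_def by simp

private lemma N_meas [measurable]: "N \<in> borel_measurable borel" unfolding N_def by measurable
private lemma ev_meas [measurable]: "ev \<in> borel_measurable borel" unfolding ev_def by measurable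
private lemma od_meas [measurable]: "od \<in> borel_measurable borel" unfolding od_def by measurable

private lemma cmod_N: "(cmod (of_real \<rho> + psi \<gamma> \<beta> l))\<^sup>2 = N l" if "0 < l" 
  using that by (simp add: cmod_power2 psi_Re N_def p_def tau_def psi_def)

private lemma u_eq: "u_dens \<rho> \<gamma> \<beta> x y =
    1 / pi * (LBINT l. indicator {0<..} l * (cos (l * (x - y)) * ev l)) +
    1 / pi * (LBINT l. indicator {0<..} l * (sin (l * (x - y)) * od l))"
proof -
  have "(LBINT l:{0..}. cos (l * (x - y)) * Re (of_real \<rho> + psi \<gamma> \<beta> l) / (cmod (of_real \<rho> + psi \<gamma> \<beta> l))\<^sup>2)
     = (LBINT l. indicator {0<..} l * (cos (l * (x - y)) * ev l))"
    unfolding set_lebesgue_integral_def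
    by (rule integral_cong_AE, measurable)
       (use AE_lborel_singleton[of 0] in eventually_elim, auto simp: indicator_def cmod_N ev_def psi_Re p_def)
  moreover have "(LBINT l:{0..}. sin (l * (x - y)) * Im (psi \<gamma> \<beta> l) / (cmod (of_real \<rho> + psi \<gamma> \<beta> l))\<^sup>2)
     = (LBINT l. indicator {0<..} l * (sin (l * (x - y)) * od l))"
    unfolding set_lebesgue_integral_def
    by (rule integral_cong_AE, measurable)
       (use AE_lborel_singleton[of 0] in eventually_elim, auto simp: indicator_def cmod_N od_def p_def tau_def, simp add: psi_def)
  ultimately show ?thesis unfolding u_dens_def by simp
qed

private lemma ev_bounds: "0 < ev l" "ev l \<le> 1 / (\<rho> + p l)"
proof -
  have r: "0 < \<rho> + p l" using \<rho> p_nonneg[of l] by simp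
  show "0 < ev l" unfolding ev_def using r N_pos by simp
  have "ev l \<le> (\<rho> + p l) / (\<rho> + p l)\<^sup>2" unfolding ev_def using r N_ge by (intro divide_left_mono) (auto simp: N_pos)
  also have "\<dots> = 1 / (\<rho> + p l)" using r by (simp add: power2_eq_square)
  finally show "ev l \<le> 1 / (\<rho> + p l)" .
qed

private lemma od_bound: "\<bar>od l\<bar> \<le> \<bar>tau\<bar> / (\<rho> + p l)"
proof -
  have r: "0 < \<rho> + p l" using \<rho> p_nonneg[of l] by simp
  have "\<bar>od l\<bar> = p l * \<bar>tau\<bar> / N l" using N_pos[of l] p_nonneg[of l] by (simp add: od_def abs_mult)
  also have "\<dots> \<le> (\<rho> + p l) * \<bar>tau\<bar> / (\<rho> + p l)\<^sup>2"
    using r N_ge \<rho> by (intro frac_le mult_right_mono) auto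
  also have "\<dots> = \<bar>tau\<bar> / (\<rho> + p l)" using r by (simp add: power2_eq_square)
  finally show ?thesis .
qed

private lemma int0: "integrable lborel (\<lambda>l. 1 / (\<rho> + p l))"
  unfolding p_def by (rule integrable_inverse_rho_powr[OF g(1) \<rho>])

private lemma int_bounded:
  assumes [measurable]: "f \<in> borel_measurable borel" and "\<And>l. 0 < l \<Longrightarrow> \<bar>f l\<bar> \<le> B / (\<rho> + p l)"
  shows "integrable lborel (\<lambda>l. indicator {0<..} l * f l)"
proof (rule Bochner_Integration.integrable_bound[OF integrable_mult_right[OF int0, of "\<bar>B\<bar>"]])
  show "AE l in lborel. norm (indicator {0<..} l * f l) \<le> norm (\<bar>B\<bar> * (1 / (\<rho> + p l)))"
  proof (rule AE_I2)
    fix l :: real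
    have r: "0 < \<rho> + p l" using \<rho> p_nonneg[of l] by simp
    have "B / (\<rho> + p l) \<le> \<bar>B\<bar> / (\<rho> + p l)" using r by (intro divide_right_mono) auto
    thus "norm (indicator {0<..} l * f l) \<le> norm (\<bar>B\<bar> * (1 / (\<rho> + p l)))"
      using assms(2)[of l] r by (auto simp: indicator_def)
  qed
qed simp

private lemma int_ev: "integrable lborel (\<lambda>l. indicator {0<..} l * (cos (l * x) * ev l))"
proof (rule int_bounded[where B=1])
  fix l :: real
  have "\<bar>cos (l * x) * ev l\<bar> \<le> 1 * ev l" unfolding abs_mult using ev_bounds(1)[of l] by (intro mult_mono) auto
  thus "\<bar>cos (l * x) * ev l\<bar> \<le> 1 / (\<rho> + p l)" using ev_bounds(2)[of l] by simp
qed simp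

private lemma int_od: "integrable lborel (\<lambda>l. indicator {0<..} l * (sin (l * x) * od l))"
proof (rule int_bounded[where B="\<bar>tau\<bar>"])
  fix l :: real
  have "\<bar>sin (l * x) * od l\<bar> \<le> 1 * \<bar>od l\<bar>" unfolding abs_mult by (intro mult_right_mono) auto
  thus "\<bar>sin (l * x) * od l\<bar> \<le> \<bar>tau\<bar> / (\<rho> + p l)" using od_bound[of l] by simp
qed simp

private definition A where "A x = 1 / pi * (LBINT l. indicator {0<..} l * (cos (l * x) * ev l))" for x
private definition B where "B x = 1 / pi * (LBINT l. indicator {0<..} l * (sin (l * x) * od l))" for x

text \<open>
  The functions \<open>A\<close> and \<open>B\<close> are the even and the odd part of the kernel
  as a function of \<open>x - y\<close>.
\<close>
private lemma u_AB: "u_dens \<rho> \<gamma> \<beta> x y = A (x - y) + B (x - y)" "u_dens \<rho> \<gamma> \<beta> y x = A (x - y) - B (x - y)"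
proof -
  show "u_dens \<rho> \<gamma> \<beta> x y = A (x - y) + B (x - y)" by (simp add: u_eq A_def B_def)
  have "A (y - x) = A (x - y)" unfolding A_def
    by (intro arg_cong[where f="\<lambda>z. 1 / pi * z"] Bochner_Integration.integral_cong refl)
       (metis cos_minus minus_diff_eq mult_minus_right)
  moreover have "B (y - x) = - B (x - y)"
  proof -
    have "(LBINT l. indicator {0<..} l * (sin (l * (y - x)) * od l)) = (LBINT l. - (indicator {0<..} l * (sin (l * (x - y)) * od l)))"
    proof (rule Bochner_Integration.integral_cong[OF refl])
      fix l :: real
      have "sin (l * (y - x)) = - sin (l * (x - y))" by (metis sin_minus minus_diff_eq mult_minus_right)
      thus "indicator {0<..} l * (sin (l * (y - x)) * od l) = - (indicator {0<..} l * (sin (l * (x - y)) * od l))" by simp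
    qed
    thus ?thesis by (simp add: B_def)
  qed
  ultimately show "u_dens \<rho> \<gamma> \<beta> y x = A (x - y) - B (x - y)" by (simp add: u_eq A_def B_def)
qed

private lemma B0: "B 0 = 0" by (simp add: B_def)

lemma u_dens_diag_pos: "0 < u_dens \<rho> \<gamma> \<beta> x x"
proof -
  have i: "integrable lborel (\<lambda>l. indicator {0<..} l * ev l)" using int_ev[of 0] by simp
  have "(LBINT l. indicator {0<..} l * ev l) \<noteq> 0"
  proof
    assume "(LBINT l. indicator {0<..} l * ev l) = 0"
    hence "AE l in lborel. indicator {0<..} l * ev l = 0"
    proof (subst (asm) integral_nonneg_eq_0_iff_AE[OF i])
      show "AE l in lborel. 0 \<le> indicator {0<..} l * ev l"
        by (intro AE_I2 mult_nonneg_nonneg less_imp_le[OF ev_bounds(1)]) auto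
    qed
    hence "AE l in lborel. l \<notin> {0..1::real}"
      using AE_lborel_singleton[of 0]
    proof eventually_elim
      case (elim l)
      thus ?case using ev_bounds(1)[of l] by (auto simp: indicator_def split: if_splits)
    qed
    hence "emeasure lborel {0..1::real} = 0" by (subst (asm) AE_iff_measurable[of "{0..1}"]) auto
    thus False by simp
  qed
  moreover have "0 \<le> (LBINT l. indicator {0<..} l * ev l)"
    by (intro integral_nonneg_AE AE_I2 mult_nonneg_nonneg less_imp_le[OF ev_bounds(1)]) auto
  ultimately show ?thesis using u_AB(1)[of x x] B0 by (simp add: A_def)
qed

private lemma l_over: "l / (\<rho> + p l) \<le> 1 / \<rho> + 1" if "0 < l" for l
proof (cases "l \<le> 1")
  case True
  have "l / (\<rho> + p l) \<le> 1 / \<rho>" using that True \<rho> p_nonneg by (intro frac_le) auto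
  thus ?thesis by simp
next
  case False
  have "l powr 1 \<le> l powr (\<gamma> + 1)" using False g by (intro powr_mono) auto
  hence "l \<le> p l" using that by (simp add: p_def)
  hence "l / (\<rho> + p l) \<le> 1" using \<rho> that by (simp add: divide_le_eq)
  thus ?thesis using \<rho> by (smt (verit) divide_pos_pos)
qed

text \<open>
  As \<open>l\<close> tends to infinity, \<open>ev l\<close> is asymptotic to \<open>l powr (-
  (\<gamma> + 1)) / (1 + tau\<^sup>2)\<close>, which is responsible for the factor \<open>1 +
  tau\<^sup>2\<close> in \<open>C_const\<close>. The error term decays fast enough to stay
  integrable after multiplication by \<open>l\<close>.
\<close>
private lemma ev_upper: "ev l \<le> l powr (- (\<gamma> + 1)) / (1 + tau\<^sup>2) + \<rho> / (\<rho> + p l)\<^sup>2" if l: "0 < l" for l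
proof -
  have pp: "0 < p l" using l by (simp add: p_def)
  have pl: "l powr (- (\<gamma> + 1)) = 1 / p l" unfolding powr_minus_divide p_def using l by simp
  have r: "0 < \<rho> + p l" using \<rho> pp by simp
  have t: "0 < 1 + tau\<^sup>2" by (simp add: add_pos_nonneg)
  have "ev l - 1 / (p l * (1 + tau\<^sup>2)) = ((\<rho> + p l) * (p l * (1 + tau\<^sup>2)) - N l) / (N l * (p l * (1 + tau\<^sup>2)))"
    unfolding ev_def using N_pos[of l] pp t by (subst diff_frac_eq) auto
  also have "(\<rho> + p l) * (p l * (1 + tau\<^sup>2)) - N l = \<rho> * p l * tau\<^sup>2 - \<rho>\<^sup>2 - \<rho> * p l"
    by (simp add: N_def power2_eq_square algebra_simps)
  also have "(\<rho> * p l * tau\<^sup>2 - \<rho>\<^sup>2 - \<rho> * p l) / (N l * (p l * (1 + tau\<^sup>2))) \<le> (\<rho> * (p l * (1 + tau\<^sup>2))) / (N l * (p l * (1 + tau\<^sup>2)))"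
    using N_pos[of l] pp t \<rho> by (intro divide_right_mono) (auto simp: algebra_simps intro!: add_nonneg_nonneg)
  also have "\<dots> = \<rho> / N l" using pp t by simp
  also have "\<dots> \<le> \<rho> / (\<rho> + p l)\<^sup>2" using N_ge[of l] r \<rho> by (intro divide_left_mono) (auto simp: N_pos)
  finally show ?thesis unfolding pl by simp
qed

text \<open>
  Integrate \<open>(1 - cos (l x)) ev l\<close> using \<open>ev_upper\<close>: the leading term
  gives exactly \<open>C_const \<gamma> \<beta> * x powr \<gamma>\<close> by scaling, and in the
  error term \<open>1 - cos (l x) \<le> l x\<close>.
\<close>
private lemma A_increment: "\<exists>K\<ge>0. \<forall>x>0. A 0 - A x \<le> C_const \<gamma> \<beta> * x powr \<gamma> + K * x"
proof -
  define R where "R l = l * (\<rho> / (\<rho> + p l)\<^sup>2)" for l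
  have R: "integrable lborel (\<lambda>l. indicator {0<..} l * R l)"
  proof (rule int_bounded[where B="(1 / \<rho> + 1) * \<rho>"])
    show "R \<in> borel_measurable borel" unfolding R_def by measurable
    fix l :: real assume l: "0 < l"
    have r: "0 < \<rho> + p l" using \<rho> p_nonneg[of l] by simp
    have "\<bar>R l\<bar> = l / (\<rho> + p l) * (\<rho> / (\<rho> + p l))" using l r \<rho> by (simp add: R_def power2_eq_square)
    also have "\<dots> \<le> (1 / \<rho> + 1) * (\<rho> / (\<rho> + p l))" using l_over[OF l] r \<rho> by (intro mult_right_mono) auto
    finally show "\<bar>R l\<bar> \<le> (1 / \<rho> + 1) * \<rho> / (\<rho> + p l)" by simp
  qed
  define K where "K = 1 / pi * (LBINT l. indicator {0<..} l * R l)"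
  have "0 \<le> (LBINT l. indicator {0<..} l * R l)"
    by (rule integral_nonneg_AE, rule AE_I2) (use \<rho> in \<open>auto simp: R_def indicator_def\<close>)
  hence K: "0 \<le> K" by (simp add: K_def)
  have "A 0 - A x \<le> C_const \<gamma> \<beta> * x powr \<gamma> + K * x" if x: "0 < x" for x
  proof -
    define c where "c = - sin ((\<gamma> + 1) * pi / 2) * Gamma (- \<gamma>)"
    let ?G = "\<lambda>l. indicator {0<..} l * ((1 - cos (l * x)) * l powr (- (\<gamma> + 1)))"
    have hb: "has_bochner_integral lborel ?G (c * x powr \<gamma>)"
      unfolding c_def by (rule integral_one_minus_cos_powr_scaled[OF g x])
    have iG: "integrable lborel ?G" and vG: "(LBINT l. ?G l) = c * x powr \<gamma>"
      using hb by (auto simp: has_bochner_integral_iff)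
    have "A 0 - A x = 1 / pi * (LBINT l. indicator {0<..} l * (cos (l * 0) * ev l) - indicator {0<..} l * (cos (l * x) * ev l))"
      unfolding A_def by (subst Bochner_Integration.integral_diff[OF int_ev int_ev]) (simp add: right_diff_distrib)
    also have "\<dots> \<le> 1 / pi * (LBINT l. 1 / (1 + tau\<^sup>2) * ?G l + x * (indicator {0<..} l * R l))"
    proof (intro mult_left_mono integral_mono Bochner_Integration.integrable_diff int_ev Bochner_Integration.integrable_add integrable_mult_right iG R)
      fix l :: real
      show "indicator {0<..} l * (cos (l * 0) * ev l) - indicator {0<..} l * (cos (l * x) * ev l)
        \<le> 1 / (1 + tau\<^sup>2) * ?G l + x * (indicator {0<..} l * R l)"
      proof (cases "0 < l")
        case l: True
        have "(1 - cos (l * x)) * ev l \<le> (1 - cos (l * x)) * (l powr (- (\<gamma> + 1)) / (1 + tau\<^sup>2) + \<rho> / (\<rho> + p l)\<^sup>2)"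
          using ev_upper[OF l] by (intro mult_left_mono) auto
        also have "\<dots> = 1 / (1 + tau\<^sup>2) * ((1 - cos (l * x)) * l powr (- (\<gamma> + 1))) + (1 - cos (l * x)) * (\<rho> / (\<rho> + p l)\<^sup>2)"
          by (simp add: distrib_left)
        also have "(1 - cos (l * x)) * (\<rho> / (\<rho> + p l)\<^sup>2) \<le> (l * x) * (\<rho> / (\<rho> + p l)\<^sup>2)"
        proof (rule mult_right_mono)
          have "\<bar>sin (l * x / 2)\<bar> \<le> \<bar>l * x / 2\<bar>" by (rule abs_sin_x_le_abs_x)
          moreover have "(sin (l * x / 2))\<^sup>2 \<le> \<bar>sin (l * x / 2)\<bar>"
            by (metis abs_ge_zero abs_sin_le_one mult_left_le power2_abs power2_eq_square)
          moreover have "cos (l * x) = 1 - 2 * (sin (l * x / 2))\<^sup>2"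
            using cos_double_sin[of "l * x / 2"] by simp
          moreover have "\<bar>l * x / 2\<bar> = l * x / 2" using l x by simp
          ultimately show "1 - cos (l * x) \<le> l * x" by linarith
        qed (use \<rho> in auto)
        finally show ?thesis using l by (simp add: R_def algebra_simps)
      qed simp
    qed auto
    also have "(LBINT l. 1 / (1 + tau\<^sup>2) * ?G l + x * (indicator {0<..} l * R l)) = 1 / (1 + tau\<^sup>2) * (c * x powr \<gamma>) + x * (LBINT l. indicator {0<..} l * R l)"
    proof (subst Bochner_Integration.integral_add)
      show "integrable lborel (\<lambda>l. 1 / (1 + tau\<^sup>2) * ?G l)" "integrable lborel (\<lambda>l. x * (indicator {0<..} l * R l))"
        by (intro integrable_mult_right iG R)+
    qed (simp only: integral_mult_right_zero vG)
    also have "1 / pi * (1 / (1 + tau\<^sup>2) * (c * x powr \<gamma>) + x * (LBINT l. indicator {0<..} l * R l)) = C_const \<gamma> \<beta> * x powr \<gamma> + K * x"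
    proof -
      define E where "E = 1 + tau\<^sup>2"
      have "C_const \<gamma> \<beta> = c / (pi * E)" by (simp add: C_const_def c_def tau_def E_def power_mult_distrib)
      moreover have "0 < E" unfolding E_def by (intro add_pos_nonneg) auto
      ultimately show ?thesis unfolding E_def[symmetric] by (simp add: K_def field_simps)
    qed
    finally show ?thesis .
  qed
  thus ?thesis using K by blast
qed

private lemma A_le: "A x \<le> A 0" and A0_pos: "0 < A 0"
proof -
  show "A x \<le> A 0" unfolding A_def
  proof (rule mult_left_mono[OF integral_mono[OF int_ev int_ev]])
    fix l :: real
    have "cos (l * x) * ev l \<le> cos (l * 0) * ev l" using ev_bounds(1)[of l] by (intro mult_right_mono) auto
    thus "indicator {0<..} l * (cos (l * x) * ev l) \<le> indicator {0<..} l * (cos (l * 0) * ev l)"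
      by (intro mult_left_mono) auto
  qed auto
  show "0 < A 0" using u_dens_diag_pos[of 0] u_AB(1)[of 0 0] B0 by simp
qed

text \<open>
  The bound \<open>\<bar>sin (l x)\<bar> \<le> (l x) powr d\<close> is integrable against
  \<open>od\<close> for every \<open>d < \<gamma>\<close>. The value \<open>d = 3 \<gamma> /
  4\<close> exceeds \<open>\<gamma> / 2\<close>, so the square of the odd part is negligible
  against \<open>x powr \<gamma>\<close>.
\<close>
private lemma B_small: "\<exists>K\<ge>0. \<forall>x>0. \<bar>B x\<bar> \<le> K * x powr (3 * \<gamma> / 4)"
proof -
  define d where "d = 3 * \<gamma> / 4"
  have d: "0 < d" "d < \<gamma>" "d < 1" using g by (auto simp: d_def)
  define Q where "Q l = l powr d * (\<bar>tau\<bar> / (\<rho> + p l))" for l :: real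
  have Q: "integrable lborel (\<lambda>l. indicator {0<..} l * Q l)"
  proof (rule Bochner_Integration.integrable_bound)
    show "integrable lborel (\<lambda>l::real. \<bar>tau\<bar> * (2 / \<rho> + 2) * (1 / (1 + \<bar>l\<bar> powr ((\<gamma> - d) + 1))))"
      by (intro integrable_mult_right integrable_inverse_rho_powr) (use d in auto)
    show "(\<lambda>l. indicator {0<..} l * Q l) \<in> borel_measurable lborel" unfolding Q_def by measurable
    show "AE l in lborel. norm (indicator {0<..} l * Q l) \<le> norm (\<bar>tau\<bar> * (2 / \<rho> + 2) * (1 / (1 + \<bar>l\<bar> powr ((\<gamma> - d) + 1))))"
    proof (rule AE_I2)
      fix l :: real
      show "norm (indicator {0<..} l * Q l) \<le> norm (\<bar>tau\<bar> * (2 / \<rho> + 2) * (1 / (1 + \<bar>l\<bar> powr ((\<gamma> - d) + 1))))"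
      proof (cases "0 < l")
        case l: True
        have r: "0 < \<rho> + p l" using \<rho> p_nonneg[of l] by simp
        have "l powr d / (\<rho> + p l) \<le> (2 / \<rho> + 2) / (1 + l powr ((\<gamma> - d) + 1))"
        proof (cases "l \<le> 1")
          case True
          have "l powr d \<le> 1" using l True d by (simp add: powr_le1)
          hence "l powr d / (\<rho> + p l) \<le> 1 / \<rho>" using \<rho> p_nonneg by (intro frac_le) auto
          also have "\<dots> = (2 / \<rho>) / 2" by simp
          also have "\<dots> \<le> (2 / \<rho> + 2) / (1 + l powr ((\<gamma> - d) + 1))"
            using \<rho> l True d by (intro frac_le) (auto simp: powr_le1 add_pos_nonneg)
          finally show ?thesis .
        next
          case False
          have "l powr d / (\<rho> + p l) \<le> l powr d / p l"
            using l \<rho> by (intro divide_left_mono) (auto simp: p_def intro!: mult_pos_pos add_pos_pos)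
          also have "\<dots> = 1 / l powr ((\<gamma> - d) + 1)"
            using l by (simp add: p_def powr_diff powr_add field_simps)
          also have "\<dots> = 2 / (2 * l powr ((\<gamma> - d) + 1))" by simp
          also have "\<dots> \<le> (2 / \<rho> + 2) / (1 + l powr ((\<gamma> - d) + 1))"
          proof (intro frac_le)
            have "1 \<le> l powr ((\<gamma> - d) + 1)" using False d by (intro ge_one_powr_ge_zero) auto
            thus "1 + l powr ((\<gamma> - d) + 1) \<le> 2 * l powr ((\<gamma> - d) + 1)" by simp
          qed (use \<rho> l in \<open>auto simp: add_pos_nonneg\<close>)
          finally show ?thesis .
        qed
        hence "\<bar>tau\<bar> * (l powr d / (\<rho> + p l)) \<le> \<bar>tau\<bar> * ((2 / \<rho> + 2) / (1 + l powr ((\<gamma> - d) + 1)))"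
          by (rule mult_left_mono) simp
        moreover have "norm (indicator {0<..} l * Q l) = \<bar>tau\<bar> * (l powr d / (\<rho> + p l))"
          using l r by (simp add: Q_def)
        moreover have "norm (\<bar>tau\<bar> * (2 / \<rho> + 2) * (1 / (1 + \<bar>l\<bar> powr ((\<gamma> - d) + 1)))) = \<bar>tau\<bar> * ((2 / \<rho> + 2) / (1 + l powr ((\<gamma> - d) + 1)))"
          using l \<rho> by (simp add: abs_mult abs_of_nonneg)
        ultimately show ?thesis by linarith
      qed simp
    qed
  qed
  define K where "K = 1 / pi * (LBINT l. indicator {0<..} l * Q l)"
  have K: "0 \<le> K" unfolding K_def Q_def using \<rho> p_nonneg
    by (intro mult_nonneg_nonneg integral_nonneg_AE AE_I2) (auto intro!: mult_nonneg_nonneg divide_nonneg_nonneg add_nonneg_nonneg)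
  have "\<bar>B x\<bar> \<le> K * x powr d" if x: "0 < x" for x
  proof -
    have "\<bar>LBINT l. indicator {0<..} l * (sin (l * x) * od l)\<bar> \<le> (LBINT l. norm (indicator {0<..} l * (sin (l * x) * od l)))"
      using integral_norm_bound[of lborel "\<lambda>l. indicator {0<..} l * (sin (l * x) * od l)"] by simp
    also have "\<dots> \<le> (LBINT l. x powr d * (indicator {0<..} l * Q l))"
    proof (intro integral_mono integrable_norm int_od integrable_mult_right Q)
      fix l :: real
      show "norm (indicator {0<..} l * (sin (l * x) * od l)) \<le> x powr d * (indicator {0<..} l * Q l)"
      proof (cases "0 < l")
        case l: True
        have "\<bar>sin (l * x)\<bar> \<le> (l * x) powr d"
        proof (cases "l * x \<le> 1")
          case True
          have "\<bar>sin (l * x)\<bar> \<le> \<bar>l * x\<bar>" by (rule abs_sin_x_le_abs_x)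
          also have "\<dots> = (l * x) powr 1" using l x by simp
          also have "\<dots> \<le> (l * x) powr d" using l x True d by (intro powr_mono') auto
          finally show ?thesis .
        next
          case False
          have "\<bar>sin (l * x)\<bar> \<le> 1" by simp
          also have "1 \<le> (l * x) powr d" using False d by (intro ge_one_powr_ge_zero) auto
          finally show ?thesis .
        qed
        hence "\<bar>sin (l * x)\<bar> * \<bar>od l\<bar> \<le> (l * x) powr d * (\<bar>tau\<bar> / (\<rho> + p l))"
          using od_bound by (intro mult_mono) auto
        thus ?thesis using l by (simp add: Q_def abs_mult powr_mult mult_ac)
      qed simp
    qed
    also have "\<dots> = x powr d * (LBINT l. indicator {0<..} l * Q l)" by simp
    finally have "1 / pi * \<bar>LBINT l. indicator {0<..} l * (sin (l * x) * od l)\<bar> \<le> 1 / pi * (x powr d * (LBINT l. indicator {0<..} l * Q l))"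
      by (rule mult_left_mono) simp
    thus ?thesis by (simp add: B_def K_def abs_mult mult_ac)
  qed
  thus ?thesis using K unfolding d_def by blast
qed

text \<open>
  In terms of the even and the odd part, the left-hand side is \<open>(A 0 - A x) (A 0 + A x) + (B
  x)\<^sup>2\<close>, and \<open>A x \<le> A 0\<close>.
\<close>
lemma kernel_gap_upper:
  assumes \<epsilon>: "0 < \<epsilon>"
  shows "\<exists>d0>0. \<forall>s t. s \<noteq> t \<and> \<bar>s - t\<bar> \<le> d0 \<longrightarrow>
    (u_dens \<rho> \<gamma> \<beta> 0 0)\<^sup>2 - u_dens \<rho> \<gamma> \<beta> s t * u_dens \<rho> \<gamma> \<beta> t s
      \<le> 2 * u_dens \<rho> \<gamma> \<beta> 0 0 * (C_const \<gamma> \<beta> + \<epsilon>) * \<bar>s - t\<bar> powr \<gamma>"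
proof -
  obtain K where K: "0 \<le> K" "\<And>x. 0 < x \<Longrightarrow> A 0 - A x \<le> C_const \<gamma> \<beta> * x powr \<gamma> + K * x" using A_increment by blast
  obtain L where L: "0 \<le> L" "\<And>x. 0 < x \<Longrightarrow> \<bar>B x\<bar> \<le> L * x powr (3 * \<gamma> / 4)" using B_small by blast
  define U where "U = A 0"
  have U: "0 < U" unfolding U_def by (rule A0_pos)
  have u0: "u_dens \<rho> \<gamma> \<beta> 0 0 = U" using u_AB(1)[of 0 0] B0 by (simp add: U_def)
  have "((\<lambda>x. 2 * U * K * x powr (1 - \<gamma>) + L\<^sup>2 * x powr (\<gamma> / 2)) \<longlongrightarrow> 0) (at_right 0)"
  proof -
    have "((\<lambda>x::real. x powr a) \<longlongrightarrow> 0) (at_right 0)" if "0 < a" for a using that by real_asymp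
    thus ?thesis using g by (intro tendsto_add_zero tendsto_mult_right_zero) auto
  qed
  moreover have "0 < 2 * U * \<epsilon>" using U \<epsilon> by simp
  ultimately have "eventually (\<lambda>x. 2 * U * K * x powr (1 - \<gamma>) + L\<^sup>2 * x powr (\<gamma> / 2) < 2 * U * \<epsilon>) (at_right 0)"
    by (rule order_tendstoD(2))
  then obtain d where d: "0 < d" "\<And>x. 0 < x \<Longrightarrow> x < d \<Longrightarrow> 2 * U * K * x powr (1 - \<gamma>) + L\<^sup>2 * x powr (\<gamma> / 2) < 2 * U * \<epsilon>"
    unfolding eventually_at_right_field by auto
  have key: "U\<^sup>2 - (A x + B x) * (A x - B x) \<le> 2 * U * (C_const \<gamma> \<beta> + \<epsilon>) * x powr \<gamma>" if x: "0 < x" "x < d" for x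
  proof -
    have "U\<^sup>2 - (A x + B x) * (A x - B x) = (U - A x) * (U + A x) + (B x)\<^sup>2" by (simp add: algebra_simps power2_eq_square)
    also have "\<dots> \<le> (U - A x) * (2 * U) + (L * x powr (3 * \<gamma> / 4))\<^sup>2"
    proof (intro add_mono mult_left_mono)
      show "(B x)\<^sup>2 \<le> (L * x powr (3 * \<gamma> / 4))\<^sup>2"
        using L(2)[OF x(1)] L(1) by (intro abs_le_square_iff[THEN iffD1]) (simp add: abs_mult)
    qed (use A_le[of x] in \<open>auto simp: U_def\<close>)
    also have "\<dots> \<le> (C_const \<gamma> \<beta> * x powr \<gamma> + K * x) * (2 * U) + (L * x powr (3 * \<gamma> / 4))\<^sup>2"
      using K(2)[OF x(1)] U by (intro add_right_mono mult_right_mono) (auto simp: U_def)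
    also have "\<dots> = 2 * U * C_const \<gamma> \<beta> * x powr \<gamma> + (2 * U * K * x powr (1 - \<gamma>) + L\<^sup>2 * x powr (\<gamma> / 2)) * x powr \<gamma>"
    proof -
      have "x powr (1 - \<gamma>) * x powr \<gamma> = x" using x by (simp flip: powr_add)
      moreover have "(x powr (3 * \<gamma> / 4))\<^sup>2 = x powr (\<gamma> / 2) * x powr \<gamma>"
        unfolding power2_eq_square using x by (simp flip: powr_add)
      ultimately show ?thesis by (simp add: power_mult_distrib algebra_simps)
    qed
    also have "\<dots> \<le> 2 * U * C_const \<gamma> \<beta> * x powr \<gamma> + (2 * U * \<epsilon>) * x powr \<gamma>"
      using d(2)[OF x] by (intro add_left_mono mult_right_mono) auto
    finally show ?thesis by (simp add: algebra_simps)
  qed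
  have "U\<^sup>2 - u_dens \<rho> \<gamma> \<beta> s t * u_dens \<rho> \<gamma> \<beta> t s \<le> 2 * U * (C_const \<gamma> \<beta> + \<epsilon>) * \<bar>s - t\<bar> powr \<gamma>"
    if st: "s \<noteq> t" "\<bar>s - t\<bar> \<le> d / 2" for s t
  proof (cases "t < s")
    case True
    thus ?thesis using key[of "s - t"] u_AB(1)[of s t] u_AB(2)[where x=s and y=t] st d(1) by (simp add: mult.commute)
  next
    case False
    thus ?thesis using key[of "t - s"] u_AB(1)[of t s] u_AB(2)[where x=t and y=s] st d(1)
      by (simp add: mult.commute abs_minus_commute)
  qed
  thus ?thesis unfolding u0 using d(1) by (intro exI[of _ "d / 2"]) auto
qed

text \<open>
  The kernel is \<open>1 / pi\<close> times the real part of the Fourier integral of \<open>1 /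
  w\<close> over the half-line, where \<open>w = \<rho> + psi\<close>. One integration by parts
  gains the factor \<open>1 / \<bar>x - y\<bar>\<close>, because \<open>w' / w\<^sup>2\<close> is
  integrable. This order suffices below, where products of two values of the kernel have to be
  summable along an arithmetic progression.
\<close>
lemma u_dens_decay: "\<exists>K\<ge>0. \<forall>x y. x \<noteq> y \<longrightarrow> \<bar>u_dens \<rho> \<gamma> \<beta> x y\<bar> \<le> K / \<bar>x - y\<bar>"
proof -
  define k where "k = 1 - \<i> * complex_of_real tau"
  \<comment> \<open>On the positive half-line this is \<open>\<rho> + psi l\<close>, and the real
    part of \<open>exp (\<i> l z) / w l\<close> equals \<open>cos (l z) ev l + sin (l z) od
    l\<close>.\<close>
  define w where "w l = of_real \<rho> + of_real (l powr (\<gamma> + 1)) * k" for l :: real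
  define w' where "w' l = of_real ((\<gamma> + 1) * l powr \<gamma>) * k" for l :: real
  have Rw: "Re (w l) = \<rho> + p l" "Im (w l) = - (p l * tau)" if "0 < l" for l
    using that by (simp_all add: w_def k_def p_def)
  have wN: "(cmod (w l))\<^sup>2 = N l" if "0 < l" for l
    using Rw[OF that] by (simp add: cmod_power2 N_def)
  have wge: "\<rho> + p l \<le> cmod (w l)" if "0 < l" for l
    using complex_Re_le_cmod[of "w l"] Rw[OF that] by simp
  have w0: "w l \<noteq> 0" if "0 < l" for l
    using wN[OF that] N_pos[of l] by auto
  have [measurable]: "w \<in> borel_measurable borel" "w' \<in> borel_measurable borel"
    unfolding w_def w'_def by measurable
  have dw: "(w has_vector_derivative w' l) (at l)" if "0 < l" for l
  proof -
    have "((\<lambda>l. l powr (\<gamma> + 1)) has_real_derivative (\<gamma> + 1) * l powr \<gamma>) (at l)"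
      using that by (auto intro!: derivative_eq_intros)
    hence "((\<lambda>l. complex_of_real (l powr (\<gamma> + 1))) has_vector_derivative of_real ((\<gamma> + 1) * l powr \<gamma>)) (at l)"
      by (rule has_vector_derivative_of_real)
    from has_vector_derivative_add[OF has_vector_derivative_const has_vector_derivative_mult_left[OF this, of k], of "of_real \<rho>"]
    show ?thesis unfolding w_def[abs_def] w'_def by simp
  qed
  have int: "integrable lborel (\<lambda>l. indicator {0<..} l *\<^sub>R F l)"
    if [measurable]: "F \<in> borel_measurable borel" and "\<And>l. 0 < l \<Longrightarrow> cmod (F l) \<le> C / (\<rho> + p l)" for F :: "real \<Rightarrow> complex" and C
  proof (rule Bochner_Integration.integrable_bound)
    show "integrable lborel (\<lambda>l. indicator {0<..} l * cmod (F l))"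
      by (rule int_bounded[where B=C]) (use that in auto)
  qed (auto simp: indicator_def)
  define q where "q l = w' l / (w l)\<^sup>2" for l
  have qm [measurable]: "q \<in> borel_measurable borel" unfolding q_def by measurable
  define C where "C = (\<gamma> + 1) * (1 / \<rho> + 1) * cmod k"
  have qb: "cmod (q l) \<le> C / (\<rho> + p l)" if l: "0 < l" for l
  proof -
    have r: "0 < \<rho> + p l" using \<rho> p_nonneg[of l] by simp
    have lg: "l powr \<gamma> / (\<rho> + p l) \<le> 1 / \<rho> + 1"
    proof (cases "l \<le> 1")
      case True
      hence "l powr \<gamma> \<le> 1" using l g by (simp add: powr_le1)
      hence "l powr \<gamma> / (\<rho> + p l) \<le> 1 / \<rho>" using \<rho> p_nonneg by (intro frac_le) auto
      thus ?thesis by simp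
    next
      case False
      have "l powr \<gamma> \<le> p l" using False g l by (auto simp: p_def intro!: powr_mono)
      hence "l powr \<gamma> / (\<rho> + p l) \<le> 1" using \<rho> r by (simp add: divide_le_eq)
      thus ?thesis using \<rho> by (smt (verit) divide_pos_pos)
    qed
    have "cmod (q l) = (\<gamma> + 1) * l powr \<gamma> * cmod k / (cmod (w l))\<^sup>2"
      using g by (simp add: q_def w'_def norm_divide norm_mult norm_power del: of_real_mult)
    also have "\<dots> \<le> (\<gamma> + 1) * l powr \<gamma> * cmod k / (\<rho> + p l)\<^sup>2"
      using wN[OF l] N_ge r g N_pos by (intro divide_left_mono) (auto intro!: mult_nonneg_nonneg)
    also have "\<dots> = (\<gamma> + 1) * (l powr \<gamma> / (\<rho> + p l)) * cmod k / (\<rho> + p l)"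
      by (simp add: power2_eq_square)
    also have "\<dots> \<le> (\<gamma> + 1) * (1 / \<rho> + 1) * cmod k / (\<rho> + p l)"
      using lg r g by (intro divide_right_mono mult_right_mono mult_left_mono) auto
    finally show ?thesis by (simp add: C_def)
  qed
  define J where "J = (LBINT l. indicator {0<..} l * cmod (q l))"
  have J: "0 \<le> J" unfolding J_def by (intro integral_nonneg_AE AE_I2) auto
  have main: "\<bar>u_dens \<rho> \<gamma> \<beta> x y\<bar> \<le> (1 / \<rho> + J) / \<bar>x - y\<bar>" if xy: "x \<noteq> y" for x y
  proof -
    define z where "z = x - y"
    have z: "z \<noteq> 0" using xy by (simp add: z_def)
    define F where "F l = iexp (l * z) / w l" for l
    have cF: "cmod (F l) \<le> 1 / (\<rho> + p l)" if "0 < l" for l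
    proof -
      have r: "0 < \<rho> + p l" using \<rho> p_nonneg[of l] by simp
      have "cmod (F l) = 1 / cmod (w l)" by (simp add: F_def norm_divide)
      also have "\<dots> \<le> 1 / (\<rho> + p l)" using wge[OF that] r by (intro frac_le) auto
      finally show ?thesis .
    qed
    have Fm [measurable]: "F \<in> borel_measurable borel" unfolding F_def by measurable
    have iF: "integrable lborel (\<lambda>l. indicator {0<..} l *\<^sub>R F l)" by (rule int[of F 1, OF Fm]) (rule cF)
    have iq: "integrable lborel (\<lambda>l. indicator {0<..} l *\<^sub>R (iexp (l * z) * q l))"
      by (rule int[where C=C], measurable) (use qb in \<open>simp add: norm_mult\<close>)
    have uF: "u_dens \<rho> \<gamma> \<beta> x y = 1 / pi * Re (CLBINT l. indicator {0<..} l *\<^sub>R F l)"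
    proof -
      have "Re (CLBINT l. indicator {0<..} l *\<^sub>R F l) = (LBINT l. Re (indicator {0<..} l *\<^sub>R F l))"
        by (rule integral_Re[symmetric, OF iF])
      also have "\<dots> = (LBINT l. indicator {0<..} l * (cos (l * z) * ev l) + indicator {0<..} l * (sin (l * z) * od l))"
      proof (rule Bochner_Integration.integral_cong[OF refl])
        fix l :: real
        show "Re (indicator {0<..} l *\<^sub>R F l) = indicator {0<..} l * (cos (l * z) * ev l) + indicator {0<..} l * (sin (l * z) * od l)"
        proof (cases "0 < l")
          case l: True
          have "Re (F l) = (cos (l * z) * Re (w l) + sin (l * z) * Im (w l)) / (cmod (w l))\<^sup>2"
            by (simp add: F_def Re_divide cmod_power2 Re_exp Im_exp)
          thus ?thesis using l by (simp add: wN[OF l] Rw[OF l] ev_def od_def add_divide_distrib diff_divide_distrib distrib_left)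
        qed simp
      qed
      also have "\<dots> = (LBINT l. indicator {0<..} l * (cos (l * z) * ev l)) + (LBINT l. indicator {0<..} l * (sin (l * z) * od l))"
        by (rule Bochner_Integration.integral_add[OF int_ev int_od])
      finally show ?thesis by (simp add: u_eq z_def distrib_left)
    qed
    have dF: "(F has_vector_derivative (\<i> * of_real z * F l - iexp (l * z) * q l)) (at l)" if l: "0 < l" for l
    proof -
      have e: "((\<lambda>l. iexp (l * z)) has_vector_derivative \<i> * of_real z * iexp (l * z)) (at l)"
      proof -
        have "((\<lambda>\<zeta>. exp (\<i> * (\<zeta> * of_real z))) has_field_derivative (\<i> * of_real z * exp (\<i> * (of_real l * of_real z)))) (at (of_real l))"
          by (auto intro!: derivative_eq_intros)
        from has_vector_derivative_real_field[OF this] show ?thesis by simp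
      qed
      have i: "((\<lambda>l. inverse (w l)) has_vector_derivative - q l) (at l)"
      proof -
        have "(inverse has_field_derivative - (inverse (w l) ^ Suc (Suc 0))) (at (w l))"
          by (rule DERIV_inverse[OF w0[OF l]])
        from field_vector_diff_chain_at[OF dw[OF l] this] show ?thesis
          by (simp add: o_def q_def divide_inverse power_inverse power2_eq_square)
      qed
      show ?thesis
        using has_vector_derivative_mult[OF e i] by (simp add: F_def[abs_def] divide_inverse algebra_simps)
    qed
    have FTC: "(CLBINT l=0..\<infinity>. \<i> * of_real z * F l - iexp (l * z) * q l) = 0 - 1 / of_real \<rho>"
    proof (rule interval_integral_FTC_integrable[where F=F])
      show "(F has_vector_derivative (\<i> * of_real z * F l - iexp (l * z) * q l)) (at l)" if "0 < ereal l" for l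
        using dF that by simp
      show "isCont (\<lambda>l. \<i> * of_real z * F l - iexp (l * z) * q l) l" if "0 < ereal l" for l
      proof -
        have l: "0 < l" using that by simp
        have cw: "isCont w l" using dw[OF l] has_vector_derivative_continuous by blast
        have cw': "isCont w' l" unfolding w'_def using l by (auto intro!: continuous_intros)
        show ?thesis unfolding F_def q_def
          using w0[OF l] by (intro continuous_intros cw cw') auto
      qed
      show "set_integrable lborel (einterval 0 \<infinity>) (\<lambda>l. \<i> * of_real z * F l - iexp (l * z) * q l)"
        using Bochner_Integration.integrable_diff[OF integrable_mult_right[OF iF, of "\<i> * of_real z"] iq]
        by (simp add: set_integrable_def zero_ereal_def einterval_eq scaleR_right_diff_distrib)
      show "((F \<circ> real_of_ereal) \<longlongrightarrow> 1 / of_real \<rho>) (at_right 0)"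
      proof -
        have "((\<lambda>l::real. l powr (\<gamma> + 1)) \<longlongrightarrow> 0) (at_right 0)" using g by real_asymp
        hence "((\<lambda>l. complex_of_real (l powr (\<gamma> + 1))) \<longlongrightarrow> of_real 0) (at_right 0)" by (rule tendsto_of_real)
        hence "(w \<longlongrightarrow> of_real \<rho> + of_real 0 * k) (at_right 0)" unfolding w_def by (intro tendsto_add tendsto_mult tendsto_const)
        moreover have "((\<lambda>l. iexp (l * z)) \<longlongrightarrow> iexp (0 * z)) (at_right 0)" by (intro tendsto_intros)
        ultimately have "(F \<longlongrightarrow> iexp (0 * z) / (of_real \<rho> + of_real 0 * k)) (at_right 0)"
          unfolding F_def using \<rho> by (intro tendsto_divide) auto
        thus ?thesis by (simp add: zero_ereal_def ereal_tendsto_simps)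
      qed
      show "((F \<circ> real_of_ereal) \<longlongrightarrow> 0) (at_left \<infinity>)"
      proof -
        have "((\<lambda>l::real. l powr (- (\<gamma> + 1))) \<longlongrightarrow> 0) at_top"
          by (rule tendsto_neg_powr) (use g in \<open>auto intro: filterlim_ident\<close>)
        moreover have "eventually (\<lambda>l. cmod (F l) \<le> l powr (- (\<gamma> + 1))) at_top"
          using eventually_gt_at_top[of 0]
        proof eventually_elim
          case (elim l)
          have "1 / (\<rho> + p l) \<le> 1 / p l" using elim \<rho> by (intro frac_le) (auto simp: p_def)
          thus ?case using cF[OF elim] elim unfolding powr_minus_divide by (simp add: p_def)
        qed
        ultimately have "(F \<longlongrightarrow> 0) at_top" by (rule Lim_null_comparison[rotated])
        thus ?thesis by (simp add: ereal_tendsto_simps)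
      qed
    qed auto
    have eq: "\<i> * of_real z * (CLBINT l. indicator {0<..} l *\<^sub>R F l) = - 1 / of_real \<rho> + (CLBINT l. indicator {0<..} l *\<^sub>R (iexp (l * z) * q l))"
    proof -
      have "(CLBINT l=0..\<infinity>. \<i> * of_real z * F l - iexp (l * z) * q l)
        = (CLBINT l. \<i> * of_real z * (indicator {0<..} l *\<^sub>R F l) - indicator {0<..} l *\<^sub>R (iexp (l * z) * q l))"
        by (simp add: interval_lebesgue_integral_def set_lebesgue_integral_def zero_ereal_def einterval_eq scaleR_right_diff_distrib)
      also have "\<dots> = \<i> * of_real z * (CLBINT l. indicator {0<..} l *\<^sub>R F l) - (CLBINT l. indicator {0<..} l *\<^sub>R (iexp (l * z) * q l))"
        by (subst Bochner_Integration.integral_diff[OF integrable_mult_right[OF iF] iq]) (simp only: integral_mult_right_zero)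
      finally show ?thesis using FTC by (simp add: algebra_simps)
    qed
    have "\<bar>z\<bar> * cmod (CLBINT l. indicator {0<..} l *\<^sub>R F l) = cmod (\<i> * of_real z * (CLBINT l. indicator {0<..} l *\<^sub>R F l))"
      by (simp add: norm_mult)
    also have "\<dots> \<le> cmod (- 1 / of_real \<rho>) + cmod (CLBINT l. indicator {0<..} l *\<^sub>R (iexp (l * z) * q l))"
      unfolding eq by (rule norm_triangle_ineq)
    also have "cmod (- 1 / of_real \<rho>) = 1 / \<rho>" using \<rho> by (simp add: norm_divide)
    also have "cmod (CLBINT l. indicator {0<..} l *\<^sub>R (iexp (l * z) * q l)) \<le> (LBINT l. cmod (indicator {0<..} l *\<^sub>R (iexp (l * z) * q l)))"
      by (rule integral_norm_bound)
    also have "\<dots> = J" unfolding J_def by (rule Bochner_Integration.integral_cong) (auto simp: norm_mult)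
    finally have "\<bar>z\<bar> * cmod (CLBINT l. indicator {0<..} l *\<^sub>R F l) \<le> 1 / \<rho> + J" by simp
    hence "cmod (CLBINT l. indicator {0<..} l *\<^sub>R F l) \<le> (1 / \<rho> + J) / \<bar>z\<bar>"
      using z by (simp add: field_simps)
    moreover have "\<bar>u_dens \<rho> \<gamma> \<beta> x y\<bar> \<le> cmod (CLBINT l. indicator {0<..} l *\<^sub>R F l)"
    proof -
      have "\<bar>u_dens \<rho> \<gamma> \<beta> x y\<bar> = 1 / pi * \<bar>Re (CLBINT l. indicator {0<..} l *\<^sub>R F l)\<bar>" by (simp add: uF abs_mult)
      also have "\<dots> \<le> 1 * cmod (CLBINT l. indicator {0<..} l *\<^sub>R F l)"
        using pi_gt3 by (intro mult_mono abs_Re_le_cmod) auto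
      finally show ?thesis by simp
    qed
    ultimately show ?thesis by (simp add: z_def)
  qed
  show ?thesis using main J \<rho> by (intro exI[of _ "1 / \<rho> + J"]) auto
qed

end

section \<open>Chaining\<close>

text \<open>
  Follow the dyadic approximations of \<open>t\<close> from below. Consecutive ones agree or are
  neighbours in the finer grid, and they converge to \<open>t\<close>; only the levels after
  \<open>m0\<close> are used.
\<close>
lemma dyadic_chain:
  fixes v :: "real \<Rightarrow> real"
  assumes L: "0 < L" and cont: "continuous_on {b..b + L} v"
    and step: "\<And>m j. m0 < m \<Longrightarrow> j < 2 ^ m \<Longrightarrow> \<bar>v (b + L * real (Suc j) / 2 ^ m) - v (b + L * real j / 2 ^ m)\<bar> \<le> r m"
    and r: "summable (\<lambda>m. r (m + Suc m0))" "\<And>m. 0 \<le> r m"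
    and t: "t \<in> {b..b + L}"
  obtains j :: nat where "j \<le> 2 ^ m0" "b + L * real j / 2 ^ m0 \<le> t" "t < b + L * real (Suc j) / 2 ^ m0"
    "\<bar>v t - v (b + L * real j / 2 ^ m0)\<bar> \<le> (\<Sum>m. r (m + Suc m0))"
proof -
  define J where "J m = nat \<lfloor>(t - b) / L * 2 ^ m\<rfloor>" for m
  define p where "p m = b + L * real (J m) / 2 ^ m" for m
  have z: "0 \<le> (t - b) / L" "(t - b) / L \<le> 1" using t L by (auto simp: field_simps)
  have J1: "real (J m) \<le> (t - b) / L * 2 ^ m" "(t - b) / L * 2 ^ m < real (J m) + 1" for m
  proof -
    have "0 \<le> (t - b) / L * 2 ^ m" using z by (intro mult_nonneg_nonneg) auto
    hence "real (J m) = of_int \<lfloor>(t - b) / L * 2 ^ m\<rfloor>" unfolding J_def by (subst of_nat_nat) auto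
    thus "real (J m) \<le> (t - b) / L * 2 ^ m" "(t - b) / L * 2 ^ m < real (J m) + 1" by linarith+
  qed
  have Jle: "J m \<le> 2 ^ m" for m
  proof -
    have "real (J m) \<le> 1 * 2 ^ m" using J1(1)[of m] z by (meson mult_right_mono order_trans zero_le_numeral zero_le_power)
    hence "real (J m) \<le> real (2 ^ m)" by simp
    thus ?thesis by (simp only: of_nat_le_iff)
  qed
  have pt: "p m \<le> t" "t < b + L * real (Suc (J m)) / 2 ^ m" for m
  proof -
    have "L * real (J m) \<le> L * ((t - b) / L * 2 ^ m)" "L * ((t - b) / L * 2 ^ m) < L * (real (J m) + 1)"
      by (rule mult_left_mono[OF J1(1) less_imp_le[OF L]], rule mult_strict_left_mono[OF J1(2) L])
    hence "L * real (J m) \<le> (t - b) * 2 ^ m" "(t - b) * 2 ^ m < L * real (Suc (J m))" using L by (auto simp: add.commute)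
    hence "L * real (J m) / 2 ^ m \<le> t - b" "t - b < L * real (Suc (J m)) / 2 ^ m"
      by (auto simp: pos_divide_le_eq pos_less_divide_eq)
    thus "p m \<le> t" "t < b + L * real (Suc (J m)) / 2 ^ m" by (auto simp: p_def)
  qed
  have pin: "p m \<in> {b..b + L}" for m using pt(1)[of m] t L by (auto simp: p_def)
  have plim: "p \<longlonglongrightarrow> t"
  proof (rule tendsto_sandwich)
    show "(\<lambda>m. t - L / 2 ^ m) \<longlonglongrightarrow> t"
    proof -
      have "(\<lambda>m. t - L * (1/2) ^ m) \<longlonglongrightarrow> t - L * 0"
        by (intro tendsto_intros LIMSEQ_power_zero) auto
      thus ?thesis by (simp add: power_divide)
    qed
    show "eventually (\<lambda>m. t - L / 2 ^ m \<le> p m) sequentially"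
    proof (intro always_eventually allI)
      fix m
      have "b + L * real (Suc (J m)) / 2 ^ m = p m + L / 2 ^ m" by (simp add: p_def distrib_left add_divide_distrib)
      thus "t - L / 2 ^ m \<le> p m" using pt(2)[of m] by linarith
    qed
  qed (use pt(1) in auto)
  have Jstep: "J (Suc m) = 2 * J m \<or> J (Suc m) = Suc (2 * J m)" for m
  proof -
    have "(t - b) / L * 2 ^ Suc m = 2 * ((t - b) / L * 2 ^ m)" by simp
    hence "2 * real (J m) < real (J (Suc m)) + 1" "real (J (Suc m)) < 2 * real (J m) + 2"
      using J1[of m] J1[of "Suc m"] by linarith+
    thus ?thesis by linarith
  qed
  have st: "\<bar>v (p (Suc m)) - v (p m)\<bar> \<le> r (Suc m)" if "m0 \<le> m" for m
  proof -
    have pm: "p m = b + L * real (2 * J m) / 2 ^ Suc m" by (simp add: p_def)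
    from Jstep[of m] show ?thesis
    proof
      assume "J (Suc m) = 2 * J m"
      hence "p (Suc m) = p m" unfolding pm by (simp only: p_def)
      thus ?thesis using r(2) by simp
    next
      assume e: "J (Suc m) = Suc (2 * J m)"
      hence "2 * J m < 2 ^ Suc m" using Jle[of "Suc m"] by simp
      from step[OF _ this] that show ?thesis unfolding pm by (simp only: p_def e)
    qed
  qed
  have sum: "\<bar>v (p (n + m0)) - v (p m0)\<bar> \<le> (\<Sum>m<n. r (m + Suc m0))" for n
  proof (induction n)
    case (Suc n)
    have "\<bar>v (p (Suc n + m0)) - v (p (n + m0))\<bar> \<le> r (n + Suc m0)" using st[of "n + m0"] by simp
    thus ?case using Suc by simp
  qed simp
  have "(\<lambda>n. \<bar>v (p (n + m0)) - v (p m0)\<bar>) \<longlonglongrightarrow> \<bar>v t - v (p m0)\<bar>"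
  proof (intro tendsto_intros)
    have "(\<lambda>n. p (n + m0)) \<longlonglongrightarrow> t" using plim by (rule LIMSEQ_ignore_initial_segment)
    thus "(\<lambda>n. v (p (n + m0))) \<longlonglongrightarrow> v t"
      by (rule continuous_on_tendsto_compose[OF cont _ t]) (intro always_eventually allI pin)
  qed
  hence "\<bar>v t - v (p m0)\<bar> \<le> (\<Sum>m. r (m + Suc m0))"
  proof (rule LIMSEQ_le_const2)
    have "(\<Sum>m<n. r (m + Suc m0)) \<le> (\<Sum>m. r (m + Suc m0))" for n
      by (rule sum_le_suminf[OF r(1)]) (use r(2) in auto)
    thus "\<exists>N. \<forall>n\<ge>N. \<bar>v (p (n + m0)) - v (p m0)\<bar> \<le> (\<Sum>m. r (m + Suc m0))"
      using sum order_trans by blast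
  qed
  thus thesis using that[of "J m0"] Jle pt[of m0] unfolding p_def by blast
qed

text \<open>
  Increments as for a Gaussian process with variance \<open>a \<bar>s - t\<bar> powr \<gamma> /
  2\<close>, up to the constant \<open>K\<close>. In the application \<open>V\<close> is the
  square root of the permanental process.
\<close>
locale exp_square_increments = prob_space M for M :: "'a measure" +
  fixes V :: "real \<Rightarrow> 'a \<Rightarrow> real" and a \<gamma> K d0 :: real
  assumes V_meas: "\<And>t. 0 \<le> t \<Longrightarrow> V t \<in> borel_measurable M"
    and V_cont: "\<And>\<omega>. \<omega> \<in> space M \<Longrightarrow> continuous_on {0..} (\<lambda>t. V t \<omega>)"
    and a_pos: "0 < a" and g_pos: "0 < \<gamma>" and d0_pos: "0 < d0" and K_pos: "0 < K"
    and tail: "\<And>s t x. 0 \<le> s \<Longrightarrow> 0 \<le> t \<Longrightarrow> s \<noteq> t \<Longrightarrow> \<bar>s - t\<bar> \<le> d0 \<Longrightarrow> 0 \<le> x \<Longrightarrow>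
      prob {\<omega> \<in> space M. x < (V s \<omega> - V t \<omega>)\<^sup>2} \<le> K * exp (- (x / (a * \<bar>s - t\<bar> powr \<gamma>)))"
begin

text \<open>
  The size of the increments at level \<open>m\<close> of the dyadic grid relative to that of the
  whole interval. The polynomial factor pays for the union bound over the \<open>2 ^ m\<close>
  increments of this level.
\<close>
definition level_weight :: "nat \<Rightarrow> real" where
  "level_weight m = 2 * (real (Suc m) * (2 powr (- (\<gamma> / 2))) ^ m)"

lemma level_weight_nonneg: "0 \<le> level_weight m" by (simp add: level_weight_def)

lemma summable_level_weight: "summable level_weight"
proof -
  have "2 powr (- (\<gamma> / 2)) < 2 powr 0" using g_pos by (intro powr_less_mono) auto
  hence "norm (2 powr (- (\<gamma> / 2))) < 1" by simp
  from geometric_deriv_sums[OF this] have "summable (\<lambda>n. real (Suc n) * (2 powr (- (\<gamma> / 2))) ^ n)"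
    by (simp add: sums_iff)
  thus ?thesis unfolding level_weight_def[abs_def] by (rule summable_mult)
qed

definition chain_const :: "nat \<Rightarrow> real" where
  "chain_const m0 = sqrt a * (\<Sum>m. level_weight (m + Suc m0))"

lemma chain_const_nonneg: "0 \<le> chain_const m0"
  unfolding chain_const_def using a_pos
  by (intro mult_nonneg_nonneg suminf_nonneg summable_ignore_initial_segment summable_level_weight level_weight_nonneg) auto

lemma chain_const_small: assumes "0 < \<epsilon>" obtains m0 where "chain_const m0 \<le> \<epsilon>"
proof -
  have "chain_const \<longlonglongrightarrow> sqrt a * 0"
    unfolding chain_const_def
  proof (intro tendsto_intros)
    have "(\<lambda>n. \<Sum>m. level_weight (m + n)) \<longlonglongrightarrow> 0" by (rule suminf_exist_split2[OF summable_level_weight])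
    thus "(\<lambda>m0. \<Sum>m. level_weight (m + Suc m0)) \<longlonglongrightarrow> 0" by (rule LIMSEQ_Suc)
  qed
  hence "eventually (\<lambda>m. chain_const m < \<epsilon>) sequentially" using assms by (intro order_tendstoD(2)) auto
  thus thesis using that by (auto simp: eventually_sequentially intro: less_imp_le)
qed

text \<open>
  The exceptional set contains the paths with a dyadic increment of level \<open>m\<close>
  exceeding a threshold with tail probability \<open>K exp (- y) / 4 ^ m\<close>; there are
  \<open>2 ^ m\<close> increments of this level, so the total is at most \<open>K exp (-
  y)\<close>. Starting at a high level \<open>m0\<close> makes \<open>chain_const m0\<close>
  small: chaining then contributes only an error term, and the sharp constants come from the
  finitely many points of level \<open>m0\<close>.
\<close>
lemma chaining:
  assumes b: "0 \<le> b" and L: "0 < L" "L \<le> d0" and y: "0 \<le> y"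
  obtains E where "E \<in> sets M" "prob E \<le> K * exp (- y)"
    "\<And>\<omega> t. \<omega> \<in> space M - E \<Longrightarrow> t \<in> {b..b + L} \<Longrightarrow>
      \<exists>j\<le>2 ^ m0. b + L * real j / 2 ^ m0 \<le> t \<and> t < b + L * real (Suc j) / 2 ^ m0 \<and>
        \<bar>V t \<omega> - V (b + L * real j / 2 ^ m0) \<omega>\<bar> \<le> chain_const m0 * L powr (\<gamma> / 2) * (sqrt y + 1)"
proof -
  \<comment> \<open>The threshold for squared increments of level \<open>m\<close>; the summand
    \<open>2 m ln 2\<close> produces the factor \<open>1 / 4 ^ m\<close>.\<close>
  define x where "x m = a * (L / 2 ^ m) powr \<gamma> * (y + 2 * real m * ln 2)" for m :: nat
  define F where "F m j = {\<omega> \<in> space M. x m < (V (b + L * real (Suc j) / 2 ^ m) \<omega> - V (b + L * real j / 2 ^ m) \<omega>)\<^sup>2}" for m j :: nat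
  define E where "E = (\<Union>m. \<Union>j\<in>{..<2 ^ Suc m}. F (Suc m) j)"
  have x0: "0 \<le> x m" for m using a_pos y by (auto simp: x_def intro!: mult_nonneg_nonneg add_nonneg_nonneg)
  have gp: "0 \<le> b + L * real j / 2 ^ m" for j m using b L by simp
  have [measurable]: "F m j \<in> sets M" for m j
    unfolding F_def using V_meas[OF gp] by measurable
  have Em: "E \<in> sets M" unfolding E_def by measurable
  have pF: "prob (F m j) \<le> K * exp (- y) * (1 / 4) ^ m" for m j
  proof -
    have d: "(b + L * real (Suc j) / 2 ^ m) - (b + L * real j / 2 ^ m) = L / 2 ^ m"
      by (simp add: distrib_left add_divide_distrib)
    have d': "0 < L / 2 ^ m" "L / 2 ^ m \<le> d0"
    proof -
      have "L / 2 ^ m \<le> L / 1" using L by (intro divide_left_mono) auto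
      thus "L / 2 ^ m \<le> d0" using L by simp
    qed (use L in simp)
    have "prob (F m j) \<le> K * exp (- (x m / (a * \<bar>(b + L * real (Suc j) / 2 ^ m) - (b + L * real j / 2 ^ m)\<bar> powr \<gamma>)))"
      unfolding F_def
    proof (rule tail[OF gp gp _ _ x0])
      show "b + L * real (Suc j) / 2 ^ m \<noteq> b + L * real j / 2 ^ m" using d d'(1) by linarith
      show "\<bar>(b + L * real (Suc j) / 2 ^ m) - (b + L * real j / 2 ^ m)\<bar> \<le> d0" unfolding d using d' by simp
    qed
    also have "\<dots> = K * exp (- (x m / (a * (L / 2 ^ m) powr \<gamma>)))" unfolding d using d'(1) L by simp
    also have "x m / (a * (L / 2 ^ m) powr \<gamma>) = y + real m * (2 * ln 2)" using a_pos L by (simp add: x_def)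
    also have "exp (- (y + real m * (2 * ln 2))) = exp (- y) * (1 / 4) ^ m"
    proof -
      have e: "exp (- (2 * ln 2)) = (1 / 4 :: real)"
      proof -
        have "- (2 * ln 2) = - ln 2 + - ln (2::real)" by simp
        hence "exp (- (2 * ln 2)) = exp (- ln 2) * exp (- ln (2::real))" by (simp only: exp_add)
        thus ?thesis by (simp add: exp_minus)
      qed
      have "exp (- (y + real m * (2 * ln 2))) = exp (- y) * exp (real m * (- (2 * ln 2)))" by (simp flip: exp_add)
      also have "exp (real m * (- (2 * ln 2))) = (1 / 4) ^ m" unfolding exp_of_nat_mult e ..
      finally show ?thesis .
    qed
    finally show ?thesis by simp
  qed
  have pU: "prob (\<Union>j\<in>{..<2 ^ Suc m}. F (Suc m) j) \<le> K * exp (- y) * (1 / 2) ^ Suc m" for m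
  proof -
    have "prob (\<Union>j\<in>{..<2 ^ Suc m}. F (Suc m) j) \<le> (\<Sum>j<2 ^ Suc m. prob (F (Suc m) j))"
      by (rule finite_measure_subadditive_finite) auto
    also have "\<dots> \<le> (\<Sum>j<(2::nat) ^ Suc m. K * exp (- y) * (1 / 4) ^ Suc m)" by (intro sum_mono pF)
    also have "\<dots> = K * exp (- y) * (2 ^ Suc m * (1 / 4) ^ Suc m)" by simp
    also have "2 ^ Suc m * (1 / 4) ^ Suc m = (1 / 2 :: real) ^ Suc m" unfolding power_mult_distrib[symmetric] by simp
    finally show ?thesis .
  qed
  have hs: "(\<lambda>m. K * exp (- y) * (1 / 2) ^ Suc m) sums (K * exp (- y))"
    using sums_mult[OF power_half_series, of "K * exp (- y)"] by simp
  have pE: "prob E \<le> K * exp (- y)"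
  proof -
    have sm: "summable (\<lambda>m. prob (\<Union>j\<in>{..<2 ^ Suc m}. F (Suc m) j))"
      by (rule summable_comparison_test'[OF sums_summable[OF hs], of 0]) (use pU in auto)
    have "prob E \<le> (\<Sum>m. prob (\<Union>j\<in>{..<2 ^ Suc m}. F (Suc m) j))"
      unfolding E_def by (rule finite_measure_subadditive_countably[OF _ sm]) auto
    also have "\<dots> \<le> (\<Sum>m. K * exp (- y) * (1 / 2) ^ Suc m)"
      by (rule suminf_le[OF pU sm sums_summable[OF hs]])
    also have "\<dots> = K * exp (- y)" using hs by (simp add: sums_iff)
    finally show ?thesis .
  qed
  define c where "c = sqrt a * L powr (\<gamma> / 2) * (sqrt y + 1)"
  have c0: "0 \<le> c" using a_pos y by (simp add: c_def)
  have sx: "sqrt (x m) \<le> c * level_weight m" for m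
  proof -
    have "sqrt (y + 2 * real m * ln 2) \<le> sqrt y + sqrt (2 * real m * ln 2)"
      using y by (intro sqrt_add_le_add_sqrt) auto
    also have "sqrt (2 * real m * ln 2) \<le> 2 * real m + 1"
    proof -
      have "2 * real m * ln 2 \<le> 2 * real m * 1" using ln_2_less_1 by (intro mult_left_mono) auto
      also have "\<dots> \<le> (2 * real m + 1)\<^sup>2" by (simp add: power2_eq_square algebra_simps)
      finally show ?thesis by (intro real_le_lsqrt) auto
    qed
    also have "sqrt y + (2 * real m + 1) \<le> (sqrt y + 1) * (2 * real (Suc m))" using y by (simp add: algebra_simps)
    finally have s1: "sqrt (y + 2 * real m * ln 2) \<le> (sqrt y + 1) * (2 * real (Suc m))" by simp
    have s2: "sqrt ((L / 2 ^ m) powr \<gamma>) = L powr (\<gamma> / 2) * (2 powr (- (\<gamma> / 2))) ^ m"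
    proof -
      have "sqrt ((L / 2 ^ m) powr \<gamma>) = (L / 2 ^ m) powr (\<gamma> / 2)"
        using L by (intro real_sqrt_unique) (auto simp: power2_eq_square simp flip: powr_add)
      also have "\<dots> = L powr (\<gamma> / 2) * (1 / 2 ^ m) powr (\<gamma> / 2)"
        using powr_mult[of L "1 / 2 ^ m" "\<gamma> / 2"] by simp
      also have "(1 / 2 ^ m) powr (\<gamma> / 2) = (2 powr (- (\<gamma> / 2))) ^ m"
      proof -
        have "(1 / 2 ^ m :: real) = 2 powr (- real m)" by (simp add: powr_minus powr_realpow divide_inverse)
        moreover have "(2 powr (- (\<gamma> / 2))) ^ m = (2 powr (- (\<gamma> / 2))) powr real m" by (simp add: powr_realpow)
        ultimately show ?thesis by (simp add: powr_powr mult.commute)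
      qed
      finally show ?thesis .
    qed
    have "sqrt (x m) = sqrt a * (L powr (\<gamma> / 2) * (2 powr (- (\<gamma> / 2))) ^ m) * sqrt (y + 2 * real m * ln 2)"
      by (simp add: x_def real_sqrt_mult s2)
    also have "\<dots> \<le> sqrt a * (L powr (\<gamma> / 2) * (2 powr (- (\<gamma> / 2))) ^ m) * ((sqrt y + 1) * (2 * real (Suc m)))"
      using s1 a_pos by (intro mult_left_mono) auto
    also have "\<dots> = c * level_weight m" by (simp add: c_def level_weight_def mult_ac)
    finally show ?thesis .
  qed
  show thesis
  proof (rule that[OF Em pE])
    fix \<omega> t assume w: "\<omega> \<in> space M - E" and t: "t \<in> {b..b + L}"
    have step: "\<bar>V (b + L * real (Suc j) / 2 ^ m) \<omega> - V (b + L * real j / 2 ^ m) \<omega>\<bar> \<le> c * level_weight m"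
      if m: "m0 < m" and j: "j < 2 ^ m" for m j
    proof -
      obtain m' where m': "m = Suc m'" using m by (cases m) auto
      have "\<omega> \<notin> F m j" using w j unfolding E_def m' by blast
      hence "(V (b + L * real (Suc j) / 2 ^ m) \<omega> - V (b + L * real j / 2 ^ m) \<omega>)\<^sup>2 \<le> x m"
        using w by (auto simp: F_def)
      hence "\<bar>V (b + L * real (Suc j) / 2 ^ m) \<omega> - V (b + L * real j / 2 ^ m) \<omega>\<bar> \<le> sqrt (x m)"
        by (metis real_sqrt_abs real_sqrt_le_mono)
      thus ?thesis using sx[of m] by linarith
    qed
    have sm: "summable (\<lambda>m. c * level_weight (m + Suc m0))"
      by (intro summable_mult summable_ignore_initial_segment summable_level_weight)
    have ct: "continuous_on {b..b + L} (\<lambda>t. V t \<omega>)"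
      by (rule continuous_on_subset[OF V_cont]) (use w b in auto)
    obtain j where j: "j \<le> 2 ^ m0" "b + L * real j / 2 ^ m0 \<le> t" "t < b + L * real (Suc j) / 2 ^ m0"
      "\<bar>V t \<omega> - V (b + L * real j / 2 ^ m0) \<omega>\<bar> \<le> (\<Sum>m. c * level_weight (m + Suc m0))"
      by (rule dyadic_chain[OF L(1) ct step sm _ t]) (use c0 level_weight_nonneg in auto)
    have "(\<Sum>m. c * level_weight (m + Suc m0)) = c * (\<Sum>m. level_weight (m + Suc m0))"
      by (intro suminf_mult summable_ignore_initial_segment summable_level_weight)
    also have "\<dots> = chain_const m0 * L powr (\<gamma> / 2) * (sqrt y + 1)" by (simp add: c_def chain_const_def mult_ac)
    finally show "\<exists>j\<le>2 ^ m0. b + L * real j / 2 ^ m0 \<le> t \<and> t < b + L * real (Suc j) / 2 ^ m0 \<and>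
        \<bar>V t \<omega> - V (b + L * real j / 2 ^ m0) \<omega>\<bar> \<le> chain_const m0 * L powr (\<gamma> / 2) * (sqrt y + 1)"
      using j by auto
  qed
qed

end

section \<open>Moduli of continuity and growth from increment tails\<close>

lemma powr_half_eq_sqrt: "0 \<le> h \<Longrightarrow> h powr (g / 2) = sqrt (h powr g)" for h g :: real
  by (simp add: powr_powr flip: powr_half_sqrt)

lemma sqrt_double_plus_one_le:
  fixes z :: real assumes "1 / 2 \<le> z" shows "sqrt (2 * z) + 1 \<le> 4 * sqrt z"
proof -
  have "1 \<le> sqrt (2 * z)" using assms by simp
  moreover have "sqrt (2 * z) = sqrt 2 * sqrt z" by (rule real_sqrt_mult)
  moreover have "sqrt 2 * sqrt z \<le> 2 * sqrt z" using assms sqrt2_less_2 by (intro mult_right_mono) auto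
  ultimately show ?thesis by linarith
qed

lemma sqrt_le_scaled:
  fixes x y \<delta> :: real assumes "0 \<le> \<delta>" "0 \<le> y" "x \<le> (1 + \<delta>) * y"
  shows "sqrt x \<le> (1 + \<delta>) * sqrt y"
proof -
  have "(1 + \<delta>) * y \<le> (1 + \<delta>)\<^sup>2 * y"
    using assms by (intro mult_right_mono) (simp_all add: power2_eq_square algebra_simps)
  hence "x \<le> (1 + \<delta>)\<^sup>2 * y" using assms(3) by linarith
  hence "sqrt x \<le> sqrt ((1 + \<delta>)\<^sup>2 * y)" by (rule real_sqrt_le_mono)
  thus ?thesis using assms by (simp add: real_sqrt_mult)
qed

text \<open>
  Places \<open>h\<close> between consecutive terms of a geometric sequence, which reduces
  statements on all small \<open>h\<close> to a sequence of events.
\<close>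
lemma geometric_bracket:
  fixes h \<theta> :: real
  assumes "0 < \<theta>" "\<theta> < 1" "0 < h" "h \<le> \<theta> ^ n2"
  obtains n where "n2 \<le> n" "\<theta> ^ Suc n < h" "h \<le> \<theta> ^ n"
proof -
  have ex: "\<exists>m. \<theta> ^ Suc m < h"
  proof -
    obtain m where "\<theta> ^ m < h" using real_arch_pow_inv[OF assms(3,2)] by blast
    moreover have "\<theta> ^ Suc m \<le> \<theta> ^ m" using assms by (intro power_decreasing) auto
    ultimately show ?thesis by (intro exI[of _ m]) linarith
  qed
  define n where "n = (LEAST m. \<theta> ^ Suc m < h)"
  have n: "\<theta> ^ Suc n < h" unfolding n_def by (rule LeastI_ex[OF ex])
  have "n2 \<le> n"
  proof (rule ccontr)
    assume "\<not> n2 \<le> n"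
    hence "\<theta> ^ n2 \<le> \<theta> ^ Suc n" using assms by (intro power_decreasing) auto
    thus False using n assms by linarith
  qed
  moreover have "h \<le> \<theta> ^ n"
  proof (cases "n2 = n")
    case False
    hence "n - 1 < n" "Suc (n - 1) = n" using \<open>n2 \<le> n\<close> by auto
    from not_less_Least[OF this(1)[unfolded n_def]] have "\<not> \<theta> ^ Suc (n - 1) < h" by (simp add: n_def)
    thus ?thesis using \<open>Suc (n - 1) = n\<close> by simp
  qed (use assms in simp)
  ultimately show thesis using that n by blast
qed

context exp_square_increments
begin

lemma increment_tail_at:
  assumes "0 \<le> s" "0 \<le> t" "s \<noteq> t" "\<bar>s - t\<bar> \<le> d" "d \<le> d0" "0 \<le> z"
  shows "prob {\<omega> \<in> space M. a * d powr \<gamma> * z < (V s \<omega> - V t \<omega>)\<^sup>2} \<le> K * exp (- z)"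
proof -
  have st: "0 < \<bar>s - t\<bar>" using assms by simp
  have "prob {\<omega> \<in> space M. a * d powr \<gamma> * z < (V s \<omega> - V t \<omega>)\<^sup>2} \<le> K * exp (- (a * d powr \<gamma> * z / (a * \<bar>s - t\<bar> powr \<gamma>)))"
    by (rule tail) (use assms a_pos in auto)
  also have "\<dots> \<le> K * exp (- z)"
  proof -
    have "\<bar>s - t\<bar> powr \<gamma> \<le> d powr \<gamma>" using assms g_pos by (intro powr_mono2) auto
    hence "a * \<bar>s - t\<bar> powr \<gamma> * z \<le> a * d powr \<gamma> * z" using a_pos assms by (intro mult_right_mono mult_left_mono) auto
    hence "z * (a * \<bar>s - t\<bar> powr \<gamma>) \<le> a * d powr \<gamma> * z" by (simp add: mult_ac)
    moreover have p: "0 < a * \<bar>s - t\<bar> powr \<gamma>" using a_pos st by simp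
    ultimately have "z \<le> a * d powr \<gamma> * z / (a * \<bar>s - t\<bar> powr \<gamma>)" unfolding pos_le_divide_eq[OF p] by simp
    thus ?thesis using K_pos by simp
  qed
  finally show ?thesis .
qed

lemma meas_increment_event:
  assumes "0 \<le> s" "0 \<le> t"
  shows "{\<omega> \<in> space M. x < (V s \<omega> - V t \<omega>)\<^sup>2} \<in> sets M"
  using V_meas[OF assms(1)] V_meas[OF assms(2)] by measurable

lemma AE_eventually_of_summable:
  assumes "\<And>n. n0 \<le> n \<Longrightarrow> A n \<in> sets M" "\<And>n. n0 \<le> n \<Longrightarrow> prob (A n) \<le> f n" "summable f"
  shows "AE \<omega> in M. eventually (\<lambda>n. \<omega> \<in> space M - A n) sequentially"
proof -
  define B where "B n = (if n0 \<le> n then A n else {})" for n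
  have "AE \<omega> in M. eventually (\<lambda>n. \<omega> \<in> space M - B n) sequentially"
  proof (rule borel_cantelli_AE1)
    show "summable (\<lambda>n. prob (B n))"
      by (rule summable_comparison_test'[OF assms(3), of n0]) (use assms in \<open>auto simp: B_def\<close>)
  qed (use assms in \<open>auto simp: B_def emeasure_eq_measure\<close>)
  thus ?thesis
  proof eventually_elim
    case (elim \<omega>)
    show ?case using elim eventually_ge_at_top[of n0] by eventually_elim (auto simp: B_def)
  qed
qed

text \<open>
  Along \<open>h = \<theta> ^ n\<close> the iterated logarithm of \<open>1 / h\<close> is about
  \<open>ln n\<close>. Exceeding \<open>a (1 + \<delta>) (\<theta> ^ n) powr \<gamma> ln n\<close>
  at a given grid point has probability of order \<open>n powr (- (1 + \<delta>))\<close>, which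
  is summable. The grid in \<open>{0..\<theta> ^ n}\<close> has a fixed number \<open>2 ^
  m0\<close> of points, and chaining with \<open>y = 2 ln n\<close> covers the points in between.
\<close>
lemma local_modulus:
  assumes c: "sqrt a < c"
  shows "AE \<omega> in M. \<exists>h0>0. \<forall>h. 0 < h \<and> h < h0 \<longrightarrow>
    (\<forall>t\<in>{0..h}. \<bar>V t \<omega> - V 0 \<omega>\<bar> \<le> c * sqrt (h powr \<gamma> * ln (ln (1 / h))))"
proof -
  have sa: "0 < sqrt a" using a_pos by simp
  have "((\<lambda>\<delta>. sqrt a * (1 + \<delta>)\<^sup>2 * (1 + 5 * \<delta>)) \<longlongrightarrow> sqrt a * (1 + 0)\<^sup>2 * (1 + 5 * 0)) (at_right 0)"
    by (intro tendsto_intros)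
  hence "eventually (\<lambda>\<delta>. sqrt a * (1 + \<delta>)\<^sup>2 * (1 + 5 * \<delta>) < c) (at_right 0)"
    using c by (intro order_tendstoD(2)) auto
  moreover have "eventually (\<lambda>\<delta>::real. 0 < \<delta>) (at_right 0)" by (simp add: eventually_at_right_less)
  ultimately obtain \<delta> where \<delta>: "0 < \<delta>" "sqrt a * (1 + \<delta>)\<^sup>2 * (1 + 5 * \<delta>) < c"
    using eventually_happens[OF eventually_conj, of _ "at_right (0::real)"] trivial_limit_at_right_real by blast
  \<comment> \<open>This ratio makes \<open>h powr (\<gamma> / 2)\<close> vary by the factor
    \<open>1 + \<delta>\<close> between consecutive scales.\<close>
  define \<theta> where "\<theta> = (1 + \<delta>) powr (- (2 / \<gamma>))"
  have th0: "0 < \<theta>" using \<delta> by (simp add: \<theta>_def)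
  have th1: "\<theta> < 1" using \<delta> g_pos powr_less_mono[of "- (2 / \<gamma>)" 0 "1 + \<delta>"] by (simp add: \<theta>_def)
  have thg: "\<theta> powr (\<gamma> / 2) = 1 / (1 + \<delta>)"
  proof -
    have "\<theta> powr (\<gamma> / 2) = (1 + \<delta>) powr (- (2 / \<gamma>) * (\<gamma> / 2))" unfolding \<theta>_def by (rule powr_powr)
    also have "- (2 / \<gamma>) * (\<gamma> / 2) = - 1" using g_pos by simp
    finally show ?thesis using \<delta> by (simp add: powr_minus_divide)
  qed
  obtain m0 where m0: "chain_const m0 \<le> sqrt a * \<delta>" using chain_const_small[of "sqrt a * \<delta>"] sa \<delta> by auto
  have "eventually (\<lambda>n. \<theta> ^ n < d0) sequentially"
    using th0 th1 d0_pos by (intro order_tendstoD(2)[OF LIMSEQ_power_zero]) auto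
  then obtain n0' where n0': "\<And>n. n0' \<le> n \<Longrightarrow> \<theta> ^ n < d0" by (auto simp: eventually_sequentially)
  define n0 where "n0 = max 1 n0'"
  have n0: "1 \<le> n" "\<theta> ^ n \<le> d0" if "n0 \<le> n" for n
    using that n0'[of n] by (auto simp: n0_def)
  have "\<exists>E. n0 \<le> n \<longrightarrow> E \<in> sets M \<and> prob E \<le> K * exp (- (2 * ln (real n))) \<and>
      (\<forall>\<omega>\<in>space M - E. \<forall>t\<in>{0..0 + \<theta> ^ n}. \<exists>j\<le>2 ^ m0. 0 + \<theta> ^ n * real j / 2 ^ m0 \<le> t \<and> t < 0 + \<theta> ^ n * real (Suc j) / 2 ^ m0 \<and>
        \<bar>V t \<omega> - V (0 + \<theta> ^ n * real j / 2 ^ m0) \<omega>\<bar> \<le> chain_const m0 * (\<theta> ^ n) powr (\<gamma> / 2) * (sqrt (2 * ln (real n)) + 1))" for n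
  proof (cases "n0 \<le> n")
    case True
    show ?thesis
      by (rule chaining[of 0 "\<theta> ^ n" "2 * ln (real n)" m0]) (use th0 n0[OF True] in auto)
  qed auto
  then obtain E where E: "\<And>n. n0 \<le> n \<Longrightarrow> E n \<in> sets M" "\<And>n. n0 \<le> n \<Longrightarrow> prob (E n) \<le> K * exp (- (2 * ln (real n)))"
    "\<And>n \<omega> t. n0 \<le> n \<Longrightarrow> \<omega> \<in> space M - E n \<Longrightarrow> t \<in> {0..\<theta> ^ n} \<Longrightarrow> \<exists>j\<le>2 ^ m0.
        \<bar>V t \<omega> - V (\<theta> ^ n * real j / 2 ^ m0) \<omega>\<bar> \<le> chain_const m0 * (\<theta> ^ n) powr (\<gamma> / 2) * (sqrt (2 * ln (real n)) + 1)"
    unfolding add_0 by metis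
  define P where "P n j = {\<omega> \<in> space M. a * (\<theta> ^ n) powr \<gamma> * ((1 + \<delta>) * ln (real n)) < (V (\<theta> ^ n * real j / 2 ^ m0) \<omega> - V 0 \<omega>)\<^sup>2}" for n j
  have gp: "0 \<le> \<theta> ^ n * real j / 2 ^ m0" for n and j :: nat using th0 by simp
  have [measurable]: "P n j \<in> sets M" for n j unfolding P_def by (rule meas_increment_event[OF gp]) simp
  have prP: "prob (P n j) \<le> K * real n powr (- (1 + \<delta>))" if n: "n0 \<le> n" and j: "j \<in> {1..2 ^ m0}" for n j
  proof -
    have "real j \<le> real (2 ^ m0)" using j unfolding of_nat_le_iff by simp
    hence "\<theta> ^ n * real j / 2 ^ m0 \<le> \<theta> ^ n" using th0 by (simp add: divide_le_eq)
    hence "prob (P n j) \<le> K * exp (- ((1 + \<delta>) * ln (real n)))"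
      unfolding P_def using th0 j n0[OF n] gp[of n j] \<delta>
      by (intro increment_tail_at) (auto intro: mult_nonneg_nonneg)
    also have "exp (- ((1 + \<delta>) * ln (real n))) = real n powr (- (1 + \<delta>))" using n0[OF n] by (simp add: powr_def algebra_simps)
    finally show ?thesis .
  qed
  define Bad where "Bad n = (\<Union>j\<in>{1..2 ^ m0}. P n j) \<union> E n" for n
  have "AE \<omega> in M. eventually (\<lambda>n. \<omega> \<in> space M - Bad n) sequentially"
  proof (rule AE_eventually_of_summable[of n0])
    fix n assume n: "n0 \<le> n"
    show "Bad n \<in> sets M" unfolding Bad_def using E(1)[OF n] by measurable
    have "prob (Bad n) \<le> prob (\<Union>j\<in>{1..2 ^ m0}. P n j) + prob (E n)"
      unfolding Bad_def by (rule measure_Un_le) (use E(1)[OF n] in auto)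
    also have "prob (\<Union>j\<in>{1..2 ^ m0}. P n j) \<le> (\<Sum>j\<in>{1..2 ^ m0}. prob (P n j))"
      by (rule finite_measure_subadditive_finite) auto
    also have "\<dots> \<le> (\<Sum>j\<in>{1..(2::nat) ^ m0}. K * real n powr (- (1 + \<delta>)))" by (rule sum_mono) (rule prP[OF n])
    also have "\<dots> = 2 ^ m0 * K * real n powr (- (1 + \<delta>))" by simp
    also have "prob (E n) \<le> K * real n powr (- 2)" using E(2)[OF n] n0[OF n] by (simp add: powr_def)
    finally show "prob (Bad n) \<le> 2 ^ m0 * K * real n powr (- (1 + \<delta>)) + K * real n powr (- 2)" by simp
  next
    show "summable (\<lambda>n. 2 ^ m0 * K * real n powr (- (1 + \<delta>)) + K * real n powr (- 2))"
      using \<delta> by (intro summable_add summable_mult) (auto simp: summable_real_powr_iff)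
  qed
  thus ?thesis
  proof eventually_elim
    case (elim \<omega>)
    define lam where "lam = ln (1 / \<theta>)"
    have lam: "0 < lam" using th0 th1 by (simp add: lam_def ln_div)
    have "eventually (\<lambda>n. - ((1 + \<delta>) * ln lam) \<le> \<delta> * ln (real n)) sequentially"
      using \<delta> by real_asymp
    moreover have "eventually (\<lambda>n. 1 \<le> ln (real n)) sequentially" by real_asymp
    ultimately have "eventually (\<lambda>n. \<omega> \<in> space M - Bad n \<and> - ((1 + \<delta>) * ln lam) \<le> \<delta> * ln (real n) \<and> 1 \<le> ln (real n) \<and> n0 \<le> n) sequentially"
      using elim eventually_ge_at_top[of n0] by eventually_elim auto
    then obtain n2 where n2: "\<And>n. n2 \<le> n \<Longrightarrow> \<omega> \<in> space M - Bad n \<and> - ((1 + \<delta>) * ln lam) \<le> \<delta> * ln (real n) \<and> 1 \<le> ln (real n) \<and> n0 \<le> n"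
      by (auto simp: eventually_sequentially)
    show ?case
    proof (intro exI[of _ "\<theta> ^ n2"] conjI allI impI ballI)
      show "0 < \<theta> ^ n2" using th0 by simp
      fix h t assume h: "0 < h \<and> h < \<theta> ^ n2" and t: "t \<in> {0..h}"
      obtain n where n: "n2 \<le> n" "\<theta> ^ Suc n < h" "h \<le> \<theta> ^ n"
        using geometric_bracket[OF th0 th1, of h n2] h by auto
      have w: "\<omega> \<in> space M - Bad n" and l1: "- ((1 + \<delta>) * ln lam) \<le> \<delta> * ln (real n)" and l2: "1 \<le> ln (real n)" and nn: "n0 \<le> n"
        using n2[OF n(1)] by auto
      have npos: "0 < real n" using n0[OF nn] by simp
      define r where "r = sqrt (ln (real n))"
      have r1: "1 \<le> r" using l2 by (simp add: r_def)
      define q where "q = (\<theta> ^ n) powr (\<gamma> / 2)"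
      have q0: "0 \<le> q" by (simp add: q_def)
      have qq: "q\<^sup>2 = (\<theta> ^ n) powr \<gamma>" using th0 by (simp add: q_def powr_half_eq_sqrt)
      obtain j where j: "j \<le> 2 ^ m0" "\<bar>V t \<omega> - V (\<theta> ^ n * real j / 2 ^ m0) \<omega>\<bar> \<le> chain_const m0 * q * (sqrt (2 * ln (real n)) + 1)"
        using E(3)[OF nn _, of \<omega> t] w t n unfolding Bad_def q_def by auto
      have four: "sqrt (2 * ln (real n)) + 1 \<le> 4 * r"
        unfolding r_def by (rule sqrt_double_plus_one_le) (use l2 in simp)
      have "chain_const m0 * q * (sqrt (2 * ln (real n)) + 1) \<le> (sqrt a * \<delta>) * q * (4 * r)"
        using m0 q0 chain_const_nonneg four l2 sa \<delta> by (intro mult_mono) auto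
      with j have A1: "\<bar>V t \<omega> - V (\<theta> ^ n * real j / 2 ^ m0) \<omega>\<bar> \<le> (sqrt a * \<delta>) * q * (4 * r)" by linarith
      have A2: "\<bar>V (\<theta> ^ n * real j / 2 ^ m0) \<omega> - V 0 \<omega>\<bar> \<le> sqrt a * (1 + \<delta>) * q * r"
      proof (cases "j = 0")
        case True
        thus ?thesis using sa \<delta> q0 r1 by simp
      next
        case False
        hence "\<omega> \<notin> P n j" using w j by (auto simp: Bad_def)
        hence "(V (\<theta> ^ n * real j / 2 ^ m0) \<omega> - V 0 \<omega>)\<^sup>2 \<le> a * (\<theta> ^ n) powr \<gamma> * ((1 + \<delta>) * ln (real n))"
          using w by (auto simp: P_def)
        also have "\<dots> \<le> a * (\<theta> ^ n) powr \<gamma> * ((1 + \<delta>)\<^sup>2 * ln (real n))"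
        proof -
          have "1 + \<delta> \<le> (1 + \<delta>)\<^sup>2" using \<delta> by (simp add: power2_eq_square)
          thus ?thesis using a_pos l2 by (intro mult_left_mono mult_right_mono) auto
        qed
        also have "\<dots> = (sqrt a * (1 + \<delta>) * q * r)\<^sup>2"
          using a_pos l2 by (simp add: power_mult_distrib qq r_def)
        finally show ?thesis using sa \<delta> q0 r1 by (simp add: abs_le_square_iff[symmetric] abs_of_nonneg)
      qed
      have qh: "q \<le> (1 + \<delta>) * h powr (\<gamma> / 2)"
      proof -
        have "q / (1 + \<delta>) = (\<theta> ^ Suc n) powr (\<gamma> / 2)"
          using thg by (simp add: q_def powr_mult)
        also have "\<dots> \<le> h powr (\<gamma> / 2)" using n th0 g_pos by (intro powr_mono2) auto
        finally show ?thesis using \<delta> by (simp add: divide_le_eq mult.commute)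
      qed
      have lnh: "ln (real n) \<le> (1 + \<delta>) * ln (ln (1 / h))"
      proof -
        have "1 / \<theta> ^ n \<le> 1 / h" using n h by (intro divide_left_mono) (auto intro: mult_pos_pos simp: th0)
        hence "ln (1 / \<theta> ^ n) \<le> ln (1 / h)" using h th0 by (subst ln_le_cancel_iff) auto
        moreover have "ln (1 / \<theta> ^ n) = real n * lam" using th0 by (simp add: lam_def ln_div ln_realpow)
        ultimately have "real n * lam \<le> ln (1 / h)" by simp
        moreover have "0 < real n * lam" using npos lam by simp
        ultimately have "ln (real n * lam) \<le> ln (ln (1 / h))"
          by (subst ln_le_cancel_iff) linarith+
        hence "ln (real n) + ln lam \<le> ln (ln (1 / h))" using npos lam by (simp add: ln_mult)
        hence "(1 + \<delta>) * (ln (real n) + ln lam) \<le> (1 + \<delta>) * ln (ln (1 / h))" using \<delta> by (intro mult_left_mono) auto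
        thus ?thesis using l1 by (simp add: algebra_simps)
      qed
      have ll: "0 \<le> ln (ln (1 / h))"
      proof -
        have "0 < (1 + \<delta>) * ln (ln (1 / h))" using lnh l2 by linarith
        thus ?thesis using \<delta> by (simp add: zero_less_mult_iff)
      qed
      have rh: "r \<le> (1 + \<delta>) * sqrt (ln (ln (1 / h)))"
        unfolding r_def using \<delta>(1) by (intro sqrt_le_scaled[OF _ ll lnh]) simp
      have "\<bar>V t \<omega> - V 0 \<omega>\<bar> \<le> (sqrt a * \<delta>) * q * (4 * r) + sqrt a * (1 + \<delta>) * q * r" using A1 A2 by linarith
      also have "\<dots> = sqrt a * (1 + 5 * \<delta>) * (q * r)" by (simp add: algebra_simps)
      also have "\<dots> \<le> sqrt a * (1 + 5 * \<delta>) * (((1 + \<delta>) * h powr (\<gamma> / 2)) * ((1 + \<delta>) * sqrt (ln (ln (1 / h)))))"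
        using qh rh q0 r1 sa \<delta> by (intro mult_left_mono mult_mono) auto
      also have "\<dots> = (sqrt a * (1 + \<delta>)\<^sup>2 * (1 + 5 * \<delta>)) * (h powr (\<gamma> / 2) * sqrt (ln (ln (1 / h))))"
        by (simp add: power2_eq_square mult_ac)
      also have "\<dots> \<le> c * (h powr (\<gamma> / 2) * sqrt (ln (ln (1 / h))))"
        using \<delta>(2) ll by (intro mult_right_mono mult_nonneg_nonneg) auto
      also have "h powr (\<gamma> / 2) * sqrt (ln (ln (1 / h))) = sqrt (h powr \<gamma> * ln (ln (1 / h)))"
        using h by (simp add: powr_half_eq_sqrt real_sqrt_mult)
      finally show "\<bar>V t \<omega> - V 0 \<omega>\<bar> \<le> c * sqrt (h powr \<gamma> * ln (ln (1 / h)))" .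
    qed
  qed
qed

text \<open>
  As in \<open>local_modulus\<close>, with the blocks \<open>{n L..n L + L}\<close> in place of
  \<open>{0..\<theta> ^ n}\<close> and the marginal tails in place of those of the increments.
  Only the marginals determine the constant, because the chaining error can be made arbitrarily
  small compared with \<open>sqrt (ln n)\<close>.
\<close>
lemma eventual_growth:
  assumes V0: "\<And>t \<omega>. 0 \<le> t \<Longrightarrow> \<omega> \<in> space M \<Longrightarrow> 0 \<le> V t \<omega>"
    and u: "0 < u"
    and marg: "\<And>\<delta>. 0 < \<delta> \<Longrightarrow> \<delta> < 1 \<Longrightarrow> \<exists>K'. \<forall>t\<ge>0. \<forall>x\<ge>0. prob {\<omega> \<in> space M. x < (V t \<omega>)\<^sup>2} \<le> K' * exp (- ((1 - \<delta>) * x / u))"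
    and c: "sqrt u < c"
  shows "AE \<omega> in M. eventually (\<lambda>t. V t \<omega> \<le> c * sqrt (ln t)) at_top"
proof -
  have su: "0 < sqrt u" using u by simp
  have "((\<lambda>\<delta>. sqrt u * (1 + \<delta>) * (1 + 5 * \<delta>)) \<longlongrightarrow> sqrt u * (1 + 0) * (1 + 5 * 0)) (at_right 0)"
    by (intro tendsto_intros)
  hence "eventually (\<lambda>\<delta>. sqrt u * (1 + \<delta>) * (1 + 5 * \<delta>) < c) (at_right 0)"
    using c by (intro order_tendstoD(2)) auto
  moreover have "eventually (\<lambda>\<delta>::real. 0 < \<delta>) (at_right 0)" by (simp add: eventually_at_right_less)
  ultimately obtain \<delta> where \<delta>: "0 < \<delta>" "sqrt u * (1 + \<delta>) * (1 + 5 * \<delta>) < c"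
    using eventually_happens[OF eventually_conj, of _ "at_right (0::real)"] trivial_limit_at_right_real by blast
  define L where "L = d0"
  have L: "0 < L" "L \<le> d0" using d0_pos by (auto simp: L_def)
  obtain m0 where "chain_const m0 \<le> sqrt u * \<delta> / L powr (\<gamma> / 2)"
    using chain_const_small[of "sqrt u * \<delta> / L powr (\<gamma> / 2)"] su \<delta> L by auto
  hence m0: "chain_const m0 * L powr (\<gamma> / 2) \<le> sqrt u * \<delta>" using L by (simp add: pos_le_divide_eq)
  \<comment> \<open>Loss in the marginal tail chosen so that the threshold below still gives the
    summable probabilities \<open>n powr (- (1 + \<delta>))\<close>.\<close>
  define \<eta> where "\<eta> = \<delta> / (1 + \<delta>)"
  have eta: "0 < \<eta>" "\<eta> < 1" "(1 - \<eta>) * (1 + \<delta>) = 1" using \<delta> by (auto simp: \<eta>_def field_simps)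
  obtain K' where K': "\<And>t x. 0 \<le> t \<Longrightarrow> 0 \<le> x \<Longrightarrow> prob {\<omega> \<in> space M. x < (V t \<omega>)\<^sup>2} \<le> K' * exp (- ((1 - \<eta>) * x / u))"
    using marg[OF eta(1,2)] by blast
  have "\<exists>E. 1 \<le> n \<longrightarrow> E \<in> sets M \<and> prob E \<le> K * exp (- (2 * ln (real n))) \<and>
      (\<forall>\<omega>\<in>space M - E. \<forall>t\<in>{real n * L..real n * L + L}. \<exists>j\<le>2 ^ m0. real n * L + L * real j / 2 ^ m0 \<le> t \<and> t < real n * L + L * real (Suc j) / 2 ^ m0 \<and>
        \<bar>V t \<omega> - V (real n * L + L * real j / 2 ^ m0) \<omega>\<bar> \<le> chain_const m0 * L powr (\<gamma> / 2) * (sqrt (2 * ln (real n)) + 1))" for n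
  proof (cases "1 \<le> n")
    case True
    show ?thesis
      by (rule chaining[of "real n * L" L "2 * ln (real n)" m0]) (use L True in auto)
  qed auto
  then obtain E where E: "\<And>n. 1 \<le> n \<Longrightarrow> E n \<in> sets M" "\<And>n. 1 \<le> n \<Longrightarrow> prob (E n) \<le> K * exp (- (2 * ln (real n)))"
    "\<And>n \<omega> t. 1 \<le> n \<Longrightarrow> \<omega> \<in> space M - E n \<Longrightarrow> t \<in> {real n * L..real n * L + L} \<Longrightarrow> \<exists>j\<le>2 ^ m0.
        \<bar>V t \<omega> - V (real n * L + L * real j / 2 ^ m0) \<omega>\<bar> \<le> chain_const m0 * L powr (\<gamma> / 2) * (sqrt (2 * ln (real n)) + 1)"
    by metis
  define P where "P n j = {\<omega> \<in> space M. u * (1 + \<delta>)\<^sup>2 * ln (real n) < (V (real n * L + L * real j / 2 ^ m0) \<omega>)\<^sup>2}" for n j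
  have gp: "0 \<le> real n * L + L * real j / 2 ^ m0" for n and j :: nat using L by simp
  have [measurable]: "P n j \<in> sets M" for n j unfolding P_def using V_meas[OF gp] by measurable
  have prP: "prob (P n j) \<le> K' * real n powr (- (1 + \<delta>))" if n: "1 \<le> n" for n j
  proof -
    have "prob (P n j) \<le> K' * exp (- ((1 - \<eta>) * (u * (1 + \<delta>)\<^sup>2 * ln (real n)) / u))"
      unfolding P_def by (rule K'[OF gp]) (use u n in auto)
    also have "(1 - \<eta>) * (u * (1 + \<delta>)\<^sup>2 * ln (real n)) / u = ((1 - \<eta>) * (1 + \<delta>)) * (1 + \<delta>) * ln (real n)"
      using u by (simp add: power2_eq_square)
    also have "exp (- (((1 - \<eta>) * (1 + \<delta>)) * (1 + \<delta>) * ln (real n))) = real n powr (- (1 + \<delta>))"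
      unfolding eta(3) using n by (simp add: powr_def algebra_simps)
    finally show ?thesis .
  qed
  define Bad where "Bad n = (\<Union>j\<in>{..2 ^ m0}. P n j) \<union> E n" for n
  have "AE \<omega> in M. eventually (\<lambda>n. \<omega> \<in> space M - Bad n) sequentially"
  proof (rule AE_eventually_of_summable[of 1])
    fix n :: nat assume n: "1 \<le> n"
    show "Bad n \<in> sets M" unfolding Bad_def using E(1)[OF n] by measurable
    have "prob (Bad n) \<le> prob (\<Union>j\<in>{..2 ^ m0}. P n j) + prob (E n)"
      unfolding Bad_def by (rule measure_Un_le) (use E(1)[OF n] in auto)
    also have "prob (\<Union>j\<in>{..2 ^ m0}. P n j) \<le> (\<Sum>j\<in>{..2 ^ m0}. prob (P n j))"
      by (rule finite_measure_subadditive_finite) auto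
    also have "\<dots> \<le> (\<Sum>j\<in>{..(2::nat) ^ m0}. K' * real n powr (- (1 + \<delta>)))" by (rule sum_mono) (rule prP[OF n])
    also have "\<dots> = (2 ^ m0 + 1) * K' * real n powr (- (1 + \<delta>))" by simp
    also have "prob (E n) \<le> K * real n powr (- 2)" using E(2)[OF n] n by (simp add: powr_def)
    finally show "prob (Bad n) \<le> (2 ^ m0 + 1) * K' * real n powr (- (1 + \<delta>)) + K * real n powr (- 2)" by simp
  next
    show "summable (\<lambda>n. (2 ^ m0 + 1) * K' * real n powr (- (1 + \<delta>)) + K * real n powr (- 2))"
      using \<delta> by (intro summable_add summable_mult) (auto simp: summable_real_powr_iff)
  qed
  thus ?thesis
  proof eventually_elim
    case (elim \<omega>)
    have "eventually (\<lambda>n. - ((1 + \<delta>) * ln L) \<le> \<delta> * ln (real n)) sequentially"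
      using \<delta> by real_asymp
    moreover have "eventually (\<lambda>n. 1 \<le> ln (real n)) sequentially" by real_asymp
    ultimately have "eventually (\<lambda>n. \<omega> \<in> space M - Bad n \<and> - ((1 + \<delta>) * ln L) \<le> \<delta> * ln (real n) \<and> 1 \<le> ln (real n) \<and> 1 \<le> n) sequentially"
      using elim eventually_ge_at_top[of 1] by eventually_elim auto
    then obtain n2 where n2: "\<And>n. n2 \<le> n \<Longrightarrow> \<omega> \<in> space M - Bad n \<and> - ((1 + \<delta>) * ln L) \<le> \<delta> * ln (real n) \<and> 1 \<le> ln (real n) \<and> 1 \<le> n"
      by (auto simp: eventually_sequentially)
    show ?case
      using eventually_ge_at_top[of "real n2 * L"]
    proof eventually_elim
      fix t assume t: "real n2 * L \<le> t"
      define n where "n = nat \<lfloor>t / L\<rfloor>"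
      have tL: "real n2 \<le> t / L" using t L by (simp add: pos_le_divide_eq)
      hence "real n = of_int \<lfloor>t / L\<rfloor>" unfolding n_def by (subst of_nat_nat) (auto intro: order_trans[OF of_nat_0_le_iff])
      hence nt: "real n \<le> t / L" "t / L < real n + 1" by linarith+
      have nn: "n2 \<le> n" using tL nt by linarith
      have w: "\<omega> \<in> space M - Bad n" and l1: "- ((1 + \<delta>) * ln L) \<le> \<delta> * ln (real n)" and l2: "1 \<le> ln (real n)" and n1: "1 \<le> n"
        using n2[OF nn] by auto
      have npos: "0 < real n" using n1 by simp
      have tn: "real n * L \<le> t" "t \<le> real n * L + L" using nt L by (auto simp: pos_le_divide_eq pos_divide_less_eq distrib_right)
      define r where "r = sqrt (ln (real n))"
      have r1: "1 \<le> r" using l2 by (simp add: r_def)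
      obtain j where j: "j \<le> 2 ^ m0" "\<bar>V t \<omega> - V (real n * L + L * real j / 2 ^ m0) \<omega>\<bar> \<le> chain_const m0 * L powr (\<gamma> / 2) * (sqrt (2 * ln (real n)) + 1)"
        using E(3)[OF n1 _, of \<omega> t] w tn unfolding Bad_def by auto
      have four: "sqrt (2 * ln (real n)) + 1 \<le> 4 * r"
        unfolding r_def by (rule sqrt_double_plus_one_le) (use l2 in simp)
      have "chain_const m0 * L powr (\<gamma> / 2) * (sqrt (2 * ln (real n)) + 1) \<le> (sqrt u * \<delta>) * (4 * r)"
        using four l2 su \<delta> by (intro mult_mono[OF m0]) auto
      with j have A1: "\<bar>V t \<omega> - V (real n * L + L * real j / 2 ^ m0) \<omega>\<bar> \<le> (sqrt u * \<delta>) * (4 * r)" by linarith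
      have A2: "V (real n * L + L * real j / 2 ^ m0) \<omega> \<le> sqrt u * (1 + \<delta>) * r"
      proof -
        have "\<omega> \<notin> P n j" using w j by (auto simp: Bad_def)
        hence "(V (real n * L + L * real j / 2 ^ m0) \<omega>)\<^sup>2 \<le> u * (1 + \<delta>)\<^sup>2 * ln (real n)"
          using w by (auto simp: P_def)
        also have "\<dots> = (sqrt u * (1 + \<delta>) * r)\<^sup>2"
          using u l2 by (simp add: power_mult_distrib r_def)
        finally show ?thesis by (rule power2_le_imp_le) (use su \<delta> r1 in simp)
      qed
      have tpos: "0 < t" using tn(1) npos L by (meson less_le_trans mult_pos_pos)
      have lnt: "ln (real n) \<le> (1 + \<delta>) * ln t"
      proof -
        have "ln (real n * L) \<le> ln t" using tn(1) npos L tpos by (subst ln_le_cancel_iff) auto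
        hence "ln (real n) + ln L \<le> ln t" using npos L by (simp add: ln_mult)
        hence "(1 + \<delta>) * (ln (real n) + ln L) \<le> (1 + \<delta>) * ln t" using \<delta> by (intro mult_left_mono) auto
        thus ?thesis using l1 by (simp add: algebra_simps)
      qed
      have ll: "0 \<le> ln t"
      proof -
        have "0 < (1 + \<delta>) * ln t" using lnt l2 by linarith
        thus ?thesis using \<delta> by (simp add: zero_less_mult_iff)
      qed
      have rh: "r \<le> (1 + \<delta>) * sqrt (ln t)"
        unfolding r_def using \<delta>(1) by (intro sqrt_le_scaled[OF _ ll lnt]) simp
      have "V t \<omega> \<le> (sqrt u * \<delta>) * (4 * r) + sqrt u * (1 + \<delta>) * r" using A1 A2 by linarith
      also have "\<dots> = sqrt u * (1 + 5 * \<delta>) * r" by (simp add: algebra_simps)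
      also have "\<dots> \<le> sqrt u * (1 + 5 * \<delta>) * ((1 + \<delta>) * sqrt (ln t))"
        using rh su \<delta> by (intro mult_left_mono) auto
      also have "\<dots> = (sqrt u * (1 + \<delta>) * (1 + 5 * \<delta>)) * sqrt (ln t)" by simp
      also have "\<dots> \<le> c * sqrt (ln t)" using \<delta>(2) ll by (intro mult_right_mono) auto
      finally show "V t \<omega> \<le> c * sqrt (ln t)" .
    qed
  qed
qed

end

context exp_square_increments
begin

text \<open>
  Let \<open>h\<close> lie between \<open>m / 2 ^ (n + 1)\<close> and \<open>m / 2 ^ n\<close> for
  a large fixed \<open>m\<close>. Points at distance at most \<open>h\<close> are close to grid
  points of level \<open>n\<close> that are at most \<open>m + 1\<close> steps apart. There are of
  order \<open>2 ^ n\<close> such pairs of grid points, and each exceeds \<open>a (k / 2 ^ n) powr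
  \<gamma> (1 + \<delta>) n ln 2\<close> with probability of order \<open>2 powr (- (1 + \<delta>)
  n)\<close>, which leaves a summable bound. Passing from the points to the grid costs only a
  multiple of \<open>m powr (- \<gamma> / 2)\<close> relative to \<open>h powr (\<gamma> /
  2)\<close>, so it is \<open>m\<close> that makes this error small; chaining with \<open>m0 =
  0\<close> is good enough here.
\<close>
lemma uniform_modulus:
  assumes c: "sqrt a < c"
  shows "AE \<omega> in M. \<exists>h0>0. \<forall>h. 0 < h \<and> h < h0 \<longrightarrow>
    (\<forall>s\<in>{0..T}. \<forall>t\<in>{0..T}. \<bar>s - t\<bar> \<le> h \<longrightarrow> \<bar>V s \<omega> - V t \<omega>\<bar> \<le> c * sqrt (h powr \<gamma> * ln (1 / h)))"
proof -
  have sa: "0 < sqrt a" using a_pos by simp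
  define \<delta> where "\<delta> = (c - sqrt a) / (2 * sqrt a)"
  have \<delta>: "0 < \<delta>" using c sa by (simp add: \<delta>_def)
  have "sqrt a * (1 + \<delta>) = (sqrt a + c) / 2" using sa by (simp add: \<delta>_def field_simps)
  also have "\<dots> < c" using c by simp
  finally have \<delta>c: "sqrt a * (1 + \<delta>) < c" .
  define C1 where "C1 = chain_const 0"
  have C1: "0 \<le> C1" unfolding C1_def by (rule chain_const_nonneg)
  have "((\<lambda>m. sqrt a * (1 + \<delta>) * (1 + 2 / real m) powr (\<gamma> / 2) + 8 * C1 * (1 + \<delta>) * (2 powr (\<gamma> / 2) * real m powr (- (\<gamma> / 2))))
      \<longlongrightarrow> sqrt a * (1 + \<delta>) * (1 + 0) powr (\<gamma> / 2) + 8 * C1 * (1 + \<delta>) * (2 powr (\<gamma> / 2) * 0)) sequentially"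
  proof -
    have l1: "(\<lambda>m. 2 / real m) \<longlonglongrightarrow> 0" by real_asymp
    have l2: "(\<lambda>m. real m powr (- (\<gamma> / 2))) \<longlonglongrightarrow> 0"
      using g_pos by (intro tendsto_neg_powr filterlim_real_sequentially) auto
    show ?thesis by (intro tendsto_add tendsto_mult tendsto_powr tendsto_const l1 l2) auto
  qed
  hence "eventually (\<lambda>m. sqrt a * (1 + \<delta>) * (1 + 2 / real m) powr (\<gamma> / 2) + 8 * C1 * (1 + \<delta>) * (2 powr (\<gamma> / 2) * real m powr (- (\<gamma> / 2))) < c) sequentially"
    using \<delta>c by (intro order_tendstoD(2)) auto
  \<comment> \<open>The number \<open>m\<close> of grid steps per \<open>h\<close>: large enough for
    the rounding of distances and the chaining error to fit between \<open>sqrt a * (1 +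
    \<delta>)\<close> and \<open>c\<close>.\<close>
  from eventually_conj[OF this eventually_ge_at_top[of 1]]
  obtain m :: nat where m: "1 \<le> m"
    "sqrt a * (1 + \<delta>) * (1 + 2 / real m) powr (\<gamma> / 2) + 8 * C1 * (1 + \<delta>) * (2 powr (\<gamma> / 2) * real m powr (- (\<gamma> / 2))) < c"
    by (auto simp: eventually_sequentially)
  have mpos: "0 < real m" using m by simp
  have "eventually (\<lambda>n. real (Suc m) * (1 / 2) ^ n < d0) sequentially"
  proof (intro order_tendstoD(2))
    show "(\<lambda>n. real (Suc m) * (1 / 2) ^ n) \<longlonglongrightarrow> real (Suc m) * 0"
      by (intro tendsto_intros LIMSEQ_power_zero) auto
  qed (use d0_pos in auto)
  then obtain n0' where n0': "\<And>n. n0' \<le> n \<Longrightarrow> real (Suc m) * (1 / 2) ^ n < d0" by (auto simp: eventually_sequentially)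
  define n0 where "n0 = max 1 n0'"
  have n0: "1 \<le> n" "real (Suc m) / 2 ^ n \<le> d0" "1 / 2 ^ n \<le> d0" if "n0 \<le> n" for n
  proof -
    show "1 \<le> n" using that by (simp add: n0_def)
    show *: "real (Suc m) / 2 ^ n \<le> d0" using that n0'[of n] by (simp add: n0_def power_divide)
    have "1 / 2 ^ n \<le> real (Suc m) / 2 ^ n" by (intro divide_right_mono) auto
    thus "1 / 2 ^ n \<le> d0" using * by linarith
  qed
  define N where "N = nat \<lceil>T\<rceil>"
  have TN: "T \<le> real N" unfolding N_def by (simp add: real_nat_ceiling_ge)
  define ly where "ly n = real n * ln 2" for n :: nat
  have ly0: "0 \<le> ly n" for n by (simp add: ly_def)
  have "\<exists>E. n0 \<le> n \<longrightarrow> E \<in> sets M \<and> prob E \<le> K * exp (- (2 * ly n)) \<and>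
      (\<forall>\<omega>\<in>space M - E. \<forall>t\<in>{real i / 2 ^ n..real i / 2 ^ n + 1 / 2 ^ n}. \<exists>j\<le>2 ^ 0. real i / 2 ^ n + 1 / 2 ^ n * real j / 2 ^ 0 \<le> t \<and> t < real i / 2 ^ n + 1 / 2 ^ n * real (Suc j) / 2 ^ 0 \<and>
        \<bar>V t \<omega> - V (real i / 2 ^ n + 1 / 2 ^ n * real j / 2 ^ 0) \<omega>\<bar> \<le> chain_const 0 * (1 / 2 ^ n) powr (\<gamma> / 2) * (sqrt (2 * ly n) + 1))" for n i :: nat
  proof (cases "n0 \<le> n")
    case True
    show ?thesis
      by (rule chaining[of "real i / 2 ^ n" "1 / 2 ^ n" "2 * ly n" 0]) (use n0[OF True] ly0 in auto)
  qed auto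
  then obtain E where E: "\<And>n i. n0 \<le> n \<Longrightarrow> E n i \<in> sets M" "\<And>n i. n0 \<le> n \<Longrightarrow> prob (E n i) \<le> K * exp (- (2 * ly n))"
    and E3: "\<And>n i \<omega> t. n0 \<le> n \<Longrightarrow> \<omega> \<in> space M - E n i \<Longrightarrow> t \<in> {real i / 2 ^ n..real i / 2 ^ n + 1 / 2 ^ n} \<Longrightarrow>
      \<exists>j\<le>2 ^ 0. real i / 2 ^ n + 1 / 2 ^ n * real j / 2 ^ 0 \<le> t \<and> t < real i / 2 ^ n + 1 / 2 ^ n * real (Suc j) / 2 ^ 0 \<and>
        \<bar>V t \<omega> - V (real i / 2 ^ n + 1 / 2 ^ n * real j / 2 ^ 0) \<omega>\<bar> \<le> chain_const 0 * (1 / 2 ^ n) powr (\<gamma> / 2) * (sqrt (2 * ly n) + 1)"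
    by metis
  have E4: "\<bar>V t \<omega> - V (real i / 2 ^ n) \<omega>\<bar> \<le> C1 * (1 / 2 ^ n) powr (\<gamma> / 2) * (sqrt (2 * ly n) + 1)"
    if n: "n0 \<le> n" and w: "\<omega> \<in> space M - E n i" and t: "real i / 2 ^ n \<le> t" "t < real i / 2 ^ n + 1 / 2 ^ n" for n i \<omega> t
  proof -
    obtain j where j: "real i / 2 ^ n + 1 / 2 ^ n * real j / 2 ^ 0 \<le> t"
      "\<bar>V t \<omega> - V (real i / 2 ^ n + 1 / 2 ^ n * real j / 2 ^ 0) \<omega>\<bar> \<le> chain_const 0 * (1 / 2 ^ n) powr (\<gamma> / 2) * (sqrt (2 * ly n) + 1)"
      using E3[OF n w, of t] t by auto
    have "j = 0"
    proof (rule ccontr)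
      assume "j \<noteq> 0"
      hence "1 / 2 ^ n * 1 \<le> 1 / 2 ^ n * real j" by (intro mult_left_mono) auto
      thus False using j(1) t(2) by simp
    qed
    thus ?thesis using j(2) by (simp add: C1_def)
  qed
  define P where "P n k i = {\<omega> \<in> space M. a * (real k / 2 ^ n) powr \<gamma> * ((1 + \<delta>) * ly n) < (V (real i / 2 ^ n) \<omega> - V (real (i + k) / 2 ^ n) \<omega>)\<^sup>2}" for n k i :: nat
  have [measurable]: "P n k i \<in> sets M" for n k i unfolding P_def by (rule meas_increment_event) auto
  have prP: "prob (P n k i) \<le> K * exp (- ((1 + \<delta>) * ly n))" if n: "n0 \<le> n" and k: "k \<in> {1..Suc m}" for n k i
  proof -
    have d: "real (i + k) / 2 ^ n - real i / 2 ^ n = real k / 2 ^ n" by (simp add: add_divide_distrib)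
    have k0: "0 < real k / 2 ^ n" using k by simp
    have "real k / 2 ^ n \<le> real (Suc m) / 2 ^ n" using k by (intro divide_right_mono) auto
    hence kd: "real k / 2 ^ n \<le> d0" using n0(2)[OF n] by linarith
    show ?thesis unfolding P_def
    proof (rule increment_tail_at[OF _ _ _ _ kd])
      show "real i / 2 ^ n \<noteq> real (i + k) / 2 ^ n" using d k0 by linarith
      show "\<bar>real i / 2 ^ n - real (i + k) / 2 ^ n\<bar> \<le> real k / 2 ^ n" using d k0 by linarith
      show "0 \<le> (1 + \<delta>) * ly n" using \<delta> ly0 by simp
    qed auto
  qed
  define R where "R n = N * 2 ^ n" for n :: nat
  define Bad where "Bad n = (\<Union>k\<in>{1..Suc m}. \<Union>i\<in>{..R n}. P n k i) \<union> (\<Union>i\<in>{..R n}. E n i)" for n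
  have Rn: "real (Suc (R n)) \<le> real (Suc N) * 2 ^ n" for n
  proof -
    have "Suc (R n) \<le> Suc N * 2 ^ n" by (simp add: R_def)
    hence "real (Suc (R n)) \<le> real (Suc N * 2 ^ n)" by (simp only: of_nat_le_iff)
    thus ?thesis by (simp only: of_nat_mult of_nat_power of_nat_numeral)
  qed
  \<comment> \<open>The number of grid points times the probability of one exceedance.\<close>
  have e2: "2 ^ n * exp (- ((1 + e) * ly n)) = (2 powr (- e)) ^ n" for e :: real and n
  proof -
    have "(2::real) ^ n = exp (ly n)" by (simp add: ly_def exp_of_nat_mult)
    moreover have "(2 powr (- e)) ^ n = exp (- e * ly n)" by (simp add: powr_def ly_def exp_of_nat_mult[symmetric] mult_ac)
    ultimately show ?thesis by (simp add: algebra_simps flip: exp_add)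
  qed
  have "AE \<omega> in M. eventually (\<lambda>n. \<omega> \<in> space M - Bad n) sequentially"
  proof (rule AE_eventually_of_summable[of n0])
    fix n assume n: "n0 \<le> n"
    have mE: "E n i \<in> sets M" for i by (rule E(1)[OF n])
    show "Bad n \<in> sets M" unfolding Bad_def using mE by measurable
    have uni: "prob (\<Union>i\<in>{..R n}. Q i) \<le> real (Suc N) * 2 ^ n * B"
      if "\<And>i. Q i \<in> sets M" "\<And>i. prob (Q i) \<le> B" "0 \<le> B" for Q B
    proof -
      have "prob (\<Union>i\<in>{..R n}. Q i) \<le> (\<Sum>i\<in>{..R n}. prob (Q i))"
        by (rule finite_measure_subadditive_finite) (use that in auto)
      also have "\<dots> \<le> (\<Sum>i\<in>{..R n}. B)" by (rule sum_mono) (rule that)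
      also have "\<dots> = real (Suc (R n)) * B" by simp
      also have "\<dots> \<le> real (Suc N) * 2 ^ n * B" by (rule mult_right_mono[OF Rn that(3)])
      finally show ?thesis .
    qed
    have "prob (Bad n) \<le> prob (\<Union>k\<in>{1..Suc m}. \<Union>i\<in>{..R n}. P n k i) + prob (\<Union>i\<in>{..R n}. E n i)"
      unfolding Bad_def by (rule measure_Un_le) (use mE in auto)
    also have "prob (\<Union>k\<in>{1..Suc m}. \<Union>i\<in>{..R n}. P n k i) \<le> (\<Sum>k\<in>{1..Suc m}. prob (\<Union>i\<in>{..R n}. P n k i))"
      by (rule finite_measure_subadditive_finite) auto
    also have "\<dots> \<le> (\<Sum>k\<in>{1..Suc m}. real (Suc N) * 2 ^ n * (K * exp (- ((1 + \<delta>) * ly n))))"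
      by (intro sum_mono uni prP[OF n]) (use K_pos in auto)
    also have "\<dots> = real (Suc m) * real (Suc N) * K * (2 ^ n * exp (- ((1 + \<delta>) * ly n)))" by simp
    also have "2 ^ n * exp (- ((1 + \<delta>) * ly n)) = (2 powr (- \<delta>)) ^ n" by (rule e2)
    also have "prob (\<Union>i\<in>{..R n}. E n i) \<le> real (Suc N) * 2 ^ n * (K * exp (- (2 * ly n)))"
      by (intro uni E(2)[OF n] mE) (use K_pos in auto)
    also have "\<dots> = real (Suc N) * K * (2 ^ n * exp (- ((1 + 1) * ly n)))" by simp
    also have "2 ^ n * exp (- ((1 + 1) * ly n)) = (2 powr (- 1)) ^ n" by (rule e2)
    finally show "prob (Bad n) \<le> real (Suc m) * real (Suc N) * K * (2 powr (- \<delta>)) ^ n + real (Suc N) * K * (2 powr (- 1)) ^ n" by simp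
  next
    have "2 powr (- \<delta>) < 2 powr 0" using \<delta> by (intro powr_less_mono) auto
    thus "summable (\<lambda>n. real (Suc m) * real (Suc N) * K * (2 powr (- \<delta>)) ^ n + real (Suc N) * K * (2 powr (- 1)) ^ n)"
      by (intro summable_add summable_mult summable_geometric) (auto simp: powr_minus)
  qed
  thus ?thesis
  proof eventually_elim
    case (elim \<omega>)
    have "eventually (\<lambda>n. (1 + \<delta>) * ln (real m) \<le> \<delta> * (real n * ln 2)) sequentially"
      using \<delta> by real_asymp
    hence "eventually (\<lambda>n. \<omega> \<in> space M - Bad n \<and> (1 + \<delta>) * ln (real m) \<le> \<delta> * ly n \<and> n0 \<le> n) sequentially"
      using elim eventually_ge_at_top[of n0] by eventually_elim (auto simp: ly_def)
    then obtain n2 where n2: "\<And>n. n2 \<le> n \<Longrightarrow> \<omega> \<in> space M - Bad n \<and> (1 + \<delta>) * ln (real m) \<le> \<delta> * ly n \<and> n0 \<le> n"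
      by (auto simp: eventually_sequentially)
    show ?case
    proof (intro exI[of _ "real m * (1 / 2) ^ n2"] conjI allI impI ballI)
      show "0 < real m * (1 / 2) ^ n2" using mpos by simp
      fix h s t assume h: "0 < h \<and> h < real m * (1 / 2) ^ n2" and s: "s \<in> {0..T}" and t: "t \<in> {0..T}" and st: "\<bar>s - t\<bar> \<le> h"
      have h0: "0 < h" using h by simp
      have "h / real m \<le> (1 / 2) ^ n2" using h mpos by (simp add: pos_divide_le_eq mult.commute)
      then obtain n where n: "n2 \<le> n" "(1 / 2) ^ Suc n < h / real m" "h / real m \<le> (1 / 2) ^ n"
        using geometric_bracket[of "1 / 2" "h / real m" n2] h0 mpos by auto
      have w: "\<omega> \<in> space M - Bad n" and l1: "(1 + \<delta>) * ln (real m) \<le> \<delta> * ly n" and nn: "n0 \<le> n"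
        using n2[OF n(1)] by auto
      have n1: "1 \<le> n" using n0[OF nn] by simp
      define q where "q = (1 / 2 :: real) ^ n"
      have q0: "0 < q" by (simp add: q_def)
      have q1: "1 / 2 ^ n = q" by (simp add: q_def power_divide)
      have qh: "q < 2 * h / real m" "h \<le> real m * q"
        using n mpos by (auto simp: q_def pos_divide_le_eq mult.commute)
      have ly1: "1 / 2 \<le> ly n"
      proof -
        have "1 / 2 \<le> ln (2::real)" using ln2_ge_two_thirds by simp
        also have "ln 2 \<le> real n * ln 2" using n1 by simp
        finally show ?thesis by (simp add: ly_def)
      qed
      define r where "r = sqrt (ly n)"
      have r0: "0 < r" using ly1 by (simp add: r_def)
      have r2: "sqrt (2 * ly n) + 1 \<le> 4 * r"
        unfolding r_def by (rule sqrt_double_plus_one_le[OF ly1])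
      define ix where "ix x = nat \<lfloor>x * 2 ^ n\<rfloor>" for x :: real
      have ix: "real (ix x) / 2 ^ n \<le> x" "x < real (ix x) / 2 ^ n + 1 / 2 ^ n" "ix x \<le> R n"
        "real (ix x) \<le> x * 2 ^ n" "x * 2 ^ n < real (ix x) + 1" if "x \<in> {0..T}" for x
      proof -
        have "0 \<le> x * 2 ^ n" using that by simp
        hence e: "real (ix x) = of_int \<lfloor>x * 2 ^ n\<rfloor>" unfolding ix_def by (subst of_nat_nat) auto
        thus a: "real (ix x) \<le> x * 2 ^ n" "x * 2 ^ n < real (ix x) + 1" by linarith+
        show "real (ix x) / 2 ^ n \<le> x" using a by (simp add: pos_divide_le_eq)
        have "x < (real (ix x) + 1) / 2 ^ n" using a by (simp add: pos_less_divide_eq)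
        thus "x < real (ix x) / 2 ^ n + 1 / 2 ^ n" by (simp add: add_divide_distrib)
        have "x * 2 ^ n \<le> real N * 2 ^ n" using that TN by (intro mult_right_mono) auto
        moreover have "real (R n) = real N * 2 ^ n" by (simp add: R_def)
        ultimately have "real (ix x) \<le> real (R n)" using a(1) by linarith
        thus "ix x \<le> R n" by (simp only: of_nat_le_iff)
      qed
      have near: "\<bar>V x \<omega> - V (real (ix x) / 2 ^ n) \<omega>\<bar> \<le> C1 * q powr (\<gamma> / 2) * (4 * r)" if x: "x \<in> {0..T}" for x
      proof -
        have "\<omega> \<in> space M - E n (ix x)" using w ix(3)[OF x] by (auto simp: Bad_def)
        from E4[OF nn this ix(1,2)[OF x]]
        have "\<bar>V x \<omega> - V (real (ix x) / 2 ^ n) \<omega>\<bar> \<le> C1 * q powr (\<gamma> / 2) * (sqrt (2 * ly n) + 1)" unfolding q1 .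
        also have "\<dots> \<le> C1 * q powr (\<gamma> / 2) * (4 * r)" using r2 C1 by (intro mult_left_mono) auto
        finally show ?thesis .
      qed
      \<comment> \<open>Rounding both points to the grid enlarges their distance by at most one grid
        step \<open>q < 2 h / m\<close>.\<close>
      define B where "B = h * (1 + 2 / real m)"
      have B0: "0 < B" using h0 mpos by (simp add: B_def add_pos_pos)
      have B: "h + q \<le> B"
      proof -
        have "B = h + 2 * h / real m" by (simp add: B_def distrib_left)
        thus ?thesis using add_left_mono[OF less_imp_le[OF qh(1)], of h] by simp
      qed
      have grid: "\<bar>V (real i / 2 ^ n) \<omega> - V (real (i + k) / 2 ^ n) \<omega>\<bar> \<le> sqrt a * (1 + \<delta>) powr (1 / 2) * B powr (\<gamma> / 2) * r"
        if i: "i \<le> R n" and k: "real k < real m + 1 + 1" "real k / 2 ^ n \<le> B" for i k :: nat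
      proof (cases "k = 0")
        case True
        thus ?thesis using sa \<delta> r0 by simp
      next
        case False
        have "k \<le> Suc m" using k(1) by linarith
        hence "\<omega> \<notin> P n k i" using w i False unfolding Bad_def by force
        hence "(V (real i / 2 ^ n) \<omega> - V (real (i + k) / 2 ^ n) \<omega>)\<^sup>2 \<le> a * (real k / 2 ^ n) powr \<gamma> * ((1 + \<delta>) * ly n)"
          using w by (auto simp: P_def)
        also have "\<dots> \<le> a * B powr \<gamma> * ((1 + \<delta>) * ly n)"
          using k(2) a_pos g_pos \<delta> ly0[of n] by (intro mult_right_mono mult_left_mono powr_mono2) auto
        also have "\<dots> = (sqrt a * (1 + \<delta>) powr (1 / 2) * B powr (\<gamma> / 2) * r)\<^sup>2"
        proof -
          have "(B powr (\<gamma> / 2))\<^sup>2 = B powr \<gamma>" using B0 by (simp add: powr_half_eq_sqrt)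
          moreover have "((1 + \<delta>) powr (1 / 2))\<^sup>2 = 1 + \<delta>" using \<delta> by (simp add: powr_half_sqrt)
          ultimately show ?thesis using a_pos ly0[of n] by (simp add: power_mult_distrib r_def)
        qed
        finally show ?thesis
          using sa \<delta> r0 by (simp add: abs_le_square_iff[symmetric] abs_of_nonneg)
      qed
      have grid2: "\<bar>V (real (ix x) / 2 ^ n) \<omega> - V (real (ix y) / 2 ^ n) \<omega>\<bar> \<le> sqrt a * (1 + \<delta>) powr (1 / 2) * B powr (\<gamma> / 2) * r"
        if x: "x \<in> {0..T}" and y: "y \<in> {0..T}" and le: "ix x \<le> ix y" and xy: "\<bar>x - y\<bar> \<le> h" for x y
      proof -
        define k where "k = ix y - ix x"
        have yk: "ix y = ix x + k" using le by (simp add: k_def)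
        have "real k = real (ix y) - real (ix x)" using le by (simp add: k_def of_nat_diff)
        hence "real k < y * 2 ^ n - x * 2 ^ n + 1" using ix(4)[OF y] ix(5)[OF x] by linarith
        also have "y * 2 ^ n - x * 2 ^ n \<le> h * 2 ^ n"
        proof -
          have "(y - x) * 2 ^ n \<le> h * 2 ^ n" using xy by (intro mult_right_mono) auto
          thus ?thesis by (simp add: left_diff_distrib)
        qed
        finally have k1: "real k < h * 2 ^ n + 1" by simp
        have hq: "h * 2 ^ n \<le> real m"
        proof -
          have "h * 2 ^ n \<le> (real m * q) * 2 ^ n" using qh(2) by (intro mult_right_mono) auto
          also have "\<dots> = real m" by (simp add: q1[symmetric])
          finally show ?thesis .
        qed
        have "real k / 2 ^ n \<le> (h * 2 ^ n + 1) / 2 ^ n" using k1 by (intro divide_right_mono) auto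
        also have "\<dots> = h + q" by (simp add: add_divide_distrib q1)
        finally have "real k / 2 ^ n \<le> B" using B by linarith
        with k1 hq show ?thesis unfolding yk by (intro grid ix(3)[OF x]) auto
      qed
      have g3: "\<bar>V (real (ix s) / 2 ^ n) \<omega> - V (real (ix t) / 2 ^ n) \<omega>\<bar> \<le> sqrt a * (1 + \<delta>) powr (1 / 2) * B powr (\<gamma> / 2) * r"
        using grid2[OF s t _ st] grid2[OF t s] st by (cases "ix s \<le> ix t") (auto simp: abs_minus_commute)
      define l where "l = ln (1 / h)"
      have lyl: "ly n \<le> (1 + \<delta>) * l"
      proof -
        have "1 / (real m * q) \<le> 1 / h" using qh h0 by (intro frac_le) auto
        hence "ln (1 / (real m * q)) \<le> l" unfolding l_def using h0 mpos q0 by (subst ln_le_cancel_iff) auto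
        moreover have "ln (1 / (real m * q)) = ly n - ln (real m)"
          using mpos q0 by (simp add: ln_div ln_mult q_def ln_realpow ly_def)
        ultimately have "(1 + \<delta>) * (ly n - ln (real m)) \<le> (1 + \<delta>) * l" using \<delta> by (intro mult_left_mono) auto
        thus ?thesis using l1 by (simp add: algebra_simps)
      qed
      have l0: "0 \<le> l"
      proof -
        have "0 < (1 + \<delta>) * l" using lyl ly1 by linarith
        thus ?thesis using \<delta> by (simp add: zero_less_mult_iff)
      qed
      define z where "z = (1 + \<delta>) powr (1 / 2)"
      have z: "1 \<le> z" "z * z = 1 + \<delta>" "z \<le> 1 + \<delta>"
      proof -
        show "1 \<le> z" unfolding z_def using \<delta> by (intro ge_one_powr_ge_zero) auto
        show zz: "z * z = 1 + \<delta>" using \<delta> by (simp add: z_def flip: powr_add)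
        have "z * 1 \<le> z * z" using \<open>1 \<le> z\<close> by (intro mult_left_mono) auto
        thus "z \<le> 1 + \<delta>" using zz by simp
      qed
      have rl: "r \<le> z * sqrt l"
      proof -
        have "r \<le> sqrt ((1 + \<delta>) * l)" unfolding r_def using lyl by simp
        also have "\<dots> = sqrt (1 + \<delta>) * sqrt l" by (rule real_sqrt_mult)
        also have "sqrt (1 + \<delta>) = z" using \<delta> by (simp add: z_def powr_half_sqrt)
        finally show ?thesis .
      qed
      define H where "H = h powr (\<gamma> / 2)"
      have H0: "0 \<le> H" by (simp add: H_def)
      have Bp: "B powr (\<gamma> / 2) = H * (1 + 2 / real m) powr (\<gamma> / 2)" unfolding B_def H_def by (rule powr_mult)
      have qp: "q powr (\<gamma> / 2) \<le> H * (2 powr (\<gamma> / 2) * real m powr (- (\<gamma> / 2)))"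
      proof -
        have "q powr (\<gamma> / 2) \<le> (h * (2 * (1 / real m))) powr (\<gamma> / 2)" using qh q0 g_pos by (intro powr_mono2) (auto simp: mult.commute)
        also have "\<dots> = H * (2 powr (\<gamma> / 2) * (1 / real m) powr (\<gamma> / 2))" by (simp only: powr_mult H_def)
        also have "(1 / real m) powr (\<gamma> / 2) = real m powr (- (\<gamma> / 2))"
          using mpos by (simp add: powr_divide powr_minus_divide)
        finally show ?thesis .
      qed
      have "\<bar>V s \<omega> - V t \<omega>\<bar> \<le> sqrt a * z * B powr (\<gamma> / 2) * r + 8 * C1 * q powr (\<gamma> / 2) * r"
        using near[OF s] near[OF t] g3 unfolding z_def by linarith
      also have "\<dots> \<le> sqrt a * z * B powr (\<gamma> / 2) * (z * sqrt l) + 8 * C1 * (H * (2 powr (\<gamma> / 2) * real m powr (- (\<gamma> / 2)))) * ((1 + \<delta>) * sqrt l)"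
      proof (intro add_mono mult_mono)
        have "z * sqrt l \<le> (1 + \<delta>) * sqrt l" using z l0 by (intro mult_right_mono) auto
        thus "r \<le> (1 + \<delta>) * sqrt l" using rl by linarith
      qed (use rl qp sa z C1 H0 r0 in \<open>auto intro!: mult_nonneg_nonneg\<close>)
      also have "\<dots> = (sqrt a * (z * z) * (1 + 2 / real m) powr (\<gamma> / 2) + 8 * C1 * (1 + \<delta>) * (2 powr (\<gamma> / 2) * real m powr (- (\<gamma> / 2)))) * (H * sqrt l)"
        unfolding Bp by (simp add: algebra_simps)
      also have "\<dots> \<le> c * (H * sqrt l)" unfolding z(2) using m(2) H0 l0 by (intro mult_right_mono) auto
      also have "H * sqrt l = sqrt (h powr \<gamma> * ln (1 / h))"
        using h0 by (simp add: H_def l_def powr_half_eq_sqrt real_sqrt_mult)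
      finally show "\<bar>V s \<omega> - V t \<omega>\<bar> \<le> c * sqrt (h powr \<gamma> * ln (1 / h))" .
    qed
  qed
qed

end

section \<open>Divergence of weakly correlated sums\<close>

text \<open>
  A second Borel-Cantelli lemma. By the row sum bound on \<open>b\<close> the variance of a
  partial sum is at most \<open>R\<close> times its mean \<open>m n\<close>, so Chebyshev's
  inequality bounds the probability that the partial sum stays below half its mean by \<open>4 R /
  m n\<close>.
\<close>
lemma (in prob_space) weakly_correlated_sum_diverges:
  fixes Z :: "nat \<Rightarrow> 'a \<Rightarrow> real" and b :: "nat \<Rightarrow> nat \<Rightarrow> real"
  assumes Zm [measurable]: "\<And>i. Z i \<in> borel_measurable M"
    and Z: "\<And>i \<omega>. \<omega> \<in> space M \<Longrightarrow> 0 \<le> Z i \<omega> \<and> Z i \<omega> \<le> 1"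
    and cov: "\<And>i j. (LINT \<omega>|M. Z i \<omega> * Z j \<omega>) - (LINT \<omega>|M. Z i \<omega>) * (LINT \<omega>|M. Z j \<omega>) \<le> b i j * (((LINT \<omega>|M. Z i \<omega>) + (LINT \<omega>|M. Z j \<omega>)) / 2)"
    and b: "\<And>i j. 0 \<le> b i j" "\<And>i j. b i j = b j i" "\<And>i n. (\<Sum>j<n. b i j) \<le> R"
    and div: "\<not> summable (\<lambda>i. LINT \<omega>|M. Z i \<omega>)"
  shows "AE \<omega> in M. \<forall>B. \<exists>n. B < (\<Sum>i<n. Z i \<omega>)"
proof -
  define e where "e i = (LINT \<omega>|M. Z i \<omega>)" for i
  define m where "m n = (\<Sum>i<n. e i)" for n
  define S where "S n \<omega> = (\<Sum>i<n. Z i \<omega>)" for n \<omega>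
  have [measurable]: "S n \<in> borel_measurable M" for n unfolding S_def by measurable
  have Zi: "integrable M (Z i)" for i by (rule integrable_const_bound[where B=1]) (use Z in \<open>auto intro!: AE_I2\<close>)
  have ZZ: "integrable M (\<lambda>\<omega>. Z i \<omega> * Z j \<omega>)" for i j
    by (rule integrable_const_bound[where B=1]) (use Z in \<open>auto intro!: AE_I2 mult_le_one simp: abs_mult\<close>)
  have e0: "0 \<le> e i" for i unfolding e_def by (rule integral_nonneg_AE) (use Z in \<open>auto intro!: AE_I2\<close>)
  have R0: "0 \<le> R" using b(3)[of 0 0] by simp
  have mdiv: "\<exists>n. K < m n" for K
  proof (rule ccontr)
    assume "\<not> ?thesis"
    hence "m (Suc n) \<le> K" for n by (auto simp: not_less)
    hence "(\<Sum>i\<le>n. e i) \<le> K" for n by (simp only: m_def lessThan_Suc_atMost)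
    hence "summable e" by (intro bounded_imp_summable[of e K] e0)
    thus False using div by (simp add: e_def[abs_def])
  qed
  have var: "(LINT \<omega>|M. (S n \<omega> - m n)\<^sup>2) \<le> R * m n" for n
  proof -
    have sq: "(S n \<omega> - m n)\<^sup>2 = (\<Sum>i<n. \<Sum>j<n. Z i \<omega> * Z j \<omega> - e j * Z i \<omega> - e i * Z j \<omega> + e i * e j)" for \<omega>
    proof -
      have "S n \<omega> - m n = (\<Sum>i<n. Z i \<omega> - e i)" by (simp add: S_def m_def sum_subtractf)
      hence "(S n \<omega> - m n)\<^sup>2 = (\<Sum>i<n. \<Sum>j<n. (Z i \<omega> - e i) * (Z j \<omega> - e j))" by (simp only: power2_eq_square sum_product)
      thus ?thesis by (simp add: algebra_simps)
    qed
    have "(LINT \<omega>|M. (S n \<omega> - m n)\<^sup>2) = (\<Sum>i<n. \<Sum>j<n. (LINT \<omega>|M. Z i \<omega> * Z j \<omega> - e j * Z i \<omega> - e i * Z j \<omega> + e i * e j))"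
      unfolding sq by (simp add: Bochner_Integration.integral_sum ZZ Zi)
    also have "\<dots> = (\<Sum>i<n. \<Sum>j<n. (LINT \<omega>|M. Z i \<omega> * Z j \<omega>) - e i * e j)"
    proof (intro sum.cong refl)
      fix i j
      show "(LINT \<omega>|M. Z i \<omega> * Z j \<omega> - e j * Z i \<omega> - e i * Z j \<omega> + e i * e j) = (LINT \<omega>|M. Z i \<omega> * Z j \<omega>) - e i * e j"
        using ZZ[of i j] Zi[of i] Zi[of j] by (simp add: e_def[symmetric] prob_space algebra_simps)
    qed
    also have "\<dots> \<le> (\<Sum>i<n. \<Sum>j<n. b i j * e i / 2 + b i j * e j / 2)"
      using cov by (intro sum_mono) (simp add: e_def algebra_simps add_divide_distrib)
    also have "\<dots> = (\<Sum>i<n. \<Sum>j<n. b i j * e i / 2) + (\<Sum>i<n. \<Sum>j<n. b i j * e j / 2)"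
      by (simp add: sum.distrib)
    also have "(\<Sum>i<n. \<Sum>j<n. b i j * e j / 2) = (\<Sum>i<n. \<Sum>j<n. b i j * e i / 2)"
      by (subst sum.swap) (intro sum.cong refl, metis b(2))
    also have "(\<Sum>i<n. \<Sum>j<n. b i j * e i / 2) + (\<Sum>i<n. \<Sum>j<n. b i j * e i / 2) = (\<Sum>i<n. (\<Sum>j<n. b i j) * e i)"
      by (simp add: sum_distrib_left mult.commute flip: sum.distrib)
    also have "\<dots> \<le> (\<Sum>i<n. R * e i)" by (intro sum_mono mult_right_mono b(3) e0)
    also have "\<dots> = R * m n" by (simp add: m_def sum_distrib_left)
    finally show ?thesis .
  qed
  have zero: "prob {\<omega> \<in> space M. \<forall>n. S n \<omega> \<le> B} = 0" for B
  proof -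
    let ?A = "{\<omega> \<in> space M. \<forall>n. S n \<omega> \<le> B}"
    have bound: "prob ?A \<le> 4 * R / K" if K: "0 < K" for K
    proof -
      obtain n where n: "max K (2 * \<bar>B\<bar>) < m n" using mdiv by blast
      hence mn: "0 < m n" "K < m n" "B \<le> m n / 2" using K by auto
      have "?A \<subseteq> {\<omega> \<in> space M. (m n / 2)\<^sup>2 \<le> (S n \<omega> - m n)\<^sup>2}"
      proof safe
        fix \<omega> assume "\<omega> \<in> space M" "\<forall>n. S n \<omega> \<le> B"
        hence "m n / 2 \<le> m n - S n \<omega>" using mn(3) by (smt (verit) field_sum_of_halves)
        hence "(m n / 2)\<^sup>2 \<le> (m n - S n \<omega>)\<^sup>2" using mn by (intro power_mono) auto
        thus "(m n / 2)\<^sup>2 \<le> (S n \<omega> - m n)\<^sup>2" by (simp add: power2_commute)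
      qed
      hence "prob ?A \<le> prob {\<omega> \<in> space M. (m n / 2)\<^sup>2 \<le> (S n \<omega> - m n)\<^sup>2}"
        by (rule finite_measure_mono) measurable
      also have "\<dots> \<le> (LINT \<omega>|M. (S n \<omega> - m n)\<^sup>2) / (m n / 2)\<^sup>2"
      proof (rule integral_Markov_inequality_measure[where A="{}"])
        have "integrable M (S n)" unfolding S_def using Zi by simp
        moreover have "\<bar>S n \<omega> - m n\<bar> \<le> real n + m n" if "\<omega> \<in> space M" for \<omega>
        proof -
          have "S n \<omega> \<le> (\<Sum>i<n. 1)" unfolding S_def by (rule sum_mono) (use Z that in auto)
          moreover have "0 \<le> S n \<omega>" unfolding S_def by (rule sum_nonneg) (use Z that in auto)
          ultimately show ?thesis using mn by simp
        qed
        hence "(S n \<omega> - m n)\<^sup>2 \<le> (real n + m n)\<^sup>2" if "\<omega> \<in> space M" for \<omega>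
          using that mn by (intro abs_le_square_iff[THEN iffD1]) auto
        thus "integrable M (\<lambda>\<omega>. (S n \<omega> - m n)\<^sup>2)"
          by (intro integrable_const_bound[where B="(real n + m n)\<^sup>2"]) (auto intro!: AE_I2)
      qed (use mn in auto)
      also have "\<dots> \<le> (R * m n) / (m n / 2)\<^sup>2" by (rule divide_right_mono[OF var]) simp
      also have "\<dots> = 4 * R / m n" using mn by (simp add: power2_eq_square)
      also have "\<dots> \<le> 4 * R / K" using mn R0 K by (intro divide_left_mono) auto
      finally show ?thesis .
    qed
    have "prob ?A \<le> 0 + \<epsilon>" if "0 < \<epsilon>" for \<epsilon>
    proof -
      have "prob ?A \<le> 4 * R / ((4 * R + 1) / \<epsilon>)" using that R0 by (intro bound) simp
      also have "\<dots> \<le> \<epsilon>" using that R0 by (simp add: field_simps)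
      finally show ?thesis by simp
    qed
    hence "prob ?A \<le> 0" by (rule field_le_epsilon)
    thus ?thesis by (simp add: measure_le_0_iff)
  qed
  have "AE \<omega> in M. \<exists>n. real B < S n \<omega>" for B :: nat
  proof -
    have "{\<omega> \<in> space M. \<not> (\<exists>n. real B < S n \<omega>)} = {\<omega> \<in> space M. \<forall>n. S n \<omega> \<le> real B}" by (auto simp: not_less)
    thus ?thesis using zero[of "real B"] by (intro AE_I[of _ _ "{\<omega> \<in> space M. \<forall>n. S n \<omega> \<le> real B}"]) (auto simp: emeasure_eq_measure)
  qed
  hence "AE \<omega> in M. \<forall>B :: nat. \<exists>n. real B < S n \<omega>" by (simp add: AE_all_countable)
  thus ?thesis
  proof eventually_elim
    case (elim \<omega>)
    show ?case
    proof
      fix B :: real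
      obtain k :: nat where "B \<le> real k" using real_arch_simple by blast
      thus "\<exists>n. B < (\<Sum>i<n. Z i \<omega>)" using elim[rule_format, of k] by (auto simp: S_def intro: le_less_trans)
    qed
  qed
qed

section \<open>Marginals of permanental processes\<close>

lemma det_two:
  fixes A :: "'a :: comm_ring_1 mat"
  assumes A: "A \<in> carrier_mat 2 2"
  shows "Determinant.det A = A $$ (0, 0) * A $$ (1, 1) - A $$ (0, 1) * A $$ (1, 0)"
proof -
  have d: "Determinant.det (Matrix.mat (Suc 0) (Suc 0) f) = f (0, 0)" for f :: "nat \<times> nat \<Rightarrow> 'a"
    by (subst det_single) auto
  have "Determinant.det A = (\<Sum>j<2. A $$ (0, j) * cofactor A 0 j)"
    by (rule laplace_expansion_row[OF A]) simp
  also have "\<dots> = A $$ (0, 0) * A $$ (1, 1) - A $$ (0, 1) * A $$ (1, 0)"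
    using A by (simp add: cofactor_def d numeral_2_eq_2 mat_delete_def)
  finally show ?thesis .
qed

lemma permanental_process_nonneg:
  assumes "permanental_process M \<alpha> T Y u" and "t \<in> T" and "\<omega> \<in> space M"
  shows "0 \<le> Y t \<omega>"
  using assms(1)[unfolded permanental_process_def, rule_format, of 1 "\<lambda>_. t"] assms(2,3)
  by (auto simp: permanental_vector_def)

lemma permanental_process_single:
  assumes Y: "permanental_process M \<alpha> T Y u" and M: "prob_space M" and pos: "0 < \<alpha>" "0 < u t t" and t: "t \<in> T"
  shows "gamma_variable M (Y t) \<alpha> (u t t)"
proof (rule gamma_variable.intro[OF M], rule gamma_variable_axioms.intro)
  have pv: "permanental_vector M \<alpha> 1 (\<lambda>i. Y t) (Matrix.mat 1 1 (\<lambda>(i, j). u t t))"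
    using Y[unfolded permanental_process_def, rule_format, of 1 "\<lambda>_. t"] t by simp
  show "Y t \<in> borel_measurable M" using pv unfolding permanental_vector_def by auto
  show "0 \<le> Y t \<omega>" if "\<omega> \<in> space M" for \<omega> by (rule permanental_process_nonneg[OF Y t that])
  fix s :: real assume s: "0 < s"
  have "Determinant.det (1\<^sub>m 1 + Matrix.mat 1 1 (\<lambda>(i, j). u t t) * mat_diag 1 (\<lambda>_. s)) = 1 + u t t * s"
  proof -
    have "Matrix.mat 1 1 (\<lambda>(i, j). u t t) * mat_diag 1 (\<lambda>_. s) = Matrix.mat 1 1 (\<lambda>(i, j). u t t * s)"
      by (subst mat_diag_mult_right[where n=1 and nr=1]) (auto intro!: eq_matI)
    thus ?thesis by (subst det_single) auto
  qed
  thus "(LINT \<omega>|M. exp (- (s * Y t \<omega>))) = (1 + u t t * s) powr (- \<alpha>)"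
    using pv[unfolded permanental_vector_def, THEN conjunct2, THEN conjunct2, rule_format, of "\<lambda>_. s"] s by simp
qed (fact pos)+

text \<open>
  The determinant in the definition is required to be positive for all positive arguments. Its
  leading coefficient along the diagonal is \<open>\<kappa>\<close>, which therefore cannot be
  negative.
\<close>
lemma permanental_process_pair:
  assumes Y: "permanental_process M \<alpha> T Y u" and M: "prob_space M" and \<alpha>: "0 < \<alpha>" and v: "0 < v"
    and st: "s \<in> T" "t \<in> T" and uv: "u s s = v" "u t t = v"
  shows "gamma_pair M (Y s) (Y t) \<alpha> v (v\<^sup>2 - u s t * u t s)"
proof -
  define \<tau> where "\<tau> i = (if i = 0 then s else t)" for i :: nat
  let ?U = "Matrix.mat 2 2 (\<lambda>(i, j). u (\<tau> i) (\<tau> j))"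
  have pv: "permanental_vector M \<alpha> 2 (\<lambda>i. Y (\<tau> i)) ?U"
    using Y[unfolded permanental_process_def, rule_format, of 2 \<tau>] st by (simp add: \<tau>_def)
  define \<sigma> where "\<sigma> s1 s2 i = (if i = 0 then s1 else s2)" for s1 s2 :: real and i :: nat
  have det: "Determinant.det (1\<^sub>m 2 + ?U * mat_diag 2 (\<sigma> s1 s2)) = 1 + v * s1 + v * s2 + (v\<^sup>2 - u s t * u t s) * s1 * s2" for s1 s2
  proof -
    have "?U * mat_diag 2 (\<sigma> s1 s2) = Matrix.mat 2 2 (\<lambda>(i, j). u (\<tau> i) (\<tau> j) * \<sigma> s1 s2 j)"
      by (subst mat_diag_mult_right[where n=2 and nr=2]) (auto intro!: eq_matI)
    thus ?thesis
      by (subst det_two) (auto simp: \<tau>_def \<sigma>_def uv algebra_simps power2_eq_square)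
  qed
  have main: "0 < 1 + v * s1 + v * s2 + (v\<^sup>2 - u s t * u t s) * s1 * s2 \<and>
     (LINT \<omega>|M. exp (- (s1 * Y s \<omega> + s2 * Y t \<omega>))) = (1 + v * s1 + v * s2 + (v\<^sup>2 - u s t * u t s) * s1 * s2) powr (- \<alpha>)"
    if "0 < s1" "0 < s2" for s1 s2
    using pv[unfolded permanental_vector_def, THEN conjunct2, THEN conjunct2, rule_format, of "\<sigma> s1 s2"] that
    unfolding det by (simp add: \<sigma>_def \<tau>_def numeral_2_eq_2)
  have "0 \<le> v\<^sup>2 - u s t * u t s"
  proof (rule ccontr)
    define k where "k = - (v\<^sup>2 - u s t * u t s)"
    assume "\<not> ?thesis"
    hence k: "0 < k" by (simp add: k_def)
    define x where "x = max 1 ((1 + 2 * v) / k)"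
    have x: "1 \<le> x" "1 + 2 * v \<le> k * x"
    proof -
      have "(1 + 2 * v) / k \<le> x" by (simp add: x_def)
      thus "1 + 2 * v \<le> k * x" using k by (simp add: pos_divide_le_eq mult.commute)
    qed (simp add: x_def)
    have "0 < 1 + v * x + v * x + (v\<^sup>2 - u s t * u t s) * x * x" using main[of x x] x by simp
    also have "\<dots> = 1 + 2 * v * x - k * x * x" by (simp add: k_def algebra_simps)
    also have "\<dots> \<le> (1 + 2 * v - k * x) * x" using x(1) by (simp add: algebra_simps)
    also have "\<dots> \<le> 0" using x by (intro mult_nonpos_nonneg) auto
    finally show False by simp
  qed
  thus ?thesis
    using permanental_process_single[OF Y M \<alpha>, of s] permanental_process_single[OF Y M \<alpha>, of t] uv v st main
    by (intro gamma_pair.intro[OF M] gamma_pair_axioms.intro) auto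
qed

section \<open>Permanental processes with a stable kernel\<close>

context
  fixes M :: "'a measure" and Y :: "real \<Rightarrow> 'a \<Rightarrow> real" and \<alpha> \<beta> \<gamma> \<rho> :: real
  assumes g: "0 < \<gamma>" "\<gamma> < 1" and \<rho>: "0 < \<rho>" and \<alpha>: "0 < \<alpha>"
    and PM: "prob_space M"
    and Y: "permanental_process M \<alpha> {0..} Y (u_dens \<rho> \<gamma> \<beta>)"
    and Ycont: "\<forall>\<omega>\<in>space M. continuous_on {0..} (\<lambda>x. Y x \<omega>)"
begin

private lemma diag: "u_dens \<rho> \<gamma> \<beta> t t = D_const \<rho> \<gamma> \<beta>"
  by (rule D_const_eq[symmetric])

private lemma D_pos: "0 < D_const \<rho> \<gamma> \<beta>"
  using u_dens_diag_pos[OF g \<rho>, of \<beta> 0] diag by simp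

private lemma Y_gamma: "0 \<le> t \<Longrightarrow> gamma_variable M (Y t) \<alpha> (D_const \<rho> \<gamma> \<beta>)"
  using permanental_process_single[OF Y PM \<alpha>, of t] diag D_pos by simp

private lemma Y_pair:
  "0 \<le> s \<Longrightarrow> 0 \<le> t \<Longrightarrow> gamma_pair M (Y s) (Y t) \<alpha> (D_const \<rho> \<gamma> \<beta>)
    ((D_const \<rho> \<gamma> \<beta>)\<^sup>2 - u_dens \<rho> \<gamma> \<beta> s t * u_dens \<rho> \<gamma> \<beta> t s)"
  using permanental_process_pair[OF Y PM \<alpha> D_pos, of s t] diag by simp

private lemma Y_meas: "0 \<le> t \<Longrightarrow> Y t \<in> borel_measurable M"
  and Y_nonneg: "0 \<le> t \<Longrightarrow> \<omega> \<in> space M \<Longrightarrow> 0 \<le> Y t \<omega>"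
  using gamma_variable.X_meas[OF Y_gamma] gamma_variable.X_nonneg[OF Y_gamma] by auto

text \<open>
  Combines \<open>pair_tail\<close> and \<open>kernel_gap_upper\<close>. Both lose a factor close
  to one, which is accommodated in the gap between \<open>2 * C_const \<gamma> \<beta>\<close> and
  \<open>a\<close>.
\<close>
private lemma sqrt_increments:
  assumes a: "2 * C_const \<gamma> \<beta> < a"
  obtains K d0 where "exp_square_increments M (\<lambda>t \<omega>. sqrt (Y t \<omega>)) a \<gamma> K d0"
proof -
  interpret prob_space M by (rule PM)
  define u where "u = D_const \<rho> \<gamma> \<beta>"
  have u: "0 < u" unfolding u_def by (rule D_pos)
  have C: "0 < C_const \<gamma> \<beta>" by (rule C_const_pos[OF g])
  have a0: "0 < a" using a C by simp
  have "((\<lambda>\<eta>. (1 - \<eta>)\<^sup>2 * a) \<longlongrightarrow> (1 - 0)\<^sup>2 * a) (at_right 0)" by (intro tendsto_intros)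
  hence "eventually (\<lambda>\<eta>. 2 * C_const \<gamma> \<beta> < (1 - \<eta>)\<^sup>2 * a) (at_right 0)"
    using a by (intro order_tendstoD(1)) auto
  moreover have "eventually (\<lambda>\<eta>::real. \<eta> \<in> {0<..<1}) (at_right 0)" by (rule eventually_at_right_real) simp
  ultimately have "eventually (\<lambda>\<eta>. 2 * C_const \<gamma> \<beta> < (1 - \<eta>)\<^sup>2 * a \<and> \<eta> \<in> {0<..<1}) (at_right 0)"
    by (rule eventually_conj)
  from eventually_happens'[OF trivial_limit_at_right_real this]
  obtain \<eta> where \<eta>: "0 < \<eta>" "\<eta> < 1" "2 * C_const \<gamma> \<beta> < (1 - \<eta>)\<^sup>2 * a" by auto
  define \<epsilon> where "\<epsilon> = ((1 - \<eta>)\<^sup>2 * a - 2 * C_const \<gamma> \<beta>) / 2"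
  have \<epsilon>: "0 < \<epsilon>" using \<eta> by (simp add: \<epsilon>_def)
  obtain d0 where d0: "0 < d0" "\<And>s t. s \<noteq> t \<Longrightarrow> \<bar>s - t\<bar> \<le> d0 \<Longrightarrow>
     (u_dens \<rho> \<gamma> \<beta> 0 0)\<^sup>2 - u_dens \<rho> \<gamma> \<beta> s t * u_dens \<rho> \<gamma> \<beta> t s
      \<le> 2 * u_dens \<rho> \<gamma> \<beta> 0 0 * (C_const \<gamma> \<beta> + \<epsilon>) * \<bar>s - t\<bar> powr \<gamma>"
    using kernel_gap_upper[OF g \<rho> \<epsilon>, of \<beta>] by blast
  define K where "K = 2 * tail_const \<alpha> \<eta>"
  have K: "0 < K" using tail_const_ge_1[OF \<alpha> \<eta>(1,2)] by (simp add: K_def)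
  show thesis
  proof (rule that, rule exp_square_increments.intro[OF PM], unfold_locales)
    show "(\<lambda>\<omega>. sqrt (Y t \<omega>)) \<in> borel_measurable M" if "0 \<le> t" for t
      using Y_meas[OF that] by measurable
    show "continuous_on {0..} (\<lambda>t. sqrt (Y t \<omega>))" if "\<omega> \<in> space M" for \<omega>
      using Ycont that by (intro continuous_on_real_sqrt) auto
    show "0 < a" "0 < \<gamma>" "0 < d0" "0 < K" by fact+
    fix s t x :: real
    assume s: "0 \<le> s" and t: "0 \<le> t" and st: "s \<noteq> t" "\<bar>s - t\<bar> \<le> d0" and x: "0 \<le> x"
    define \<kappa> where "\<kappa> = u\<^sup>2 - u_dens \<rho> \<gamma> \<beta> s t * u_dens \<rho> \<gamma> \<beta> t s"
    define d where "d = \<bar>s - t\<bar> powr \<gamma>"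
    have d: "0 < d" using st by (simp add: d_def)
    have "\<kappa> \<le> 2 * u * (C_const \<gamma> \<beta> + \<epsilon>) * d" using d0(2)[OF st] diag by (simp add: \<kappa>_def d_def u_def)
    also have "2 * u * (C_const \<gamma> \<beta> + \<epsilon>) = u * ((1 - \<eta>)\<^sup>2 * a)"
    proof -
      have "2 * \<epsilon> = (1 - \<eta>)\<^sup>2 * a - 2 * C_const \<gamma> \<beta>" 
      proof -
        have "2 * (z / 2) = z" for z :: real by simp
        thus ?thesis unfolding \<epsilon>_def .
      qed
      hence "2 * (C_const \<gamma> \<beta> + \<epsilon>) = (1 - \<eta>)\<^sup>2 * a" by (simp add: distrib_left)
      thus ?thesis by (metis mult.assoc mult.commute)
    qed
    finally have \<kappa>: "\<kappa> \<le> u * ((1 - \<eta>)\<^sup>2 * a) * d" .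
    \<comment> \<open>Chosen so that \<open>(1 - \<eta>) l\<close> is the rate \<open>1 / (a
      d)\<close> to be shown.\<close>
    define l where "l = 1 / ((1 - \<eta>) * a * d)"
    have l: "0 < l" using \<eta> a0 d by (simp add: l_def)
    have kl: "\<kappa> * l \<le> (1 - \<eta>) * u"
    proof -
      have "\<kappa> * l \<le> u * ((1 - \<eta>)\<^sup>2 * a) * d * l" using \<kappa> l by (intro mult_right_mono) auto
      also have "\<dots> = (1 - \<eta>) * u" using \<eta> a0 d by (simp add: l_def power2_eq_square)
      finally show ?thesis .
    qed
    have "prob {\<omega> \<in> space M. x < (sqrt (Y s \<omega>) - sqrt (Y t \<omega>))\<^sup>2} \<le> 2 * tail_const \<alpha> \<eta> * exp (- ((1 - \<eta>) * l * x))"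
      by (rule gamma_pair.pair_tail[OF Y_pair[OF s t] \<eta>(1,2) l _ x]) (use kl in \<open>simp add: \<kappa>_def u_def\<close>)
    also have "(1 - \<eta>) * l * x = x / (a * \<bar>s - t\<bar> powr \<gamma>)" using \<eta> by (simp add: l_def d_def)
    finally show "prob {\<omega> \<in> space M. x < (sqrt (Y s \<omega>) - sqrt (Y t \<omega>))\<^sup>2} \<le> K * exp (- (x / (a * \<bar>s - t\<bar> powr \<gamma>)))"
      by (simp add: K_def)
  qed
qed

private lemma between_square:
  assumes "sqrt b < c" "0 \<le> b"
  obtains a where "b < a" "sqrt a < c"
proof (rule that)
  define m where "m = (sqrt b + c) / 2"
  have m: "0 \<le> sqrt b" "sqrt b < m" "m < c" using assms by (auto simp: m_def)
  have "0 \<le> m" using less_imp_le[OF le_less_trans[OF m(1,2)]] .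
  hence "sqrt (m\<^sup>2) = m" by simp
  thus "sqrt (m\<^sup>2) < c" using m(3) by simp
  have "(sqrt b)\<^sup>2 < m\<^sup>2" using m by (intro power_strict_mono) auto
  thus "b < m\<^sup>2" using assms by simp
qed

private lemma le_limit_of_le:
  fixes x :: ereal
  assumes "\<And>n. x \<le> X n" "X \<longlonglongrightarrow> y"
  shows "x \<le> y"
  by (rule LIMSEQ_le_const[OF assms(2)]) (use assms(1) in blast)

private lemma tendsto_c: "(\<lambda>n. x + inverse (real (Suc n))) \<longlonglongrightarrow> x"
  using tendsto_add[OF tendsto_const LIMSEQ_inverse_real_of_nat, of x] by simp

lemma permanental_uniform_modulus:
  assumes T: "0 < T"
  shows "AE \<omega> in M.
      Limsup (at_right 0) (\<lambda>h. SUP (s, t) \<in> {(s, t). s \<in> {0..T} \<and> t \<in> {0..T} \<and> \<bar>s - t\<bar> \<le> h}.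
          ereal (\<bar>Y s \<omega> - Y t \<omega>\<bar> / sqrt (h powr \<gamma> * ln (1 / h))))
        \<le> ereal (2 * sqrt (2 * C_const \<gamma> \<beta>) * sqrt (SUP t\<in>{0..T}. Y t \<omega>))"
proof -
  interpret prob_space M by (rule PM)
  define cn where "cn n = sqrt (2 * C_const \<gamma> \<beta>) + inverse (real (Suc n))" for n
  have C: "0 < C_const \<gamma> \<beta>" by (rule C_const_pos[OF g])
  have cn0: "0 \<le> cn n" for n using C by (simp add: cn_def)
  have "AE \<omega> in M. \<exists>h0>0. \<forall>h. 0 < h \<and> h < h0 \<longrightarrow>
    (\<forall>s\<in>{0..T}. \<forall>t\<in>{0..T}. \<bar>s - t\<bar> \<le> h \<longrightarrow> \<bar>sqrt (Y s \<omega>) - sqrt (Y t \<omega>)\<bar> \<le> cn n * sqrt (h powr \<gamma> * ln (1 / h)))" for n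
  proof -
    obtain a where a: "2 * C_const \<gamma> \<beta> < a" "sqrt a < cn n"
      by (rule between_square[of "2 * C_const \<gamma> \<beta>" "cn n"]) (use C in \<open>auto simp: cn_def\<close>)
    obtain K d0 where "exp_square_increments M (\<lambda>t \<omega>. sqrt (Y t \<omega>)) a \<gamma> K d0" by (rule sqrt_increments[OF a(1)])
    from exp_square_increments.uniform_modulus[OF this a(2)] show ?thesis .
  qed
  hence "AE \<omega> in M. \<forall>n. \<exists>h0>0. \<forall>h. 0 < h \<and> h < h0 \<longrightarrow>
    (\<forall>s\<in>{0..T}. \<forall>t\<in>{0..T}. \<bar>s - t\<bar> \<le> h \<longrightarrow> \<bar>sqrt (Y s \<omega>) - sqrt (Y t \<omega>)\<bar> \<le> cn n * sqrt (h powr \<gamma> * ln (1 / h)))"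
    by (simp add: AE_all_countable)
  thus ?thesis
    using AE_space
  proof eventually_elim
    case (elim \<omega>)
    define S where "S = sqrt (SUP t\<in>{0..T}. Y t \<omega>)"
    have "compact ((\<lambda>t. Y t \<omega>) ` {0..T})"
      by (rule compact_continuous_image[OF continuous_on_subset[OF Ycont[rule_format, OF elim(2)]]]) auto
    hence bdd: "bdd_above ((\<lambda>t. Y t \<omega>) ` {0..T})" by (intro bounded_imp_bdd_above compact_imp_bounded)
    have VS: "sqrt (Y t \<omega>) \<le> S" if "t \<in> {0..T}" for t
      unfolding S_def using cSUP_upper[OF that bdd] by simp
    have "Limsup (at_right 0) (\<lambda>h. SUP (s, t) \<in> {(s, t). s \<in> {0..T} \<and> t \<in> {0..T} \<and> \<bar>s - t\<bar> \<le> h}.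
          ereal (\<bar>Y s \<omega> - Y t \<omega>\<bar> / sqrt (h powr \<gamma> * ln (1 / h)))) \<le> ereal (2 * cn n * S)" (is "?LS \<le> _") for n
    proof (rule Limsup_bounded)
      obtain h0 where h0: "0 < h0" "\<And>h s t. 0 < h \<Longrightarrow> h < h0 \<Longrightarrow> s \<in> {0..T} \<Longrightarrow> t \<in> {0..T} \<Longrightarrow> \<bar>s - t\<bar> \<le> h \<Longrightarrow>
          \<bar>sqrt (Y s \<omega>) - sqrt (Y t \<omega>)\<bar> \<le> cn n * sqrt (h powr \<gamma> * ln (1 / h))"
        using elim(1)[rule_format, of n] by blast
      have ev: "eventually (\<lambda>h. h \<in> {0<..<min h0 1}) (at_right 0)" using h0(1) by (intro eventually_at_right_real) simp
      show "eventually (\<lambda>h. (SUP (s, t) \<in> {(s, t). s \<in> {0..T} \<and> t \<in> {0..T} \<and> \<bar>s - t\<bar> \<le> h}.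
          ereal (\<bar>Y s \<omega> - Y t \<omega>\<bar> / sqrt (h powr \<gamma> * ln (1 / h)))) \<le> ereal (2 * cn n * S)) (at_right 0)"
        using ev
      proof eventually_elim
        fix h assume h: "h \<in> {0<..<min h0 1}"
        define H where "H = sqrt (h powr \<gamma> * ln (1 / h))"
        have "0 < ln (1 / h)" using h by (intro ln_gt_zero) auto
        hence H: "0 < H" unfolding H_def using h by (intro real_sqrt_gt_zero mult_pos_pos) auto
        show "(SUP (s, t) \<in> {(s, t). s \<in> {0..T} \<and> t \<in> {0..T} \<and> \<bar>s - t\<bar> \<le> h}.
          ereal (\<bar>Y s \<omega> - Y t \<omega>\<bar> / sqrt (h powr \<gamma> * ln (1 / h)))) \<le> ereal (2 * cn n * S)"
        proof (rule SUP_least, safe)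
          fix s t assume s: "s \<in> {0..T}" and t: "t \<in> {0..T}" and st: "\<bar>s - t\<bar> \<le> h"
          define v where "v = sqrt (Y s \<omega>)"
          define w where "w = sqrt (Y t \<omega>)"
          have v2: "Y s \<omega> = v\<^sup>2" and w2: "Y t \<omega> = w\<^sup>2"
            using Y_nonneg[OF _ elim(2)] s t by (auto simp: v_def w_def)
          have v0: "0 \<le> v" "0 \<le> w" using Y_nonneg[OF _ elim(2)] s t by (auto simp: v_def w_def)
          have "\<bar>Y s \<omega> - Y t \<omega>\<bar> = \<bar>v - w\<bar> * (v + w)"
            using v0 by (simp add: v2 w2 abs_mult[symmetric] power2_eq_square square_diff_square_factored) (simp add: abs_mult mult.commute)
          also have "\<dots> \<le> (cn n * H) * (2 * S)"
          proof (rule mult_mono)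
            show "\<bar>v - w\<bar> \<le> cn n * H" unfolding v_def w_def H_def using h by (intro h0(2) s t st) auto
            show "v + w \<le> 2 * S" using VS[OF s] VS[OF t] unfolding v_def w_def by linarith
          qed (use v0 cn0 H in auto)
          finally have "\<bar>Y s \<omega> - Y t \<omega>\<bar> / H \<le> 2 * cn n * S" using H by (simp add: pos_divide_le_eq mult_ac)
          thus "ereal (\<bar>Y s \<omega> - Y t \<omega>\<bar> / sqrt (h powr \<gamma> * ln (1 / h))) \<le> ereal (2 * cn n * S)" by (simp add: H_def)
        qed
      qed
    qed
    moreover have "(\<lambda>n. ereal (2 * cn n * S)) \<longlonglongrightarrow> ereal (2 * sqrt (2 * C_const \<gamma> \<beta>) * S)"
      unfolding cn_def by (intro tendsto_ereal tendsto_mult tendsto_const tendsto_c)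
    ultimately have "?LS \<le> ereal (2 * sqrt (2 * C_const \<gamma> \<beta>) * S)" by (rule le_limit_of_le)
    thus ?case unfolding S_def[symmetric] .
  qed
qed

text \<open>
  Here \<open>sqrt (Y t) + sqrt (Y 0)\<close> is at most \<open>2 sqrt (Y 0)\<close> plus an
  increment that vanishes as \<open>t\<close> tends to \<open>0\<close>, so the limit superior
  involves \<open>Y 0\<close> itself and not a supremum.
\<close>
lemma permanental_local_modulus:
  shows "AE \<omega> in M.
      Limsup (at_right 0) (\<lambda>h. SUP t \<in> {0..h}. ereal (\<bar>Y t \<omega> - Y 0 \<omega>\<bar> / sqrt (h powr \<gamma> * ln (ln (1 / h)))))
        \<le> ereal (2 * sqrt (2 * C_const \<gamma> \<beta>) * sqrt (Y 0 \<omega>))"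
proof -
  interpret prob_space M by (rule PM)
  define cn where "cn n = sqrt (2 * C_const \<gamma> \<beta>) + inverse (real (Suc n))" for n
  have C: "0 < C_const \<gamma> \<beta>" by (rule C_const_pos[OF g])
  have cn0: "0 \<le> cn n" for n using C by (simp add: cn_def)
  have "AE \<omega> in M. \<exists>h0>0. \<forall>h. 0 < h \<and> h < h0 \<longrightarrow>
    (\<forall>t\<in>{0..h}. \<bar>sqrt (Y t \<omega>) - sqrt (Y 0 \<omega>)\<bar> \<le> cn n * sqrt (h powr \<gamma> * ln (ln (1 / h))))" for n
  proof -
    obtain a where a: "2 * C_const \<gamma> \<beta> < a" "sqrt a < cn n"
      by (rule between_square[of "2 * C_const \<gamma> \<beta>" "cn n"]) (use C in \<open>auto simp: cn_def\<close>)
    obtain K d0 where "exp_square_increments M (\<lambda>t \<omega>. sqrt (Y t \<omega>)) a \<gamma> K d0" by (rule sqrt_increments[OF a(1)])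
    from exp_square_increments.local_modulus[OF this a(2)] show ?thesis .
  qed
  hence "AE \<omega> in M. \<forall>n. \<exists>h0>0. \<forall>h. 0 < h \<and> h < h0 \<longrightarrow>
    (\<forall>t\<in>{0..h}. \<bar>sqrt (Y t \<omega>) - sqrt (Y 0 \<omega>)\<bar> \<le> cn n * sqrt (h powr \<gamma> * ln (ln (1 / h))))"
    by (simp add: AE_all_countable)
  thus ?thesis
    using AE_space
  proof eventually_elim
    case (elim \<omega>)
    define w where "w = sqrt (Y 0 \<omega>)"
    have w0: "0 \<le> w" using Y_nonneg[OF _ elim(2), of 0] by (simp add: w_def)
    have w2: "Y 0 \<omega> = w\<^sup>2" using Y_nonneg[OF _ elim(2), of 0] by (simp add: w_def)
    define H where "H h = sqrt (h powr \<gamma> * ln (ln (1 / h)))" for h :: real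
    have H0: "(H \<longlongrightarrow> 0) (at_right 0)"
    proof -
      have "((\<lambda>h. h powr \<gamma> * ln (ln (1 / h))) \<longlongrightarrow> 0) (at_right 0)" using g by real_asymp
      from tendsto_real_sqrt[OF this] show ?thesis unfolding H_def by simp
    qed
    have "Limsup (at_right 0) (\<lambda>h. SUP t \<in> {0..h}. ereal (\<bar>Y t \<omega> - Y 0 \<omega>\<bar> / H h)) \<le> ereal (2 * cn n * w)" (is "?LS \<le> _") for n
    proof -
      obtain h0 where h0: "0 < h0" "\<And>h t. 0 < h \<Longrightarrow> h < h0 \<Longrightarrow> t \<in> {0..h} \<Longrightarrow>
          \<bar>sqrt (Y t \<omega>) - w\<bar> \<le> cn n * H h"
        using elim(1)[rule_format, of n] unfolding H_def w_def by blast
      have "eventually (\<lambda>h. h \<in> {0<..<h0}) (at_right 0)" using h0(1) by (intro eventually_at_right_real) simp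
      moreover have "eventually (\<lambda>h::real. 1 < ln (1 / h)) (at_right 0)" by real_asymp
      ultimately have "eventually (\<lambda>h. (SUP t \<in> {0..h}. ereal (\<bar>Y t \<omega> - Y 0 \<omega>\<bar> / H h)) \<le> ereal (cn n * (cn n * H h + 2 * w))) (at_right 0)"
      proof eventually_elim
        fix h assume h: "h \<in> {0<..<h0}" and l: "1 < ln (1 / h)"
        have H: "0 < H h" unfolding H_def using h ln_gt_zero[OF l] by (intro real_sqrt_gt_zero mult_pos_pos) auto
        show "(SUP t \<in> {0..h}. ereal (\<bar>Y t \<omega> - Y 0 \<omega>\<bar> / H h)) \<le> ereal (cn n * (cn n * H h + 2 * w))"
        proof (rule SUP_least)
          fix t assume t: "t \<in> {0..h}"
          define v where "v = sqrt (Y t \<omega>)"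
          have v0: "0 \<le> v" and v2: "Y t \<omega> = v\<^sup>2" using Y_nonneg[OF _ elim(2), of t] t by (auto simp: v_def)
          have vw: "\<bar>v - w\<bar> \<le> cn n * H h" unfolding v_def using h t by (intro h0(2)) auto
          have "\<bar>Y t \<omega> - Y 0 \<omega>\<bar> = \<bar>v - w\<bar> * (v + w)"
            using v0 w0 by (simp add: v2 w2 abs_mult[symmetric] power2_eq_square square_diff_square_factored) (simp add: abs_mult mult.commute)
          also have "\<dots> \<le> (cn n * H h) * (cn n * H h + 2 * w)"
          proof (rule mult_mono[OF vw])
            show "v + w \<le> cn n * H h + 2 * w" using vw by linarith
          qed (use v0 w0 cn0 H in auto)
          finally have "\<bar>Y t \<omega> - Y 0 \<omega>\<bar> / H h \<le> cn n * (cn n * H h + 2 * w)" using H by (simp add: pos_divide_le_eq mult_ac)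
          thus "ereal (\<bar>Y t \<omega> - Y 0 \<omega>\<bar> / H h) \<le> ereal (cn n * (cn n * H h + 2 * w))" by simp
        qed
      qed
      hence "Limsup (at_right 0) (\<lambda>h. SUP t \<in> {0..h}. ereal (\<bar>Y t \<omega> - Y 0 \<omega>\<bar> / H h)) \<le> Limsup (at_right 0) (\<lambda>h. ereal (cn n * (cn n * H h + 2 * w)))"
        by (rule Limsup_mono)
      also have "\<dots> = ereal (cn n * (cn n * 0 + 2 * w))"
        by (intro lim_imp_Limsup tendsto_ereal tendsto_mult tendsto_add tendsto_const H0) (simp add: trivial_limit_at_right_real)
      finally show ?thesis by (simp add: mult_ac)
    qed
    moreover have "(\<lambda>n. ereal (2 * cn n * w)) \<longlonglongrightarrow> ereal (2 * sqrt (2 * C_const \<gamma> \<beta>) * w)"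
      unfolding cn_def by (intro tendsto_ereal tendsto_mult tendsto_const tendsto_c)
    ultimately have "?LS \<le> ereal (2 * sqrt (2 * C_const \<gamma> \<beta>) * w)" by (rule le_limit_of_le)
    thus ?case unfolding w_def[symmetric] H_def[symmetric] .
  qed
qed

lemma permanental_growth_upper:
  shows "AE \<omega> in M. Limsup at_top (\<lambda>t. ereal (Y t \<omega> / ln t)) \<le> ereal (D_const \<rho> \<gamma> \<beta>)"
proof -
  interpret prob_space M by (rule PM)
  define u where "u = D_const \<rho> \<gamma> \<beta>"
  have u: "0 < u" unfolding u_def by (rule D_pos)
  define cn where "cn n = sqrt u + inverse (real (Suc n))" for n
  obtain K d0 where inc: "exp_square_increments M (\<lambda>t \<omega>. sqrt (Y t \<omega>)) (2 * C_const \<gamma> \<beta> + 1) \<gamma> K d0"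
    by (rule sqrt_increments[of "2 * C_const \<gamma> \<beta> + 1"]) auto
  have "AE \<omega> in M. eventually (\<lambda>t. sqrt (Y t \<omega>) \<le> cn n * sqrt (ln t)) at_top" for n
  proof (rule exp_square_increments.eventual_growth[OF inc _ u])
    show "0 \<le> sqrt (Y t \<omega>)" if "0 \<le> t" "\<omega> \<in> space M" for t \<omega> using Y_nonneg[OF that] by simp
    show "sqrt u < cn n" by (simp add: cn_def)
    fix \<delta> :: real assume \<delta>: "0 < \<delta>" "\<delta> < 1"
    have "prob {\<omega> \<in> space M. x < (sqrt (Y t \<omega>))\<^sup>2} \<le> \<delta> powr (- \<alpha>) * exp (- ((1 - \<delta>) * x / u))" if t: "0 \<le> t" for t x
    proof -
      have "{\<omega> \<in> space M. x < (sqrt (Y t \<omega>))\<^sup>2} = {\<omega> \<in> space M. x < Y t \<omega>}" using Y_nonneg[OF t] by auto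
      thus ?thesis
        using gamma_variable.tail_upper[OF Y_gamma[OF t] \<delta>, of x] by (simp add: u_def)
    qed
    thus "\<exists>K'. \<forall>t\<ge>0. \<forall>x\<ge>0. prob {\<omega> \<in> space M. x < (sqrt (Y t \<omega>))\<^sup>2} \<le> K' * exp (- ((1 - \<delta>) * x / u))" by blast
  qed
  hence "AE \<omega> in M. \<forall>n. eventually (\<lambda>t. sqrt (Y t \<omega>) \<le> cn n * sqrt (ln t)) at_top" by (simp add: AE_all_countable)
  thus ?thesis
    using AE_space
  proof eventually_elim
    case (elim \<omega>)
    have "Limsup at_top (\<lambda>t. ereal (Y t \<omega> / ln t)) \<le> ereal ((cn n)\<^sup>2)" (is "?LS \<le> _") for n
    proof (rule Limsup_bounded)
      show "eventually (\<lambda>t. ereal (Y t \<omega> / ln t) \<le> ereal ((cn n)\<^sup>2)) at_top"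
        using elim(1)[rule_format, of n] eventually_gt_at_top[of "1::real"]
      proof eventually_elim
        fix t assume le: "sqrt (Y t \<omega>) \<le> cn n * sqrt (ln t)" and t: "1 < t"
        have l: "0 < ln t" using t by simp
        have Y0: "0 \<le> Y t \<omega>" using Y_nonneg[OF _ elim(2), of t] t by simp
        have "(sqrt (Y t \<omega>))\<^sup>2 \<le> (cn n * sqrt (ln t))\<^sup>2" using le Y0 by (intro power_mono) auto
        hence "Y t \<omega> \<le> (cn n)\<^sup>2 * ln t" using Y0 l by (simp add: power_mult_distrib)
        thus "ereal (Y t \<omega> / ln t) \<le> ereal ((cn n)\<^sup>2)" using l by (simp add: pos_divide_le_eq)
      qed
    qed
    moreover have "(\<lambda>n. ereal ((cn n)\<^sup>2)) \<longlonglongrightarrow> ereal ((sqrt u)\<^sup>2)"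
      unfolding cn_def by (intro tendsto_ereal tendsto_power tendsto_c)
    ultimately have "Limsup at_top (\<lambda>t. ereal (Y t \<omega> / ln t)) \<le> ereal ((sqrt u)\<^sup>2)" by (rule le_limit_of_le)
    thus ?case using u by (simp add: u_def)
  qed
qed

text \<open>
  Apply \<open>weakly_correlated_sum_diverges\<close> along \<open>t i = J (i + 1)\<close> to
  continuous substitutes \<open>Z i\<close> for the indicators of \<open>(1 - \<epsilon>) u ln (t
  i) < Y (t i)\<close>. Their means are at least of order \<open>t i powr (- (1 + \<epsilon>) (1 -
  \<epsilon>))\<close>, which is not summable, and by \<open>u_dens_decay\<close> their
  correlations are at most \<open>1 / (i - j)\<^sup>2\<close>.
\<close>
lemma permanental_growth_lower:
  assumes \<epsilon>: "0 < \<epsilon>" "\<epsilon> < 1"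
  shows "AE \<omega> in M. \<exists>\<^sub>F t in at_top. (1 - \<epsilon>) * D_const \<rho> \<gamma> \<beta> * ln t < Y t \<omega>"
proof -
  interpret prob_space M by (rule PM)
  define u where "u = D_const \<rho> \<gamma> \<beta>"
  have u: "0 < u" unfolding u_def by (rule D_pos)
  obtain K where K: "0 \<le> K" "\<And>x y. x \<noteq> y \<Longrightarrow> \<bar>u_dens \<rho> \<gamma> \<beta> x y\<bar> \<le> K / \<bar>x - y\<bar>"
    using u_dens_decay[OF g \<rho>, of \<beta>] by blast
  \<comment> \<open>With this spacing the decay bound at neighbouring times is already at most
    \<open>u\<close>, so that all correlations of distinct times are at most one.\<close>
  define J where "J = max 1 (K / u)"
  have J: "1 \<le> J" "K / J \<le> u"
  proof -
    show "1 \<le> J" by (simp add: J_def)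
    have "K / u \<le> J" by (simp add: J_def)
    hence "K \<le> u * J" using u by (simp add: pos_divide_le_eq mult.commute)
    thus "K / J \<le> u" using \<open>1 \<le> J\<close> by (simp add: pos_divide_le_eq)
  qed
  define t where "t i = J * real (Suc i)" for i
  have t1: "1 \<le> t i" for i
  proof -
    have "1 * 1 \<le> J * real (Suc i)" using J by (intro mult_mono) auto
    thus ?thesis by (simp add: t_def)
  qed
  have t0: "0 \<le> t i" for i using t1[of i] by simp
  define r where "r i j = u_dens \<rho> \<gamma> \<beta> (t i) (t j) * u_dens \<rho> \<gamma> \<beta> (t j) (t i) / u\<^sup>2" for i j
  have rb: "\<bar>r i j\<bar> \<le> 1 / (real i - real j)\<^sup>2" if "i \<noteq> j" for i j
  proof -
    define d where "d = \<bar>real i - real j\<bar>"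
    have d: "0 < d" using that by (simp add: d_def)
    have tij: "\<bar>t i - t j\<bar> = J * d" "\<bar>t j - t i\<bar> = J * d" "t i \<noteq> t j" "t j \<noteq> t i"
    proof -
      have "t i - t j = J * (real i - real j)" by (simp add: t_def algebra_simps)
      thus a: "\<bar>t i - t j\<bar> = J * d" using J by (simp add: abs_mult d_def)
      thus "\<bar>t j - t i\<bar> = J * d" by (simp add: abs_minus_commute)
      have "0 < J * d" using J d by simp
      thus "t i \<noteq> t j" using a by auto
      thus "t j \<noteq> t i" by simp
    qed
    have one: "K / (J * d) \<le> u / d"
    proof -
      have "K / J / d \<le> u / d" using J d by (intro divide_right_mono) auto
      thus ?thesis by simp
    qed
    have "\<bar>r i j\<bar> = \<bar>u_dens \<rho> \<gamma> \<beta> (t i) (t j)\<bar> * \<bar>u_dens \<rho> \<gamma> \<beta> (t j) (t i)\<bar> / u\<^sup>2" by (simp add: r_def abs_mult)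
    also have "\<dots> \<le> (u / d) * (u / d) / u\<^sup>2"
    proof (intro divide_right_mono mult_mono)
      show "\<bar>u_dens \<rho> \<gamma> \<beta> (t i) (t j)\<bar> \<le> u / d" using K(2)[OF tij(3)] one unfolding tij by linarith
      show "\<bar>u_dens \<rho> \<gamma> \<beta> (t j) (t i)\<bar> \<le> u / d" using K(2)[OF tij(4)] one unfolding tij by linarith
    qed (use u d in auto)
    also have "\<dots> = 1 / d\<^sup>2" using u by (simp add: power2_eq_square)
    finally show ?thesis by (simp add: d_def)
  qed
  \<comment> \<open>The value \<open>1\<close> at \<open>0\<close> covers the diagonal terms, where
    the covariance is the variance.\<close>
  define gg where "gg k = (if k = 0 then 1 else 1 / (real k)\<^sup>2)" for k :: nat
  have gg0: "0 \<le> gg k" for k by (simp add: gg_def)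
  have gsum: "summable gg"
  proof -
    have "summable (\<lambda>n. real n powr (- 2))" by (simp add: summable_real_powr_iff)
    moreover have "gg n = real n powr (- 2)" if "1 \<le> n" for n
    proof -
      have "real n powr (- 2) = 1 / real n powr 2" by (rule powr_minus_divide)
      thus ?thesis using that by (simp add: gg_def)
    qed
    ultimately show ?thesis
      by (subst summable_cong[where g="\<lambda>n. real n powr (- 2)"]) (auto simp: eventually_sequentially)
  qed
  define b where "b i j = gg (nat \<bar>int i - int j\<bar>)" for i j :: nat
  have b0: "0 \<le> b i j" and bsym: "b i j = b j i" for i j
    by (auto simp: b_def gg0 abs_minus_commute)
  have bsum: "(\<Sum>j<n. b i j) \<le> 2 * suminf gg" for i n
  proof -
    have "(\<Sum>j<n. b i j) \<le> (\<Sum>j\<in>{..i} \<union> {i..<i + n}. b i j)"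
      by (rule sum_mono2) (auto simp: b0)
    also have "\<dots> \<le> (\<Sum>j\<in>{..i}. b i j) + (\<Sum>j\<in>{i..<i + n}. b i j)"
      by (subst sum.union_inter[symmetric]) (auto intro!: sum_nonneg b0)
    also have "(\<Sum>j\<in>{..i}. b i j) = (\<Sum>k\<in>{..i}. gg k)"
      by (rule sum.reindex_bij_witness[of _ "\<lambda>k. i - k" "\<lambda>j. i - j"]) (auto simp: b_def nat_diff_distrib)
    also have "(\<Sum>j\<in>{i..<i + n}. b i j) = (\<Sum>k\<in>{..<n}. gg k)"
      by (rule sum.reindex_bij_witness[of _ "\<lambda>k. i + k" "\<lambda>j. j - i"]) (auto simp: b_def nat_diff_distrib)
    also have "(\<Sum>k\<in>{..i}. gg k) \<le> suminf gg" by (rule sum_le_suminf[OF gsum]) (auto simp: gg0)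
    also have "(\<Sum>k\<in>{..<n}. gg k) \<le> suminf gg" by (rule sum_le_suminf[OF gsum]) (auto simp: gg0)
    finally show ?thesis by simp
  qed
  have r_le_b: "\<bar>r i j\<bar> \<le> b i j" if "i \<noteq> j" for i j
  proof -
    have "real (nat \<bar>int i - int j\<bar>) = \<bar>real i - real j\<bar>" by simp
    thus ?thesis using rb[OF that] that by (simp add: b_def gg_def)
  qed
  have r1: "\<bar>r i j\<bar> \<le> 1" if "i \<noteq> j" for i j
  proof -
    have "1 \<le> \<bar>int i - int j\<bar>" using that by linarith
    hence "1 \<le> \<bar>real i - real j\<bar>" by linarith
    hence "1 \<le> (real i - real j)\<^sup>2" by (metis abs_ge_zero one_le_power power2_abs)
    hence "1 / (real i - real j)\<^sup>2 \<le> 1" by (simp add: divide_le_eq)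
    thus ?thesis using rb[OF that] by linarith
  qed
  define c where "c i = (1 - \<epsilon>) * u * ln (t i)" for i
  have c0: "0 \<le> c i" for i using \<epsilon> u t1[of i] by (simp add: c_def)
  \<comment> \<open>A ramp from \<open>1\<close> to \<open>0\<close> on \<open>{c i..c i +
    1}\<close>: \<open>cov_bound\<close> needs continuous functions vanishing near infinity, and
    passing to \<open>1 - \<psi> i\<close> does not change covariances.\<close>
  define \<psi> where "\<psi> i x = max 0 (min 1 (c i + 1 - x))" for i and x :: real
  have psi: "continuous_on UNIV (\<psi> i)" "\<And>x. c i + 1 \<le> x \<Longrightarrow> \<psi> i x = 0" "\<And>x. \<bar>\<psi> i x\<bar> \<le> 1"
    "\<And>x. 0 \<le> \<psi> i x" "\<And>x. \<psi> i x \<le> 1" "\<And>x. x \<le> c i \<Longrightarrow> \<psi> i x = 1" for i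
    unfolding \<psi>_def by (auto intro!: continuous_intros)
  have psim [measurable]: "\<psi> i \<in> borel_measurable borel" for i using psi(1) by (rule borel_measurable_continuous_onI)
  have Ym [measurable]: "Y (t i) \<in> borel_measurable M" for i by (rule Y_meas[OF t0])
  define Z where "Z i \<omega> = 1 - \<psi> i (Y (t i) \<omega>)" for i \<omega>
  have Zm [measurable]: "Z i \<in> borel_measurable M" for i unfolding Z_def by measurable
  have Z01: "0 \<le> Z i \<omega> \<and> Z i \<omega> \<le> 1" for i \<omega> using psi(4,5) by (simp add: Z_def)
  define W where "W i \<omega> = \<psi> i (Y (t i) \<omega>)" for i \<omega>
  have Wm [measurable]: "W i \<in> borel_measurable M" for i unfolding W_def by measurable
  have W01: "0 \<le> W i \<omega>" "W i \<omega> \<le> 1" for i \<omega> using psi(4,5) by (auto simp: W_def)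
  have ZW: "Z i \<omega> = 1 - W i \<omega>" for i \<omega> by (simp add: Z_def W_def)
  have Wi: "integrable M (W i)" for i by (rule integrable_const_bound[where B=1]) (use W01 in auto)
  have WWi: "integrable M (\<lambda>\<omega>. W i \<omega> * W j \<omega>)" for i j
    by (rule integrable_const_bound[where B=1]) (use W01 in \<open>auto intro!: mult_le_one simp: abs_mult\<close>)
  have EZ: "expectation (Z i) = 1 - expectation (W i)" for i
    unfolding ZW using Wi by (simp add: prob_space)
  have EZZ: "(LINT \<omega>|M. Z i \<omega> * Z j \<omega>) - expectation (Z i) * expectation (Z j)
     = (LINT \<omega>|M. W i \<omega> * W j \<omega>) - expectation (W i) * expectation (W j)" for i j
  proof -
    have "Z i \<omega> * Z j \<omega> = 1 - W i \<omega> - W j \<omega> + W i \<omega> * W j \<omega>" for \<omega> by (simp add: ZW algebra_simps)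
    hence "(LINT \<omega>|M. Z i \<omega> * Z j \<omega>) = 1 - expectation (W i) - expectation (W j) + (LINT \<omega>|M. W i \<omega> * W j \<omega>)"
      using Wi WWi by (simp add: prob_space)
    thus ?thesis unfolding EZ by (simp add: algebra_simps)
  qed
  have EW: "0 \<le> expectation (W i)" "expectation (W i) \<le> 1" for i
  proof -
    show "0 \<le> expectation (W i)" by (rule integral_nonneg_AE) (use W01 in auto)
    have "expectation (W i) \<le> (LINT \<omega>|M. 1)" by (rule integral_mono) (use W01 Wi in auto)
    thus "expectation (W i) \<le> 1" by (simp add: prob_space)
  qed
  have var: "(LINT \<omega>|M. (W i \<omega>)\<^sup>2) - (expectation (W i))\<^sup>2 \<le> expectation (Z i)" for i
  proof -
    define e where "e = expectation (W i)"
    have "(LINT \<omega>|M. (W i \<omega>)\<^sup>2) \<le> e" unfolding e_def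
      by (rule integral_mono) (use WWi[of i i] Wi W01 in \<open>auto simp: power2_eq_square mult_left_le\<close>)
    hence "(LINT \<omega>|M. (W i \<omega>)\<^sup>2) - e\<^sup>2 \<le> e * (1 - e)" by (simp add: power2_eq_square algebra_simps)
    also have "\<dots> \<le> 1 * (1 - e)" using EW[of i] by (intro mult_right_mono) (auto simp: e_def)
    finally show ?thesis unfolding EZ e_def by simp
  qed
  have cov: "(LINT \<omega>|M. Z i \<omega> * Z j \<omega>) - expectation (Z i) * expectation (Z j) \<le> b i j * ((expectation (Z i) + expectation (Z j)) / 2)" for i j
  proof (cases "i = j")
    case True
    have "b j j = 1" by (simp add: b_def gg_def)
    thus ?thesis using var[of j] unfolding EZZ True by (simp add: power2_eq_square)
  next
    case False
    have EZ0: "0 \<le> expectation (Z i)" for i unfolding EZ using EW by simp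
    have "\<bar>(LINT \<omega>|M. W i \<omega> * W j \<omega>) - expectation (W i) * expectation (W j)\<bar>
      \<le> \<bar>r i j\<bar> * (((LINT \<omega>|M. (W i \<omega>)\<^sup>2) - (expectation (W i))\<^sup>2) + ((LINT \<omega>|M. (W j \<omega>)\<^sup>2) - (expectation (W j))\<^sup>2)) / 2"
    proof -
      define \<kappa> where "\<kappa> = u\<^sup>2 - u_dens \<rho> \<gamma> \<beta> (t i) (t j) * u_dens \<rho> \<gamma> \<beta> (t j) (t i)"
      interpret gamma_pair M "Y (t i)" "Y (t j)" \<alpha> u \<kappa>
        unfolding \<kappa>_def u_def by (rule Y_pair[OF t0 t0])
      have "corr = r i j" using u unfolding corr_def by (simp add: \<kappa>_def r_def diff_divide_distrib)
      moreover have "W i = (\<lambda>\<omega>. \<psi> i (Y (t i) \<omega>))" for i by (simp add: W_def fun_eq_iff)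
      ultimately show ?thesis
        using cov_bound[of "\<psi> i" "c i + 1" 1 "\<psi> j" "c j + 1"] psi(1-3) r1[OF False] by simp
    qed
    also have "\<dots> \<le> \<bar>r i j\<bar> * (expectation (Z i) + expectation (Z j)) / 2"
      using var[of i] var[of j] by (intro divide_right_mono mult_left_mono add_mono) auto
    also have "\<dots> \<le> b i j * (expectation (Z i) + expectation (Z j)) / 2"
      using r_le_b[OF False] EZ0 by (intro divide_right_mono mult_right_mono) auto
    finally show ?thesis unfolding EZZ times_divide_eq_right by (rule order_trans[OF abs_ge_self])
  qed
  have div: "\<not> summable (\<lambda>i. LINT \<omega>|M. Z i \<omega>)"
  proof
    assume sm: "summable (\<lambda>i. LINT \<omega>|M. Z i \<omega>)"
    define c1 where "c1 = \<epsilon> / u / (Gamma \<alpha> * u powr \<alpha>) * exp (- ((1 + \<epsilon>) * 2 / u))"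
    have c1: "0 < c1" using \<epsilon> u \<alpha> Gamma_real_pos[OF \<alpha>] by (simp add: c1_def)
    have low: "c1 * (1 / (J * real (Suc i))) \<le> expectation (Z i)" for i
    proof -
      have "\<epsilon> / u / (Gamma \<alpha> * u powr \<alpha>) * exp (- ((1 + \<epsilon>) * ((c i + 1) + 1) / u)) \<le> prob {\<omega> \<in> space M. c i + 1 < Y (t i) \<omega>}"
        unfolding u_def by (rule gamma_variable.tail_lower[OF Y_gamma[OF t0] \<epsilon>(1)]) (use c0[of i] in simp)
      also have "\<dots> = (LINT \<omega>|M. indicator {\<omega> \<in> space M. c i + 1 < Y (t i) \<omega>} \<omega>)"
        by (subst Bochner_Integration.integral_indicator) (auto intro!: arg_cong[where f=prob])
      also have "\<dots> \<le> expectation (Z i)"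
      proof (rule integral_mono)
        show "integrable M (Z i)" unfolding ZW using Wi by simp
        show "indicator {\<omega> \<in> space M. c i + 1 < Y (t i) \<omega>} \<omega> \<le> Z i \<omega>" for \<omega>
          using psi(2)[of i "Y (t i) \<omega>"] Z01[of i \<omega>] by (auto simp: Z_def indicator_def)
      qed (auto intro!: integrable_real_indicator simp: emeasure_eq_measure)
      finally have A: "\<epsilon> / u / (Gamma \<alpha> * u powr \<alpha>) * exp (- ((1 + \<epsilon>) * ((c i + 1) + 1) / u)) \<le> expectation (Z i)" .
      have "exp (- ((1 + \<epsilon>) * ((c i + 1) + 1) / u)) = exp (- ((1 + \<epsilon>) * 2 / u)) * exp (- ((1 + \<epsilon>) * c i / u))"
        by (simp add: add_divide_distrib algebra_simps flip: exp_add)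
      moreover have "1 / (J * real (Suc i)) \<le> exp (- ((1 + \<epsilon>) * c i / u))"
      proof -
        have "(1 + \<epsilon>) * c i / u = (1 + \<epsilon>) * (1 - \<epsilon>) * ln (t i)" using u by (simp add: c_def)
        also have "(1 + \<epsilon>) * (1 - \<epsilon>) = 1 - \<epsilon> * \<epsilon>" by (simp add: algebra_simps)
        also have "(1 - \<epsilon> * \<epsilon>) * ln (t i) \<le> 1 * ln (t i)" using \<epsilon> t1[of i] by (intro mult_right_mono) auto
        finally have "exp (- ln (t i)) \<le> exp (- ((1 + \<epsilon>) * c i / u))" by simp
        thus ?thesis using t1[of i] by (simp add: exp_minus t_def inverse_eq_divide del: of_nat_Suc)
      qed
      ultimately have "c1 * (1 / (J * real (Suc i))) \<le> \<epsilon> / u / (Gamma \<alpha> * u powr \<alpha>) * exp (- ((1 + \<epsilon>) * ((c i + 1) + 1) / u))"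
        using c1 by (simp only: c1_def mult.assoc[symmetric]) (rule mult_left_mono, auto simp: c1_def)
      thus ?thesis using A by linarith
    qed
    have "summable (\<lambda>i. c1 * (1 / (J * real (Suc i))))"
      by (rule summable_comparison_test'[OF sm, of 0]) (use low c1 J in \<open>auto simp: abs_mult\<close>)
    hence "summable (\<lambda>i. (J / c1) * (c1 * (1 / (J * real (Suc i)))))" by (rule summable_mult)
    moreover have "(J / c1) * (c1 * (1 / (J * real (Suc i)))) = real (Suc i) powr (- 1)" for i
      using c1 J by (simp add: powr_minus_divide del: of_nat_Suc)
    ultimately have "summable (\<lambda>i. real (Suc i) powr (- 1))" by simp
    hence "summable (\<lambda>i. real i powr (- 1))" by (subst (asm) summable_Suc_iff)
    hence "(- 1 :: real) < - 1" by (simp only: summable_real_powr_iff)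
    thus False by simp
  qed
  have "AE \<omega> in M. \<forall>B. \<exists>n. B < (\<Sum>i<n. Z i \<omega>)"
    by (rule weakly_correlated_sum_diverges[OF Zm _ cov b0 bsym bsum div]) (rule Z01)
  thus ?thesis
  proof eventually_elim
    case (elim \<omega>)
    show ?case
    proof (rule ccontr)
      assume "\<not> ?case"
      hence "eventually (\<lambda>x. Y x \<omega> \<le> (1 - \<epsilon>) * u * ln x) at_top" by (simp add: not_frequently not_less u_def)
      then obtain x0 where x0: "\<And>x. x0 \<le> x \<Longrightarrow> Y x \<omega> \<le> (1 - \<epsilon>) * u * ln x" by (auto simp: eventually_at_top_linorder)
      obtain N :: nat where N: "x0 \<le> real N" using real_arch_simple by blast
      have Z0: "Z i \<omega> = 0" if "N \<le> i" for i
      proof -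
        have "real N \<le> 1 * real (Suc i)" using that by simp
        also have "\<dots> \<le> t i" unfolding t_def using J by (intro mult_right_mono) auto
        finally have "Y (t i) \<omega> \<le> c i" unfolding c_def using N by (intro x0) linarith
        thus ?thesis using psi(6) by (simp add: Z_def)
      qed
      obtain n where n: "real N < (\<Sum>i<n. Z i \<omega>)" using elim by blast
      also have "(\<Sum>i<n. Z i \<omega>) \<le> (\<Sum>i<n. if i < N then 1 else 0)"
        by (rule sum_mono) (use Z0 Z01 in \<open>auto simp: not_less\<close>)
      also have "\<dots> = real (card ({..<n} \<inter> {i. i < N}))" by (simp add: sum.If_cases)
      also have "\<dots> \<le> real (card {..<N})" by (intro of_nat_mono card_mono) auto
      finally show False by simp
    qed
  qed
qed

lemma permanental_growth:
  shows "AE \<omega> in M. Limsup at_top (\<lambda>t. ereal (Y t \<omega> / ln t)) = ereal (D_const \<rho> \<gamma> \<beta>)"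
proof -
  define en where "en n = inverse (real (Suc (Suc n)))" for n
  have en: "0 < en n" "en n < 1" for n by (auto simp: en_def inverse_less_1_iff)
  have "AE \<omega> in M. \<forall>n. \<exists>\<^sub>F t in at_top. (1 - en n) * D_const \<rho> \<gamma> \<beta> * ln t < Y t \<omega>"
    unfolding AE_all_countable by (intro allI permanental_growth_lower en)
  thus ?thesis
    using permanental_growth_upper
  proof eventually_elim
    case (elim \<omega>)
    define LS where "LS = Limsup at_top (\<lambda>t. ereal (Y t \<omega> / ln t))"
    have "ereal ((1 - en n) * D_const \<rho> \<gamma> \<beta>) \<le> LS" for n
    proof (rule ccontr)
      assume "\<not> ?thesis"
      hence "LS < ereal ((1 - en n) * D_const \<rho> \<gamma> \<beta>)" by simp
      hence "eventually (\<lambda>t. ereal (Y t \<omega> / ln t) < ereal ((1 - en n) * D_const \<rho> \<gamma> \<beta>)) at_top"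
        unfolding LS_def by (rule Limsup_lessD)
      hence "eventually (\<lambda>t. \<not> (1 - en n) * D_const \<rho> \<gamma> \<beta> * ln t < Y t \<omega>) at_top"
        using eventually_gt_at_top[of "1::real"]
      proof eventually_elim
        fix t :: real assume "ereal (Y t \<omega> / ln t) < ereal ((1 - en n) * D_const \<rho> \<gamma> \<beta>)" "1 < t"
        hence "Y t \<omega> < (1 - en n) * D_const \<rho> \<gamma> \<beta> * ln t" by (simp add: pos_divide_less_eq)
        thus "\<not> (1 - en n) * D_const \<rho> \<gamma> \<beta> * ln t < Y t \<omega>" by simp
      qed
      thus False using elim(1)[rule_format, of n] by (simp add: frequently_def)
    qed
    hence le: "\<exists>N. \<forall>n\<ge>N. ereal ((1 - en n) * D_const \<rho> \<gamma> \<beta>) \<le> LS" by blast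
    have "(\<lambda>n. ereal ((1 - en n) * D_const \<rho> \<gamma> \<beta>)) \<longlonglongrightarrow> ereal ((1 - 0) * D_const \<rho> \<gamma> \<beta>)"
      unfolding en_def by (intro tendsto_ereal tendsto_mult tendsto_diff tendsto_const LIMSEQ_Suc[OF LIMSEQ_inverse_real_of_nat])
    from LIMSEQ_le_const2[OF this le] have "ereal ((1 - 0) * D_const \<rho> \<gamma> \<beta>) \<le> LS" .
    thus ?case using elim(2) unfolding LS_def by simp
  qed
qed

end

theorem theorem1p8:
  fixes M :: "'a measure" and Y :: "real \<Rightarrow> 'a \<Rightarrow> real"
    and \<alpha> \<beta> \<gamma> \<rho> :: real
  assumes "0 < \<gamma>" and "\<gamma> < 1" and "\<bar>\<beta>\<bar> \<le> 1" and "0 < \<rho>" and "0 < \<alpha>"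
    and "prob_space M"
    and "permanental_process M \<alpha> {0..} Y (u_dens \<rho> \<gamma> \<beta>)"
    and "\<forall>\<omega>\<in>space M. continuous_on {0..} (\<lambda>x. Y x \<omega>)"
  shows "0 < C_const \<gamma> \<beta> \<and>
    (\<forall>T>0. AE \<omega> in M.
      Limsup (at_right 0) (\<lambda>h. SUP (s, t) \<in> {(s, t). s \<in> {0..T} \<and> t \<in> {0..T} \<and> \<bar>s - t\<bar> \<le> h}.
          ereal (\<bar>Y s \<omega> - Y t \<omega>\<bar> / sqrt (h powr \<gamma> * ln (1 / h))))
        \<le> ereal (2 * sqrt 2 * sqrt ((1 + \<bar>\<beta>\<bar>) * C_const \<gamma> \<beta>) * sqrt (SUP t\<in>{0..T}. Y t \<omega>))) \<and>
    (AE \<omega> in M.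
      Limsup (at_right 0) (\<lambda>h. SUP t \<in> {0..h}.
          ereal (\<bar>Y t \<omega> - Y 0 \<omega>\<bar> / sqrt (h powr \<gamma> * ln (ln (1 / h)))))
        \<le> ereal (2 * sqrt 2 * sqrt ((1 + \<bar>\<beta>\<bar>) * C_const \<gamma> \<beta>) * sqrt (Y 0 \<omega>))) \<and>
    (AE \<omega> in M. Limsup at_top (\<lambda>t. ereal (Y t \<omega> / ln t)) = ereal (D_const \<rho> \<gamma> \<beta>))"
proof -
  note A = assms(1,2,4,5,6,7,8)
  have C: "0 < C_const \<gamma> \<beta>" by (rule C_const_pos[OF assms(1,2)])
  have c: "2 * sqrt (2 * C_const \<gamma> \<beta>) \<le> 2 * sqrt 2 * sqrt ((1 + \<bar>\<beta>\<bar>) * C_const \<gamma> \<beta>)"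
  proof -
    have "1 * C_const \<gamma> \<beta> \<le> (1 + \<bar>\<beta>\<bar>) * C_const \<gamma> \<beta>" using C by (intro mult_right_mono) auto
    hence "2 * sqrt 2 * sqrt (C_const \<gamma> \<beta>) \<le> 2 * sqrt 2 * sqrt ((1 + \<bar>\<beta>\<bar>) * C_const \<gamma> \<beta>)"
      by (intro mult_left_mono real_sqrt_le_mono) auto
    thus ?thesis by (simp only: real_sqrt_mult[of 2 "C_const \<gamma> \<beta>"] mult.assoc)
  qed
  have le: "ereal (2 * sqrt (2 * C_const \<gamma> \<beta>) * x) \<le> ereal (2 * sqrt 2 * sqrt ((1 + \<bar>\<beta>\<bar>) * C_const \<gamma> \<beta>) * x)" if "0 \<le> x" for x
    using mult_right_mono[OF c that] by simp
  have nn: "0 \<le> Y t \<omega>" if "0 \<le> t" "\<omega> \<in> space M" for t \<omega>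
    using permanental_process_nonneg[OF assms(7)] that by simp
  show ?thesis
  proof (intro conjI allI impI)
    show "0 < C_const \<gamma> \<beta>" by (rule C)
    show "AE \<omega> in M. Limsup at_top (\<lambda>t. ereal (Y t \<omega> / ln t)) = ereal (D_const \<rho> \<gamma> \<beta>)"
      by (rule permanental_growth[OF A])
    show "AE \<omega> in M.
      Limsup (at_right 0) (\<lambda>h. SUP t \<in> {0..h}.
          ereal (\<bar>Y t \<omega> - Y 0 \<omega>\<bar> / sqrt (h powr \<gamma> * ln (ln (1 / h)))))
        \<le> ereal (2 * sqrt 2 * sqrt ((1 + \<bar>\<beta>\<bar>) * C_const \<gamma> \<beta>) * sqrt (Y 0 \<omega>))"
      using permanental_local_modulus[OF A] AE_space
    proof eventually_elim
      case (elim \<omega>)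
      show ?case using nn[of 0, OF _ elim(2)] by (intro order_trans[OF elim(1)] le) simp
    qed
    fix T :: real assume T: "0 < T"
    show "AE \<omega> in M.
      Limsup (at_right 0) (\<lambda>h. SUP (s, t) \<in> {(s, t). s \<in> {0..T} \<and> t \<in> {0..T} \<and> \<bar>s - t\<bar> \<le> h}.
          ereal (\<bar>Y s \<omega> - Y t \<omega>\<bar> / sqrt (h powr \<gamma> * ln (1 / h))))
        \<le> ereal (2 * sqrt 2 * sqrt ((1 + \<bar>\<beta>\<bar>) * C_const \<gamma> \<beta>) * sqrt (SUP t\<in>{0..T}. Y t \<omega>))"
      using permanental_uniform_modulus[OF A T] AE_space
    proof eventually_elim
      case (elim \<omega>)
      have "compact ((\<lambda>t. Y t \<omega>) ` {0..T})"
        by (rule compact_continuous_image[OF continuous_on_subset[OF assms(8)[rule_format, OF elim(2)]]]) auto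
      hence bdd: "bdd_above ((\<lambda>t. Y t \<omega>) ` {0..T})" by (intro bounded_imp_bdd_above compact_imp_bounded)
      have "0 \<le> Y 0 \<omega>" by (rule nn[OF _ elim(2)]) simp
      also have "\<dots> \<le> (SUP t\<in>{0..T}. Y t \<omega>)" using T by (intro cSUP_upper bdd) auto
      finally show ?case by (intro order_trans[OF elim(1)] le) simp
    qed
  qed
qed

end
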